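(* Let $\mathcal{R}$ be a finite set of real linear relations in the variables $e,p_1,\dots,p_N$, let $\mathcal{U}_{\mathcal{R}}=\operatorname{span}\{e,p_1,\dots,p_N\}$ be the associated $*$-vector space, and let $\mathcal{E}^{\mathrm{proj}}$ be the matrix ordering on $\mathcal{U}_{\mathcal{R}}$ defined in the context. Suppose there exists an operator system $(\mathcal{V},\mathcal{D},f)$ spanned by its unit $f$ and (abstract) projections $q_1,\dots,q_N$ such that $f,q_1,\dots,q_N$ satisfy $\mathcal{R}$ and $\dim(\mathcal{V})=\dim(\mathcal{U}_{\mathcal{R}})$. Then: (1) the matrix ordering $\mathcal{E}^{\mathrm{proj}}$ is proper (i.e. $\mathcal{E}^{\mathrm{proj}}_n\cap-\mathcal{E}^{\mathrm{proj}}_n=\{0\}$ for all $n$); (2) the elements $p_1,\dots,p_N$ of the operator system $(\mathcal{U}_{\mathcal{R}},\mathcal{E}^{\mathrm{proj}},e)$ are abstract projections; (3) the mapping $\varphi:\mathcal{U}_{\mathcal{R}}\to\mathcal{V}$ defined by $\varphi(e)=f$ and $\varphi(p_i)=q_i$ for all $i\in[N]$ is completely positive (with respect to $\mathcal{E}^{\mathrm{proj}}$ and $\mathcal{D}$).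
   Context: Notation: $[N]=\{1,\dots,N\}$; $M_{n,k}$ is the space of complex $n\times k$ matrices, $M_n=M_{n,n}$; $J_2$ is the $2\times 2$ all-ones matrix; $a\oplus b$ denotes the diagonal $2\times2$ matrix with entries $a,b$. Operator systems. For a $*$-vector space $\mathcal{V}$, $\mathcal V_h$ is its set of hermitian elements, and $M_n(\mathcal{V})$ has involution $(a_{ij})^*=(a_{ji}^* )$. A cone is a subset of the hermitian elements closed under sums and nonnegative scalars; it is proper if $C\cap -C=\{0\}$. A matrix ordering is a sequence of cones $\mathcal{C}_n\subseteq M_n(\mathcal{V})_h$ with $\alpha^*\mathcal{C}_n\alpha\subseteq\mathcal{C}_m$ for $\alpha\in M_{n,m}$; it is proper if each $\mathcal C_n$ is. An operator system is $(\mathcal{V},\mathcal{C},e)$ with $\mathcal{C}$ a proper matrix ordering and $e\in\mathcal V_h$ such that each $I_n\otimes e$ is an Archimedean order unit for $(M_n(\mathcal{V}),\mathcal{C}_n)$. A linear map $\varphi$ is completely positive if each amplification $\varphi_n((a_{ij}))=(\varphi(a_{ij}))$ maps the $n$-th cone into the $n$-th cone. An element $p$ of an operator system is an abstract projection if its image in the C*-envelope is a projection (equivalently, its image is a projection in some C*-cover, i.e. in some C*-algebra generated by the image of a unital complete order embedding of the operator system). The space $\mathcal{U}_{\mathcal{R}}$. The relations $\mathcal{R}$ consist of $l$ linear equations encoded by a matrix $M_{\mathcal{R}}\in M_{l,N+1}(\mathbb{R})$ with rows $r_1,\dots,r_l$. Vectors $f,q_1,\dots,q_N$ in a complex vector space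 satisfy $\mathcal{R}$ if $M_{\mathcal{R}}\,(f\ q_1\ \cdots\ q_N)^T=0$. Put $J_{\mathcal{R}}=\operatorname{span}\{r_i^T\}\subseteq\mathbb{C}^{N+1}$, $\mathcal{U}_{\mathcal{R}}=\mathbb{C}^{N+1}/J_{\mathcal{R}}$, $e=e_0+J_{\mathcal{R}}$, $p_i=e_i+J_{\mathcal{R}}$, where $e_0,\dots,e_N$ is the standard basis; the involution is induced by entrywise conjugation. Write $p^\perp=e-p$. The cone $E$ and $E^{\max}$. $\widetilde{E}=\{r_0e+\sum_{i=1}^N t_ip_i+\sum_{i=1}^N s_ip_i^\perp: r_0,t_i,s_i\ge0\}$ and $E=\{x\in\mathcal{U}_{\mathcal{R}}: x=x^*,\ x+\epsilon e\in\widetilde{E}\ \forall\epsilon>0\}$. $D_n^{\max}=\{\alpha^*\operatorname{diag}(s_1,\dots,s_m)\alpha: m\in\mathbb{N},\alpha\in M_{m,n},s_i\in E\}$, and $E_n^{\max}$ is its Archimedean closure $\{x\in M_n(\mathcal{U}_{\mathcal{R}})_h: x+\epsilon I_n\otimes e\in D_n^{\max}\ \forall\epsilon>0\}$. The operation $\mathcal{C}\mapsto\mathcal{C}(p)$. For a matrix ordering $\mathcal{C}$ and a hermitian $p$ with $p,p^\perp\in\mathcal{C}_1$, $x\in\mathcal{C}(p)_n$ iff for every $\epsilon>0$ there is $t>0$ with $$x\otimes J_2+\epsilon I_n\otimes(p\oplus p^\perp)+tI_n\otimes(p^\perp\oplus p)\in\mathcal{C}_{2n}.$$ The matrix ordering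 $\mathcal{E}^{\mathrm{proj}}$. Extend $p_1,\dots,p_N$ periodically by $p_m=p_i$ if $m\equiv i\pmod N$, $i\in[N]$. Set $\mathcal{E}^0=E^{\max}$ and $\mathcal{E}^{n+1}=\mathcal{E}^n(p_{n+1})$ for $n\ge0$. Then $\mathcal{E}^{\mathrm{proj}}$ is the inductive limit: $x\in\mathcal{E}^{\mathrm{proj}}_k$ iff for every $\epsilon>0$ there is $n$ with $x+\epsilon I_k\otimes e\in\mathcal{E}^n_k$. *)

theory Defs
  imports "Jordan_Normal_Form.VS_Connect" "HOL-Algebra.AbelCoset"
begin

section \<open>*-vector spaces and their matrix spaces\<close>

text \<open>Structures are HOL-Algebra records with explicit carriers; \<open>class_ring\<close> is the field of
  complex numbers. The fields \<open>mult\<close> and \<open>one\<close> inherited from the ring record are only meaningful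
  for C*-algebras.\<close>

record 'a star_space = "(complex, 'a) module" +
  star :: "'a \<Rightarrow> 'a"

definition star_vector_space :: "('a, 'm) star_space_scheme \<Rightarrow> bool" where
  "star_vector_space V \<longleftrightarrow>
     vectorspace class_ring V \<and>
     (\<forall>x\<in>carrier V. star V x \<in> carrier V \<and> star V (star V x) = x) \<and>
     (\<forall>x\<in>carrier V. \<forall>y\<in>carrier V. star V (x \<oplus>\<^bsub>V\<^esub> y) = star V x \<oplus>\<^bsub>V\<^esub> star V y) \<and>
     (\<forall>c. \<forall>x\<in>carrier V. star V (c \<odot>\<^bsub>V\<^esub> x) = cnj c \<odot>\<^bsub>V\<^esub> star V x)"

definition hermitian :: "('a, 'm) star_space_scheme \<Rightarrow> 'a set" where
  "hermitian V = {x \<in> carrier V. star V x = x}"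

text \<open>The space of \<open>n \<times> n\<close> matrices over \<open>V\<close>, with the involution \<open>(x\<^sub>i\<^sub>j)\<^sup>* = (x\<^sub>j\<^sub>i\<^sup>*)\<close>. The ring
  operations are the usual ones when \<open>V\<close> is a *-algebra.\<close>

definition matrices :: "('a, 'm) star_space_scheme \<Rightarrow> nat \<Rightarrow> 'a mat star_space" where
  "matrices V n = \<lparr>
     carrier = {x \<in> carrier_mat n n. \<forall>i<n. \<forall>j<n. x $$ (i, j) \<in> carrier V},
     mult = (\<lambda>x y. mat n n (\<lambda>(i, j). \<Oplus>\<^bsub>V\<^esub>k\<in>{..<n}. x $$ (i, k) \<otimes>\<^bsub>V\<^esub> y $$ (k, j))),
     one = mat n n (\<lambda>(i, j). if i = j then \<one>\<^bsub>V\<^esub> else \<zero>\<^bsub>V\<^esub>),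
     zero = mat n n (\<lambda>_. \<zero>\<^bsub>V\<^esub>),
     add = (\<lambda>x y. mat n n (\<lambda>(i, j). x $$ (i, j) \<oplus>\<^bsub>V\<^esub> y $$ (i, j))),
     smult = (\<lambda>c x. mat n n (\<lambda>(i, j). c \<odot>\<^bsub>V\<^esub> x $$ (i, j))),
     star = (\<lambda>x. mat n n (\<lambda>(i, j). star V (x $$ (j, i))))\<rparr>"

definition diag_matrix :: "('a, 'm) star_space_scheme \<Rightarrow> nat \<Rightarrow> (nat \<Rightarrow> 'a) \<Rightarrow> 'a mat" where
  "diag_matrix V n s = mat n n (\<lambda>(i, j). if i = j then s i else \<zero>\<^bsub>V\<^esub>)"

text \<open>\<open>I\<^sub>n \<otimes> e\<close>\<close>
definition amp_unit :: "('a, 'm) star_space_scheme \<Rightarrow> nat \<Rightarrow> 'a \<Rightarrow> 'a mat" where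
  "amp_unit V n e = diag_matrix V n (\<lambda>_. e)"

text \<open>\<open>\<alpha>\<^sup>* x \<alpha>\<close> for a scalar matrix \<open>\<alpha>\<close>\<close>
definition conj_by :: "('a, 'm) star_space_scheme \<Rightarrow> complex mat \<Rightarrow> 'a mat \<Rightarrow> 'a mat" where
  "conj_by V \<alpha> x = mat (dim_col \<alpha>) (dim_col \<alpha>) (\<lambda>(i, j).
     \<Oplus>\<^bsub>V\<^esub>k\<in>{..<dim_row \<alpha>}. \<Oplus>\<^bsub>V\<^esub>l\<in>{..<dim_row \<alpha>}.
       (cnj (\<alpha> $$ (k, i)) * \<alpha> $$ (l, j)) \<odot>\<^bsub>V\<^esub> x $$ (k, l))"


section \<open>Operator systems\<close>

text \<open>Cones are nonempty, hence contain 0. The matrix size 0 is admitted throughout; there every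
  cone consists of the unique \<open>0 \<times> 0\<close> matrix and every condition is trivial.\<close>

definition is_cone :: "('a, 'm) star_space_scheme \<Rightarrow> 'a set \<Rightarrow> bool" where
  "is_cone V C \<longleftrightarrow>
     C \<subseteq> hermitian V \<and> C \<noteq> {} \<and>
     (\<forall>x\<in>C. \<forall>y\<in>C. x \<oplus>\<^bsub>V\<^esub> y \<in> C) \<and>
     (\<forall>r\<ge>0. \<forall>x\<in>C. complex_of_real r \<odot>\<^bsub>V\<^esub> x \<in> C)"

definition proper_cone :: "('a, 'm) star_space_scheme \<Rightarrow> 'a set \<Rightarrow> bool" where
  "proper_cone V C \<longleftrightarrow> is_cone V C \<and> C \<inter> (\<lambda>x. \<ominus>\<^bsub>V\<^esub> x) ` C = {\<zero>\<^bsub>V\<^esub>}"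

definition matrix_ordering ::
    "('a, 'm) star_space_scheme \<Rightarrow> (nat \<Rightarrow> 'a mat set) \<Rightarrow> bool" where
  "matrix_ordering V C \<longleftrightarrow>
     (\<forall>n. is_cone (matrices V n) (C n)) \<and>
     (\<forall>n m. \<forall>\<alpha>\<in>carrier_mat n m. \<forall>x\<in>C n. conj_by V \<alpha> x \<in> C m)"

definition proper_matrix_ordering ::
    "('a, 'm) star_space_scheme \<Rightarrow> (nat \<Rightarrow> 'a mat set) \<Rightarrow> bool" where
  "proper_matrix_ordering V C \<longleftrightarrow>
     matrix_ordering V C \<and> (\<forall>n. proper_cone (matrices V n) (C n))"

definition archimedean_order_unit ::
    "('a, 'm) star_space_scheme \<Rightarrow> 'a set \<Rightarrow> 'a \<Rightarrow> bool" where
  "archimedean_order_unit V C e \<longleftrightarrow>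
     e \<in> hermitian V \<and>
     (\<forall>x\<in>hermitian V. \<exists>r>0. complex_of_real r \<odot>\<^bsub>V\<^esub> e \<ominus>\<^bsub>V\<^esub> x \<in> C) \<and>
     (\<forall>x\<in>hermitian V. (\<forall>\<epsilon>>0. x \<oplus>\<^bsub>V\<^esub> complex_of_real \<epsilon> \<odot>\<^bsub>V\<^esub> e \<in> C) \<longrightarrow> x \<in> C)"

definition operator_system ::
    "('a, 'm) star_space_scheme \<Rightarrow> (nat \<Rightarrow> 'a mat set) \<Rightarrow> 'a \<Rightarrow> bool" where
  "operator_system V C e \<longleftrightarrow>
     star_vector_space V \<and> proper_matrix_ordering V C \<and> e \<in> hermitian V \<and>
     (\<forall>n. archimedean_order_unit (matrices V n) (C n) (amp_unit V n e))"

definition completely_positive ::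
    "('a, 'm) star_space_scheme \<Rightarrow> (nat \<Rightarrow> 'a mat set) \<Rightarrow>
     ('b, 'k) star_space_scheme \<Rightarrow> (nat \<Rightarrow> 'b mat set) \<Rightarrow> ('a \<Rightarrow> 'b) \<Rightarrow> bool" where
  "completely_positive V C W D \<phi> \<longleftrightarrow>
     linear_map class_ring V W \<phi> \<and> (\<forall>n. \<forall>x\<in>C n. map_mat \<phi> x \<in> D n)"


section \<open>C*-covers and abstract projections\<close>

record 'a normed_star_space = "'a star_space" +
  cnorm :: "'a \<Rightarrow> real"

text \<open>Unital C*-algebras; the zero algebra is allowed.\<close>

definition cstar_algebra :: "('a, 'm) normed_star_space_scheme \<Rightarrow> bool" where
  "cstar_algebra A \<longleftrightarrow>
     ring A \<and> star_vector_space A \<and>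
     (\<forall>c. \<forall>x\<in>carrier A. \<forall>y\<in>carrier A.
        (c \<odot>\<^bsub>A\<^esub> x) \<otimes>\<^bsub>A\<^esub> y = c \<odot>\<^bsub>A\<^esub> (x \<otimes>\<^bsub>A\<^esub> y) \<and>
        x \<otimes>\<^bsub>A\<^esub> (c \<odot>\<^bsub>A\<^esub> y) = c \<odot>\<^bsub>A\<^esub> (x \<otimes>\<^bsub>A\<^esub> y)) \<and>
     (\<forall>x\<in>carrier A. \<forall>y\<in>carrier A. star A (x \<otimes>\<^bsub>A\<^esub> y) = star A y \<otimes>\<^bsub>A\<^esub> star A x) \<and>
     (\<forall>x\<in>carrier A. 0 \<le> cnorm A x \<and> (cnorm A x = 0 \<longleftrightarrow> x = \<zero>\<^bsub>A\<^esub>)) \<and>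
     (\<forall>c. \<forall>x\<in>carrier A. cnorm A (c \<odot>\<^bsub>A\<^esub> x) = cmod c * cnorm A x) \<and>
     (\<forall>x\<in>carrier A. \<forall>y\<in>carrier A. cnorm A (x \<oplus>\<^bsub>A\<^esub> y) \<le> cnorm A x + cnorm A y) \<and>
     (\<forall>x\<in>carrier A. \<forall>y\<in>carrier A. cnorm A (x \<otimes>\<^bsub>A\<^esub> y) \<le> cnorm A x * cnorm A y) \<and>
     (\<forall>x\<in>carrier A. cnorm A (star A x \<otimes>\<^bsub>A\<^esub> x) = (cnorm A x)\<^sup>2) \<and>
     (\<forall>\<sigma>::nat \<Rightarrow> 'a. range \<sigma> \<subseteq> carrier A \<longrightarrow>
        (\<forall>\<epsilon>>0. \<exists>K. \<forall>m\<ge>K. \<forall>n\<ge>K. cnorm A (\<sigma> m \<ominus>\<^bsub>A\<^esub> \<sigma> n) < \<epsilon>) \<longrightarrow>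
        (\<exists>x\<in>carrier A. (\<lambda>n. cnorm A (\<sigma> n \<ominus>\<^bsub>A\<^esub> x)) \<longlonglongrightarrow> 0))"

text \<open>Norm-closed *-subalgebras\<close>
definition cstar_subalgebra :: "('a, 'm) normed_star_space_scheme \<Rightarrow> 'a set \<Rightarrow> bool" where
  "cstar_subalgebra A B \<longleftrightarrow>
     B \<subseteq> carrier A \<and> \<zero>\<^bsub>A\<^esub> \<in> B \<and>
     (\<forall>x\<in>B. \<forall>y\<in>B. x \<oplus>\<^bsub>A\<^esub> y \<in> B \<and> x \<otimes>\<^bsub>A\<^esub> y \<in> B) \<and>
     (\<forall>c. \<forall>x\<in>B. c \<odot>\<^bsub>A\<^esub> x \<in> B) \<and>
     (\<forall>x\<in>B. star A x \<in> B) \<and>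
     (\<forall>\<sigma>::nat \<Rightarrow> 'a. \<forall>x\<in>carrier A.
        range \<sigma> \<subseteq> B \<longrightarrow> (\<lambda>n. cnorm A (\<sigma> n \<ominus>\<^bsub>A\<^esub> x)) \<longlonglongrightarrow> 0 \<longrightarrow> x \<in> B)"

definition generates :: "('a, 'm) normed_star_space_scheme \<Rightarrow> 'a set \<Rightarrow> bool" where
  "generates A S \<longleftrightarrow>
     S \<subseteq> carrier A \<and> (\<forall>B. cstar_subalgebra A B \<longrightarrow> S \<subseteq> B \<longrightarrow> B = carrier A)"

text \<open>The positive elements of a C*-algebra. It is applied to the algebra of \<open>n \<times> n\<close> matrices over
  a C*-algebra, which is again a C*-algebra in a unique norm; the norm is not needed here.\<close>

definition positives :: "('a, 'm) star_space_scheme \<Rightarrow> 'a set" where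
  "positives A = {star A y \<otimes>\<^bsub>A\<^esub> y | y. y \<in> carrier A}"

definition is_projection :: "('a, 'm) star_space_scheme \<Rightarrow> 'a \<Rightarrow> bool" where
  "is_projection A p \<longleftrightarrow> p \<in> carrier A \<and> star A p = p \<and> p \<otimes>\<^bsub>A\<^esub> p = p"

definition unital_complete_order_embedding ::
    "('a, 'm) star_space_scheme \<Rightarrow> (nat \<Rightarrow> 'a mat set) \<Rightarrow> 'a \<Rightarrow>
     ('b, 'k) normed_star_space_scheme \<Rightarrow> ('a \<Rightarrow> 'b) \<Rightarrow> bool" where
  "unital_complete_order_embedding V C e A \<iota> \<longleftrightarrow>
     linear_map class_ring V A \<iota> \<and> inj_on \<iota> (carrier V) \<and> \<iota> e = \<one>\<^bsub>A\<^esub> \<and>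
     (\<forall>n. \<forall>x\<in>carrier (matrices V n). x \<in> C n \<longleftrightarrow> map_mat \<iota> x \<in> positives (matrices A n))"

definition cstar_cover ::
    "('a, 'm) star_space_scheme \<Rightarrow> (nat \<Rightarrow> 'a mat set) \<Rightarrow> 'a \<Rightarrow>
     ('b, 'k) normed_star_space_scheme \<Rightarrow> ('a \<Rightarrow> 'b) \<Rightarrow> bool" where
  "cstar_cover V C e A \<iota> \<longleftrightarrow>
     cstar_algebra A \<and> unital_complete_order_embedding V C e A \<iota> \<and> generates A (\<iota> ` carrier V)"

text \<open>Being a projection in some C*-cover is equivalent to being a projection in the C*-envelope, since
  every C*-cover maps onto the envelope compatibly with the embeddings. The carrier of the C*-cover is a subset of the type \<open>'b\<close>, which has to be named because HOL
  cannot quantify over types. A C*-cover of a finite-dimensional operator system is separable, so it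
  has at most continuum many elements and any \<open>'b\<close> of at least that size loses no generality.\<close>

definition abstract_projection ::
    "'b itself \<Rightarrow> ('a, 'm) star_space_scheme \<Rightarrow> (nat \<Rightarrow> 'a mat set) \<Rightarrow> 'a \<Rightarrow> 'a \<Rightarrow> bool" where
  "abstract_projection TYPE('b) V C e p \<longleftrightarrow>
     p \<in> carrier V \<and>
     (\<exists>(A :: 'b normed_star_space) \<iota>. cstar_cover V C e A \<iota> \<and> is_projection A (\<iota> p))"


section \<open>The space of a set of linear relations\<close>

text \<open>A matrix with columns indexed by \<open>0..N\<close> encodes the relations; \<open>g 0, \<dots>, g N\<close> satisfies them
  if every row annihilates it.\<close>

definition satisfies_relations ::
    "('a, 'm) star_space_scheme \<Rightarrow> real mat \<Rightarrow> (nat \<Rightarrow> 'a) \<Rightarrow> bool" where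
  "satisfies_relations V M g \<longleftrightarrow>
     (\<forall>i<dim_row M.
        (\<Oplus>\<^bsub>V\<^esub>j\<in>{..<dim_col M}. complex_of_real (M $$ (i, j)) \<odot>\<^bsub>V\<^esub> g j) = \<zero>\<^bsub>V\<^esub>)"

abbreviation std_space :: "nat \<Rightarrow> (complex, complex vec) module" where
  "std_space N \<equiv> module_vec TYPE(complex) (Suc N)"

definition rel_span :: "nat \<Rightarrow> real mat \<Rightarrow> complex vec set" where
  "rel_span N M =
     LinearCombinations.module.span class_ring (std_space N) (set (rows (map_mat complex_of_real M)))"

text \<open>The quotient of the standard space by \<open>rel_span\<close>, with cosets as elements. In \<open>smult\<close> the
  relation space is added so that the result is a full coset also for the scalar 0.\<close>

definition rel_space :: "nat \<Rightarrow> real mat \<Rightarrow> complex vec set star_space" where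
  "rel_space N M = \<lparr>
     carrier = a_rcosets\<^bsub>std_space N\<^esub> (rel_span N M),
     mult = undefined,
     one = undefined,
     zero = rel_span N M,
     add = (\<lambda>X Y. X <+>\<^bsub>std_space N\<^esub> Y),
     smult = (\<lambda>c X. rel_span N M <+>\<^bsub>std_space N\<^esub> ((\<lambda>v. c \<cdot>\<^sub>v v) ` X)),
     star = (\<lambda>X. map_vec cnj ` X)\<rparr>"

text \<open>The classes of the standard basis vectors: \<open>rel_gen N M 0\<close> is the unit \<open>e\<close> and
  \<open>rel_gen N M i\<close> is \<open>p\<^sub>i\<close> for \<open>1 \<le> i \<le> N\<close>.\<close>

definition rel_gen :: "nat \<Rightarrow> real mat \<Rightarrow> nat \<Rightarrow> complex vec set" where
  "rel_gen N M i = rel_span N M +>\<^bsub>std_space N\<^esub> unit_vec (Suc N) i"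


section \<open>The projection ordering\<close>

definition compl :: "('a, 'm) star_space_scheme \<Rightarrow> 'a \<Rightarrow> 'a \<Rightarrow> 'a" where
  "compl V e p = e \<ominus>\<^bsub>V\<^esub> p"

definition gen_cone ::
    "('a, 'm) star_space_scheme \<Rightarrow> 'a \<Rightarrow> nat \<Rightarrow> (nat \<Rightarrow> 'a) \<Rightarrow> 'a set" where
  "gen_cone V e N p =
     {complex_of_real r\<^sub>0 \<odot>\<^bsub>V\<^esub> e \<oplus>\<^bsub>V\<^esub>
        (\<Oplus>\<^bsub>V\<^esub>i\<in>{1..N}. complex_of_real (t i) \<odot>\<^bsub>V\<^esub> p i) \<oplus>\<^bsub>V\<^esub>
        (\<Oplus>\<^bsub>V\<^esub>i\<in>{1..N}. complex_of_real (s i) \<odot>\<^bsub>V\<^esub> compl V e (p i))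
      | r\<^sub>0 t s. r\<^sub>0 \<ge> 0 \<and> (\<forall>i\<in>{1..N}. t i \<ge> 0 \<and> s i \<ge> 0)}"

definition closed_gen_cone ::
    "('a, 'm) star_space_scheme \<Rightarrow> 'a \<Rightarrow> nat \<Rightarrow> (nat \<Rightarrow> 'a) \<Rightarrow> 'a set" where
  "closed_gen_cone V e N p =
     {x \<in> hermitian V. \<forall>\<epsilon>>0. x \<oplus>\<^bsub>V\<^esub> complex_of_real \<epsilon> \<odot>\<^bsub>V\<^esub> e \<in> gen_cone V e N p}"

definition D_max :: "('a, 'm) star_space_scheme \<Rightarrow> 'a set \<Rightarrow> nat \<Rightarrow> 'a mat set" where
  "D_max V E n =
     {conj_by V \<alpha> (diag_matrix V m s) | m \<alpha> s. \<alpha> \<in> carrier_mat m n \<and> (\<forall>i<m. s i \<in> E)}"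

definition E_max :: "('a, 'm) star_space_scheme \<Rightarrow> 'a \<Rightarrow> 'a set \<Rightarrow> nat \<Rightarrow> 'a mat set" where
  "E_max V e E n =
     {x \<in> hermitian (matrices V n). \<forall>\<epsilon>>0.
        x \<oplus>\<^bsub>matrices V n\<^esub> complex_of_real \<epsilon> \<odot>\<^bsub>matrices V n\<^esub> amp_unit V n e \<in> D_max V E n}"

text \<open>\<open>x \<otimes> J\<^sub>2\<close> and \<open>I\<^sub>n \<otimes> (a \<oplus> b)\<close>, where the index \<open>2 i + c\<close> of a \<open>2 n \<times> 2 n\<close> matrix stands for the
  pair \<open>(i, c)\<close>\<close>

definition tensor_J2 :: "nat \<Rightarrow> 'a mat \<Rightarrow> 'a mat" where
  "tensor_J2 n x = mat (2 * n) (2 * n) (\<lambda>(r, s). x $$ (r div 2, s div 2))"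

definition amp_pair :: "('a, 'm) star_space_scheme \<Rightarrow> nat \<Rightarrow> 'a \<Rightarrow> 'a \<Rightarrow> 'a mat" where
  "amp_pair V n a b = diag_matrix V (2 * n) (\<lambda>r. if even r then a else b)"

text \<open>The operation \<open>\<C> \<mapsto> \<C>(p)\<close>\<close>
definition proj_step ::
    "('a, 'm) star_space_scheme \<Rightarrow> 'a \<Rightarrow> (nat \<Rightarrow> 'a mat set) \<Rightarrow> 'a \<Rightarrow> nat \<Rightarrow> 'a mat set" where
  "proj_step V e C p n =
     {x \<in> carrier (matrices V n). \<forall>\<epsilon>>0. \<exists>t>0.
        tensor_J2 n x
          \<oplus>\<^bsub>matrices V (2 * n)\<^esub>
            complex_of_real \<epsilon> \<odot>\<^bsub>matrices V (2 * n)\<^esub> amp_pair V n p (compl V e p)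
          \<oplus>\<^bsub>matrices V (2 * n)\<^esub>
            complex_of_real t \<odot>\<^bsub>matrices V (2 * n)\<^esub> amp_pair V n (compl V e p) p
        \<in> C (2 * n)}"

text \<open>The sequence \<open>p\<^sub>1, p\<^sub>2, \<dots>\<close> is \<open>p\<^sub>1, \<dots>, p\<^sub>N\<close> extended periodically, so
  \<open>p\<^sub>n\<^sub>+\<^sub>1\<close> is \<open>p (n mod N + 1)\<close>.\<close>

primrec proj_iterate ::
    "('a, 'm) star_space_scheme \<Rightarrow> 'a \<Rightarrow> nat \<Rightarrow> (nat \<Rightarrow> 'a) \<Rightarrow> nat \<Rightarrow> nat \<Rightarrow> 'a mat set" where
  "proj_iterate V e N p 0 = E_max V e (closed_gen_cone V e N p)"
| "proj_iterate V e N p (Suc n) = proj_step V e (proj_iterate V e N p n) (p (n mod N + 1))"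

definition proj_limit ::
    "('a, 'm) star_space_scheme \<Rightarrow> 'a \<Rightarrow> nat \<Rightarrow> (nat \<Rightarrow> 'a) \<Rightarrow> nat \<Rightarrow> 'a mat set" where
  "proj_limit V e N p k =
     {x \<in> carrier (matrices V k). \<forall>\<epsilon>>0. \<exists>n.
        x \<oplus>\<^bsub>matrices V k\<^esub> complex_of_real \<epsilon> \<odot>\<^bsub>matrices V k\<^esub> amp_unit V k e
        \<in> proj_iterate V e N p n k}"

definition E_proj :: "nat \<Rightarrow> real mat \<Rightarrow> nat \<Rightarrow> complex vec set mat set" where
  "E_proj N M = proj_limit (rel_space N M) (rel_gen N M 0) N (rel_gen N M)"

end

theory Submission
  imports Defs "HOL-Analysis.Function_Topology" "HOL-Analysis.L2_Norm" "HOL-Analysis.Topology_Euclidean_Space"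
begin

text \<open>The proof has two halves. The first compares \<open>E\<^sup>p\<^sup>r\<^sup>o\<^sup>j\<close> with the given operator system. The
  relations hold in \<open>V\<close>, so \<open>\<phi>\<close> is a well-defined linear map. It is positive on the generating cone,
  hence on \<open>E\<^sup>m\<^sup>a\<^sup>x\<close>, and positivity survives each step \<open>C \<mapsto> C(p)\<close> because the ordering \<open>D\<close> satisfies
  \<open>D(q) \<subseteq> D\<close> for every abstract projection \<open>q\<close>: compressing
  \<open>x \<otimes> J\<^sub>2 + \<epsilon> I \<otimes> (q \<oplus> q\<^sup>\<bottom>) + t I \<otimes> (q\<^sup>\<bottom> \<oplus> q)\<close> by the column \<open>(q, q\<^sup>\<bottom>)\<close> in a C*-cover
  leaves \<open>x + \<epsilon> I \<otimes> e\<close> (\<open>projection_in_cover\<close>, \<open>transfer_positivity\<close>). So \<open>\<phi>\<close> is completely positive.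
  It maps onto \<open>V\<close>, and equality of dimensions makes it injective; the properness of \<open>D\<close> therefore gives that of
  \<open>E\<^sup>p\<^sup>r\<^sup>o\<^sup>j\<close>. The remaining axioms of an operator system hold because
  \<open>E\<^sup>p\<^sup>r\<^sup>o\<^sup>j\<close> is an Archimedean closure and the generators with their complements are positive.

  The second half realises the generators as projections. Since the chain defining \<open>E\<^sup>p\<^sup>r\<^sup>o\<^sup>j\<close> uses each
  generator \<open>p\<close> infinitely often, \<open>E\<^sup>p\<^sup>r\<^sup>o\<^sup>j(p) \<subseteq> E\<^sup>p\<^sup>r\<^sup>o\<^sup>j\<close> (\<open>limit_proj_step\<close>). Any Archimedean
  ordering \<open>C\<close> with \<open>C(p) \<subseteq> C\<close> comes from representations in which \<open>p\<close> is a projection: an element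
  \<open>x\<close> outside \<open>C\<close> is outside \<open>C(p)\<close>, so there is a positive functional on \<open>2n \<times> 2n\<close>
  matrices that vanishes on \<open>I \<otimes> (p\<^sup>\<bottom> \<oplus> p)\<close> and is negative on \<open>x \<otimes> J\<^sub>2\<close>. Its scalar part is a
  semi-inner product, and the vanishing forces \<open>p\<close> to act as the projection onto the even coordinates;
  orthonormalisation yields a unital completely positive map into matrices under which \<open>p\<close> becomes a projection and
  \<open>x\<close> fails to be positive (\<open>representation_exists\<close>).

  By separability of the space of coefficients, countably many of these maps suffice. Their direct sum is a complete order
  embedding into the block-diagonal bounded matrices, and the C*-algebra generated by its image is a
  C*-cover. All blocks are finite, so the norm, the C*-identity and completeness are elementary, and the carrier consists of
  functions \<open>nat \<Rightarrow> nat \<Rightarrow> complex\<close>. Positive elements need a square root in the generated algebra itself; it is the limit of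
  the iteration \<open>s \<mapsto> (k + s\<^sup>2) / 2\<close>, whose rate of convergence is the same for all contractions \<open>k\<close>
  (\<open>positive_root\<close>).\<close>

section \<open>Positive semidefinite kernels\<close>

definition sesq :: "'i set \<Rightarrow> ('i \<Rightarrow> 'i \<Rightarrow> complex) \<Rightarrow> ('i \<Rightarrow> complex) \<Rightarrow> ('i \<Rightarrow> complex) \<Rightarrow> complex" where
  "sesq S q v w = (\<Sum>r\<in>S. \<Sum>s\<in>S. cnj (v r) * q r s * w s)"

text \<open>Kernels \<open>q\<close> on an index set \<open>S\<close> stand for matrices with rows and columns in \<open>S\<close>; they may be
  indexed by pairs, which makes matrices over a matrix algebra kernels as well.\<close>
definition psd :: "'i set \<Rightarrow> ('i \<Rightarrow> 'i \<Rightarrow> complex) \<Rightarrow> bool" where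
  "psd S q \<longleftrightarrow> (\<forall>r\<in>S. \<forall>s\<in>S. q s r = cnj (q r s)) \<and> (\<forall>v. 0 \<le> Re (sesq S q v v))"

lemma psd_nonneg: "psd S q \<Longrightarrow> 0 \<le> Re (sesq S q v v)"
  unfolding psd_def by blast

lemma psd_hermitian: "psd S q \<Longrightarrow> r \<in> S \<Longrightarrow> s \<in> S \<Longrightarrow> q s r = cnj (q r s)"
  unfolding psd_def by blast

lemma sesq_add_right: "sesq S q v (\<lambda>s. w s + w' s) = sesq S q v w + sesq S q v w'"
  by (simp add: sesq_def distrib_left sum.distrib)

lemma sesq_scale_right: "sesq S q v (\<lambda>s. c * w s) = c * sesq S q v w"
  by (simp add: sesq_def sum_distrib_left mult_ac)

lemma sesq_add_left: "sesq S q (\<lambda>s. v s + v' s) w = sesq S q v w + sesq S q v' w"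
  by (simp add: sesq_def distrib_left distrib_right sum.distrib)

lemma sesq_scale_left: "sesq S q (\<lambda>s. c * v s) w = cnj c * sesq S q v w"
  by (simp add: sesq_def sum_distrib_left mult_ac)

lemma sesq_sum_right: "sesq S q v (\<lambda>s. \<Sum>k\<in>K. c k * w k s) = (\<Sum>k\<in>K. c k * sesq S q v (w k))"
proof (induction K rule: infinite_finite_induct)
  case (insert k K)
  then show ?case using sesq_add_right[of S q v "\<lambda>s. c k * w k s"] by (simp add: sesq_scale_right)
qed (simp_all add: sesq_def)

lemma sesq_sum_left: "sesq S q (\<lambda>s. \<Sum>k\<in>K. c k * v k s) w = (\<Sum>k\<in>K. cnj (c k) * sesq S q (v k) w)"
proof (induction K rule: infinite_finite_induct)
  case (insert k K)
  then show ?case using sesq_add_left[of S q "\<lambda>s. c k * v k s"] by (simp add: sesq_scale_left)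
qed (simp_all add: sesq_def)

lemma sesq_cong:
  "(\<And>r s. r \<in> S \<Longrightarrow> s \<in> S \<Longrightarrow> q r s = q' r s) \<Longrightarrow> (\<And>r. r \<in> S \<Longrightarrow> v r = v' r) \<Longrightarrow>
   (\<And>r. r \<in> S \<Longrightarrow> w r = w' r) \<Longrightarrow> sesq S q v w = sesq S q' v' w'"
  by (simp add: sesq_def)

lemma psd_cong:
  assumes "\<And>r s. r \<in> S \<Longrightarrow> s \<in> S \<Longrightarrow> q r s = q' r s"
  shows "psd S q = psd S q'"
proof -
  have "sesq S q v v = sesq S q' v v" for v by (rule sesq_cong) (use assms in auto)
  then show ?thesis using assms unfolding psd_def by metis
qed

lemma sesq_cnj:
  assumes "psd S q" shows "sesq S q w v = cnj (sesq S q v w)"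
proof -
  have h: "\<And>r s. r \<in> S \<Longrightarrow> s \<in> S \<Longrightarrow> q s r = cnj (q r s)" by (rule psd_hermitian[OF assms])
  have "cnj (sesq S q v w) = (\<Sum>r\<in>S. \<Sum>s\<in>S. v r * cnj (q r s) * cnj (w s))"
    by (simp add: sesq_def)
  also have "\<dots> = (\<Sum>s\<in>S. \<Sum>r\<in>S. v r * cnj (q r s) * cnj (w s))" by (rule sum.swap)
  also have "\<dots> = sesq S q w v" unfolding sesq_def
  proof (intro sum.cong refl)
    fix s r assume "s \<in> S" "r \<in> S"
    then have "cnj (q r s) = q s r" by (intro h[symmetric])
    then show "v r * cnj (q r s) * cnj (w s) = cnj (w s) * q s r * v r" by simp
  qed
  finally show ?thesis by simp
qed

lemma sesq_diag_real:
  assumes "psd S q" shows "sesq S q v v = complex_of_real (Re (sesq S q v v))"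
  using arg_cong[OF sesq_cnj[OF assms, of v v], of Im] by (simp add: complex_eq_iff)

lemma psd_expand:
  assumes "psd S q"
  shows "0 \<le> Re (sesq S q v v) + 2 * Re (c * sesq S q v w) + (cmod c)\<^sup>2 * Re (sesq S q w w)"
proof -
  have "sesq S q (\<lambda>s. v s + c * w s) (\<lambda>s. v s + c * w s)
      = sesq S q v v + c * sesq S q v w + (cnj c * sesq S q w v + cnj c * (c * sesq S q w w))"
    by (simp add: sesq_add_left sesq_add_right sesq_scale_left sesq_scale_right distrib_left)
  also have "\<dots> = sesq S q v v + (c * sesq S q v w + cnj (c * sesq S q v w))
      + complex_of_real ((cmod c)\<^sup>2) * sesq S q w w"
    by (simp add: sesq_cnj[OF assms, of w v] complex_norm_square mult_ac del: of_real_power)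
  finally have "Re (sesq S q (\<lambda>s. v s + c * w s) (\<lambda>s. v s + c * w s))
     = Re (sesq S q v v) + 2 * Re (c * sesq S q v w) + (cmod c)\<^sup>2 * Re (sesq S q w w)"
    by (simp only: plus_complex.sel complex_cnj Re_complex_of_real) (simp)
  then show ?thesis by (metis psd_nonneg[OF assms])
qed

text \<open>The discriminant argument, applied to the multiple of \<open>w\<close> that minimises the form on
  \<open>v + c w\<close>. If the form vanishes at \<open>w\<close> there is no minimum, and a large multiple shows that
  the mixed term is \<open>0\<close>.\<close>
lemma psd_Cauchy_Schwarz:
  assumes "psd S q"
  shows "(cmod (sesq S q v w))\<^sup>2 \<le> Re (sesq S q v v) * Re (sesq S q w w)"
proof (cases "Re (sesq S q w w) = 0")
  case True
  let ?a = "(cmod (sesq S q v w))\<^sup>2"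
  have "?a = 0"
  proof (rule ccontr)
    assume "?a \<noteq> 0"
    then have a: "?a > 0" by simp
    define t where "t = (Re (sesq S q v v) + 1) / (2 * ?a)"
    define c where "c = - complex_of_real t * cnj (sesq S q v w)"
    have "c * sesq S q v w = complex_of_real (- t * ?a)"
      by (simp add: c_def complex_norm_square mult_ac del: of_real_power)
    then have "Re (c * sesq S q v w) = - t * ?a" by (simp only: Re_complex_of_real)
    then have "0 \<le> Re (sesq S q v v) - 2 * t * ?a"
      using psd_expand[OF assms, of v c w] True by simp
    also have "2 * t * ?a = Re (sesq S q v v) + 1" using a by (simp add: t_def)
    finally show False by simp
  qed
  then show ?thesis using True by simp
next
  case False
  define b where "b = Re (sesq S q w w)"
  have b: "b > 0" using False psd_nonneg[OF assms] by (simp add: b_def less_le)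
  let ?a = "(cmod (sesq S q v w))\<^sup>2"
  define c where "c = - cnj (sesq S q v w) / complex_of_real b"
  have "c * sesq S q v w = complex_of_real (- ?a / b)"
    by (simp add: c_def complex_norm_square mult_ac del: of_real_power)
  then have r: "Re (c * sesq S q v w) = - ?a / b" by (simp only: Re_complex_of_real)
  have "(cmod c)\<^sup>2 = ?a / b\<^sup>2" by (simp add: c_def norm_divide power_divide)
  then have "0 \<le> Re (sesq S q v v) - 2 * (?a / b) + ?a / b\<^sup>2 * b"
    using psd_expand[OF assms, of v c w] r by (simp add: b_def)
  also have "?a / b\<^sup>2 * b = ?a / b" using b by (simp add: power2_eq_square)
  finally have "?a / b \<le> Re (sesq S q v v)" by simp
  then show ?thesis using b by (simp add: b_def[symmetric] pos_divide_le_eq)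
qed

lemma psd_null:
  assumes "psd S q" "Re (sesq S q w w) = 0" shows "sesq S q v w = 0"
  using psd_Cauchy_Schwarz[OF assms(1), of v w] assms(2) by simp

abbreviation delta :: "'i \<Rightarrow> 'i \<Rightarrow> complex" where
  "delta r s \<equiv> (if r = s then 1 else 0)"

lemma sesq_delta:
  assumes "finite S" "r \<in> S" "s \<in> S" shows "sesq S q (delta r) (delta s) = q r s"
proof -
  have "sesq S q (delta r) (delta s)
      = (\<Sum>r'\<in>S. \<Sum>s'\<in>S. if r' = r then if s' = s then q r s else 0 else 0)"
    unfolding sesq_def by (intro sum.cong refl) auto
  also have "\<dots> = (\<Sum>r'\<in>S. if r' = r then q r s else 0)"
    by (intro sum.cong refl) (use assms in auto)
  finally show ?thesis using assms by simp
qed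

lemma sesq_expand_right:
  assumes "finite S" shows "sesq S q v w = (\<Sum>s\<in>S. w s * sesq S q v (delta s))"
proof -
  have "sesq S q v w = sesq S q v (\<lambda>r. \<Sum>s\<in>S. w s * delta s r)"
    by (intro sesq_cong refl) (simp add: assms if_distrib cong: if_cong)
  then show ?thesis by (simp add: sesq_sum_right)
qed

text \<open>Gram--Schmidt for a form that may be degenerate. Orthogonalising the next basis vector leaves a
  remainder \<open>w\<close>; if the form vanishes at \<open>w\<close> then \<open>w\<close> is in the radical by
  Cauchy--Schwarz and contributes nothing, otherwise the normalised \<open>w\<close> is added to the frame.\<close>
lemma psd_orthonormal_on_subset:
  assumes q: "psd S q" and "finite T"
  shows "\<exists>(m::nat) u. (\<forall>k<m. \<forall>l<m. sesq S q (u k) (u l) = delta k l) \<and>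
    (\<forall>r\<in>T. \<forall>v. sesq S q v (delta r) = (\<Sum>k<m. sesq S q v (u k) * sesq S q (u k) (delta r)))"
  using assms(2)
proof (induction T)
  case empty
  show ?case by (rule exI[of _ 0]) auto
next
  case (insert t T)
  let ?Q = "sesq S q"
  from insert.IH obtain m :: nat and u where
    on: "\<And>k l. k < m \<Longrightarrow> l < m \<Longrightarrow> ?Q (u k) (u l) = delta k l" and
    ex: "\<And>r v. r \<in> T \<Longrightarrow> ?Q v (delta r) = (\<Sum>k<m. ?Q v (u k) * ?Q (u k) (delta r))"
    by blast
  \<comment> \<open>the part of the new basis vector orthogonal to the frame\<close>
  define w where "w = (\<lambda>s. delta t s + (\<Sum>k<m. (- ?Q (u k) (delta t)) * u k s))"
  have Qw: "?Q v w = ?Q v (delta t) - (\<Sum>k<m. ?Q v (u k) * ?Q (u k) (delta t))" for v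
    unfolding w_def sesq_add_right sesq_sum_right by (simp add: sum_negf mult_ac)
  have orth: "?Q (u k) w = 0" if "k < m" for k
  proof -
    have "(\<Sum>l<m. ?Q (u k) (u l) * ?Q (u l) (delta t)) = (\<Sum>l<m. if l = k then ?Q (u k) (delta t) else 0)"
      by (intro sum.cong refl) (auto simp: on that)
    then show ?thesis using that by (simp add: Qw)
  qed
  have orth': "?Q w (u k) = 0" if "k < m" for k
    using orth[OF that] sesq_cnj[OF q, of w "u k"] by simp
  define c where "c = Re (?Q w w)"
  have cc: "?Q w w = complex_of_real c" unfolding c_def by (rule sesq_diag_real[OF q])
  have wt: "?Q w (delta t) = complex_of_real c"
  proof -
    have "?Q w w = ?Q w (delta t)" unfolding Qw by (simp add: orth')
    then show ?thesis using cc by simp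
  qed
  show ?case
  proof (cases "c = 0")
    case True
    have "?Q v w = 0" for v by (rule psd_null[OF q]) (use True c_def in simp)
    then have "?Q v (delta t) = (\<Sum>k<m. ?Q v (u k) * ?Q (u k) (delta t))" for v
      using Qw[of v] by simp
    then have "\<forall>r\<in>insert t T. \<forall>v. ?Q v (delta r) = (\<Sum>k<m. ?Q v (u k) * ?Q (u k) (delta r))"
      using ex by blast
    with on show ?thesis by blast
  next
    case False
    then have c: "c > 0" using psd_nonneg[OF q] by (simp add: c_def less_le)
    define z where "z = (\<lambda>s. complex_of_real (1 / sqrt c) * w s)"
    define u' where "u' = u(m := z)"
    have cc1: "complex_of_real (1 / sqrt c) * complex_of_real (1 / sqrt c) = complex_of_real (1 / c)"
      unfolding of_real_mult[symmetric] using c by (simp add: real_sqrt_mult[symmetric])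
    have zz: "?Q z z = 1"
    proof -
      have "?Q z z = (complex_of_real (1 / sqrt c) * complex_of_real (1 / sqrt c)) * complex_of_real c"
        unfolding z_def sesq_scale_left sesq_scale_right cc by simp
      also have "\<dots> = 1" unfolding cc1 using c by simp
      finally show ?thesis .
    qed
    have zprod: "?Q v z * ?Q z x = complex_of_real (1 / c) * (?Q v w * ?Q w x)" for v x
    proof -
      have "?Q v z * ?Q z x = (complex_of_real (1 / sqrt c) * complex_of_real (1 / sqrt c)) * (?Q v w * ?Q w x)"
        unfolding z_def sesq_scale_left sesq_scale_right complex_cnj_complex_of_real
        by (simp only: mult_ac)
      then show ?thesis unfolding cc1 .
    qed
    have on': "?Q (u' k) (u' l) = delta k l" if "k < Suc m" "l < Suc m" for k l
    proof -
      have uz: "?Q (u k) z = 0" "?Q z (u k) = 0" if "k < m" for k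
        unfolding z_def sesq_scale_left sesq_scale_right using orth[OF that] orth'[OF that] by simp_all
      then show ?thesis using that zz on[of k l] by (auto simp: u'_def less_Suc_eq)
    qed
    have sum': "(\<Sum>k<Suc m. ?Q v (u' k) * ?Q (u' k) x)
        = (\<Sum>k<m. ?Q v (u k) * ?Q (u k) x) + complex_of_real (1 / c) * (?Q v w * ?Q w x)" for v x
      by (simp add: u'_def zprod)
    have "?Q v (delta r) = (\<Sum>k<Suc m. ?Q v (u' k) * ?Q (u' k) (delta r))" if "r \<in> insert t T" for v r
    proof (cases "r = t")
      case True
      show ?thesis unfolding sum' True wt using c Qw[of v] by simp
    next
      case False
      then have r: "r \<in> T" using that by auto
      have "?Q w (delta r) = 0" unfolding ex[OF r, of w] by (simp add: orth')
      then show ?thesis unfolding sum' using ex[OF r, of v] by (simp only: mult_zero_right add_0_right)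
    qed
    then show ?thesis using on' by blast
  qed
qed

text \<open>Parseval's identity: the vectors \<open>u k\<close> are an orthonormal basis of the quotient by the radical.\<close>
lemma psd_orthonormal_frame:
  assumes q: "psd S q" and S: "finite S"
  shows "\<exists>(m::nat) u. (\<forall>k<m. \<forall>l<m. sesq S q (u k) (u l) = delta k l) \<and>
    (\<forall>v w. sesq S q v w = (\<Sum>k<m. sesq S q v (u k) * sesq S q (u k) w))"
proof -
  from psd_orthonormal_on_subset[OF q S] obtain m :: nat and u where
    mu: "(\<forall>k<m. \<forall>l<m. sesq S q (u k) (u l) = delta k l) \<and>
      (\<forall>r\<in>S. \<forall>v. sesq S q v (delta r) = (\<Sum>k<m. sesq S q v (u k) * sesq S q (u k) (delta r)))"
    by (elim exE)
  note 1 = conjunct1[OF mu] and 2 = bspec[OF conjunct2[OF mu], THEN spec]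
  have "sesq S q v w = (\<Sum>k<m. sesq S q v (u k) * sesq S q (u k) w)" for v w
  proof -
    have "sesq S q v w = (\<Sum>s\<in>S. w s * (\<Sum>k<m. sesq S q v (u k) * sesq S q (u k) (delta s)))"
      by (subst sesq_expand_right[OF S], intro sum.cong refl arg_cong2[of _ _ _ _ "(*)"] 2)
    also have "\<dots> = (\<Sum>s\<in>S. \<Sum>k<m. sesq S q v (u k) * (w s * sesq S q (u k) (delta s)))"
      by (simp add: sum_distrib_left mult_ac)
    also have "\<dots> = (\<Sum>k<m. \<Sum>s\<in>S. sesq S q v (u k) * (w s * sesq S q (u k) (delta s)))"
      by (rule sum.swap)
    also have "\<dots> = (\<Sum>k<m. sesq S q v (u k) * sesq S q (u k) w)"
      by (simp add: sesq_expand_right[OF S, of q _ w] sum_distrib_left)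
    finally show ?thesis .
  qed
  then have 3: "\<forall>v w. sesq S q v w = (\<Sum>k<m. sesq S q v (u k) * sesq S q (u k) w)" by (intro allI)
  show ?thesis by (rule exI[of _ m], rule exI[of _ u], rule conjI[OF 1 3])
qed

lemma psd_factorization:
  assumes q: "psd S q" and S: "finite S"
  shows "\<exists>(m::nat) b. \<forall>r\<in>S. \<forall>s\<in>S. q r s = (\<Sum>k<m. cnj (b k r) * b k s)"
proof -
  from psd_orthonormal_frame[OF q S] obtain m :: nat and u where
    "(\<forall>k<m. \<forall>l<m. sesq S q (u k) (u l) = delta k l) \<and>
     (\<forall>v w. sesq S q v w = (\<Sum>k<m. sesq S q v (u k) * sesq S q (u k) w))"
    by (elim exE)
  then have u: "\<And>v w. sesq S q v w = (\<Sum>k<m. sesq S q v (u k) * sesq S q (u k) w)"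
    by (elim conjE allE)
  have "q r s = (\<Sum>k<m. cnj (sesq S q (u k) (delta r)) * sesq S q (u k) (delta s))"
    if "r \<in> S" "s \<in> S" for r s
  proof -
    have "q r s = (\<Sum>k<m. sesq S q (delta r) (u k) * sesq S q (u k) (delta s))"
      unfolding u[symmetric] by (rule sesq_delta[OF S that, symmetric])
    moreover have "sesq S q (delta r) (u k) = cnj (sesq S q (u k) (delta r))" for k
      by (rule sesq_cnj[OF q])
    ultimately show ?thesis by (simp only:)
  qed
  then show ?thesis by (intro exI ballI)
qed

section \<open>Bounded kernels\<close>

definition kapp :: "'i set \<Rightarrow> ('i \<Rightarrow> 'i \<Rightarrow> complex) \<Rightarrow> ('i \<Rightarrow> complex) \<Rightarrow> 'i \<Rightarrow> complex" where
  "kapp S a v r = (\<Sum>s\<in>S. a r s * v s)"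

definition kmult :: "'i set \<Rightarrow> ('i \<Rightarrow> 'i \<Rightarrow> complex) \<Rightarrow> ('i \<Rightarrow> 'i \<Rightarrow> complex) \<Rightarrow> 'i \<Rightarrow> 'i \<Rightarrow> complex" where
  "kmult S a b r t = (\<Sum>s\<in>S. a r s * b s t)"

definition kadj :: "('i \<Rightarrow> 'i \<Rightarrow> complex) \<Rightarrow> 'i \<Rightarrow> 'i \<Rightarrow> complex" where
  "kadj a r s = cnj (a s r)"

definition l2 :: "'i set \<Rightarrow> ('i \<Rightarrow> complex) \<Rightarrow> real" where
  "l2 S v = L2_set (\<lambda>r. cmod (v r)) S"

text \<open>\<open>c\<close> bounds the operator norm of \<open>a\<close> on the finite-dimensional Hilbert space of functions on \<open>S\<close>.\<close>
definition bd :: "'i set \<Rightarrow> ('i \<Rightarrow> 'i \<Rightarrow> complex) \<Rightarrow> real \<Rightarrow> bool" where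
  "bd S a c \<longleftrightarrow> (\<forall>v. l2 S (kapp S a v) \<le> c * l2 S v)"

lemma bdD: "bd S a c \<Longrightarrow> l2 S (kapp S a v) \<le> c * l2 S v"
  by (simp add: bd_def)

lemma l2_nonneg: "0 \<le> l2 S v" by (simp add: l2_def L2_set_nonneg)

lemma l2_sq: "(l2 S v)\<^sup>2 = (\<Sum>r\<in>S. (cmod (v r))\<^sup>2)"
  by (simp add: l2_def L2_set_def sum_nonneg)

lemma l2_cong: "(\<And>r. r \<in> S \<Longrightarrow> v r = w r) \<Longrightarrow> l2 S v = l2 S w"
  by (simp add: l2_def cong: L2_set_cong)

lemma l2_inner_le: "cmod (\<Sum>r\<in>S. cnj (v r) * w r) \<le> l2 S v * l2 S w"
proof -
  have "cmod (\<Sum>r\<in>S. cnj (v r) * w r) \<le> (\<Sum>r\<in>S. \<bar>cmod (v r)\<bar> * \<bar>cmod (w r)\<bar>)"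
    by (rule order.trans[OF norm_sum]) (simp add: norm_mult)
  also have "\<dots> \<le> l2 S v * l2 S w" unfolding l2_def by (rule L2_set_mult_ineq)
  finally show ?thesis .
qed

lemma l2_inner_self: "(\<Sum>r\<in>S. cnj (v r) * v r) = complex_of_real ((l2 S v)\<^sup>2)"
  by (simp add: l2_sq complex_norm_square mult.commute del: of_real_power)

lemma l2_add: "l2 S (\<lambda>r. v r + w r) \<le> l2 S v + l2 S w"
proof -
  have "l2 S (\<lambda>r. v r + w r) \<le> L2_set (\<lambda>r. cmod (v r) + cmod (w r)) S"
    unfolding l2_def by (rule L2_set_mono) (auto intro: norm_triangle_ineq)
  also have "\<dots> \<le> l2 S v + l2 S w" unfolding l2_def by (rule L2_set_triangle_ineq)
  finally show ?thesis .
qed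

lemma l2_scale: "l2 S (\<lambda>r. c * v r) = cmod c * l2 S v"
  unfolding l2_def by (simp add: norm_mult L2_set_right_distrib)

lemma l2_delta: "finite S \<Longrightarrow> s \<in> S \<Longrightarrow> l2 S (delta s) = 1"
  unfolding l2_def L2_set_def by (simp add: if_distrib[of cmod] if_distrib[of "\<lambda>x. x\<^sup>2"] cong: if_cong)

lemma l2_entry: "finite S \<Longrightarrow> s \<in> S \<Longrightarrow> cmod (v s) \<le> l2 S v"
  unfolding l2_def by (rule member_le_L2_set) auto

lemma kapp_cong:
  "(\<And>s. s \<in> S \<Longrightarrow> a r s = a' r s) \<Longrightarrow> (\<And>s. s \<in> S \<Longrightarrow> v s = v' s) \<Longrightarrow> kapp S a v r = kapp S a' v' r"
  by (simp add: kapp_def)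

lemma bd_cong:
  assumes "\<And>r s. r \<in> S \<Longrightarrow> s \<in> S \<Longrightarrow> a r s = a' r s"
  shows "bd S a c = bd S a' c"
proof -
  have "l2 S (kapp S a v) = l2 S (kapp S a' v)" for v
    by (intro l2_cong kapp_cong) (use assms in auto)
  then show ?thesis by (simp add: bd_def)
qed

lemma bd_mono: "bd S a c \<Longrightarrow> c \<le> d \<Longrightarrow> bd S a d"
  unfolding bd_def by (meson l2_nonneg mult_right_mono order.trans)

lemma bd_add:
  assumes "bd S a c" "bd S b d" shows "bd S (\<lambda>r s. a r s + b r s) (c + d)"
  unfolding bd_def
proof
  fix v
  have "kapp S (\<lambda>r s. a r s + b r s) v = (\<lambda>r. kapp S a v r + kapp S b v r)"
    by (simp add: kapp_def distrib_right sum.distrib fun_eq_iff)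
  then have "l2 S (kapp S (\<lambda>r s. a r s + b r s) v) \<le> l2 S (kapp S a v) + l2 S (kapp S b v)"
    by (simp add: l2_add)
  also have "\<dots> \<le> c * l2 S v + d * l2 S v" using assms by (simp add: bd_def add_mono)
  finally show "l2 S (kapp S (\<lambda>r s. a r s + b r s) v) \<le> (c + d) * l2 S v" by (simp add: distrib_right)
qed

lemma bd_scale:
  assumes "bd S a c" shows "bd S (\<lambda>r s. z * a r s) (cmod z * c)"
  unfolding bd_def
proof
  fix v
  have "kapp S (\<lambda>r s. z * a r s) v = (\<lambda>r. z * kapp S a v r)"
    by (simp add: kapp_def sum_distrib_left mult_ac fun_eq_iff)
  then have "l2 S (kapp S (\<lambda>r s. z * a r s) v) = cmod z * l2 S (kapp S a v)"
    by (simp add: l2_scale)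
  also have "\<dots> \<le> cmod z * (c * l2 S v)" using assms by (simp add: bd_def mult_left_mono)
  finally show "l2 S (kapp S (\<lambda>r s. z * a r s) v) \<le> cmod z * c * l2 S v" by (simp add: mult_ac)
qed

lemma kapp_kmult: "kapp S (kmult S a b) v = kapp S a (kapp S b v)"
proof
  fix r
  have "kapp S (kmult S a b) v r = (\<Sum>t\<in>S. \<Sum>s\<in>S. a r s * b s t * v t)"
    by (simp add: kapp_def kmult_def sum_distrib_right)
  also have "\<dots> = (\<Sum>s\<in>S. \<Sum>t\<in>S. a r s * b s t * v t)" by (rule sum.swap)
  finally show "kapp S (kmult S a b) v r = kapp S a (kapp S b v) r"
    by (simp add: kapp_def sum_distrib_left mult_ac)
qed

lemma bd_mult:
  assumes "bd S a c" "bd S b d" "0 \<le> c" shows "bd S (kmult S a b) (c * d)"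
  unfolding bd_def kapp_kmult
proof
  fix v
  have "l2 S (kapp S a (kapp S b v)) \<le> c * l2 S (kapp S b v)" using assms by (simp add: bd_def)
  also have "\<dots> \<le> c * (d * l2 S v)" using assms by (simp add: bd_def mult_left_mono)
  finally show "l2 S (kapp S a (kapp S b v)) \<le> c * d * l2 S v" by (simp add: mult_ac)
qed

lemma kadj_inner: "(\<Sum>r\<in>S. cnj (v r) * kapp S (kadj a) w r) = (\<Sum>r\<in>S. cnj (kapp S a v r) * w r)"
proof -
  have "(\<Sum>r\<in>S. cnj (v r) * kapp S (kadj a) w r) = (\<Sum>r\<in>S. \<Sum>s\<in>S. cnj (v r) * cnj (a s r) * w s)"
    by (simp add: kapp_def kadj_def sum_distrib_left mult_ac)
  also have "\<dots> = (\<Sum>s\<in>S. \<Sum>r\<in>S. cnj (v r) * cnj (a s r) * w s)" by (rule sum.swap)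
  also have "\<dots> = (\<Sum>r\<in>S. cnj (kapp S a v r) * w r)"
    by (simp add: kapp_def sum_distrib_right sum_distrib_left mult_ac)
  finally show ?thesis .
qed

lemma sq_le_mult_imp_le: "0 \<le> x \<Longrightarrow> 0 \<le> y \<Longrightarrow> x\<^sup>2 \<le> y * x \<Longrightarrow> x \<le> (y::real)"
  by (cases "x = 0") (auto simp: power2_eq_square mult_le_cancel_right)

lemma eq_cmod_if_of_real_eq: "0 \<le> x \<Longrightarrow> complex_of_real x = z \<Longrightarrow> x = cmod z"
  by (auto simp del: of_real_power)

text \<open>The estimate \<open>\<parallel>a\<^sup>*v\<parallel>\<^sup>2 = \<langle>a a\<^sup>* v, v\<rangle> \<le> c \<parallel>a\<^sup>* v\<parallel> \<parallel>v\<parallel>\<close>.\<close>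
lemma bd_adj:
  assumes a: "bd S a c" and c: "0 \<le> c" shows "bd S (kadj a) c"
  unfolding bd_def
proof
  fix v
  let ?w = "kapp S (kadj a) v"
  have "complex_of_real ((l2 S ?w)\<^sup>2) = (\<Sum>r\<in>S. cnj (kapp S a ?w r) * v r)"
    by (simp only: l2_inner_self[symmetric] kadj_inner)
  then have "(l2 S ?w)\<^sup>2 = cmod (\<Sum>r\<in>S. cnj (kapp S a ?w r) * v r)"
    by (intro eq_cmod_if_of_real_eq zero_le_power2)
  also have "\<dots> \<le> l2 S (kapp S a ?w) * l2 S v" by (rule l2_inner_le)
  also have "\<dots> \<le> (c * l2 S ?w) * l2 S v"
    by (intro mult_right_mono bdD[OF a] l2_nonneg)
  finally have "(l2 S ?w)\<^sup>2 \<le> (c * l2 S v) * l2 S ?w" by (simp only: mult_ac)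
  then show "l2 S ?w \<le> c * l2 S v"
    by (rule sq_le_mult_imp_le[OF l2_nonneg mult_nonneg_nonneg[OF c l2_nonneg]])
qed

lemma kadj_kadj: "kadj (kadj a) = a" by (simp add: kadj_def fun_eq_iff)

text \<open>The estimate \<open>\<parallel>a v\<parallel>\<^sup>2 = \<langle>a\<^sup>* a v, v\<rangle>\<close> with Cauchy--Schwarz; this is the nontrivial half of the C*-identity.\<close>
lemma bd_cstar:
  assumes a: "bd S (kmult S (kadj a) a) (c\<^sup>2)" and c: "0 \<le> c" shows "bd S a c"
  unfolding bd_def
proof
  fix v
  let ?w = "kapp S a v"
  have "complex_of_real ((l2 S ?w)\<^sup>2) = (\<Sum>r\<in>S. cnj (v r) * kapp S (kadj a) ?w r)"
    by (simp only: l2_inner_self[symmetric] kadj_inner)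
  then have "(l2 S ?w)\<^sup>2 = cmod (\<Sum>r\<in>S. cnj (v r) * kapp S (kadj a) ?w r)"
    by (intro eq_cmod_if_of_real_eq zero_le_power2)
  also have "\<dots> \<le> l2 S v * l2 S (kapp S (kadj a) ?w)" by (rule l2_inner_le)
  also have "\<dots> \<le> l2 S v * (c\<^sup>2 * l2 S v)"
    unfolding kapp_kmult[symmetric] by (intro mult_left_mono bdD[OF a] l2_nonneg)
  finally have "(l2 S ?w)\<^sup>2 \<le> (c * l2 S v)\<^sup>2" by (simp add: power2_eq_square mult_ac)
  then show "l2 S ?w \<le> c * l2 S v"
    by (rule power2_le_imp_le[OF _ mult_nonneg_nonneg[OF c l2_nonneg]])
qed

lemma kapp_delta: "finite S \<Longrightarrow> s \<in> S \<Longrightarrow> kapp S a (delta s) r = a r s"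
  by (simp add: kapp_def if_distrib cong: if_cong)

lemma bd_entry:
  assumes "bd S a c" "finite S" "r \<in> S" "s \<in> S" shows "cmod (a r s) \<le> c"
proof -
  have "cmod (kapp S a (delta s) r) \<le> l2 S (kapp S a (delta s))" by (rule l2_entry[OF assms(2,3)])
  also have "\<dots> \<le> c * l2 S (delta s)" using assms by (simp add: bd_def)
  finally show ?thesis using assms by (simp add: kapp_delta l2_delta)
qed

lemma bd_lim:
  assumes lim: "\<And>r s. r \<in> S \<Longrightarrow> s \<in> S \<Longrightarrow> (\<lambda>n. f n r s) \<longlonglongrightarrow> a r s"
    and ev: "\<forall>\<^sub>F n in sequentially. bd S (f n) c"
  shows "bd S a c"
  unfolding bd_def
proof
  fix v
  have "(\<lambda>n. l2 S (kapp S (f n) v)) \<longlonglongrightarrow> l2 S (kapp S a v)"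
    unfolding l2_def L2_set_def kapp_def by (intro tendsto_intros lim) auto
  moreover have "\<forall>\<^sub>F n in sequentially. l2 S (kapp S (f n) v) \<le> c * l2 S v"
    using ev by eventually_elim (simp add: bd_def)
  ultimately show "l2 S (kapp S a v) \<le> c * l2 S v"
    by (rule tendsto_upperbound) simp
qed

lemma sesq_kapp: "sesq S k w v = (\<Sum>r\<in>S. cnj (w r) * kapp S k v r)"
  by (simp add: sesq_def kapp_def sum_distrib_left mult_ac)

lemma sesq_diff: "sesq S (\<lambda>r s. a r s - b r s) v w = sesq S a v w - sesq S b v w"
  by (simp add: sesq_def algebra_simps sum_subtractf)

lemma sesq_id: "finite S \<Longrightarrow> sesq S delta v w = (\<Sum>r\<in>S. cnj (v r) * w r)"
  by (simp add: sesq_def if_distrib if_distribR cong: if_cong)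

text \<open>Cauchy--Schwarz for the form \<open>k\<close> gives \<open>\<parallel>k v\<parallel>\<^sup>4 = \<bar>\<langle>k v, v\<rangle>\<^sub>k\<bar>\<^sup>2 \<le> \<langle>k v, k v\<rangle>\<^sub>k \<langle>v, v\<rangle>\<^sub>k\<close>,
  and both factors on the right are at most the corresponding squared norms because \<open>k \<le> 1\<close>.
  No eigenvalues are needed.\<close>
lemma psd_contraction:
  assumes S: "finite S" and k: "psd S k" and k': "psd S (\<lambda>r s. delta r s - k r s)"
  shows "bd S k 1"
  unfolding bd_def
proof
  fix v
  let ?w = "kapp S k v"
  have le: "Re (sesq S k x x) \<le> (l2 S x)\<^sup>2" for x
  proof -
    have "0 \<le> Re (sesq S (\<lambda>r s. delta r s - k r s) x x)" by (rule psd_nonneg[OF k'])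
    then show ?thesis by (simp add: sesq_diff sesq_id[OF S] l2_inner_self)
  qed
  have "sesq S k ?w v = complex_of_real ((l2 S ?w)\<^sup>2)"
    by (simp only: sesq_kapp l2_inner_self)
  then have "((l2 S ?w)\<^sup>2)\<^sup>2 = (cmod (sesq S k ?w v))\<^sup>2"
    by (simp del: of_real_power)
  also have "\<dots> \<le> Re (sesq S k ?w ?w) * Re (sesq S k v v)" by (rule psd_Cauchy_Schwarz[OF k])
  also have "\<dots> \<le> (l2 S ?w)\<^sup>2 * (l2 S v)\<^sup>2"
    by (intro mult_mono le) (auto simp: psd_nonneg[OF k])
  finally have "((l2 S ?w)\<^sup>2)\<^sup>2 \<le> (l2 S v)\<^sup>2 * (l2 S ?w)\<^sup>2" by (simp only: mult.commute)
  then have "(l2 S ?w)\<^sup>2 \<le> (l2 S v)\<^sup>2"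
    by (rule sq_le_mult_imp_le[OF zero_le_power2 zero_le_power2])
  then show "l2 S ?w \<le> 1 * l2 S v" using power2_le_imp_le[OF _ l2_nonneg] by simp
qed

section \<open>Extension of positive functionals\<close>

text \<open>The Riesz extension theorem in coordinates. The coordinate \<open>z\<close> is the direction of an order unit
  and the hypothesis on it says that \<open>-1\<close> times this unit is outside \<open>K\<close>. The functional is
  defined on the line through \<open>z\<close> by the value \<open>1\<close> and is extended one coordinate at a
  time, so no topology is used and \<open>K\<close> does not have to be closed.\<close>
lemma riesz_extension:
  fixes K :: "('i \<Rightarrow> real) set"
  assumes "finite I" "z \<notin> I"
    and "\<And>x y. x \<in> K \<Longrightarrow> y \<in> K \<Longrightarrow> (\<lambda>i. x i + y i) \<in> K"
    and "\<And>r x. 0 < r \<Longrightarrow> x \<in> K \<Longrightarrow> (\<lambda>i. r * x i) \<in> K"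
    and "\<And>x y. x \<in> K \<Longrightarrow> (\<And>i. i \<in> insert z I \<Longrightarrow> x i = y i) \<Longrightarrow> y \<in> K"
    and "\<And>x. \<exists>r. (\<lambda>i. (if i = z then r else 0) + x i) \<in> K"
    and "(\<lambda>i. if i = z then -1 else 0) \<notin> K"
  shows "\<exists>g. g z = 1 \<and> (\<forall>x\<in>K. 0 \<le> (\<Sum>i\<in>insert z I. g i * x i))"
  using assms
proof (induction I arbitrary: K)
  case empty
  have "0 \<le> x z" if x: "x \<in> K" for x
  proof (rule ccontr)
    assume "\<not> 0 \<le> x z"
    then have "(\<lambda>i. 1 / - x z * x i) \<in> K" using empty.prems(3)[of "1 / - x z" x] x by simp
    then have "(\<lambda>i. if i = z then -1 else 0) \<in> K"
      by (rule empty.prems(4)) (use \<open>\<not> 0 \<le> x z\<close> in auto)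
    then show False using empty.prems(6) by simp
  qed
  then show ?case by (intro exI[of _ "\<lambda>_. 1"]) auto
next
  case (insert j J)
  have jz: "j \<noteq> z" and zJ: "z \<notin> J" using insert.prems(1) by auto
  note add = insert.prems(2) and scale = insert.prems(3) and cong = insert.prems(4)
    and unit = insert.prems(5) and neg = insert.prems(6)
  \<comment> \<open>the section of the cone with the hyperplane where the coordinate \<open>j\<close> vanishes\<close>
  define K' where "K' = {x. x(j := 0) \<in> K}"
  have "\<exists>g. g z = 1 \<and> (\<forall>x\<in>K'. 0 \<le> (\<Sum>i\<in>insert z J. g i * x i))"
  proof (rule insert.IH[OF zJ])
    fix x y assume "x \<in> K'" "y \<in> K'"
    then have "x(j := 0) \<in> K" "y(j := 0) \<in> K" by (simp_all add: K'_def)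
    then have "(\<lambda>i. (x(j := 0)) i + (y(j := 0)) i) \<in> K" by (rule add)
    then have "(\<lambda>i. x i + y i)(j := 0) \<in> K" by (rule cong) simp
    then show "(\<lambda>i. x i + y i) \<in> K'" by (simp add: K'_def)
  next
    fix r :: real and x assume "0 < r" "x \<in> K'"
    then have "x(j := 0) \<in> K" by (simp add: K'_def)
    with \<open>0 < r\<close> have "(\<lambda>i. r * (x(j := 0)) i) \<in> K" by (rule scale)
    then have "(\<lambda>i. r * x i)(j := 0) \<in> K" by (rule cong) simp
    then show "(\<lambda>i. r * x i) \<in> K'" by (simp add: K'_def)
  next
    fix x y assume x: "x \<in> K'" and xy: "\<And>i. i \<in> insert z J \<Longrightarrow> x i = y i"
    from x have "x(j := 0) \<in> K" by (simp add: K'_def)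
    then have "y(j := 0) \<in> K" by (rule cong) (use xy in auto)
    then show "y \<in> K'" by (simp add: K'_def)
  next
    fix x :: "'i \<Rightarrow> real"
    obtain r where "(\<lambda>i. (if i = z then r else 0) + (x(j := 0)) i) \<in> K"
      using unit[of "x(j := 0)"] by blast
    then have "(\<lambda>i. (if i = z then r else 0) + x i)(j := 0) \<in> K"
      by (rule cong) (use jz in auto)
    then show "\<exists>r. (\<lambda>i. (if i = z then r else 0) + x i) \<in> K'" unfolding K'_def by blast
  next
    show "(\<lambda>i. if i = z then -1 else 0) \<notin> K'"
    proof
      assume "(\<lambda>i. if i = z then -1 else 0) \<in> K'"
      then have "(\<lambda>i. if i = z then -1 else (0::real))(j := 0) \<in> K" by (simp add: K'_def)
      then have "(\<lambda>i. if i = z then -1 else 0) \<in> K" by (rule cong) (use jz in auto)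
      then show False using neg by simp
    qed
  qed
  then obtain g where gz: "g z = 1" and
    g: "\<And>x. x \<in> K' \<Longrightarrow> 0 \<le> (\<Sum>i\<in>insert z J. g i * x i)" by blast
  define L where "L x = (\<Sum>i\<in>insert z J. g i * x i)" for x
  have Ladd: "L (\<lambda>i. x i + y i) = L x + L y" for x y
    by (simp add: L_def distrib_left sum.distrib)
  have Lscale: "L (\<lambda>i. r * x i) = r * L x" for x r
    by (simp add: L_def sum_distrib_left mult_ac)
  have Lnn: "0 \<le> L x" if "x \<in> K" "x j = 0" for x
  proof -
    have "x(j := 0) = x" using that by auto
    then show ?thesis using g[of x] that by (simp add: L_def K'_def)
  qed
  have pair: "0 \<le> L x + L y" if "x \<in> K" "y \<in> K" "x j + y j = 0" for x y
    using Lnn[OF add[OF that(1,2)]] that(3) by (simp add: Ladd)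
  \<comment> \<open>The value \<open>c\<close> at the new coordinate has to lie above the set \<open>A\<close> and below all \<open>L y\<close> with \<open>y j = -1\<close>.\<close>
  define A where "A = {- L x | x. x \<in> K \<and> x j = 1}"
  obtain r1 where r1: "(\<lambda>i. (if i = z then r1 else 0) + (if i = j then 1 else 0)) \<in> K"
    using unit[of "\<lambda>i. if i = j then 1 else 0"] by blast
  obtain r2 where r2: "(\<lambda>i. (if i = z then r2 else 0) + (if i = j then -1 else 0)) \<in> K"
    using unit[of "\<lambda>i. if i = j then -1 else 0"] by blast
  have AI: "- L x \<in> A" if "x \<in> K" "x j = 1" for x using that unfolding A_def by blast
  have "- L (\<lambda>i. (if i = z then r1 else 0) + (if i = j then 1 else 0)) \<in> A"
    by (rule AI[OF r1]) (use jz in simp)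
  then have "A \<noteq> {}" by blast
  have up: "a \<le> L y" if "a \<in> A" "y \<in> K" "y j = -1" for a y
  proof -
    from that(1) obtain x where "a = - L x" "x \<in> K" "x j = 1" unfolding A_def by blast
    then show ?thesis using pair[of x y] that by simp
  qed
  have "bdd_above A" by (rule bdd_aboveI, rule up[OF _ r2]) (use jz in auto)
  define c where "c = Sup A"
  have c1: "- L x \<le> c" if "x \<in> K" "x j = 1" for x
    unfolding c_def by (rule cSup_upper[OF AI[OF that] \<open>bdd_above A\<close>])
  have c2: "c \<le> L y" if "y \<in> K" "y j = -1" for y
    unfolding c_def using that \<open>A \<noteq> {}\<close> up by (intro cSup_least) auto
  have main: "0 \<le> L x + c * x j" if x: "x \<in> K" for x
  proof (cases "x j" "0::real" rule: linorder_cases)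
    case equal
    then show ?thesis using Lnn[OF x] by simp
  next
    case greater
    then have "- L (\<lambda>i. 1 / x j * x i) \<le> c" by (intro c1 scale x) auto
    then have "- (1 / x j * L x) * x j \<le> c * x j" unfolding Lscale using greater by (intro mult_right_mono) auto
    then show ?thesis using greater by simp
  next
    case less
    then have "c \<le> L (\<lambda>i. 1 / - x j * x i)" by (intro c2 scale x) auto
    then have "c * - x j \<le> (1 / - x j * L x) * - x j" unfolding Lscale using less by (intro mult_right_mono) auto
    then show ?thesis using less by simp
  qed
  have "(\<Sum>i\<in>insert z (insert j J). (g(j := c)) i * x i) = L x + c * x j" for x
  proof -
    have "(\<Sum>i\<in>insert z (insert j J). (g(j := c)) i * x i)
       = c * x j + (\<Sum>i\<in>insert z J. (g(j := c)) i * x i)"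
      using insert.hyps jz by (subst insert_commute) simp
    also have "(\<Sum>i\<in>insert z J. (g(j := c)) i * x i) = L x" unfolding L_def
      using insert.hyps jz by (intro sum.cong) auto
    finally show ?thesis by simp
  qed
  then show ?case using main gz jz by (intro exI[of _ "g(j := c)"]) simp
qed

section \<open>Square roots of contractions\<close>

text \<open>The scalar case of the square-root iteration below, at \<open>k = 1\<close>; it majorises the increments of
  the matrix case.\<close>
primrec usq :: "nat \<Rightarrow> real" where
  "usq 0 = 0"
| "usq (Suc n) = (1 + (usq n)\<^sup>2) / 2"

lemma usq_bounds: "0 \<le> usq n \<and> usq n \<le> 1"
proof (induction n)
  case (Suc n)
  then have "(usq n)\<^sup>2 \<le> 1" by (simp add: power_le_one)
  then show ?case by simp
qed simp

lemma usq_mono: "usq n \<le> usq (Suc n)"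
proof -
  have "0 \<le> (1 - usq n)\<^sup>2" by simp
  then show ?thesis by (simp add: power2_eq_square algebra_simps)
qed

declare usq.simps [simp del]

lemma usq_convergent: "convergent usq"
proof -
  have "incseq usq" by (rule incseq_SucI) (rule usq_mono)
  then obtain L where "usq \<longlonglongrightarrow> L" using incseq_convergent[of usq 1] usq_bounds by metis
  then show ?thesis by (rule convergentI)
qed

text \<open>The iteration \<open>s\<^bsub>m+1\<^esub> = (k + s\<^sub>m\<^sup>2) / 2\<close> has as its limit a solution of \<open>s = (k + s\<^sup>2) / 2\<close>,
  that is, of \<open>(1 - s)\<^sup>2 = 1 - k\<close>. All iterates are polynomials in \<open>k\<close>, so they stay in any
  algebra that contains \<open>k\<close>.\<close>
primrec ksq :: "'i set \<Rightarrow> ('i \<Rightarrow> 'i \<Rightarrow> complex) \<Rightarrow> nat \<Rightarrow> 'i \<Rightarrow> 'i \<Rightarrow> complex" where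
  "ksq S k 0 = (\<lambda>r s. 0)"
| "ksq S k (Suc n) = (\<lambda>r s. (1/2) * (k r s + kmult S (ksq S k n) (ksq S k n) r s))"

lemma bd_zero: "0 \<le> c \<Longrightarrow> bd S (\<lambda>r s. 0) c"
  by (simp add: bd_def kapp_def l2_def L2_set_def sum_nonneg)

lemma kmult_diff_squares:
  "kmult S a a r t - kmult S b b r t = kmult S a (\<lambda>r s. a r s - b r s) r t + kmult S (\<lambda>r s. a r s - b r s) b r t"
  by (simp add: kmult_def sum_subtractf[symmetric] sum.distrib[symmetric] algebra_simps)

text \<open>For consecutive iterates \<open>s\<close> and \<open>t\<close> the difference of the squares is \<open>t (t - s) + (t - s) s\<close>, so norms of
  iterates and increments are dominated by those of the scalar iteration.\<close>
lemma ksq_bd: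
  assumes k: "bd S k 1"
  shows "bd S (ksq S k n) (usq n) \<and> bd S (\<lambda>r s. ksq S k (Suc n) r s - ksq S k n r s) (usq (Suc n) - usq n)"
proof (induction n)
  case 0
  have "bd S (\<lambda>r s. 1/2 * k r s) (cmod (1/2) * 1)" by (rule bd_scale[OF k])
  then show ?case by (simp add: bd_zero kmult_def usq.simps)
next
  case (Suc n)
  let ?a = "ksq S k (Suc n)" and ?b = "ksq S k n"
  have b: "bd S ?b (usq n)" and d: "bd S (\<lambda>r s. ?a r s - ?b r s) (usq (Suc n) - usq n)"
    using Suc.IH by auto
  have "bd S (\<lambda>r s. 1/2 * (k r s + kmult S ?b ?b r s)) (cmod (1/2) * (1 + usq n * usq n))"
    using usq_bounds[of n] by (intro bd_scale bd_add bd_mult k b) auto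
  then have a: "bd S ?a (usq (Suc n))" by (simp add: usq.simps power2_eq_square)
  have eq: "ksq S k (Suc (Suc n)) r s - ?a r s
      = 1/2 * (kmult S ?a (\<lambda>r s. ?a r s - ?b r s) r s + kmult S (\<lambda>r s. ?a r s - ?b r s) ?b r s)" for r s
    unfolding kmult_diff_squares[symmetric]
    by (subst ksq.simps(2)[of _ _ "Suc n"], subst (3) ksq.simps(2)[of _ _ n]) (simp add: algebra_simps del: ksq.simps)
  have "bd S (\<lambda>r s. ksq S k (Suc (Suc n)) r s - ?a r s)
     (cmod (1/2) * (usq (Suc n) * (usq (Suc n) - usq n) + (usq (Suc n) - usq n) * usq n))"
    unfolding eq using usq_bounds[of "Suc n"] usq_mono[of n]
    by (intro bd_scale bd_add bd_mult a b d) auto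
  also have "cmod (1/2) * (usq (Suc n) * (usq (Suc n) - usq n) + (usq (Suc n) - usq n) * usq n)
     = usq (Suc (Suc n)) - usq (Suc n)"
  proof -
    have e: "2 * usq (Suc n) - (usq n)\<^sup>2 = 1" by (simp add: usq.simps field_simps)
    have "2 * usq (Suc (Suc n)) = 1 + (usq (Suc n))\<^sup>2" by (simp add: usq.simps(2)[of "Suc n"])
    then have "2 * usq (Suc (Suc n)) = 2 * usq (Suc n) - (usq n)\<^sup>2 + (usq (Suc n))\<^sup>2"
      by (simp only: e)
    then show ?thesis by (simp add: power2_eq_square algebra_simps)
  qed
  finally show ?case using a by blast
qed

lemma ksq_bd_diff:
  assumes k: "bd S k 1" and "n \<le> m"
  shows "bd S (\<lambda>r s. ksq S k m r s - ksq S k n r s) (usq m - usq n)"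
  using assms(2)
proof (induction m rule: dec_induct)
  case base
  show ?case by (simp add: bd_zero)
next
  case (step m)
  have "bd S (\<lambda>r s. (ksq S k (Suc m) r s - ksq S k m r s) + (ksq S k m r s - ksq S k n r s))
      ((usq (Suc m) - usq m) + (usq m - usq n))"
    using ksq_bd[OF k, of m] by (intro bd_add step.IH) blast
  then show ?case by (simp del: ksq.simps usq.simps)
qed

text \<open>The rate does not depend on \<open>k\<close> or \<open>S\<close>: the iteration can be run in infinitely many blocks at
  once and converges uniformly.\<close>
lemma ksq_Cauchy:
  assumes "0 < e"
  obtains n0 where "\<And>S (k :: 'i \<Rightarrow> 'i \<Rightarrow> complex) m n. bd S k 1 \<Longrightarrow> n0 \<le> m \<Longrightarrow> n0 \<le> n \<Longrightarrow>
     bd S (\<lambda>r s. ksq S k m r s - ksq S k n r s) e"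
proof -
  have "Cauchy usq" using usq_convergent by (rule convergent_Cauchy)
  then obtain n0 where n0: "\<And>m n. n0 \<le> m \<Longrightarrow> n0 \<le> n \<Longrightarrow> dist (usq m) (usq n) < e"
    using assms unfolding Cauchy_def by metis
  have "bd S (\<lambda>r s. ksq S k m r s - ksq S k n r s) e"
    if "bd S k 1" "n0 \<le> m" "n0 \<le> n" for S and k :: "'i \<Rightarrow> 'i \<Rightarrow> complex" and m n
  proof (cases "n \<le> m")
    case True
    have "usq m - usq n \<le> e" using n0[OF that(2,3)] by (simp add: dist_real_def)
    then show ?thesis by (rule bd_mono[OF ksq_bd_diff[OF that(1) True]])
  next
    case False
    have "usq n - usq m \<le> e" using n0[OF that(2,3)] by (simp add: dist_real_def)
    moreover have "bd S (\<lambda>r s. ksq S k n r s - ksq S k m r s) (usq n - usq m)"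
      using False by (intro ksq_bd_diff that(1)) simp
    ultimately have "bd S (\<lambda>r s. ksq S k n r s - ksq S k m r s) e" by (rule bd_mono[rotated])
    from bd_scale[OF this, of "-1"] show ?thesis by simp
  qed
  then show ?thesis by (rule that)
qed

lemma ksq_hermitian:
  assumes "\<And>r s. r \<in> S \<Longrightarrow> s \<in> S \<Longrightarrow> k s r = cnj (k r s)" "r \<in> S" "s \<in> S"
  shows "ksq S k n s r = cnj (ksq S k n r s)"
  using assms(2,3)
proof (induction n arbitrary: r s)
  case (Suc n)
  have "kmult S (ksq S k n) (ksq S k n) s r = cnj (kmult S (ksq S k n) (ksq S k n) r s)"
    unfolding kmult_def cnj_sum
  proof (intro sum.cong refl)
    fix t assume "t \<in> S"
    then have "ksq S k n s t = cnj (ksq S k n t s)" "ksq S k n t r = cnj (ksq S k n r t)"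
      by (intro Suc.IH Suc.prems; assumption)+
    then show "ksq S k n s t * ksq S k n t r = cnj (ksq S k n r t * ksq S k n t s)"
      by (simp only: complex_cnj_mult complex_cnj_cnj mult.commute)
  qed
  moreover have "k s r = cnj (k r s)" by (rule assms(1)[OF Suc.prems])
  ultimately have "k s r + kmult S (ksq S k n) (ksq S k n) s r = cnj (k r s + kmult S (ksq S k n) (ksq S k n) r s)"
    by (simp only: complex_cnj_add)
  then show ?case by (simp only: ksq.simps complex_cnj_mult complex_cnj_divide complex_cnj_one complex_cnj_numeral)
qed simp

section \<open>Coordinates in a *-vector space\<close>

context
  fixes U :: "('a, 'm) star_space_scheme"
  assumes U: "star_vector_space U"
begin

lemma svs_module: "Module.module class_ring U"
  using U by (simp add: star_vector_space_def vectorspace_def)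

lemma svs_abelian_group: "abelian_group U"
  using svs_module by (simp add: Module.module_def)

lemma svs_smult_closed: "x \<in> carrier U \<Longrightarrow> c \<odot>\<^bsub>U\<^esub> x \<in> carrier U"
  using Module.module.smult_closed[OF svs_module, of c x] by simp

lemma svs_smult_add: "x \<in> carrier U \<Longrightarrow> (c + d) \<odot>\<^bsub>U\<^esub> x = c \<odot>\<^bsub>U\<^esub> x \<oplus>\<^bsub>U\<^esub> d \<odot>\<^bsub>U\<^esub> x"
  using Module.module.smult_l_distr[OF svs_module, of c d x] by simp

lemma svs_smult_right: "x \<in> carrier U \<Longrightarrow> y \<in> carrier U \<Longrightarrow>
    c \<odot>\<^bsub>U\<^esub> (x \<oplus>\<^bsub>U\<^esub> y) = c \<odot>\<^bsub>U\<^esub> x \<oplus>\<^bsub>U\<^esub> c \<odot>\<^bsub>U\<^esub> y"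
  using Module.module.smult_r_distr[OF svs_module, of c x y] by simp

lemma svs_smult_assoc: "x \<in> carrier U \<Longrightarrow> (c * d) \<odot>\<^bsub>U\<^esub> x = c \<odot>\<^bsub>U\<^esub> (d \<odot>\<^bsub>U\<^esub> x)"
  using Module.module.smult_assoc1[OF svs_module, of c d x] by simp

lemma svs_smult_one: "x \<in> carrier U \<Longrightarrow> 1 \<odot>\<^bsub>U\<^esub> x = x"
  using Module.module.smult_one[OF svs_module, of x] by simp

lemma svs_smult_zero: "x \<in> carrier U \<Longrightarrow> 0 \<odot>\<^bsub>U\<^esub> x = \<zero>\<^bsub>U\<^esub>"
  using Module.module.smult_l_null[OF svs_module, of x] by simp

lemma svs_smult_null: "c \<odot>\<^bsub>U\<^esub> \<zero>\<^bsub>U\<^esub> = \<zero>\<^bsub>U\<^esub>"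
  using Module.module.smult_r_null[OF svs_module, of c] by simp

lemma svs_smult_minus: "x \<in> carrier U \<Longrightarrow> (- 1) \<odot>\<^bsub>U\<^esub> x = \<ominus>\<^bsub>U\<^esub> x"
proof -
  assume x: "x \<in> carrier U"
  interpret abelian_group U by (rule svs_abelian_group)
  have "x \<oplus>\<^bsub>U\<^esub> (- 1) \<odot>\<^bsub>U\<^esub> x = \<zero>\<^bsub>U\<^esub>"
    using svs_smult_add[OF x, of 1 "-1"] svs_smult_one[OF x] svs_smult_zero[OF x] by simp
  then show ?thesis using x svs_smult_closed[OF x, of "-1"] by (metis minus_equality a_comm)
qed

lemma svs_smult_finsum: "finite K \<Longrightarrow> f \<in> K \<rightarrow> carrier U \<Longrightarrow>
    c \<odot>\<^bsub>U\<^esub> (\<Oplus>\<^bsub>U\<^esub>k\<in>K. f k) = (\<Oplus>\<^bsub>U\<^esub>k\<in>K. c \<odot>\<^bsub>U\<^esub> f k)"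
  using Module.module.finsum_smult_ldistr[OF svs_module, of K c f] by simp

lemma svs_star_closed: "x \<in> carrier U \<Longrightarrow> star U x \<in> carrier U"
  and svs_star_star: "x \<in> carrier U \<Longrightarrow> star U (star U x) = x"
  and svs_star_add: "x \<in> carrier U \<Longrightarrow> y \<in> carrier U \<Longrightarrow> star U (x \<oplus>\<^bsub>U\<^esub> y) = star U x \<oplus>\<^bsub>U\<^esub> star U y"
  and svs_star_smult: "x \<in> carrier U \<Longrightarrow> star U (c \<odot>\<^bsub>U\<^esub> x) = cnj c \<odot>\<^bsub>U\<^esub> star U x"
  using U by (simp_all add: star_vector_space_def)

lemma svs_star_zero: "star U \<zero>\<^bsub>U\<^esub> = \<zero>\<^bsub>U\<^esub>"
proof -
  interpret abelian_group U by (rule svs_abelian_group)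
  show ?thesis
    using svs_star_smult[of "\<zero>\<^bsub>U\<^esub>" 0] svs_smult_zero[OF svs_star_closed[of "\<zero>\<^bsub>U\<^esub>"]]
    by (simp add: svs_smult_null)
qed

lemma svs_star_finsum: "finite K \<Longrightarrow> f \<in> K \<rightarrow> carrier U \<Longrightarrow>
    star U (\<Oplus>\<^bsub>U\<^esub>k\<in>K. f k) = (\<Oplus>\<^bsub>U\<^esub>k\<in>K. star U (f k))"
proof (induction K rule: finite_induct)
  case empty
  interpret abelian_group U by (rule svs_abelian_group)
  show ?case by (simp add: svs_star_zero)
next
  case (insert k K)
  interpret abelian_group U by (rule svs_abelian_group)
  have "f k \<in> carrier U" "f \<in> K \<rightarrow> carrier U" "(\<lambda>k. star U (f k)) \<in> K \<rightarrow> carrier U"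
    using insert.prems svs_star_closed by auto
  then show ?case using insert svs_star_closed
    by (simp add: svs_star_add finsum_closed)
qed

end

text \<open>An element of a space spanned by \<open>g 0, \<dots>, g N\<close> is written through a coefficient function
  \<open>nat \<Rightarrow> complex\<close>, and a matrix over the space through coefficients \<open>X a i j\<close>. Here \<open>ev b\<close>
  and \<open>perp b\<close> are the coefficients of \<open>g b\<close> and of its complement \<open>g 0 - g b\<close>, \<open>dg s\<close> those
  of the diagonal matrix with entries \<open>s\<close>, and \<open>cj m A X\<close> those of \<open>A\<^sup>* X A\<close> for an
  \<open>m\<close>-rowed scalar matrix \<open>A\<close>. The generators may be linearly dependent, so coefficients are
  not unique.\<close>
definition ev :: "nat \<Rightarrow> nat \<Rightarrow> complex" where
  "ev b a = (if a = b then 1 else 0)"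

definition perp :: "nat \<Rightarrow> nat \<Rightarrow> complex" where
  "perp b a = ev 0 a - ev b a"

definition dg :: "(nat \<Rightarrow> nat \<Rightarrow> complex) \<Rightarrow> nat \<Rightarrow> nat \<Rightarrow> nat \<Rightarrow> complex" where
  "dg s a i j = (if i = j then s i a else 0)"

definition cj :: "nat \<Rightarrow> (nat \<Rightarrow> nat \<Rightarrow> complex) \<Rightarrow> (nat \<Rightarrow> nat \<Rightarrow> nat \<Rightarrow> complex) \<Rightarrow> nat \<Rightarrow> nat \<Rightarrow> nat \<Rightarrow> complex" where
  "cj m A X a i j = (\<Sum>k<m. \<Sum>l<m. cnj (A k i) * A l j * X a k l)"

locale herm_family =
  fixes U :: "('a, 'm) star_space_scheme" and N :: nat and g :: "nat \<Rightarrow> 'a"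
  assumes svs: "star_vector_space U"
    and gen_hermitian: "a \<le> N \<Longrightarrow> g a \<in> hermitian U"
begin

interpretation U: abelian_group U by (rule svs_abelian_group[OF svs])

definition comb :: "(nat \<Rightarrow> complex) \<Rightarrow> 'a" where
  "comb c = (\<Oplus>\<^bsub>U\<^esub>a\<in>{..N}. c a \<odot>\<^bsub>U\<^esub> g a)"

lemma gen_carrier: "a \<le> N \<Longrightarrow> g a \<in> carrier U"
  and gen_star: "a \<le> N \<Longrightarrow> star U (g a) = g a"
  using gen_hermitian by (auto simp: hermitian_def)

lemma comb_term_closed: "(\<lambda>a. c a \<odot>\<^bsub>U\<^esub> g a) \<in> {..N} \<rightarrow> carrier U"
  using gen_carrier svs_smult_closed[OF svs] by auto

lemma comb_closed: "comb c \<in> carrier U"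
  unfolding comb_def by (intro U.finsum_closed comb_term_closed)

lemma comb_cong: "(\<And>a. a \<le> N \<Longrightarrow> c a = d a) \<Longrightarrow> comb c = comb d"
  unfolding comb_def using gen_carrier svs_smult_closed[OF svs]
  by (intro U.finsum_cong') auto

lemma comb_add: "comb c \<oplus>\<^bsub>U\<^esub> comb d = comb (\<lambda>a. c a + d a)"
proof -
  have "comb (\<lambda>a. c a + d a) = (\<Oplus>\<^bsub>U\<^esub>a\<in>{..N}. c a \<odot>\<^bsub>U\<^esub> g a \<oplus>\<^bsub>U\<^esub> d a \<odot>\<^bsub>U\<^esub> g a)"
    unfolding comb_def using gen_carrier svs_smult_closed[OF svs]
    by (intro U.finsum_cong') (auto simp: svs_smult_add[OF svs])
  also have "\<dots> = comb c \<oplus>\<^bsub>U\<^esub> comb d"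
    unfolding comb_def by (intro U.finsum_addf comb_term_closed)
  finally show ?thesis by simp
qed

lemma comb_smult: "z \<odot>\<^bsub>U\<^esub> comb c = comb (\<lambda>a. z * c a)"
proof -
  have "z \<odot>\<^bsub>U\<^esub> comb c = (\<Oplus>\<^bsub>U\<^esub>a\<in>{..N}. z \<odot>\<^bsub>U\<^esub> (c a \<odot>\<^bsub>U\<^esub> g a))"
    unfolding comb_def by (intro svs_smult_finsum[OF svs] comb_term_closed) simp
  also have "\<dots> = comb (\<lambda>a. z * c a)"
    unfolding comb_def using gen_carrier svs_smult_closed[OF svs]
    by (intro U.finsum_cong') (auto simp: svs_smult_assoc[OF svs])
  finally show ?thesis .
qed

lemma comb_zero: "comb (\<lambda>a. 0) = \<zero>\<^bsub>U\<^esub>"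
  using comb_smult[of 0 "\<lambda>_. 0"] svs_smult_zero[OF svs comb_closed] by simp

lemma comb_minus: "\<ominus>\<^bsub>U\<^esub> comb c = comb (\<lambda>a. - c a)"
  using comb_smult[of "-1" c] svs_smult_minus[OF svs comb_closed, of c] by simp

lemma comb_diff: "comb c \<ominus>\<^bsub>U\<^esub> comb d = comb (\<lambda>a. c a - d a)"
  by (simp add: a_minus_def comb_minus comb_add)

lemma comb_star: "star U (comb c) = comb (\<lambda>a. cnj (c a))"
proof -
  have "star U (comb c) = (\<Oplus>\<^bsub>U\<^esub>a\<in>{..N}. star U (c a \<odot>\<^bsub>U\<^esub> g a))"
    unfolding comb_def by (intro svs_star_finsum[OF svs] comb_term_closed) simp
  also have "\<dots> = comb (\<lambda>a. cnj (c a))"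
    unfolding comb_def using gen_carrier svs_smult_closed[OF svs]
    by (intro U.finsum_cong') (auto simp: svs_star_smult[OF svs] gen_star)
  finally show ?thesis .
qed

lemma comb_finsum: "finite K \<Longrightarrow> (\<Oplus>\<^bsub>U\<^esub>k\<in>K. comb (F k)) = comb (\<lambda>a. \<Sum>k\<in>K. F k a)"
proof (induction K rule: finite_induct)
  case (insert k K)
  have "(\<lambda>k. comb (F k)) \<in> K \<rightarrow> carrier U" by (simp add: comb_closed)
  then show ?case using insert by (simp add: comb_closed comb_add)
qed (simp add: comb_zero)

lemma comb_finsum':
  assumes "finite K" "\<And>k. k \<in> K \<Longrightarrow> f k = comb (F k)"
  shows "(\<Oplus>\<^bsub>U\<^esub>k\<in>K. f k) = comb (\<lambda>a. \<Sum>k\<in>K. F k a)"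
  using comb_finsum[OF assms(1), of F]
  by (metis (no_types, lifting) U.finsum_cong' Pi_I assms(2) comb_closed)

lemma comb_gen: "b \<le> N \<Longrightarrow> comb (ev b) = g b"
proof -
  assume b: "b \<le> N"
  have "comb (ev b) = (\<Oplus>\<^bsub>U\<^esub>a\<in>{..N}. if b = a then g a else \<zero>\<^bsub>U\<^esub>)"
    unfolding comb_def using gen_carrier
    by (intro U.finsum_cong') (auto simp: ev_def svs_smult_one[OF svs] svs_smult_zero[OF svs])
  also have "\<dots> = g b" using b gen_carrier by (intro U.finsum_singleton) auto
  finally show ?thesis .
qed

lemma compl_gen: "b \<le> N \<Longrightarrow> compl U (g 0) (g b) = comb (perp b)"
  using comb_diff[of "ev 0" "ev b"] by (simp add: compl_def comb_gen perp_def[abs_def])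

end

text \<open>The index \<open>0\<close> is reserved for the unit: \<open>g 0\<close> plays the role of \<open>e\<close>, and \<open>g b\<close> that of
  \<open>p\<^sub>b\<close> for \<open>1 \<le> b \<le> N\<close>.\<close>
locale gen_space = herm_family +
  assumes comb_surj: "x \<in> carrier U \<Longrightarrow> \<exists>c. x = comb c"
begin

definition mk :: "nat \<Rightarrow> (nat \<Rightarrow> nat \<Rightarrow> nat \<Rightarrow> complex) \<Rightarrow> 'a mat" where
  "mk n X = Matrix.mat n n (\<lambda>(i, j). comb (\<lambda>a. X a i j))"

lemma mk_closed: "mk n X \<in> carrier (matrices U n)"
  by (auto simp: mk_def matrices_def comb_closed)

lemma mk_surj:
  assumes "x \<in> carrier (matrices U n)" shows "\<exists>X. x = mk n X"
proof -
  have x: "x \<in> carrier_mat n n" "\<And>i j. i < n \<Longrightarrow> j < n \<Longrightarrow> x $$ (i, j) \<in> carrier U"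
    using assms by (auto simp: matrices_def)
  have "\<forall>i j. \<exists>c. i < n \<longrightarrow> j < n \<longrightarrow> x $$ (i, j) = comb c" using comb_surj x(2) by blast
  then obtain C where C: "\<And>i j. i < n \<Longrightarrow> j < n \<Longrightarrow> x $$ (i, j) = comb (C i j)" by metis
  have "x = mk n (\<lambda>a i j. C i j a)"
    by (rule eq_matI) (use x(1) C in \<open>auto simp: mk_def\<close>)
  then show ?thesis by blast
qed

lemma mk_eq_iff: "mk n X = mk n Y \<longleftrightarrow> (\<forall>i<n. \<forall>j<n. comb (\<lambda>a. X a i j) = comb (\<lambda>a. Y a i j))"
  unfolding mk_def mat_eq_iff by auto

lemma mk_cong: "(\<And>a i j. a \<le> N \<Longrightarrow> i < n \<Longrightarrow> j < n \<Longrightarrow> X a i j = Y a i j) \<Longrightarrow> mk n X = mk n Y"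
  unfolding mk_eq_iff by (blast intro: comb_cong)

lemma mk_add: "mk n X \<oplus>\<^bsub>matrices U n\<^esub> mk n Y = mk n (\<lambda>a i j. X a i j + Y a i j)"
  by (rule eq_matI) (auto simp: matrices_def mk_def comb_add)

lemma mk_smult: "z \<odot>\<^bsub>matrices U n\<^esub> mk n X = mk n (\<lambda>a i j. z * X a i j)"
  by (rule eq_matI) (auto simp: matrices_def mk_def comb_smult)

lemma mk_star: "star (matrices U n) (mk n X) = mk n (\<lambda>a i j. cnj (X a j i))"
  by (rule eq_matI) (auto simp: matrices_def mk_def comb_star)

lemma mk_zero: "\<zero>\<^bsub>matrices U n\<^esub> = mk n (\<lambda>a i j. 0)"
  by (rule eq_matI) (auto simp: matrices_def mk_def comb_zero)

lemma abelian_group_matrices: "abelian_group (matrices U n)"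
proof (rule abelian_groupI)
  fix x y z assume "x \<in> carrier (matrices U n)" "y \<in> carrier (matrices U n)" "z \<in> carrier (matrices U n)"
  then obtain X Y Z where "x = mk n X" "y = mk n Y" "z = mk n Z" using mk_surj by metis
  then show "x \<oplus>\<^bsub>matrices U n\<^esub> y \<oplus>\<^bsub>matrices U n\<^esub> z = x \<oplus>\<^bsub>matrices U n\<^esub> (y \<oplus>\<^bsub>matrices U n\<^esub> z)"
    by (simp add: mk_add add.assoc)
next
  fix x y assume "x \<in> carrier (matrices U n)" "y \<in> carrier (matrices U n)"
  then obtain X Y where xy: "x = mk n X" "y = mk n Y" using mk_surj by metis
  show "x \<oplus>\<^bsub>matrices U n\<^esub> y \<in> carrier (matrices U n)" by (simp add: xy mk_add mk_closed)
  show "x \<oplus>\<^bsub>matrices U n\<^esub> y = y \<oplus>\<^bsub>matrices U n\<^esub> x" by (simp add: xy mk_add add.commute)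
next
  fix x assume "x \<in> carrier (matrices U n)"
  then obtain X where x: "x = mk n X" using mk_surj by metis
  show "\<zero>\<^bsub>matrices U n\<^esub> \<oplus>\<^bsub>matrices U n\<^esub> x = x" by (simp add: x mk_zero mk_add)
  have "mk n (\<lambda>a i j. - X a i j) \<oplus>\<^bsub>matrices U n\<^esub> x = \<zero>\<^bsub>matrices U n\<^esub>" by (simp add: x mk_zero mk_add)
  then show "\<exists>y\<in>carrier (matrices U n). y \<oplus>\<^bsub>matrices U n\<^esub> x = \<zero>\<^bsub>matrices U n\<^esub>" using mk_closed by blast
qed (simp add: mk_zero mk_closed)

lemma mk_minus: "\<ominus>\<^bsub>matrices U n\<^esub> mk n X = mk n (\<lambda>a i j. - X a i j)"
proof -
  interpret M: abelian_group "matrices U n" by (rule abelian_group_matrices)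
  have "mk n (\<lambda>a i j. - X a i j) \<oplus>\<^bsub>matrices U n\<^esub> mk n X = \<zero>\<^bsub>matrices U n\<^esub>" by (simp add: mk_zero mk_add)
  then show ?thesis using mk_closed by (metis M.minus_equality)
qed

lemma mk_diff: "mk n X \<ominus>\<^bsub>matrices U n\<^esub> mk n Y = mk n (\<lambda>a i j. X a i j - Y a i j)"
  by (simp add: a_minus_def mk_minus mk_add)

lemma mk_diag: "(\<And>i. i < n \<Longrightarrow> s i = comb (S i)) \<Longrightarrow> diag_matrix U n s = mk n (dg S)"
  by (rule eq_matI) (auto simp: diag_matrix_def mk_def dg_def comb_zero)

lemma mk_amp_unit: "amp_unit U n (g 0) = mk n (dg (\<lambda>_. ev 0))"
  unfolding amp_unit_def by (rule mk_diag) (simp add: comb_gen)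

lemma mk_conj: "conj_by U (Matrix.mat m n (\<lambda>(k, i). A k i)) (mk m X) = mk n (cj m A X)"
proof (rule eq_matI)
  fix i j assume ij: "i < dim_row (mk n (cj m A X))" "j < dim_col (mk n (cj m A X))"
  then have ij: "i < n" "j < n" by (auto simp: mk_def)
  have "conj_by U (Matrix.mat m n (\<lambda>(k, i). A k i)) (mk m X) $$ (i, j)
     = (\<Oplus>\<^bsub>U\<^esub>k\<in>{..<m}. \<Oplus>\<^bsub>U\<^esub>l\<in>{..<m}. (cnj (Matrix.mat m n (\<lambda>(k, i). A k i) $$ (k, i)) * Matrix.mat m n (\<lambda>(k, i). A k i) $$ (l, j)) \<odot>\<^bsub>U\<^esub> mk m X $$ (k, l))"
    using ij by (simp add: conj_by_def)
  also have "\<dots> = comb (\<lambda>a. \<Sum>k<m. \<Sum>l<m. cnj (A k i) * A l j * X a k l)"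
  proof (rule comb_finsum')
    fix k assume "k \<in> {..<m}"
    then show "(\<Oplus>\<^bsub>U\<^esub>l\<in>{..<m}. (cnj (Matrix.mat m n (\<lambda>(k, i). A k i) $$ (k, i)) * Matrix.mat m n (\<lambda>(k, i). A k i) $$ (l, j)) \<odot>\<^bsub>U\<^esub> mk m X $$ (k, l))
      = comb (\<lambda>a. \<Sum>l<m. cnj (A k i) * A l j * X a k l)"
      using ij by (intro comb_finsum') (auto simp: mk_def comb_smult)
  qed simp
  finally show "conj_by U (Matrix.mat m n (\<lambda>(k, i). A k i)) (mk m X) $$ (i, j) = mk n (cj m A X) $$ (i, j)"
    using ij by (simp add: mk_def cj_def)
qed (auto simp: conj_by_def mk_def)

lemma mk_conj':
  assumes "\<alpha> \<in> carrier_mat m n"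
  shows "conj_by U \<alpha> (mk m X) = mk n (cj m (\<lambda>k i. \<alpha> $$ (k, i)) X)"
proof -
  have "\<alpha> = Matrix.mat m n (\<lambda>(k, i). \<alpha> $$ (k, i))" using assms by (intro eq_matI) auto
  then show ?thesis using mk_conj[of m n "\<lambda>k i. \<alpha> $$ (k, i)" X] by simp
qed

lemma mk_tensor_J2: "tensor_J2 n (mk n X) = mk (2 * n) (\<lambda>a r s. X a (r div 2) (s div 2))"
  by (rule eq_matI) (auto simp: tensor_J2_def mk_def)

lemma mk_amp_pair:
  "amp_pair U n (comb c) (comb d) = mk (2 * n) (dg (\<lambda>r. if even r then c else d))"
  unfolding amp_pair_def by (rule mk_diag) simp

lemma mk_hermitian: "mk n X \<in> hermitian (matrices U n) \<longleftrightarrow> mk n (\<lambda>a i j. cnj (X a j i)) = mk n X"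
  by (simp add: hermitian_def mk_closed mk_star)

text \<open>Averaging with the adjoint makes the coefficients themselves hermitian, although linear relations between
  the generators leave other choices.\<close>
lemma mk_hermitian_rep:
  assumes "x \<in> hermitian (matrices U n)"
  shows "\<exists>X. x = mk n X \<and> (\<forall>a i j. X a j i = cnj (X a i j))"
proof -
  obtain X where X: "x = mk n X" using assms mk_surj by (auto simp: hermitian_def)
  define Y where "Y a i j = (1/2) * (X a i j + cnj (X a j i))" for a i j
  have "mk n X = mk n (\<lambda>a i j. cnj (X a j i))" using assms X mk_hermitian by metis
  then have "mk n X \<oplus>\<^bsub>matrices U n\<^esub> mk n X = mk n (\<lambda>a i j. X a i j + cnj (X a j i))"
    by (simp add: mk_add[symmetric])
  then have "(1/2) \<odot>\<^bsub>matrices U n\<^esub> (mk n X \<oplus>\<^bsub>matrices U n\<^esub> mk n X) = mk n Y"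
    by (simp add: mk_smult Y_def[abs_def])
  then have "x = mk n Y" by (simp add: mk_add mk_smult X)
  moreover have "Y a j i = cnj (Y a i j)" for a i j by (simp add: Y_def add.commute)
  ultimately show ?thesis by blast
qed

end

section \<open>Matrix orderings in coordinates\<close>

lemma psd_gram:
  assumes "finite K" shows "psd S (\<lambda>r s. \<Sum>k\<in>K. cnj (b k r) * b k s)"
  unfolding psd_def
proof (intro conjI ballI allI)
  fix r s show "(\<Sum>k\<in>K. cnj (b k s) * b k r) = cnj (\<Sum>k\<in>K. cnj (b k r) * b k s)"
    by (simp add: mult.commute)
next
  fix v
  have "sesq S (\<lambda>r s. \<Sum>k\<in>K. cnj (b k r) * b k s) v v
    = (\<Sum>k\<in>K. \<Sum>r\<in>S. \<Sum>s\<in>S. cnj (b k r * v r) * (b k s * v s))"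
  proof -
    have "sesq S (\<lambda>r s. \<Sum>k\<in>K. cnj (b k r) * b k s) v v
      = (\<Sum>r\<in>S. \<Sum>s\<in>S. \<Sum>k\<in>K. cnj (b k r * v r) * (b k s * v s))"
      unfolding sesq_def sum_distrib_left sum_distrib_right by (simp add: mult_ac)
    also have "\<dots> = (\<Sum>r\<in>S. \<Sum>k\<in>K. \<Sum>s\<in>S. cnj (b k r * v r) * (b k s * v s))"
      by (intro sum.cong refl sum.swap)
    also have "\<dots> = (\<Sum>k\<in>K. \<Sum>r\<in>S. \<Sum>s\<in>S. cnj (b k r * v r) * (b k s * v s))"
      by (rule sum.swap)
    finally show ?thesis .
  qed
  also have "\<dots> = (\<Sum>k\<in>K. cnj (\<Sum>r\<in>S. b k r * v r) * (\<Sum>s\<in>S. b k s * v s))"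
    by (simp add: sum_product)
  also have "\<dots> = complex_of_real (\<Sum>k\<in>K. (cmod (\<Sum>s\<in>S. b k s * v s))\<^sup>2)"
    by (simp add: complex_norm_square mult.commute del: of_real_power)
  finally show "0 \<le> Re (sesq S (\<lambda>r s. \<Sum>k\<in>K. cnj (b k r) * b k s) v v)"
    by (simp add: sum_nonneg del: of_real_sum of_real_power)
qed

lemma psd_scale:
  assumes "psd S q" "0 \<le> c" shows "psd S (\<lambda>r s. complex_of_real c * q r s)"
  unfolding psd_def
proof (intro conjI ballI allI)
  fix r s assume "r \<in> S" "s \<in> S"
  then have "q s r = cnj (q r s)" by (rule psd_hermitian[OF assms(1)])
  then show "complex_of_real c * q s r = cnj (complex_of_real c * q r s)" by simp
next
  fix v
  have "sesq S (\<lambda>r s. complex_of_real c * q r s) v v = complex_of_real c * sesq S q v v"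
    by (simp add: sesq_def sum_distrib_left mult_ac)
  then show "0 \<le> Re (sesq S (\<lambda>r s. complex_of_real c * q r s) v v)"
    using psd_nonneg[OF assms(1)] assms(2) by simp
qed

text \<open>A diagonal bound: for every pair of indices, \<open>2 Re (cnj v\<^sub>r v\<^sub>s q\<^sub>r\<^sub>s)\<close> is controlled by
  \<open>\<bar>v\<^sub>r\<bar>\<^sup>2 + \<bar>v\<^sub>s\<bar>\<^sup>2\<close>.\<close>
lemma hermitian_dominated:
  assumes S: "finite S" and q: "\<And>r s. r \<in> S \<Longrightarrow> s \<in> S \<Longrightarrow> q s r = cnj (q r s)"
  shows "\<exists>c>0. psd S (\<lambda>r s. complex_of_real c * delta r s - q r s)"
proof -
  define c where "c = (\<Sum>r\<in>S. \<Sum>s\<in>S. cmod (q r s)) + 1"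
  have c: "c > 0" unfolding c_def by (intro add_nonneg_pos sum_nonneg) auto
  have "psd S (\<lambda>r s. complex_of_real c * delta r s - q r s)"
    unfolding psd_def
  proof (intro conjI ballI allI)
    fix r s assume "r \<in> S" "s \<in> S"
    then have "q s r = cnj (q r s)" by (rule q)
    then show "complex_of_real c * delta s r - q s r = cnj (complex_of_real c * delta r s - q r s)"
      by auto
  next
    fix v
    have "cmod (sesq S q v v) \<le> (\<Sum>r\<in>S. \<Sum>s\<in>S. cmod (q r s) * (l2 S v * l2 S v))"
      unfolding sesq_def
    proof (rule order.trans[OF norm_sum], rule sum_mono, rule order.trans[OF norm_sum], rule sum_mono)
      fix r s assume rs: "r \<in> S" "s \<in> S"
      have "cmod (v r) * cmod (v s) \<le> l2 S v * l2 S v"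
        by (intro mult_mono l2_entry S rs l2_nonneg) auto
      then have "cmod (q r s) * (cmod (v r) * cmod (v s)) \<le> cmod (q r s) * (l2 S v * l2 S v)"
        by (rule mult_left_mono) simp
      then show "cmod (cnj (v r) * q r s * v s) \<le> cmod (q r s) * (l2 S v * l2 S v)"
        by (simp add: norm_mult mult_ac)
    qed
    also have "\<dots> = (c - 1) * (l2 S v)\<^sup>2"
      by (simp add: c_def sum_distrib_right power2_eq_square)
    also have "\<dots> \<le> c * (l2 S v)\<^sup>2" by (simp add: mult_right_mono)
    finally have "Re (sesq S q v v) \<le> c * (l2 S v)\<^sup>2" using complex_Re_le_cmod order.trans by blast
    moreover have "sesq S (\<lambda>r s. complex_of_real c * delta r s - q r s) v v
        = complex_of_real c * complex_of_real ((l2 S v)\<^sup>2) - sesq S q v v"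
    proof -
      have "sesq S (\<lambda>r s. complex_of_real c * delta r s) v v = complex_of_real c * sesq S delta v v"
        by (simp add: sesq_def sum_distrib_left mult_ac)
      then show ?thesis by (simp only: sesq_diff sesq_id[OF S] l2_inner_self)
    qed
    ultimately show "0 \<le> Re (sesq S (\<lambda>r s. complex_of_real c * delta r s - q r s) v v)"
      by (simp del: of_real_power)
  qed
  with c show ?thesis by blast
qed

lemma sum_double: "(\<Sum>r<2 * n. f r) = (\<Sum>i<n. f (2 * i) + f (2 * i + 1 :: nat))" for f :: "nat \<Rightarrow> complex"
  by (induction n) (simp_all add: add.assoc)

lemma sum_lessThan_add: "(\<Sum>k<m + n. f k) = (\<Sum>k<m. f k) + (\<Sum>k<n. f (m + k :: nat))" for f :: "nat \<Rightarrow> complex"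
  by (induction n) (simp_all add: add.assoc)

context gen_space
begin

lemma matrix_orderingI:
  assumes sub: "\<And>n. C n \<subseteq> carrier (matrices U n)"
    and herm: "\<And>n X. mk n X \<in> C n \<Longrightarrow> mk n (\<lambda>a i j. cnj (X a j i)) = mk n X"
    and zero: "\<And>n. mk n (\<lambda>a i j. 0) \<in> C n"
    and add: "\<And>n X Y. mk n X \<in> C n \<Longrightarrow> mk n Y \<in> C n \<Longrightarrow> mk n (\<lambda>a i j. X a i j + Y a i j) \<in> C n"
    and scale: "\<And>n X r. mk n X \<in> C n \<Longrightarrow> 0 < r \<Longrightarrow> mk n (\<lambda>a i j. complex_of_real r * X a i j) \<in> C n"
    and conj: "\<And>m n A X. mk m X \<in> C m \<Longrightarrow> mk n (cj m A X) \<in> C n"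
  shows "matrix_ordering U C"
  unfolding matrix_ordering_def is_cone_def
proof (intro conjI allI ballI impI)
  fix n
  have ex: "\<exists>X. x = mk n X" if "x \<in> C n" for x n using sub that mk_surj by blast
  show "C n \<subseteq> hermitian (matrices U n)"
  proof
    fix x assume x: "x \<in> C n"
    then obtain X where "x = mk n X" using ex by blast
    then show "x \<in> hermitian (matrices U n)" using herm x mk_hermitian by simp
  qed
  show "C n \<noteq> {}" using zero by blast
  show "x \<oplus>\<^bsub>matrices U n\<^esub> y \<in> C n" if "x \<in> C n" "y \<in> C n" for x y
  proof -
    from ex[OF that(1)] ex[OF that(2)] obtain X Y where "x = mk n X" "y = mk n Y" by blast
    then show ?thesis using add that by (simp add: mk_add)
  qed
  show "complex_of_real r \<odot>\<^bsub>matrices U n\<^esub> x \<in> C n" if "0 \<le> r" "x \<in> C n" for r x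
  proof -
    from ex[OF that(2)] obtain X where "x = mk n X" by blast
    then show ?thesis using scale[of n X r] zero[of n] that by (cases "r = 0") (simp_all add: mk_smult)
  qed
  show "conj_by U \<alpha> x \<in> C m" if "\<alpha> \<in> carrier_mat n m" "x \<in> C n" for m \<alpha> x
  proof -
    from ex[OF that(2)] obtain X where "x = mk n X" by blast
    then show ?thesis using conj that by (simp add: mk_conj')
  qed
qed

context
  fixes C :: "nat \<Rightarrow> 'a mat set"
  assumes C: "matrix_ordering U C"
begin

lemma mo_sub: "C n \<subseteq> carrier (matrices U n)"
  using C by (auto simp: matrix_ordering_def is_cone_def hermitian_def)

lemma mo_herm: "mk n X \<in> C n \<Longrightarrow> mk n (\<lambda>a i j. cnj (X a j i)) = mk n X"
  using C unfolding matrix_ordering_def is_cone_def mk_hermitian[symmetric] by blast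

lemma mo_add: "mk n X \<in> C n \<Longrightarrow> mk n Y \<in> C n \<Longrightarrow> mk n (\<lambda>a i j. X a i j + Y a i j) \<in> C n"
  using C unfolding matrix_ordering_def is_cone_def mk_add[symmetric] by blast

lemma mo_scale: "mk n X \<in> C n \<Longrightarrow> 0 \<le> r \<Longrightarrow> mk n (\<lambda>a i j. complex_of_real r * X a i j) \<in> C n"
  using C unfolding matrix_ordering_def is_cone_def mk_smult[symmetric] by blast

lemma mo_zero: "mk n (\<lambda>a i j. 0) \<in> C n"
proof -
  have "C n \<noteq> {}" using C unfolding matrix_ordering_def is_cone_def by blast
  then obtain X where "mk n X \<in> C n" using mo_sub mk_surj by blast
  from mo_scale[OF this, of 0] show ?thesis by simp
qed

lemma mo_conj: "mk m X \<in> C m \<Longrightarrow> mk n (cj m A X) \<in> C n"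
  using C unfolding matrix_ordering_def mk_conj[symmetric] by (metis mat_carrier)

lemma mo_sum:
  assumes "finite K" "\<And>k. k \<in> K \<Longrightarrow> mk n (F k) \<in> C n"
  shows "mk n (\<lambda>a i j. \<Sum>k\<in>K. F k a i j) \<in> C n"
  using assms by (induction K rule: finite_induct) (simp_all add: mo_zero mo_add)

lemma mo_rank_one:
  assumes "mk 1 (\<lambda>a i j. c a) \<in> C 1"
  shows "mk n (\<lambda>a i j. cnj (b i) * b j * c a) \<in> C n"
  using mo_conj[OF assms, of n "\<lambda>k i. b i"] by (simp add: cj_def[abs_def])

text \<open>A positive semidefinite scalar matrix is a sum of rank-one ones, and \<open>b\<^sup>* c b\<close> belongs to the
  ordering for a row \<open>b\<close>.\<close>
lemma mo_psd:
  assumes c: "mk 1 (\<lambda>a i j. c a) \<in> C 1" and Q: "psd {..<n} Q"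
  shows "mk n (\<lambda>a i j. Q i j * c a) \<in> C n"
proof -
  obtain m :: nat and b where b: "\<forall>r\<in>{..<n}. \<forall>s\<in>{..<n}. Q r s = (\<Sum>k<m. cnj (b k r) * b k s)"
    using psd_factorization[OF Q] by auto
  have "mk n (\<lambda>a i j. \<Sum>k<m. cnj (b k i) * b k j * c a) \<in> C n"
    by (intro mo_sum mo_rank_one c) simp
  also have "mk n (\<lambda>a i j. \<Sum>k<m. cnj (b k i) * b k j * c a) = mk n (\<lambda>a i j. Q i j * c a)"
    by (rule mk_cong) (simp add: b sum_distrib_right)
  finally show ?thesis .
qed

lemma mo_diag:
  assumes "\<And>i. i < n \<Longrightarrow> mk 1 (\<lambda>a _ _. s i a) \<in> C 1"
  shows "mk n (dg s) \<in> C n"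
proof -
  have "mk n (\<lambda>a i j. cnj (delta i k) * delta j k * s k a) \<in> C n" if "k < n" for k
    by (rule mo_rank_one[OF assms[OF that]])
  then have "mk n (\<lambda>a i j. \<Sum>k<n. cnj (delta i k) * delta j k * s k a) \<in> C n"
    by (intro mo_sum[where F = "\<lambda>k a i j. cnj (delta i k) * delta j k * s k a"]) simp_all
  also have "mk n (\<lambda>a i j. \<Sum>k<n. cnj (delta i k) * delta j k * s k a) = mk n (dg s)"
  proof (rule mk_cong)
    fix a i j assume "i < n"
    have "(\<Sum>k<n. cnj (delta i k) * delta j k * s k a) = (\<Sum>k<n. if k = i then dg s a i j else 0)"
      by (intro sum.cong refl) (simp add: dg_def)
    then show "(\<Sum>k<n. cnj (delta i k) * delta j k * s k a) = dg s a i j" using \<open>i < n\<close> by simp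
  qed
  finally show ?thesis .
qed

end

definition arch :: "(nat \<Rightarrow> 'a mat set) \<Rightarrow> nat \<Rightarrow> 'a mat set" where
  "arch C n = {x \<in> carrier (matrices U n). \<forall>\<epsilon>>0.
     x \<oplus>\<^bsub>matrices U n\<^esub> complex_of_real \<epsilon> \<odot>\<^bsub>matrices U n\<^esub> amp_unit U n (g 0) \<in> C n}"

lemma arch_mk: "mk n X \<in> arch C n \<longleftrightarrow>
    (\<forall>\<epsilon>>0. mk n (\<lambda>a i j. X a i j + complex_of_real \<epsilon> * dg (\<lambda>_. ev 0) a i j) \<in> C n)"
  by (simp add: arch_def mk_closed mk_amp_unit mk_smult mk_add)

lemma archD: "mk n X \<in> arch C n \<Longrightarrow> 0 < \<epsilon> \<Longrightarrow>
    mk n (\<lambda>a i j. X a i j + complex_of_real \<epsilon> * dg (\<lambda>_. ev 0) a i j) \<in> C n"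
  unfolding arch_mk by (elim allE[of _ \<epsilon>] mp)

lemma dg_herm: "(\<And>i a. cnj (s i a) = s i a) \<Longrightarrow> cnj (dg s a j i) = dg s a i j"
  by (auto simp: dg_def)

lemma ev_real: "cnj (ev b a) = ev b a" by (simp add: ev_def)
lemma perp_real: "cnj (perp b a) = perp b a" by (simp add: perp_def ev_real)

lemma arch_matrix_ordering:
  assumes C: "matrix_ordering U C" and e: "mk 1 (\<lambda>a i j. ev 0 a) \<in> C 1"
  shows "matrix_ordering U (arch C)"
proof (rule matrix_orderingI)
  let ?e = "dg (\<lambda>_. ev 0)"
  have de: "mk n ?e \<in> C n" for n by (rule mo_diag[OF C e])
  show "arch C n \<subseteq> carrier (matrices U n)" for n by (auto simp: arch_def)
  show "mk n (\<lambda>a i j. cnj (X a j i)) = mk n X" if "mk n X \<in> arch C n" for n X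
  proof -
    from archD[OF that, of 1] have "mk n (\<lambda>a i j. X a i j + ?e a i j) \<in> C n" by simp
    from mo_herm[OF C this] have "mk n (\<lambda>a i j. cnj (X a j i) + ?e a i j) = mk n (\<lambda>a i j. X a i j + ?e a i j)"
      by (simp add: dg_herm ev_real)
    then have "mk n (\<lambda>a i j. cnj (X a j i) + ?e a i j) \<ominus>\<^bsub>matrices U n\<^esub> mk n ?e
        = mk n (\<lambda>a i j. X a i j + ?e a i j) \<ominus>\<^bsub>matrices U n\<^esub> mk n ?e" by simp
    then show ?thesis by (simp add: mk_diff)
  qed
  show "mk n (\<lambda>a i j. 0) \<in> arch C n" for n
    using mo_scale[OF C de] by (simp add: arch_mk)
  show "mk n (\<lambda>a i j. X a i j + Y a i j) \<in> arch C n" if "mk n X \<in> arch C n" "mk n Y \<in> arch C n" for n X Y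
    unfolding arch_mk
  proof (intro allI impI)
    fix \<epsilon> :: real assume "\<epsilon> > 0"
    note h = half_gt_zero[OF this]
    from mo_add[OF C archD[OF that(1) h] archD[OF that(2) h]]
    show "mk n (\<lambda>a i j. X a i j + Y a i j + complex_of_real \<epsilon> * ?e a i j) \<in> C n"
      by (rule back_subst[of "\<lambda>x. x \<in> C n"]) (rule mk_cong, simp add: field_simps)
  qed
  show "mk n (\<lambda>a i j. complex_of_real r * X a i j) \<in> arch C n" if "mk n X \<in> arch C n" "0 < r" for n X r
    unfolding arch_mk
  proof (intro allI impI)
    fix \<epsilon> :: real assume "\<epsilon> > 0"
    then have "0 < \<epsilon> / r" using that(2) by simp
    from mo_scale[OF C archD[OF that(1) this] less_imp_le[OF that(2)]]
    show "mk n (\<lambda>a i j. complex_of_real r * X a i j + complex_of_real \<epsilon> * ?e a i j) \<in> C n"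
      by (rule back_subst[of "\<lambda>x. x \<in> C n"], intro mk_cong) (use that in \<open>simp add: distrib_left\<close>)
  qed
  show "mk n (cj m A X) \<in> arch C n" if X: "mk m X \<in> arch C m" for m n A X
    unfolding arch_mk
  proof (intro allI impI)
    fix \<epsilon> :: real assume eps: "\<epsilon> > 0"
    let ?G = "\<lambda>i j. \<Sum>k<m. cnj (A k i) * A k j"
    have G: "psd {..<n} ?G" by (rule psd_gram) simp
    have "\<exists>K>0. psd {..<n} (\<lambda>i j. complex_of_real K * delta i j - ?G i j)"
      by (rule hermitian_dominated[OF finite_lessThan psd_hermitian[OF G]])
    then obtain K where K: "K > 0" "psd {..<n} (\<lambda>i j. complex_of_real K * delta i j - ?G i j)"
      by blast
    define d where "d = \<epsilon> / K"
    have d: "d > 0" "d * K = \<epsilon>" using eps K(1) by (simp_all add: d_def)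
    from mo_conj[OF C archD[OF X d(1)], of n A]
    have 1: "mk n (cj m A (\<lambda>a i j. X a i j + complex_of_real d * ?e a i j)) \<in> C n" .
    have 2: "mk n (\<lambda>a i j. complex_of_real d * (complex_of_real K * delta i j - ?G i j) * ev 0 a) \<in> C n"
      using d by (intro mo_psd[OF C e] psd_scale K) simp
    have "cj m A (\<lambda>a i j. X a i j + complex_of_real d * ?e a i j) a i j
       = cj m A X a i j + complex_of_real d * ?G i j * ev 0 a" for a i j
    proof -
      have "(\<Sum>k<m. \<Sum>l<m. cnj (A k i) * A l j * (complex_of_real d * ?e a k l))
         = (\<Sum>k<m. cnj (A k i) * A k j * (complex_of_real d * ev 0 a))"
      proof (intro sum.cong refl)
        fix k assume k: "k \<in> {..<m}"
        have "(\<Sum>l<m. cnj (A k i) * A l j * (complex_of_real d * ?e a k l))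
           = (\<Sum>l<m. if l = k then cnj (A k i) * A k j * (complex_of_real d * ev 0 a) else 0)"
          by (intro sum.cong refl) (simp add: dg_def)
        then show "(\<Sum>l<m. cnj (A k i) * A l j * (complex_of_real d * ?e a k l))
           = cnj (A k i) * A k j * (complex_of_real d * ev 0 a)" using k by simp
      qed
      then show ?thesis
        by (simp add: cj_def distrib_left sum.distrib sum_distrib_left sum_distrib_right mult_ac)
    qed
    then have "cj m A (\<lambda>a i j. X a i j + complex_of_real d * ?e a i j) a i j
         + complex_of_real d * (complex_of_real K * delta i j - ?G i j) * ev 0 a
      = cj m A X a i j + complex_of_real \<epsilon> * ?e a i j" for a i j
      unfolding d(2)[symmetric] by (simp add: dg_def algebra_simps)
    with mo_add[OF C 1 2] show "mk n (\<lambda>a i j. cj m A X a i j + complex_of_real \<epsilon> * ?e a i j) \<in> C n"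
      by simp
  qed
qed

lemma arch_superset:
  assumes C: "matrix_ordering U C" and e: "mk 1 (\<lambda>a i j. ev 0 a) \<in> C 1"
  shows "C n \<subseteq> arch C n"
proof
  fix x assume x: "x \<in> C n"
  then obtain X where X: "x = mk n X" using mo_sub[OF C] mk_surj by blast
  have "mk n (\<lambda>a i j. X a i j + complex_of_real \<epsilon> * dg (\<lambda>_. ev 0) a i j) \<in> C n" if "\<epsilon> > 0" for \<epsilon>
    using x X mo_add[OF C _ mo_scale[OF C mo_diag[OF C e]]] that by simp
  then show "x \<in> arch C n" unfolding X arch_mk by blast
qed

text \<open>Write \<open>X\<close> as the sum of the \<open>X\<^sub>a \<otimes> g a\<close>. With \<open>X\<^sub>a \<le> R\<^sub>a\<close> for scalar matrices one has
  \<open>X\<^sub>a \<otimes> g a \<le> R\<^sub>a I \<otimes> g a \<le> R\<^sub>a I \<otimes> e\<close>, since \<open>g a\<close> and its complement are positive.\<close>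
lemma order_unit:
  assumes C: "matrix_ordering U C"
    and gens: "\<And>a. a \<le> N \<Longrightarrow> mk 1 (\<lambda>b i j. ev a b) \<in> C 1" "\<And>a. a \<le> N \<Longrightarrow> mk 1 (\<lambda>b i j. perp a b) \<in> C 1"
    and herm: "\<And>a i j. X a j i = cnj (X a i j)"
  shows "\<exists>r>0. mk n (\<lambda>a i j. complex_of_real r * dg (\<lambda>_. ev 0) a i j - X a i j) \<in> C n"
proof -
  have "\<forall>a. \<exists>c>0. psd {..<n} (\<lambda>r s. complex_of_real c * delta r s - X a r s)"
    by (intro allI hermitian_dominated finite_lessThan herm)
  from choice[OF this] obtain R where R': "\<forall>a. 0 < R a \<and> psd {..<n} (\<lambda>r s. complex_of_real (R a) * delta r s - X a r s)" ..
  note R = R'[THEN spec, THEN conjunct1] R'[THEN spec, THEN conjunct2]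
  \<comment> \<open>the sum of the two gaps in the estimate for the generator \<open>a\<close>\<close>
  have 1: "mk n (\<lambda>b i j. (complex_of_real (R a) * delta i j - X a i j) * ev a b
        + complex_of_real (R a) * dg (\<lambda>_. perp a) b i j) \<in> C n" if "a \<le> N" for a
    by (intro mo_add[OF C] mo_psd[OF C] mo_scale[OF C] mo_diag[OF C] R(2) gens that less_imp_le[OF R(1)])
  have "mk n (\<lambda>b i j. \<Sum>a\<le>N. (complex_of_real (R a) * delta i j - X a i j) * ev a b
        + complex_of_real (R a) * dg (\<lambda>_. perp a) b i j) \<in> C n"
    by (rule mo_sum[OF C]) (use 1 in auto)
  also have "mk n (\<lambda>b i j. \<Sum>a\<le>N. (complex_of_real (R a) * delta i j - X a i j) * ev a b
        + complex_of_real (R a) * dg (\<lambda>_. perp a) b i j)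
     = mk n (\<lambda>b i j. complex_of_real (\<Sum>a\<le>N. R a) * dg (\<lambda>_. ev 0) b i j - X b i j)"
  proof (rule mk_cong)
    fix b i j assume b: "b \<le> N"
    have "(complex_of_real (R a) * delta i j - X a i j) * ev a b + complex_of_real (R a) * dg (\<lambda>_. perp a) b i j
       = complex_of_real (R a) * dg (\<lambda>_. ev 0) b i j - (if a = b then X a i j else 0)" for a
      by (auto simp: dg_def perp_def ev_def)
    then show "(\<Sum>a\<le>N. (complex_of_real (R a) * delta i j - X a i j) * ev a b
        + complex_of_real (R a) * dg (\<lambda>_. perp a) b i j)
      = complex_of_real (\<Sum>a\<le>N. R a) * dg (\<lambda>_. ev 0) b i j - X b i j"
      using b by (simp add: sum_subtractf sum_distrib_right)
  qed
  finally show ?thesis using R(1) by (intro exI[of _ "\<Sum>a\<le>N. R a"] conjI sum_pos) auto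
qed

end

section \<open>The ordering C(p)\<close>

text \<open>The coefficients of \<open>I\<^sub>n \<otimes> (p \<oplus> p\<^sup>\<bottom>)\<close>, of \<open>I\<^sub>n \<otimes> (p\<^sup>\<bottom> \<oplus> p)\<close> and of \<open>x \<otimes> J\<^sub>2\<close>, where row
  \<open>2 i + c\<close> stands for the pair \<open>(i, c)\<close>.\<close>
definition pd :: "nat \<Rightarrow> nat \<Rightarrow> nat \<Rightarrow> nat \<Rightarrow> complex" where
  "pd b = dg (\<lambda>r. if even r then ev b else perp b)"

definition qd :: "nat \<Rightarrow> nat \<Rightarrow> nat \<Rightarrow> nat \<Rightarrow> complex" where
  "qd b = dg (\<lambda>r. if even r then perp b else ev b)"

definition dbl :: "(nat \<Rightarrow> nat \<Rightarrow> nat \<Rightarrow> complex) \<Rightarrow> nat \<Rightarrow> nat \<Rightarrow> nat \<Rightarrow> complex" where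
  "dbl X a r s = X a (r div 2) (s div 2)"

lemma pd_herm: "cnj (pd b a s r) = pd b a r s" and qd_herm: "cnj (qd b a s r) = qd b a r s"
  unfolding pd_def qd_def dg_def by (auto simp: ev_def perp_def)

lemma sum_delta_mult: "s < n \<Longrightarrow> (\<Sum>l<n. delta l s * f l) = f (s::nat)"
proof -
  assume "s < n"
  have "(\<Sum>l<n. delta l s * f l) = (\<Sum>l<n. if l = s then f s else 0)" by (intro sum.cong refl) auto
  then show ?thesis using \<open>s < n\<close> by simp
qed

context gen_space
begin

lemma proj_step_mk:
  assumes "b \<le> N"
  shows "mk n X \<in> proj_step U (g 0) C (g b) n \<longleftrightarrow> (\<forall>\<epsilon>>0. \<exists>t>0.
    mk (2 * n) (\<lambda>a r s. dbl X a r s + complex_of_real \<epsilon> * pd b a r s + complex_of_real t * qd b a r s) \<in> C (2 * n))"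
proof -
  have "tensor_J2 n (mk n X) = mk (2 * n) (dbl X)"
    unfolding mk_tensor_J2 by (rule mk_cong) (simp add: dbl_def)
  moreover have "amp_pair U n (g b) (compl U (g 0) (g b)) = mk (2 * n) (pd b)"
    using mk_amp_pair[of n "ev b" "perp b"] assms by (simp add: comb_gen compl_gen pd_def)
  moreover have "amp_pair U n (compl U (g 0) (g b)) (g b) = mk (2 * n) (qd b)"
    using mk_amp_pair[of n "perp b" "ev b"] assms by (simp add: comb_gen compl_gen qd_def)
  ultimately show ?thesis by (simp add: proj_step_def mk_closed mk_smult mk_add)
qed

lemma mo_mono_in:
  assumes "matrix_ordering U C" "mk n X \<in> C n" "mk n Y \<in> C n"
    and "\<And>a i j. a \<le> N \<Longrightarrow> i < n \<Longrightarrow> j < n \<Longrightarrow> Z a i j = X a i j + Y a i j"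
  shows "mk n Z \<in> C n"
proof -
  have "mk n Z = mk n (\<lambda>a i j. X a i j + Y a i j)" by (rule mk_cong) (rule assms(4))
  then show ?thesis using mo_add[OF assms(1-3)] by simp
qed

lemma proj_stepI:
  assumes "b \<le> N"
    and "\<And>\<epsilon>. 0 < \<epsilon> \<Longrightarrow> \<exists>t>0. mk (2 * n) (\<lambda>a r s. dbl X a r s + complex_of_real \<epsilon> * pd b a r s
           + complex_of_real t * qd b a r s) \<in> C (2 * n)"
  shows "mk n X \<in> proj_step U (g 0) C (g b) n"
  unfolding proj_step_mk[OF assms(1)] using assms(2) by blast

lemma proj_stepE:
  assumes "mk n X \<in> proj_step U (g 0) C (g b) n" "b \<le> N" "0 < \<epsilon>"
  obtains t where "0 < t" "mk (2 * n) (\<lambda>a r s. dbl X a r s + complex_of_real \<epsilon> * pd b a r s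
           + complex_of_real t * qd b a r s) \<in> C (2 * n)"
  using assms(1,3) unfolding proj_step_mk[OF assms(2)] by blast

context
  fixes C b
  assumes C: "matrix_ordering U C" and b: "b \<le> N"
    and p: "mk 1 (\<lambda>a i j. ev b a) \<in> C 1" and p': "mk 1 (\<lambda>a i j. perp b a) \<in> C 1"
begin

lemma mo_pd: "mk n (pd b) \<in> C n"
  unfolding pd_def by (rule mo_diag[OF C]) (use p p' in simp)

lemma mo_qd: "mk n (qd b) \<in> C n"
  unfolding qd_def by (rule mo_diag[OF C]) (use p p' in simp)

text \<open>This is \<open>Q \<otimes> (c \<oplus> d)\<close>, the sum of two compressions of \<open>Q \<otimes> c\<close> and \<open>Q \<otimes> d\<close> that place them
  on the even and on the odd coordinates.\<close>
lemma mo_alternate: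
  assumes Q: "psd {..<n} Q" and c: "mk 1 (\<lambda>a i j. c a) \<in> C 1"
    and d: "mk 1 (\<lambda>a i j. d a) \<in> C 1"
  shows "mk (2 * n) (\<lambda>a r s. if even r = even s then Q (r div 2) (s div 2) * (if even r then c a else d a) else 0) \<in> C (2 * n)"
proof -
  have "mk (2 * n) (cj n (\<lambda>k r. if r = 2 * k then 1 else 0) (\<lambda>a i j. Q i j * c a)) \<in> C (2 * n)"
    by (intro mo_conj[OF C] mo_psd[OF C] c Q)
  moreover have "mk (2 * n) (cj n (\<lambda>k r. if r = 2 * k + 1 then 1 else 0) (\<lambda>a i j. Q i j * d a)) \<in> C (2 * n)"
    by (intro mo_conj[OF C] mo_psd[OF C] d Q)
  ultimately show ?thesis
  proof (rule mo_mono_in[OF C])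
    fix a r s :: nat assume rs: "r < 2 * n" "s < 2 * n"
    have e: "cj n (\<lambda>k r. if r = 2 * k + o' then 1 else 0) F a r s
       = (if even r = even (o' :: nat) \<and> even s = even o' then F a (r div 2) (s div 2) else 0)" if "o' < 2" for o' F
    proof -
      have k: "r = 2 * k + o' \<longleftrightarrow> even r = even o' \<and> k = r div 2" for k r
      proof -
        consider "o' = 0" | "o' = 1" using \<open>o' < 2\<close> by linarith
        then show ?thesis
        proof cases
          case 1 show ?thesis unfolding 1 by presburger
        next
          case 2 show ?thesis unfolding 2 by presburger
        qed
      qed
      have "cj n (\<lambda>k r. if r = 2 * k + o' then 1 else 0) F a r s
        = (\<Sum>k<n. delta k (r div 2) * (\<Sum>l<n. delta l (s div 2) *
             (if even r = even o' \<and> even s = even o' then F a k l else 0)))"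
        unfolding cj_def k sum_distrib_left by (intro sum.cong refl) auto
      also have "\<dots> = (if even r = even o' \<and> even s = even o' then F a (r div 2) (s div 2) else 0)"
        using rs by (simp add: sum_delta_mult)
      finally show ?thesis .
    qed
    show "(if even r = even s then Q (r div 2) (s div 2) * (if even r then c a else d a) else 0)
      = cj n (\<lambda>k r. if r = 2 * k then 1 else 0) (\<lambda>a i j. Q i j * c a) a r s
      + cj n (\<lambda>k r. if r = 2 * k + 1 then 1 else 0) (\<lambda>a i j. Q i j * d a) a r s"
      using e[of 0 "\<lambda>a i j. Q i j * c a"] e[of 1 "\<lambda>a i j. Q i j * d a"] by simp
  qed
qed

text \<open>Only conjugation by \<open>A\<close> needs an argument. Conjugation by \<open>A \<otimes> I\<^sub>2\<close> turns \<open>I \<otimes> (p \<oplus> p\<^sup>\<bottom>)\<close>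
  into \<open>A\<^sup>*A \<otimes> (p \<oplus> p\<^sup>\<bottom>)\<close>, which is not of the required form. If \<open>A\<^sup>*A \<le> K\<close>, adding the positive
  element \<open>(K - A\<^sup>*A) \<otimes> (p \<oplus> p\<^sup>\<bottom>)\<close> restores the form, at the price of replacing \<open>\<epsilon>\<close> by
  \<open>\<epsilon> / K\<close> beforehand.\<close>
lemma proj_step_matrix_ordering: "matrix_ordering U (proj_step U (g 0) C (g b))"
proof (rule matrix_orderingI)
  let ?P = "proj_step U (g 0) C (g b)"
  show "?P n \<subseteq> carrier (matrices U n)" for n by (auto simp: proj_step_def)
  show "mk n (\<lambda>a i j. cnj (X a j i)) = mk n X" if X: "mk n X \<in> ?P n" for n X
  proof -
    have one: "(0::real) < 1" by simp
    obtain t where "mk (2 * n) (\<lambda>a r s. dbl X a r s + complex_of_real 1 * pd b a r s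
           + complex_of_real t * qd b a r s) \<in> C (2 * n)"
      by (rule proj_stepE[OF X b one])
    from mo_herm[OF C this] have h: "comb (\<lambda>a. cnj (dbl X a s r) + pd b a r s + complex_of_real t * qd b a r s)
       = comb (\<lambda>a. dbl X a r s + pd b a r s + complex_of_real t * qd b a r s)" if "r < 2 * n" "s < 2 * n" for r s
      unfolding mk_eq_iff using that by (simp add: pd_herm qd_herm)
    have "comb (\<lambda>a. cnj (X a j i)) = comb (\<lambda>a. X a i j)" if ij: "i < n" "j < n" for i j
    proof -
      let ?w = "\<lambda>a. pd b a (2 * i) (2 * j) + complex_of_real t * qd b a (2 * i) (2 * j)"
      have "comb (\<lambda>a. cnj (X a j i) + ?w a) \<ominus>\<^bsub>U\<^esub> comb ?w = comb (\<lambda>a. X a i j + ?w a) \<ominus>\<^bsub>U\<^esub> comb ?w"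
        using h[of "2 * i" "2 * j"] ij by (simp add: dbl_def add.assoc)
      then show ?thesis by (simp add: comb_diff)
    qed
    then show ?thesis unfolding mk_eq_iff by blast
  qed
  show "mk n (\<lambda>a i j. 0) \<in> ?P n" for n
  proof (rule proj_stepI[OF b])
    fix \<epsilon> :: real assume "0 < \<epsilon>"
    then have "mk (2 * n) (\<lambda>a r s. complex_of_real \<epsilon> * pd b a r s + complex_of_real 1 * qd b a r s) \<in> C (2 * n)"
      by (intro mo_add[OF C] mo_scale[OF C] mo_pd mo_qd) auto
    then show "\<exists>t>0. mk (2 * n) (\<lambda>a r s. dbl (\<lambda>a i j. 0) a r s + complex_of_real \<epsilon> * pd b a r s
           + complex_of_real t * qd b a r s) \<in> C (2 * n)"
      by (intro exI[of _ 1]) (simp add: dbl_def)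
  qed
  show "mk n (\<lambda>a i j. X a i j + Y a i j) \<in> ?P n" if XY: "mk n X \<in> ?P n" "mk n Y \<in> ?P n" for n X Y
  proof (rule proj_stepI[OF b])
    fix \<epsilon> :: real assume "0 < \<epsilon>"
    then have h: "0 < \<epsilon> / 2" by simp
    obtain t where t: "0 < t" "mk (2 * n) (\<lambda>a r s. dbl X a r s + complex_of_real (\<epsilon> / 2) * pd b a r s
           + complex_of_real t * qd b a r s) \<in> C (2 * n)" by (rule proj_stepE[OF XY(1) b h])
    obtain u where u: "0 < u" "mk (2 * n) (\<lambda>a r s. dbl Y a r s + complex_of_real (\<epsilon> / 2) * pd b a r s
           + complex_of_real u * qd b a r s) \<in> C (2 * n)" by (rule proj_stepE[OF XY(2) b h])
    have "mk (2 * n) (\<lambda>a r s. dbl (\<lambda>a i j. X a i j + Y a i j) a r s + complex_of_real \<epsilon> * pd b a r s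
           + complex_of_real (t + u) * qd b a r s) \<in> C (2 * n)"
      by (rule mo_mono_in[OF C t(2) u(2)]) (simp add: dbl_def field_simps)
    then show "\<exists>t>0. mk (2 * n) (\<lambda>a r s. dbl (\<lambda>a i j. X a i j + Y a i j) a r s + complex_of_real \<epsilon> * pd b a r s
           + complex_of_real t * qd b a r s) \<in> C (2 * n)"
      using t(1) u(1) by (intro exI[of _ "t + u"]) simp
  qed
  show "mk n (\<lambda>a i j. complex_of_real r * X a i j) \<in> ?P n" if X: "mk n X \<in> ?P n" "0 < r" for n X r
  proof (rule proj_stepI[OF b])
    fix \<epsilon> :: real assume "0 < \<epsilon>"
    then have h: "0 < \<epsilon> / r" using X(2) by simp
    obtain t where t: "0 < t" "mk (2 * n) (\<lambda>a r' s. dbl X a r' s + complex_of_real (\<epsilon> / r) * pd b a r' s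
           + complex_of_real t * qd b a r' s) \<in> C (2 * n)" by (rule proj_stepE[OF X(1) b h])
    have "mk (2 * n) (\<lambda>a i s. dbl (\<lambda>a i j. complex_of_real r * X a i j) a i s + complex_of_real \<epsilon> * pd b a i s
           + complex_of_real (r * t) * qd b a i s) \<in> C (2 * n)"
      using mo_scale[OF C t(2) less_imp_le[OF X(2)]]
      by (rule back_subst[of "\<lambda>x. x \<in> C (2 * n)"], intro mk_cong) (use X(2) in \<open>simp add: distrib_left dbl_def\<close>)
    then show "\<exists>t>0. mk (2 * n) (\<lambda>a i s. dbl (\<lambda>a i j. complex_of_real r * X a i j) a i s + complex_of_real \<epsilon> * pd b a i s
           + complex_of_real t * qd b a i s) \<in> C (2 * n)"
      using t(1) X(2) by (intro exI[of _ "r * t"]) simp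
  qed
  show "mk n (cj m A X) \<in> ?P n" if X: "mk m X \<in> ?P m" for m n A X
  proof (rule proj_stepI[OF b])
    fix \<epsilon> :: real assume eps: "0 < \<epsilon>"
    define G where "G i j = (\<Sum>k<m. cnj (A k i) * A k j)" for i j
    have G: "psd {..<n} G" unfolding G_def by (rule psd_gram) simp
    have "\<exists>K>0. psd {..<n} (\<lambda>i j. complex_of_real K * delta i j - G i j)"
      by (rule hermitian_dominated[OF finite_lessThan psd_hermitian[OF G]])
    then obtain K where K: "K > 0" "psd {..<n} (\<lambda>i j. complex_of_real K * delta i j - G i j)"
      by blast
    have h: "0 < \<epsilon> / K" using eps K(1) by simp
    obtain t where t: "0 < t" "mk (2 * m) (\<lambda>a r s. dbl X a r s + complex_of_real (\<epsilon> / K) * pd b a r s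
           + complex_of_real t * qd b a r s) \<in> C (2 * m)" by (rule proj_stepE[OF X b h])
    \<comment> \<open>the matrix \<open>A \<otimes> I\<^sub>2\<close>\<close>
    define B where "B k r = (if even k = even r then A (k div 2) (r div 2) else 0)" for k r :: nat
    have 1: "mk (2 * n) (cj (2 * m) B (\<lambda>a r s. dbl X a r s + complex_of_real (\<epsilon> / K) * pd b a r s
           + complex_of_real t * qd b a r s)) \<in> C (2 * n)" by (rule mo_conj[OF C t(2)])
    let ?H = "\<lambda>i j. complex_of_real K * delta i j - G i j"
    have 2: "mk (2 * n) (\<lambda>a r s. complex_of_real (\<epsilon> / K) * (if even r = even s then ?H (r div 2) (s div 2) * (if even r then ev b a else perp b a) else 0)
        + complex_of_real t * (if even r = even s then ?H (r div 2) (s div 2) * (if even r then perp b a else ev b a) else 0)) \<in> C (2 * n)"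
      by (rule mo_add[OF C mo_scale[OF C mo_alternate[OF K(2) p p'] less_imp_le[OF h]] mo_scale[OF C mo_alternate[OF K(2) p' p] less_imp_le[OF t(1)]]])
    have "mk (2 * n) (\<lambda>a r s. dbl (cj m A X) a r s + complex_of_real \<epsilon> * pd b a r s
           + complex_of_real (t * K) * qd b a r s) \<in> C (2 * n)"
    proof (rule mo_mono_in[OF C 1 2])
      fix a r s :: nat assume rs: "r < 2 * n" "s < 2 * n"
      have Bsum: "(\<Sum>k<2 * m. cnj (B k r) * F k) = (\<Sum>k<m. cnj (A k (r div 2)) * F (2 * k + (if even r then 0 else 1)))" for F r
        unfolding sum_double by (intro sum.cong refl) (auto simp: B_def)
      have Bsum': "(\<Sum>k<2 * m. B k r * F k) = (\<Sum>k<m. A k (r div 2) * F (2 * k + (if even r then 0 else 1)))" for F r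
        unfolding sum_double by (intro sum.cong refl) (auto simp: B_def)
      have cjB: "cj (2 * m) B F a r s = (\<Sum>k<m. \<Sum>l<m. cnj (A k (r div 2)) * A l (s div 2) *
          F a (2 * k + (if even r then 0 else 1)) (2 * l + (if even s then 0 else 1)))" for F
      proof -
        have "cj (2 * m) B F a r s = (\<Sum>k<2*m. cnj (B k r) * (\<Sum>l<2*m. B l s * F a k l))"
          by (simp add: cj_def sum_distrib_left mult.assoc)
        then show ?thesis unfolding Bsum Bsum' by (simp add: sum_distrib_left mult.assoc)
      qed
      have c1: "cj (2 * m) B (dbl X) a r s = dbl (cj m A X) a r s"
        unfolding cjB by (simp add: dbl_def cj_def)
      have diag: "cj (2 * m) B (dg (\<lambda>r. if even r then c else d)) a r s
          = (if even r = even s then G (r div 2) (s div 2) * (if even r then c a else d a) else 0)" for c d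
      proof -
        have "dg (\<lambda>r. if even r then c else d) a (2 * k + (if even r then 0 else 1)) (2 * l + (if even s then 0 else 1))
           = (if l = k then if even r = even s then if even r then c a else d a else 0 else 0)" for k l
        proof -
          have "2 * k + (if even r then 0 else 1) = 2 * l + (if even s then 0 else 1) \<longleftrightarrow> l = k \<and> even r = even s"
            by presburger
          then show ?thesis by (auto simp: dg_def)
        qed
        then have "cj (2 * m) B (dg (\<lambda>r. if even r then c else d)) a r s = (\<Sum>k<m. \<Sum>l<m. if l = k then
           cnj (A k (r div 2)) * A k (s div 2) * (if even r = even s then if even r then c a else d a else 0) else 0)"
          unfolding cjB by (intro sum.cong refl) auto
        also have "\<dots> = (\<Sum>k<m. cnj (A k (r div 2)) * A k (s div 2) * (if even r = even s then if even r then c a else d a else 0))"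
          by (intro sum.cong refl) auto
        also have "\<dots> = G (r div 2) (s div 2) * (if even r = even s then if even r then c a else d a else 0)"
          by (simp add: G_def sum_distrib_right)
        finally show ?thesis by (auto split: if_splits)
      qed
      have lin: "cj (2 * m) B (\<lambda>a r s. F a r s + x * P a r s + y * Q a r s) a r s
         = cj (2 * m) B F a r s + x * cj (2 * m) B P a r s + y * cj (2 * m) B Q a r s" for F P Q x y
        by (simp add: cj_def distrib_left sum.distrib sum_distrib_left mult_ac)
      have d: "r = s \<longleftrightarrow> even r = even s \<and> r div 2 = s div 2" by presburger
      have KK: "complex_of_real (\<epsilon> / K) * (complex_of_real K * x) = complex_of_real \<epsilon> * x" for x
        using K(1) by simp
      show "dbl (cj m A X) a r s + complex_of_real \<epsilon> * pd b a r s + complex_of_real (t * K) * qd b a r s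
        = cj (2 * m) B (\<lambda>a r s. dbl X a r s + complex_of_real (\<epsilon> / K) * pd b a r s
           + complex_of_real t * qd b a r s) a r s
        + (complex_of_real (\<epsilon> / K) * (if even r = even s then ?H (r div 2) (s div 2) * (if even r then ev b a else perp b a) else 0)
        + complex_of_real t * (if even r = even s then ?H (r div 2) (s div 2) * (if even r then perp b a else ev b a) else 0))"
        unfolding lin c1 pd_def qd_def diag unfolding dg_def d
        using K(1) by (auto simp: algebra_simps add_divide_distrib diff_divide_distrib)
    qed
    then show "\<exists>t>0. mk (2 * n) (\<lambda>a r s. dbl (cj m A X) a r s + complex_of_real \<epsilon> * pd b a r s
           + complex_of_real t * qd b a r s) \<in> C (2 * n)"
      using t(1) K(1) by (intro exI[of _ "t * K"]) simp
  qed
qed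

text \<open>\<open>x \<otimes> J\<^sub>2\<close> is the conjugate of \<open>x\<close> by the row \<open>(1 1)\<close>, so it is already positive.\<close>
lemma proj_step_superset: "C n \<subseteq> proj_step U (g 0) C (g b) n"
proof
  fix x assume x: "x \<in> C n"
  then obtain X where X: "x = mk n X" using mo_sub[OF C] mk_surj by blast
  show "x \<in> proj_step U (g 0) C (g b) n" unfolding X
  proof (rule proj_stepI[OF b])
    fix \<epsilon> :: real assume eps: "0 < \<epsilon>"
    let ?B = "\<lambda>i r. if i = r div 2 then 1 else (0::complex)"
    have 1: "mk (2 * n) (cj n ?B X) \<in> C (2 * n)" by (rule mo_conj[OF C]) (use x X in simp)
    have 2: "mk (2 * n) (\<lambda>a r s. complex_of_real \<epsilon> * pd b a r s + complex_of_real 1 * qd b a r s) \<in> C (2 * n)"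
      using eps by (intro mo_add[OF C] mo_scale[OF C] mo_pd mo_qd) auto
    have "mk (2 * n) (\<lambda>a r s. dbl X a r s + complex_of_real \<epsilon> * pd b a r s + complex_of_real 1 * qd b a r s) \<in> C (2 * n)"
    proof (rule mo_mono_in[OF C 1 2])
      fix a r s :: nat assume rs: "r < 2 * n" "s < 2 * n"
      have "cj n ?B X a r s = (\<Sum>k<n. delta k (r div 2) * (\<Sum>l<n. delta l (s div 2) * X a k l))"
        unfolding cj_def sum_distrib_left by (intro sum.cong refl) auto
      also have "\<dots> = dbl X a r s" using rs by (simp add: dbl_def sum_delta_mult)
      finally show "dbl X a r s + complex_of_real \<epsilon> * pd b a r s + complex_of_real 1 * qd b a r s
         = cj n ?B X a r s + (complex_of_real \<epsilon> * pd b a r s + complex_of_real 1 * qd b a r s)" by simp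
    qed
    then show "\<exists>t>0. mk (2 * n) (\<lambda>a r s. dbl X a r s + complex_of_real \<epsilon> * pd b a r s
           + complex_of_real t * qd b a r s) \<in> C (2 * n)" by (intro exI[of _ 1]) simp
  qed
qed

end

end

section \<open>The projection ordering\<close>

lemma sum_two_blocks:
  fixes x y z :: complex and r s n :: nat
  assumes "cnj x = x" "cnj y = y" "cnj z = z" "r div 2 < n"
  shows "(\<Sum>k<n. cnj (z * (if r div 2 = k then if even r then x else y else 0))
             * (z * (if s div 2 = k then if even s then x else y else 0)))
      = (if r div 2 = s div 2 then (z * z) * ((if even r then x else y) * (if even s then x else y)) else 0)"
proof -
  have "(\<Sum>k<n. cnj (z * (if r div 2 = k then if even r then x else y else 0))
             * (z * (if s div 2 = k then if even s then x else y else 0)))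
    = (\<Sum>k<n. if k = r div 2 then if r div 2 = s div 2 then (z * z) * ((if even r then x else y) * (if even s then x else y)) else 0 else 0)"
    by (intro sum.cong refl) (auto simp: assms(1-3) mult_ac)
  then show ?thesis using assms(4) by simp
qed

context gen_space
begin

lemma hermitian_rep:
  assumes "x \<in> hermitian U"
  shows "\<exists>c. x = comb c \<and> (\<forall>a. cnj (c a) = c a)"
proof -
  obtain c where c: "x = comb c" using assms comb_surj by (auto simp: hermitian_def)
  define d where "d a = (1/2) * (c a + cnj (c a))" for a
  have "comb c = comb (\<lambda>a. cnj (c a))" using assms c comb_star[of c] by (simp add: hermitian_def)
  then have "comb c \<oplus>\<^bsub>U\<^esub> comb c = comb (\<lambda>a. c a + cnj (c a))" by (simp add: comb_add[symmetric])
  then have "(1/2) \<odot>\<^bsub>U\<^esub> (comb c \<oplus>\<^bsub>U\<^esub> comb c) = comb d" by (simp add: comb_smult d_def[abs_def])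
  then have "x = comb d" by (simp add: comb_add comb_smult c)
  moreover have "cnj (d a) = d a" for a by (simp add: d_def add.commute)
  ultimately show ?thesis by blast
qed

text \<open>The coefficients of \<open>A\<^sup>* diag(S) A\<close>.\<close>
definition dm :: "nat \<Rightarrow> (nat \<Rightarrow> nat \<Rightarrow> complex) \<Rightarrow> (nat \<Rightarrow> nat \<Rightarrow> complex) \<Rightarrow> nat \<Rightarrow> nat \<Rightarrow> nat \<Rightarrow> complex" where
  "dm m A S a i j = (\<Sum>k<m. cnj (A k i) * A k j * S k a)"

lemma cj_dg: "cj m A (dg S) a i j = dm m A S a i j"
  unfolding cj_def dm_def
proof (intro sum.cong refl)
  fix k assume "k \<in> {..<m}"
  have "(\<Sum>l<m. cnj (A k i) * A l j * dg S a k l) = (\<Sum>l<m. if l = k then cnj (A k i) * A k j * S k a else 0)"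
    by (intro sum.cong refl) (simp add: dg_def)
  then show "(\<Sum>l<m. cnj (A k i) * A l j * dg S a k l) = cnj (A k i) * A k j * S k a"
    using \<open>k \<in> {..<m}\<close> by simp
qed

lemma D_maxI:
  assumes "\<And>k. k < m \<Longrightarrow> comb (S k) \<in> E"
  shows "mk n (dm m A S) \<in> D_max U E n"
proof -
  have "mk n (dm m A S) = conj_by U (Matrix.mat m n (\<lambda>(k, i). A k i)) (diag_matrix U m (\<lambda>k. comb (S k)))"
    unfolding mk_diag[of m "\<lambda>k. comb (S k)" S, OF refl] mk_conj by (rule mk_cong) (simp add: cj_dg)
  then show ?thesis unfolding D_max_def using assms mat_carrier by blast
qed

lemma D_maxE:
  assumes "x \<in> D_max U E n" "E \<subseteq> hermitian U"
  obtains m A S where "\<And>k. k < m \<Longrightarrow> comb (S k) \<in> E" "x = mk n (dm m A S)" "\<And>k a. cnj (S k a) = S k a"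
proof -
  from assms(1) obtain m \<alpha> s where x: "x = conj_by U \<alpha> (diag_matrix U m s)" and
    al: "\<alpha> \<in> carrier_mat m n" and s: "\<And>k. k < m \<Longrightarrow> s k \<in> E" unfolding D_max_def by blast
  have "\<forall>k. \<exists>c. k < m \<longrightarrow> s k = comb c \<and> (\<forall>a. cnj (c a) = c a)"
    using hermitian_rep s assms(2) by blast
  from choice[OF this] obtain S0 where S0: "\<And>k. k < m \<Longrightarrow> s k = comb (S0 k) \<and> (\<forall>a. cnj (S0 k a) = S0 k a)" by blast
  define S where "S k = (if k < m then S0 k else (\<lambda>a. 0))" for k
  have S1: "s k = comb (S k)" if "k < m" for k using S0 that by (simp add: S_def)
  have S2: "cnj (S k a) = S k a" for k a using S0 by (simp add: S_def)
  have "x = mk n (dm m (\<lambda>k i. \<alpha> $$ (k, i)) S)"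
  proof -
    have d: "diag_matrix U m s = mk m (dg S)" by (rule mk_diag) (rule S1)
    show ?thesis unfolding x d mk_conj'[OF al] by (rule mk_cong) (simp add: cj_dg)
  qed
  moreover have "comb (S k) \<in> E" if "k < m" for k using s[OF that] S1[OF that] by simp
  ultimately show ?thesis using that S2 by blast
qed

text \<open>Sums are again of the defining form by stacking the scalar matrices and concatenating the diagonals.\<close>
lemma D_max_matrix_ordering:
  assumes E: "E \<subseteq> hermitian U"
  shows "matrix_ordering U (D_max U E)"
proof (rule matrix_orderingI)
  show sub: "D_max U E n \<subseteq> carrier (matrices U n)" for n
  proof
    fix x assume "x \<in> D_max U E n"
    then show "x \<in> carrier (matrices U n)" by (rule D_maxE[OF _ E]) (simp add: mk_closed)
  qed
  show "mk n (\<lambda>a i j. cnj (X a j i)) = mk n X" if D: "mk n X \<in> D_max U E n" for n X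
  proof -
    obtain m A S where "\<And>k. k < m \<Longrightarrow> comb (S k) \<in> E" and X: "mk n X = mk n (dm m A S)"
      and S: "\<And>k a. cnj (S k a) = S k a" by (rule D_maxE[OF D E]) blast
    have "mk n (\<lambda>a i j. cnj (X a j i)) = star (matrices U n) (mk n X)" by (simp add: mk_star)
    also have "\<dots> = mk n (\<lambda>a i j. cnj (dm m A S a j i))" by (simp add: X mk_star)
    also have "\<dots> = mk n X" unfolding X by (rule mk_cong) (simp add: dm_def S mult_ac)
    finally show ?thesis .
  qed
  show "mk n (\<lambda>a i j. 0) \<in> D_max U E n" for n
    using D_maxI[of 0 "\<lambda>_ _. 0" E n "\<lambda>_ _. 0"] by (simp add: dm_def[abs_def])
  show "mk n (\<lambda>a i j. X a i j + Y a i j) \<in> D_max U E n"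
    if XY: "mk n X \<in> D_max U E n" "mk n Y \<in> D_max U E n" for n X Y
  proof -
    obtain m1 A1 S1 where 1: "\<And>k. k < m1 \<Longrightarrow> comb (S1 k) \<in> E" "mk n X = mk n (dm m1 A1 S1)"
      and "\<And>k a. cnj (S1 k a) = S1 k a" by (rule D_maxE[OF XY(1) E]) blast
    obtain m2 A2 S2 where 2: "\<And>k. k < m2 \<Longrightarrow> comb (S2 k) \<in> E" "mk n Y = mk n (dm m2 A2 S2)"
      and "\<And>k a. cnj (S2 k a) = S2 k a" by (rule D_maxE[OF XY(2) E]) blast
    let ?A = "\<lambda>k. if k < m1 then A1 k else A2 (k - m1)"
    let ?S = "\<lambda>k. if k < m1 then S1 k else S2 (k - m1)"
    have "mk n (dm (m1 + m2) ?A ?S) \<in> D_max U E n" by (rule D_maxI) (use 1 2 in auto)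
    also have "mk n (dm (m1 + m2) ?A ?S) = mk n (\<lambda>a i j. dm m1 A1 S1 a i j + dm m2 A2 S2 a i j)"
      by (rule mk_cong) (simp add: dm_def sum_lessThan_add)
    also have "\<dots> = mk n (\<lambda>a i j. X a i j + Y a i j)" by (simp only: mk_add[symmetric] 1(2) 2(2))
    finally show ?thesis .
  qed
  show "mk n (\<lambda>a i j. complex_of_real r * X a i j) \<in> D_max U E n"
    if X: "mk n X \<in> D_max U E n" "0 < r" for n X r
  proof -
    obtain m A S where 1: "\<And>k. k < m \<Longrightarrow> comb (S k) \<in> E" "mk n X = mk n (dm m A S)"
      and "\<And>k a. cnj (S k a) = S k a" by (rule D_maxE[OF X(1) E]) blast
    have "mk n (dm m (\<lambda>k i. complex_of_real (sqrt r) * A k i) S) \<in> D_max U E n" by (rule D_maxI) (rule 1(1))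
    also have "mk n (dm m (\<lambda>k i. complex_of_real (sqrt r) * A k i) S) = mk n (\<lambda>a i j. complex_of_real r * dm m A S a i j)"
    proof (rule mk_cong)
      fix a i j
      have rr: "complex_of_real (sqrt r) * complex_of_real (sqrt r) = complex_of_real r"
        unfolding of_real_mult[symmetric] using X(2) by simp
      show "dm m (\<lambda>k i. complex_of_real (sqrt r) * A k i) S a i j = complex_of_real r * dm m A S a i j"
        unfolding dm_def sum_distrib_left
      proof (intro sum.cong refl)
        fix k
        have "cnj (complex_of_real (sqrt r) * A k i) * (complex_of_real (sqrt r) * A k j) * S k a
          = (complex_of_real (sqrt r) * complex_of_real (sqrt r)) * (cnj (A k i) * A k j * S k a)"
          by (simp add: mult_ac)
        then show "cnj (complex_of_real (sqrt r) * A k i) * (complex_of_real (sqrt r) * A k j) * S k a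
          = complex_of_real r * (cnj (A k i) * A k j * S k a)"
          by (simp only: rr)
      qed
    qed
    also have "\<dots> = mk n (\<lambda>a i j. complex_of_real r * X a i j)" by (simp only: mk_smult[symmetric] 1(2))
    finally show ?thesis .
  qed
  show "mk n (cj m B X) \<in> D_max U E n" if X: "mk m X \<in> D_max U E m" for m n B X
  proof -
    obtain l A S where 1: "\<And>k. k < l \<Longrightarrow> comb (S k) \<in> E" "mk m X = mk m (dm l A S)"
      and "\<And>k a. cnj (S k a) = S k a" by (rule D_maxE[OF X E]) blast
    have "mk n (dm l (\<lambda>k j. \<Sum>p<m. A k p * B p j) S) \<in> D_max U E n" by (rule D_maxI) (rule 1(1))
    also have "mk n (dm l (\<lambda>k j. \<Sum>p<m. A k p * B p j) S) = mk n (cj m B (dm l A S))"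
    proof (rule mk_cong)
      fix a i j
      have "dm l (\<lambda>k j. \<Sum>p<m. A k p * B p j) S a i j
         = (\<Sum>k<l. \<Sum>p<m. \<Sum>q<m. cnj (B p i) * B q j * (cnj (A k p) * A k q * S k a))"
        unfolding dm_def cnj_sum sum_distrib_right sum_distrib_left
        by (rule sum.cong[OF refl], subst sum.swap) (simp add: mult_ac)
      also have "\<dots> = (\<Sum>p<m. \<Sum>k<l. \<Sum>q<m. cnj (B p i) * B q j * (cnj (A k p) * A k q * S k a))"
        by (rule sum.swap)
      also have "\<dots> = (\<Sum>p<m. \<Sum>q<m. \<Sum>k<l. cnj (B p i) * B q j * (cnj (A k p) * A k q * S k a))"
        by (intro sum.cong refl sum.swap)
      also have "\<dots> = cj m B (dm l A S) a i j" by (simp add: cj_def dm_def sum_distrib_left)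
      finally show "dm l (\<lambda>k j. \<Sum>p<m. A k p * B p j) S a i j = cj m B (dm l A S) a i j" .
    qed
    also have "\<dots> = mk n (cj m B X)"
      using mk_conj[of m n B X] mk_conj[of m n B "dm l A S"] 1(2) by simp
    finally show ?thesis .
  qed
qed

lemma D_max_single:
  assumes "comb c \<in> E" shows "mk 1 (\<lambda>a i j. c a) \<in> D_max U E 1"
  using D_maxI[of 1 "\<lambda>_. c" E 1 "\<lambda>_ _. 1"] assms by (simp add: dm_def[abs_def])

text \<open>Coefficients of a typical element of the generating cone.\<close>
definition gcoef :: "real \<Rightarrow> (nat \<Rightarrow> real) \<Rightarrow> (nat \<Rightarrow> real) \<Rightarrow> nat \<Rightarrow> complex" where
  "gcoef r t s a = complex_of_real r * ev 0 a + (\<Sum>i\<in>{1..N}. complex_of_real (t i) * ev i a)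
      + (\<Sum>i\<in>{1..N}. complex_of_real (s i) * perp i a)"

lemma gen_cone_eq:
  "gen_cone U (g 0) N g = {comb (gcoef r t s) | r t s. r \<ge> 0 \<and> (\<forall>i\<in>{1..N}. t i \<ge> 0 \<and> s i \<ge> 0)}"
proof -
  have "complex_of_real r \<odot>\<^bsub>U\<^esub> g 0 \<oplus>\<^bsub>U\<^esub>
        (\<Oplus>\<^bsub>U\<^esub>i\<in>{1..N}. complex_of_real (t i) \<odot>\<^bsub>U\<^esub> g i) \<oplus>\<^bsub>U\<^esub>
        (\<Oplus>\<^bsub>U\<^esub>i\<in>{1..N}. complex_of_real (s i) \<odot>\<^bsub>U\<^esub> compl U (g 0) (g i)) = comb (gcoef r t s)" for r t s
  proof -
    have 1: "(\<Oplus>\<^bsub>U\<^esub>i\<in>{1..N}. complex_of_real (t i) \<odot>\<^bsub>U\<^esub> g i) = comb (\<lambda>a. \<Sum>i\<in>{1..N}. complex_of_real (t i) * ev i a)"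
      by (rule comb_finsum') (simp_all add: comb_smult[symmetric] comb_gen)
    have 2: "(\<Oplus>\<^bsub>U\<^esub>i\<in>{1..N}. complex_of_real (s i) \<odot>\<^bsub>U\<^esub> compl U (g 0) (g i)) = comb (\<lambda>a. \<Sum>i\<in>{1..N}. complex_of_real (s i) * perp i a)"
      by (rule comb_finsum') (simp_all add: comb_smult[symmetric] compl_gen)
    have 3: "complex_of_real r \<odot>\<^bsub>U\<^esub> g 0 = comb (\<lambda>a. complex_of_real r * ev 0 a)"
      using comb_gen[of 0] comb_smult[of "complex_of_real r" "ev 0"] by simp
    show ?thesis unfolding 1 2 3 comb_add by (simp add: gcoef_def[abs_def])
  qed
  then show ?thesis unfolding gen_cone_def by simp
qed

lemma closed_gen_coneI:
  assumes "\<And>\<epsilon>. 0 < \<epsilon> \<Longrightarrow> \<exists>r t s. r \<ge> 0 \<and> (\<forall>i\<in>{1..N}. t i \<ge> 0 \<and> s i \<ge> 0) \<and>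
      comb (\<lambda>a. c a + complex_of_real \<epsilon> * ev 0 a) = comb (gcoef r t s)"
    and "\<And>a. cnj (c a) = c a"
  shows "comb c \<in> closed_gen_cone U (g 0) N g"
proof -
  have "complex_of_real \<epsilon> \<odot>\<^bsub>U\<^esub> g 0 = comb (\<lambda>a. complex_of_real \<epsilon> * ev 0 a)" for \<epsilon>
    using comb_gen[of 0] comb_smult[of "complex_of_real \<epsilon>" "ev 0"] by simp
  then have "comb c \<oplus>\<^bsub>U\<^esub> complex_of_real \<epsilon> \<odot>\<^bsub>U\<^esub> g 0 \<in> gen_cone U (g 0) N g" if "0 < \<epsilon>" for \<epsilon>
    using assms(1)[OF that] unfolding gen_cone_eq by (auto simp: comb_add)
  moreover have "comb c \<in> hermitian U" by (simp add: hermitian_def comb_closed comb_star assms(2))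
  ultimately show ?thesis by (simp add: closed_gen_cone_def)
qed

lemma closed_gen_coneD:
  assumes "comb c \<in> closed_gen_cone U (g 0) N g" "0 < \<epsilon>"
  shows "\<exists>r t s. r \<ge> 0 \<and> (\<forall>i\<in>{1..N}. t i \<ge> 0 \<and> s i \<ge> 0) \<and>
      comb (\<lambda>a. c a + complex_of_real \<epsilon> * ev 0 a) = comb (gcoef r t s)"
proof -
  have 1: "complex_of_real \<epsilon> \<odot>\<^bsub>U\<^esub> g 0 = comb (\<lambda>a. complex_of_real \<epsilon> * ev 0 a)"
    using comb_gen[of 0] comb_smult[of "complex_of_real \<epsilon>" "ev 0"] by simp
  have "comb c \<oplus>\<^bsub>U\<^esub> complex_of_real \<epsilon> \<odot>\<^bsub>U\<^esub> g 0 \<in> gen_cone U (g 0) N g"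
    using assms unfolding closed_gen_cone_def by blast
  then show ?thesis unfolding 1 comb_add gen_cone_eq by blast
qed

lemma closed_gen_cone_hermitian: "closed_gen_cone U (g 0) N g \<subseteq> hermitian U"
  by (auto simp: closed_gen_cone_def)

lemma ev_closed_gen_cone:
  assumes b: "b \<le> N" shows "comb (ev b) \<in> closed_gen_cone U (g 0) N g"
proof (rule closed_gen_coneI)
  fix \<epsilon> :: real assume "0 < \<epsilon>"
  let ?t = "\<lambda>i. if i = b then 1 else 0"
  have "gcoef (\<epsilon> + (if b = 0 then 1 else 0)) ?t (\<lambda>_. 0) a = ev b a + complex_of_real \<epsilon> * ev 0 a" for a
  proof -
    have "(\<Sum>i\<in>{1..N}. complex_of_real (?t i) * ev i a) = (\<Sum>i\<in>{1..N}. if i = b then ev b a else 0)"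
      by (intro sum.cong refl) auto
    then show ?thesis using b by (cases "b = 0") (auto simp: gcoef_def algebra_simps)
  qed
  then have "comb (\<lambda>a. ev b a + complex_of_real \<epsilon> * ev 0 a) = comb (gcoef (\<epsilon> + (if b = 0 then 1 else 0)) ?t (\<lambda>_. 0))"
    by (intro comb_cong) simp
  then show "\<exists>r t s. r \<ge> 0 \<and> (\<forall>i\<in>{1..N}. t i \<ge> 0 \<and> s i \<ge> 0) \<and>
      comb (\<lambda>a. ev b a + complex_of_real \<epsilon> * ev 0 a) = comb (gcoef r t s)"
    using \<open>0 < \<epsilon>\<close> by (intro exI[of _ "\<epsilon> + (if b = 0 then 1 else 0)"] exI[of _ ?t] exI[of _ "\<lambda>_. 0"]) auto
qed (simp add: ev_real)

lemma perp_closed_gen_cone: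
  assumes b: "b \<le> N" shows "comb (perp b) \<in> closed_gen_cone U (g 0) N g"
proof (rule closed_gen_coneI)
  fix \<epsilon> :: real assume "0 < \<epsilon>"
  let ?t = "\<lambda>i. if i = b then 1 else 0"
  have "gcoef \<epsilon> (\<lambda>_. 0) ?t a = perp b a + complex_of_real \<epsilon> * ev 0 a" for a
  proof -
    have "(\<Sum>i\<in>{1..N}. complex_of_real (?t i) * perp i a) = (\<Sum>i\<in>{1..N}. if i = b then perp b a else 0)"
      by (intro sum.cong refl) auto
    moreover have "b = 0 \<Longrightarrow> perp b a = 0" by (simp add: perp_def)
    ultimately show ?thesis using b by (cases "b = 0") (auto simp: gcoef_def algebra_simps)
  qed
  then have "comb (\<lambda>a. perp b a + complex_of_real \<epsilon> * ev 0 a) = comb (gcoef \<epsilon> (\<lambda>_. 0) ?t)"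
    by (intro comb_cong) simp
  then show "\<exists>r t s. r \<ge> 0 \<and> (\<forall>i\<in>{1..N}. t i \<ge> 0 \<and> s i \<ge> 0) \<and>
      comb (\<lambda>a. perp b a + complex_of_real \<epsilon> * ev 0 a) = comb (gcoef r t s)"
    using \<open>0 < \<epsilon>\<close> by (intro exI[of _ \<epsilon>] exI[of _ "\<lambda>_. 0"] exI[of _ ?t]) auto
qed (simp add: perp_real)

abbreviation cone0 :: "nat \<Rightarrow> 'a mat set" where
  "cone0 \<equiv> D_max U (closed_gen_cone U (g 0) N g)"

lemma cone0_mo: "matrix_ordering U cone0"
  by (rule D_max_matrix_ordering[OF closed_gen_cone_hermitian])

lemma E_max_eq: "E_max U (g 0) (closed_gen_cone U (g 0) N g) = arch cone0"
proof
  fix n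
  have "matrix_ordering U (arch cone0)"
    by (intro arch_matrix_ordering cone0_mo D_max_single ev_closed_gen_cone) simp
  then have "arch cone0 n \<subseteq> hermitian (matrices U n)"
    by (auto simp: matrix_ordering_def is_cone_def)
  then show "E_max U (g 0) (closed_gen_cone U (g 0) N g) n = arch cone0 n"
    unfolding E_max_def arch_def hermitian_def by blast
qed

text \<open>The properties shared by all orderings in the construction; in particular they make \<open>g 0\<close> an order unit.\<close>
definition good :: "(nat \<Rightarrow> 'a mat set) \<Rightarrow> bool" where
  "good C \<longleftrightarrow> matrix_ordering U C \<and>
     (\<forall>b\<le>N. mk 1 (\<lambda>a i j. ev b a) \<in> C 1 \<and> mk 1 (\<lambda>a i j. perp b a) \<in> C 1)"

lemma goodD:
  assumes "good C"
  shows "matrix_ordering U C" "b \<le> N \<Longrightarrow> mk 1 (\<lambda>a i j. ev b a) \<in> C 1"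
    "b \<le> N \<Longrightarrow> mk 1 (\<lambda>a i j. perp b a) \<in> C 1" "mk 1 (\<lambda>a i j. ev 0 a) \<in> C 1"
  using assms by (auto simp: good_def)

lemma good_cone0: "good cone0"
  unfolding good_def using cone0_mo D_max_single ev_closed_gen_cone perp_closed_gen_cone by blast

lemma good_arch: "good C \<Longrightarrow> good (arch C)"
  unfolding good_def using arch_matrix_ordering arch_superset by (meson le0 subsetD)

lemma good_proj_step: "good C \<Longrightarrow> b \<le> N \<Longrightarrow> good (proj_step U (g 0) C (g b))"
  unfolding good_def using proj_step_matrix_ordering proj_step_superset by (meson subsetD)

lemma mod_range: "N \<ge> 1 \<Longrightarrow> n mod N + 1 \<le> N"
  by (simp add: Suc_leI)

abbreviation chain :: "nat \<Rightarrow> nat \<Rightarrow> 'a mat set" where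
  "chain m \<equiv> proj_iterate U (g 0) N g m"

lemma good_chain: "N \<ge> 1 \<Longrightarrow> good (chain m)"
proof (induction m)
  case 0
  then show ?case using good_arch[OF good_cone0] by (simp add: E_max_eq)
next
  case (Suc m)
  then show ?case using good_proj_step[OF Suc.IH mod_range] by simp
qed

lemma chain_mono: "N \<ge> 1 \<Longrightarrow> m \<le> m' \<Longrightarrow> chain m n \<subseteq> chain m' n"
proof (induction m' rule: nat_induct)
  case (Suc m')
  have "chain m' n \<subseteq> chain (Suc m') n"
    using proj_step_superset goodD[OF good_chain[OF Suc.prems(1)]] mod_range[OF Suc.prems(1)] by simp
  then show ?case using Suc by (cases "m = Suc m'") auto
qed simp

definition chain_union :: "nat \<Rightarrow> 'a mat set" where
  "chain_union n = (\<Union>m. chain m n)"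

text \<open>The chain is increasing, so finitely many members of the union lie in a common step.\<close>
lemma good_chain_union:
  assumes N: "N \<ge> 1" shows "good chain_union"
proof -
  note mo = goodD(1)[OF good_chain[OF N]]
  have "matrix_ordering U chain_union"
  proof (rule matrix_orderingI)
    show "chain_union n \<subseteq> carrier (matrices U n)" for n
      unfolding chain_union_def using mo_sub[OF mo] by blast
    show "mk n (\<lambda>a i j. cnj (X a j i)) = mk n X" if "mk n X \<in> chain_union n" for n X
      using that unfolding chain_union_def by (auto dest: mo_herm[OF mo])
    show "mk n (\<lambda>a i j. 0) \<in> chain_union n" for n
      unfolding chain_union_def using mo_zero[OF mo] by blast
    show "mk n (\<lambda>a i j. complex_of_real r * X a i j) \<in> chain_union n" if "mk n X \<in> chain_union n" "0 < r" for n X r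
      using that unfolding chain_union_def by (auto dest: mo_scale[OF mo, where r = r])
    show "mk n (cj m A X) \<in> chain_union n" if "mk m X \<in> chain_union m" for m n A X
      using that unfolding chain_union_def by (auto dest: mo_conj[OF mo, where n = n and A = A])
    show "mk n (\<lambda>a i j. X a i j + Y a i j) \<in> chain_union n"
      if XY: "mk n X \<in> chain_union n" "mk n Y \<in> chain_union n" for n X Y
    proof -
      obtain k l where "mk n X \<in> chain k n" "mk n Y \<in> chain l n" using XY unfolding chain_union_def by blast
      then have "mk n X \<in> chain (max k l) n" "mk n Y \<in> chain (max k l) n"
        using chain_mono[OF N] by (meson max.cobounded1 max.cobounded2 subsetD)+
      from mo_add[OF mo this] show ?thesis unfolding chain_union_def by blast
    qed
  qed
  then show ?thesis using goodD(2,3)[OF good_chain[OF N]] unfolding good_def chain_union_def by blast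
qed

abbreviation limit_cone :: "nat \<Rightarrow> 'a mat set" where
  "limit_cone \<equiv> proj_limit U (g 0) N g"

text \<open>The inductive limit of the chain is the Archimedean closure of its union.\<close>
lemma limit_eq: "limit_cone = arch chain_union"
  unfolding proj_limit_def arch_def chain_union_def by (simp add: fun_eq_iff)

lemma good_limit: "N \<ge> 1 \<Longrightarrow> good limit_cone"
  unfolding limit_eq by (intro good_arch good_chain_union)

lemma limit_archimedean:
  assumes "\<And>\<epsilon>. 0 < \<epsilon> \<Longrightarrow> mk n (\<lambda>a i j. X a i j + complex_of_real \<epsilon> * dg (\<lambda>_. ev 0) a i j) \<in> limit_cone n"
  shows "mk n X \<in> limit_cone n"
  unfolding limit_eq arch_mk
proof (intro allI impI)
  fix \<epsilon> :: real assume "0 < \<epsilon>"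
  then have h: "0 < \<epsilon> / 2" by simp
  from archD[OF assms[OF h, unfolded limit_eq] h]
  show "mk n (\<lambda>a i j. X a i j + complex_of_real \<epsilon> * dg (\<lambda>_. ev 0) a i j) \<in> chain_union n"
    by (rule back_subst[of "\<lambda>x. x \<in> chain_union n"], intro mk_cong) (simp add: field_simps)
qed

text \<open>The point of cycling through the generators. Let \<open>x\<close> be in the step of \<open>E\<^sup>p\<^sup>r\<^sup>o\<^sup>j\<close> along \<open>p\<close>. For given
  \<open>\<epsilon>\<close> the defining condition with \<open>\<epsilon>/4\<close> holds in some \<open>E\<^sup>m\<close> up to an error
  \<open>(\<epsilon>/4) I \<otimes> e\<close>, and \<open>m\<close> may be increased until the next step of the chain is along \<open>p\<close>.
  The error is absorbed when \<open>x\<close> is replaced by \<open>x + \<epsilon> I \<otimes> e\<close>: the block of coefficients of \<open>p\<close> in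
  the additional term \<open>\<epsilon> I \<otimes> e \<otimes> J\<^sub>2\<close> is bounded below by a positive matrix after enlarging its
  lower corner, which is the coefficient of \<open>p\<close> in \<open>p\<^sup>\<bottom> \<oplus> p\<close> and may be as large as one likes;
  the same holds for \<open>p\<^sup>\<bottom>\<close> with the upper corner. Therefore \<open>x + \<epsilon> I \<otimes> e\<close> belongs to \<open>E\<^bsup>m+1\<^esup>\<close>.\<close>
lemma limit_proj_step:
  assumes N: "N \<ge> 1" and b: "b \<in> {1..N}"
  shows "proj_step U (g 0) limit_cone (g b) n \<subseteq> limit_cone n"
proof
  fix x assume x: "x \<in> proj_step U (g 0) limit_cone (g b) n"
  then have "x \<in> carrier (matrices U n)" by (simp add: proj_step_def)
  then obtain X where X: "x = mk n X" using mk_surj by blast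
  have bN: "b \<le> N" using b by simp
  show "x \<in> limit_cone n" unfolding X limit_eq arch_mk
  proof (intro allI impI)
    fix \<epsilon> :: real assume eps: "0 < \<epsilon>"
    then have h: "0 < \<epsilon> / 4" by simp
    obtain t where t: "0 < t" "mk (2 * n) (\<lambda>a r s. dbl X a r s + complex_of_real (\<epsilon> / 4) * pd b a r s
           + complex_of_real t * qd b a r s) \<in> limit_cone (2 * n)"
      by (rule proj_stepE[OF x[unfolded X] bN h])
    from archD[OF t(2)[unfolded limit_eq] h] obtain m where
      m: "mk (2 * n) (\<lambda>a r s. dbl X a r s + complex_of_real (\<epsilon> / 4) * pd b a r s
           + complex_of_real t * qd b a r s + complex_of_real (\<epsilon> / 4) * dg (\<lambda>_. ev 0) a r s) \<in> chain m (2 * n)"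
      unfolding chain_union_def by blast
    \<comment> \<open>a later index after which the chain uses the generator \<open>b\<close>\<close>
    define m' where "m' = m * N + (b - 1)"
    have "b - 1 < N" using b by auto
    then have "m' mod N = b - 1" unfolding m'_def by (simp only: mod_mult_self3 mod_less)
    then have m'b: "m' mod N + 1 = b" using b by simp
    have "m \<le> m'" using N by (simp add: m'_def trans_le_add1)
    note G = goodD[OF good_chain[OF N, of m']]
    note C = G(1)
    have 1: "mk (2 * n) (\<lambda>a r s. dbl X a r s + complex_of_real (\<epsilon> / 4) * pd b a r s
           + complex_of_real t * qd b a r s + complex_of_real (\<epsilon> / 4) * dg (\<lambda>_. ev 0) a r s) \<in> chain m' (2 * n)"
      using m chain_mono[OF N \<open>m \<le> m'\<close>] by blast
    have "mk n (\<lambda>a i j. X a i j + complex_of_real \<epsilon> * dg (\<lambda>_. ev 0) a i j) \<in> proj_step U (g 0) (chain m') (g b) n"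
    proof (rule proj_stepI[OF bN])
      fix d :: real assume d: "0 < d"
      \<comment> \<open>The coefficient of \<open>p\<close> is increased by \<open>\<epsilon>/2\<close> times the Gram matrix of \<open>(1, 2)\<close> in each block, and that of
        the complement by \<open>\<epsilon>/2\<close> times the Gram matrix of \<open>(2, 1)\<close>. Both have the off-diagonal entry \<open>\<epsilon>\<close>; the entries \<open>4\<close> are
        compensated by the larger \<open>t\<close>.\<close>
      define w1 where "w1 k r = complex_of_real (sqrt (\<epsilon> / 2)) * (if r div 2 = k then if even r then 1 else 2 else 0)" for k r :: nat
      define w2 where "w2 k r = complex_of_real (sqrt (\<epsilon> / 2)) * (if r div 2 = k then if even r then 2 else 1 else 0)" for k r :: nat
      have 2: "mk (2 * n) (\<lambda>a r s. (\<Sum>k<n. cnj (w1 k r) * w1 k s) * ev b a + (\<Sum>k<n. cnj (w2 k r) * w2 k s) * perp b a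
          + complex_of_real d * pd b a r s) \<in> chain m' (2 * n)"
        by (intro mo_add[OF C] mo_psd[OF C] mo_scale[OF C] mo_pd[OF C] G bN psd_gram less_imp_le[OF d] finite_lessThan)
      have "mk (2 * n) (\<lambda>a r s. dbl (\<lambda>a i j. X a i j + complex_of_real \<epsilon> * dg (\<lambda>_. ev 0) a i j) a r s
           + complex_of_real d * pd b a r s + complex_of_real (t + \<epsilon> / 4 + \<epsilon>) * qd b a r s) \<in> chain m' (2 * n)"
      proof (rule mo_mono_in[OF C 1 2])
        fix a r s :: nat assume rs: "r < 2 * n" "s < 2 * n"
        have sq: "complex_of_real (sqrt (\<epsilon> / 2)) * complex_of_real (sqrt (\<epsilon> / 2)) = complex_of_real (\<epsilon> / 2)"
          unfolding of_real_mult[symmetric] using eps by (simp add: real_sqrt_mult_self)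
        have r2: "r div 2 < n" using rs by auto
        have eq: "r = s \<longleftrightarrow> even r = even s \<and> r div 2 = s div 2" by presburger
        have S1: "(\<Sum>k<n. cnj (w1 k r) * w1 k s) = (if r div 2 = s div 2 then complex_of_real (\<epsilon> / 2) * ((if even r then 1 else 2) * (if even s then 1 else 2)) else 0)"
          unfolding w1_def sq[symmetric] by (rule sum_two_blocks) (use r2 in simp_all)
        have S2: "(\<Sum>k<n. cnj (w2 k r) * w2 k s) = (if r div 2 = s div 2 then complex_of_real (\<epsilon> / 2) * ((if even r then 2 else 1) * (if even s then 2 else 1)) else 0)"
          unfolding w2_def sq[symmetric] by (rule sum_two_blocks) (use r2 in simp_all)
        have ev0: "ev 0 a = ev b a + perp b a" by (simp add: perp_def)
        show "dbl (\<lambda>a i j. X a i j + complex_of_real \<epsilon> * dg (\<lambda>_. ev 0) a i j) a r s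
           + complex_of_real d * pd b a r s + complex_of_real (t + \<epsilon> / 4 + \<epsilon>) * qd b a r s
          = dbl X a r s + complex_of_real (\<epsilon> / 4) * pd b a r s
           + complex_of_real t * qd b a r s + complex_of_real (\<epsilon> / 4) * dg (\<lambda>_. ev 0) a r s
           + ((\<Sum>k<n. cnj (w1 k r) * w1 k s) * ev b a + (\<Sum>k<n. cnj (w2 k r) * w2 k s) * perp b a
          + complex_of_real d * pd b a r s)"
          unfolding S1 S2 dbl_def pd_def qd_def dg_def eq ev0
          by (auto simp: field_simps)
      qed
      then show "\<exists>t>0. mk (2 * n) (\<lambda>a r s. dbl (\<lambda>a i j. X a i j + complex_of_real \<epsilon> * dg (\<lambda>_. ev 0) a i j) a r s
           + complex_of_real d * pd b a r s + complex_of_real t * qd b a r s) \<in> chain m' (2 * n)"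
        using t(1) eps by (intro exI[of _ "t + \<epsilon> / 4 + \<epsilon>"]) simp
    qed
    then have "mk n (\<lambda>a i j. X a i j + complex_of_real \<epsilon> * dg (\<lambda>_. ev 0) a i j) \<in> chain (Suc m') n"
      using m'b by simp
    then show "mk n (\<lambda>a i j. X a i j + complex_of_real \<epsilon> * dg (\<lambda>_. ev 0) a i j) \<in> chain_union n"
      unfolding chain_union_def by blast
  qed
qed

end

section \<open>Projections in a C*-cover\<close>

context
  fixes A :: "('b, 'k) normed_star_space_scheme"
  assumes A: "cstar_algebra A"
begin

lemma cstar_ring: "ring A" and cstar_svs: "star_vector_space A"
  using A by (simp_all add: cstar_algebra_def)

lemma cstar_smult_left: "x \<in> carrier A \<Longrightarrow> y \<in> carrier A \<Longrightarrow> (c \<odot>\<^bsub>A\<^esub> x) \<otimes>\<^bsub>A\<^esub> y = c \<odot>\<^bsub>A\<^esub> (x \<otimes>\<^bsub>A\<^esub> y)"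
  and cstar_smult_right: "x \<in> carrier A \<Longrightarrow> y \<in> carrier A \<Longrightarrow> x \<otimes>\<^bsub>A\<^esub> (c \<odot>\<^bsub>A\<^esub> y) = c \<odot>\<^bsub>A\<^esub> (x \<otimes>\<^bsub>A\<^esub> y)"
  and cstar_star_mult: "x \<in> carrier A \<Longrightarrow> y \<in> carrier A \<Longrightarrow> star A (x \<otimes>\<^bsub>A\<^esub> y) = star A y \<otimes>\<^bsub>A\<^esub> star A x"
  using A unfolding cstar_algebra_def by blast+

lemma positives_matrices:
  assumes "x \<in> positives (matrices A n)"
  obtains y where "\<And>k j. k < n \<Longrightarrow> j < n \<Longrightarrow> y k j \<in> carrier A"
    "\<And>i j. i < n \<Longrightarrow> j < n \<Longrightarrow> x $$ (i, j) = (\<Oplus>\<^bsub>A\<^esub>k\<in>{..<n}. star A (y k i) \<otimes>\<^bsub>A\<^esub> y k j)"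
proof -
  from assms obtain Y where Y: "Y \<in> carrier (matrices A n)" "x = star (matrices A n) Y \<otimes>\<^bsub>matrices A n\<^esub> Y"
    unfolding positives_def by blast
  have c: "Y $$ (k, j) \<in> carrier A" if "k < n" "j < n" for k j
    using Y(1) that by (auto simp: matrices_def)
  interpret ring A by (rule cstar_ring)
  have "x $$ (i, j) = (\<Oplus>\<^bsub>A\<^esub>k\<in>{..<n}. star A (Y $$ (k, i)) \<otimes>\<^bsub>A\<^esub> Y $$ (k, j))" if "i < n" "j < n" for i j
  proof -
    have "x $$ (i, j) = (\<Oplus>\<^bsub>A\<^esub>k\<in>{..<n}. Matrix.mat n n (\<lambda>(i, j). star A (Y $$ (j, i))) $$ (i, k) \<otimes>\<^bsub>A\<^esub> Y $$ (k, j))"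
      unfolding Y(2) using that by (simp add: matrices_def)
    also have "\<dots> = (\<Oplus>\<^bsub>A\<^esub>k\<in>{..<n}. star A (Y $$ (k, i)) \<otimes>\<^bsub>A\<^esub> Y $$ (k, j))"
      using that c svs_star_closed[OF cstar_svs] by (intro finsum_cong') auto
    finally show ?thesis .
  qed
  with c show ?thesis by (rule that[of "\<lambda>k j. Y $$ (k, j)"])
qed

lemma positives_matricesI:
  assumes y: "\<And>k j. k < n \<Longrightarrow> j < n \<Longrightarrow> y k j \<in> carrier A"
    and x: "x \<in> carrier_mat n n" "\<And>i j. i < n \<Longrightarrow> j < n \<Longrightarrow> x $$ (i, j) = (\<Oplus>\<^bsub>A\<^esub>k\<in>{..<n}. star A (y k i) \<otimes>\<^bsub>A\<^esub> y k j)"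
  shows "x \<in> positives (matrices A n)"
proof -
  interpret ring A by (rule cstar_ring)
  let ?Y = "Matrix.mat n n (\<lambda>(k, j). y k j)"
  have "x = star (matrices A n) ?Y \<otimes>\<^bsub>matrices A n\<^esub> ?Y"
  proof (rule eq_matI)
    fix i j assume "i < dim_row (star (matrices A n) ?Y \<otimes>\<^bsub>matrices A n\<^esub> ?Y)"
      "j < dim_col (star (matrices A n) ?Y \<otimes>\<^bsub>matrices A n\<^esub> ?Y)"
    then have ij: "i < n" "j < n" by (auto simp: matrices_def)
    have "(star (matrices A n) ?Y \<otimes>\<^bsub>matrices A n\<^esub> ?Y) $$ (i, j) = (\<Oplus>\<^bsub>A\<^esub>k\<in>{..<n}. Matrix.mat n n (\<lambda>(i, j). star A (?Y $$ (j, i))) $$ (i, k) \<otimes>\<^bsub>A\<^esub> ?Y $$ (k, j))"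
      using ij by (simp add: matrices_def)
    also have "\<dots> = (\<Oplus>\<^bsub>A\<^esub>k\<in>{..<n}. star A (y k i) \<otimes>\<^bsub>A\<^esub> y k j)"
      using ij y svs_star_closed[OF cstar_svs] by (intro finsum_cong') auto
    finally show "x $$ (i, j) = (star (matrices A n) ?Y \<otimes>\<^bsub>matrices A n\<^esub> ?Y) $$ (i, j)" using x(2)[OF ij] by simp
  qed (use x(1) in \<open>auto simp: matrices_def\<close>)
  moreover have "?Y \<in> carrier (matrices A n)" using y by (auto simp: matrices_def)
  ultimately show ?thesis unfolding positives_def by blast
qed

end

context gen_space
begin

lemma operator_system_good_arch:
  assumes os: "operator_system U C (g 0)" and e: "mk 1 (\<lambda>a i j. ev 0 a) \<in> C 1"
  shows "arch C n \<subseteq> C n"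
proof
  fix x assume x: "x \<in> arch C n"
  have C: "matrix_ordering U C" using os by (simp add: operator_system_def proper_matrix_ordering_def)
  have "x \<in> hermitian (matrices U n)"
    using arch_matrix_ordering[OF C e] x by (auto simp: matrix_ordering_def is_cone_def)
  then show "x \<in> C n"
    using os x unfolding operator_system_def archimedean_order_unit_def arch_def by blast
qed

text \<open>Let \<open>P\<close> be the projection and \<open>P'\<close> its complement. If the matrix with blocks
  \<open>x + \<epsilon> P + t P'\<close>, \<open>x\<close>, \<open>x\<close>, \<open>x + \<epsilon> P' + t P\<close> equals \<open>y\<^sup>* y\<close>, then compressing it by
  the column \<open>(P, P')\<close> gives \<open>(P + P') x (P + P') + \<epsilon> (P + P') = x + \<epsilon>\<close>: the
  terms with \<open>t\<close> disappear because \<open>P P' = 0\<close>. So \<open>x + \<epsilon>\<close> is positive for every \<open>\<epsilon>\<close>.\<close>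
lemma projection_in_cover:
  assumes os: "operator_system U C (g 0)"
    and A: "cstar_algebra A" and emb: "unital_complete_order_embedding U C (g 0) A \<iota>"
    and b: "b \<le> N" and bproj: "is_projection A (\<iota> (g b))"
  shows "mk 1 (\<lambda>a i j. ev 0 a) \<in> C 1" "mk 1 (\<lambda>a i j. ev b a) \<in> C 1"
    "mk 1 (\<lambda>a i j. perp b a) \<in> C 1" "proj_step U (g 0) C (g b) n \<subseteq> C n"
proof -
  interpret A: ring A by (rule cstar_ring[OF A])
  note sv = cstar_svs[OF A]
  have lin: "linear_map class_ring U A \<iota>" and unit: "\<iota> (g 0) = \<one>\<^bsub>A\<^esub>" and
    pos: "\<And>n x. x \<in> carrier (matrices U n) \<Longrightarrow> x \<in> C n \<longleftrightarrow> map_mat \<iota> x \<in> positives (matrices A n)"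
    using emb by (auto simp: unital_complete_order_embedding_def)
  interpret L: linear_map class_ring U A \<iota> by (rule lin)
  define J where "J c = \<iota> (comb c)" for c
  have Jc: "J c \<in> carrier A" for c unfolding J_def using comb_closed L.T_im by blast
  have Jadd: "J (\<lambda>a. c a + d a) = J c \<oplus>\<^bsub>A\<^esub> J d" for c d
    unfolding J_def comb_add[symmetric] using comb_closed by (intro L.T_add)
  have Jscale: "J (\<lambda>a. z * c a) = z \<odot>\<^bsub>A\<^esub> J c" for c z
    unfolding J_def comb_smult[symmetric] using L.T_smult[OF _ comb_closed, of z c] by simp
  define P where "P = J (ev b)"
  define P' where "P' = J (perp b)"
  have e1: "J (ev 0) = \<one>\<^bsub>A\<^esub>" by (simp add: J_def comb_gen unit)
  have Pc: "P \<in> carrier A" and P'c: "P' \<in> carrier A" by (simp_all add: P_def P'_def Jc)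
  have PP: "P \<otimes>\<^bsub>A\<^esub> P = P" and Ps: "star A P = P"
    using bproj b by (simp_all add: P_def J_def comb_gen is_projection_def)
  have sum1: "P \<oplus>\<^bsub>A\<^esub> P' = \<one>\<^bsub>A\<^esub>"
    unfolding P_def P'_def Jadd[symmetric] e1[symmetric] by (simp add: perp_def)
  have Js0: "J (\<lambda>a. 0) = \<zero>\<^bsub>A\<^esub>" using Jscale[of 0 "\<lambda>a. 0"] svs_smult_zero[OF sv Jc] by simp
  have P'eq: "P' = \<one>\<^bsub>A\<^esub> \<ominus>\<^bsub>A\<^esub> P" using sum1 Pc P'c by (metis A.add.m_comm A.add.inv_solve_right A.minus_eq A.one_closed)
  have star1: "star A \<one>\<^bsub>A\<^esub> = \<one>\<^bsub>A\<^esub>"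
  proof -
    have "star A \<one>\<^bsub>A\<^esub> = star A (star A \<one>\<^bsub>A\<^esub> \<otimes>\<^bsub>A\<^esub> \<one>\<^bsub>A\<^esub>)"
      using cstar_star_mult[OF A, of "star A \<one>\<^bsub>A\<^esub>" "\<one>\<^bsub>A\<^esub>"] svs_star_closed[OF sv] svs_star_star[OF sv] by simp
    then show ?thesis using svs_star_closed[OF sv] svs_star_star[OF sv] by (metis A.one_closed A.r_one)
  qed
  have P's: "star A P' = P'"
  proof -
    have "star A P \<oplus>\<^bsub>A\<^esub> star A P' = \<one>\<^bsub>A\<^esub>" using svs_star_add[OF sv Pc P'c] sum1 star1 by simp
    then have "P \<oplus>\<^bsub>A\<^esub> star A P' = P \<oplus>\<^bsub>A\<^esub> P'" using Ps sum1 by simp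
    then show ?thesis using Pc P'c svs_star_closed[OF sv P'c] by simp
  qed
  have PP': "P \<otimes>\<^bsub>A\<^esub> P' = \<zero>\<^bsub>A\<^esub>"
  proof -
    have "P \<otimes>\<^bsub>A\<^esub> (P \<oplus>\<^bsub>A\<^esub> P') = P" using sum1 Pc by simp
    then have "P \<oplus>\<^bsub>A\<^esub> P \<otimes>\<^bsub>A\<^esub> P' = P" using Pc P'c PP by (simp add: A.r_distr)
    then show ?thesis using A.add.l_cancel_one[OF Pc A.m_closed[OF Pc P'c]] by simp
  qed
  have P'P: "P' \<otimes>\<^bsub>A\<^esub> P = \<zero>\<^bsub>A\<^esub>"
    using cstar_star_mult[OF A Pc P'c] PP' Ps P's svs_star_zero[OF sv] by simp
  have P'P': "P' \<otimes>\<^bsub>A\<^esub> P' = P'"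
  proof -
    have "(P \<oplus>\<^bsub>A\<^esub> P') \<otimes>\<^bsub>A\<^esub> P' = P'" using sum1 P'c by simp
    then show ?thesis using Pc P'c PP' by (simp add: A.l_distr)
  qed
  have one_pos: "mk 1 (\<lambda>a i j. c a) \<in> C 1" if "star A (J c) = J c" "J c \<otimes>\<^bsub>A\<^esub> J c = J c" for c
  proof -
    have "map_mat \<iota> (mk 1 (\<lambda>a i j. c a)) \<in> positives (matrices A 1)"
    proof (rule positives_matricesI[OF A, of 1 "\<lambda>_ _. J c"])
      fix i j :: nat assume ij: "i < 1" "j < 1"
      have s: "{..<1::nat} = {0}" by auto
      show "map_mat \<iota> (mk 1 (\<lambda>a i j. c a)) $$ (i, j) = (\<Oplus>\<^bsub>A\<^esub>k\<in>{..<1::nat}. star A (J c) \<otimes>\<^bsub>A\<^esub> J c)"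
        unfolding s using ij that Jc[of c] by (simp add: mk_def J_def)
    qed (auto simp: Jc mk_def)
    then show ?thesis using pos[OF mk_closed] by blast
  qed
  show e: "mk 1 (\<lambda>a i j. ev 0 a) \<in> C 1" by (rule one_pos) (simp_all add: e1 star1)
  show "mk 1 (\<lambda>a i j. ev b a) \<in> C 1" by (rule one_pos) (simp_all add: P_def[symmetric] Ps PP)
  show "mk 1 (\<lambda>a i j. perp b a) \<in> C 1" by (rule one_pos) (simp_all add: P'_def[symmetric] P's P'P')
  have C: "matrix_ordering U C" using os by (simp add: operator_system_def proper_matrix_ordering_def)
  show "proj_step U (g 0) C (g b) n \<subseteq> C n"
  proof
    fix x assume x: "x \<in> proj_step U (g 0) C (g b) n"
    then have "x \<in> carrier (matrices U n)" by (simp add: proj_step_def)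
    then obtain X where X: "x = mk n X" using mk_surj by blast
    have "mk n X \<in> arch C n" unfolding arch_mk
    proof (intro allI impI)
      fix \<epsilon> :: real assume eps: "0 < \<epsilon>"
      obtain t where t: "0 < t" "mk (2 * n) (\<lambda>a r s. dbl X a r s + complex_of_real \<epsilon> * pd b a r s
           + complex_of_real t * qd b a r s) \<in> C (2 * n)"
        by (rule proj_stepE[OF x[unfolded X] b eps])
      define ce where "ce = complex_of_real \<epsilon>"
      define ct where "ct = complex_of_real t"
      let ?Z = "\<lambda>a r s. dbl X a r s + ce * pd b a r s + ct * qd b a r s"
      define W where "W r s = J (\<lambda>a. ?Z a r s)" for r s
      have "map_mat \<iota> (mk (2 * n) ?Z) \<in> positives (matrices A (2 * n))"
        using t(2) pos[OF mk_closed] unfolding ce_def ct_def by blast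
      then obtain y where yc: "\<And>k j. k < 2 * n \<Longrightarrow> j < 2 * n \<Longrightarrow> y k j \<in> carrier A" and
        y0: "\<And>i j. i < 2 * n \<Longrightarrow> j < 2 * n \<Longrightarrow> map_mat \<iota> (mk (2 * n) ?Z) $$ (i, j) = (\<Oplus>\<^bsub>A\<^esub>k\<in>{..<2 * n}. star A (y k i) \<otimes>\<^bsub>A\<^esub> y k j)"
        by (rule positives_matrices[OF A]) blast
      have y: "W i j = (\<Oplus>\<^bsub>A\<^esub>k\<in>{..<2 * n}. star A (y k i) \<otimes>\<^bsub>A\<^esub> y k j)" if "i < 2 * n" "j < 2 * n" for i j
        using y0[OF that] that by (simp add: W_def J_def mk_def)
      have Wc: "W i j \<in> carrier A" for i j by (simp add: W_def Jc)
      note ysc = svs_star_closed[OF sv yc]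
      \<comment> \<open>the rows of \<open>y\<close> compressed by the column \<open>(P, P')\<close>\<close>
      define B where "B k j = y k (2 * j) \<otimes>\<^bsub>A\<^esub> P \<oplus>\<^bsub>A\<^esub> y k (2 * j + 1) \<otimes>\<^bsub>A\<^esub> P'" for k j
      have lt: "2 * i < 2 * n" "2 * i + 1 < 2 * n" if "i < n" for i using that by auto
      have Bc: "B k j \<in> carrier A" if "k < 2 * n" "j < n" for k j
        unfolding B_def using yc[OF that(1) lt(1)[OF that(2)]] yc[OF that(1) lt(2)[OF that(2)]] Pc P'c by simp
      have sandwich: "(\<Oplus>\<^bsub>A\<^esub>k\<in>{..<2 * n}. u \<otimes>\<^bsub>A\<^esub> (star A (y k r) \<otimes>\<^bsub>A\<^esub> y k s) \<otimes>\<^bsub>A\<^esub> v) = u \<otimes>\<^bsub>A\<^esub> W r s \<otimes>\<^bsub>A\<^esub> v"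
        if "u \<in> carrier A" "v \<in> carrier A" "r < 2 * n" "s < 2 * n" for u v r s
      proof -
        have c: "(\<lambda>k. star A (y k r) \<otimes>\<^bsub>A\<^esub> y k s) \<in> {..<2 * n} \<rightarrow> carrier A"
          using ysc yc that by auto
        have "u \<otimes>\<^bsub>A\<^esub> W r s \<otimes>\<^bsub>A\<^esub> v = (\<Oplus>\<^bsub>A\<^esub>k\<in>{..<2 * n}. u \<otimes>\<^bsub>A\<^esub> (star A (y k r) \<otimes>\<^bsub>A\<^esub> y k s)) \<otimes>\<^bsub>A\<^esub> v"
          unfolding y[OF that(3,4)] using A.finsum_rdistr[OF _ that(1) c] by simp
        also have "\<dots> = (\<Oplus>\<^bsub>A\<^esub>k\<in>{..<2 * n}. u \<otimes>\<^bsub>A\<^esub> (star A (y k r) \<otimes>\<^bsub>A\<^esub> y k s) \<otimes>\<^bsub>A\<^esub> v)"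
          using c that by (intro A.finsum_ldistr) auto
        finally show ?thesis by simp
      qed
      have BB: "(\<Oplus>\<^bsub>A\<^esub>k\<in>{..<2 * n}. star A (B k i) \<otimes>\<^bsub>A\<^esub> B k j)
         = P \<otimes>\<^bsub>A\<^esub> W (2 * i) (2 * j) \<otimes>\<^bsub>A\<^esub> P \<oplus>\<^bsub>A\<^esub> P \<otimes>\<^bsub>A\<^esub> W (2 * i) (2 * j + 1) \<otimes>\<^bsub>A\<^esub> P'
         \<oplus>\<^bsub>A\<^esub> (P' \<otimes>\<^bsub>A\<^esub> W (2 * i + 1) (2 * j) \<otimes>\<^bsub>A\<^esub> P \<oplus>\<^bsub>A\<^esub> P' \<otimes>\<^bsub>A\<^esub> W (2 * i + 1) (2 * j + 1) \<otimes>\<^bsub>A\<^esub> P')"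
        if ij: "i < n" "j < n" for i j
      proof -
        let ?F = "\<lambda>u r s v k. u \<otimes>\<^bsub>A\<^esub> (star A (y k r) \<otimes>\<^bsub>A\<^esub> y k s) \<otimes>\<^bsub>A\<^esub> v"
        have Fc: "?F u r s v \<in> {..<2 * n} \<rightarrow> carrier A" if "u \<in> carrier A" "v \<in> carrier A" "r < 2 * n" "s < 2 * n" for u r s v
          using ysc yc that by auto
        have "star A (B k i) \<otimes>\<^bsub>A\<^esub> B k j
          = ?F P (2 * i) (2 * j) P k \<oplus>\<^bsub>A\<^esub> ?F P (2 * i) (2 * j + 1) P' k
          \<oplus>\<^bsub>A\<^esub> (?F P' (2 * i + 1) (2 * j) P k \<oplus>\<^bsub>A\<^esub> ?F P' (2 * i + 1) (2 * j + 1) P' k)" if k: "k < 2 * n" for k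
        proof -
          note c = yc[OF k lt(1)[OF ij(1)]] yc[OF k lt(2)[OF ij(1)]] yc[OF k lt(1)[OF ij(2)]] yc[OF k lt(2)[OF ij(2)]]
          note c' = c Pc P'c c[THEN svs_star_closed[OF sv]]
          have "star A (B k i) = P \<otimes>\<^bsub>A\<^esub> star A (y k (2 * i)) \<oplus>\<^bsub>A\<^esub> P' \<otimes>\<^bsub>A\<^esub> star A (y k (2 * i + 1))"
            unfolding B_def using c' by (simp add: svs_star_add[OF sv] cstar_star_mult[OF A] Ps P's del: add_Suc_right One_nat_def)
          then show ?thesis unfolding B_def using c'
            by (simp add: A.l_distr A.r_distr A.m_assoc A.a_assoc A.a_lcomm A.a_comm del: add_Suc_right One_nat_def)
        qed
        then have "(\<Oplus>\<^bsub>A\<^esub>k\<in>{..<2 * n}. star A (B k i) \<otimes>\<^bsub>A\<^esub> B k j)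
          = (\<Oplus>\<^bsub>A\<^esub>k\<in>{..<2 * n}. ?F P (2 * i) (2 * j) P k \<oplus>\<^bsub>A\<^esub> ?F P (2 * i) (2 * j + 1) P' k
          \<oplus>\<^bsub>A\<^esub> (?F P' (2 * i + 1) (2 * j) P k \<oplus>\<^bsub>A\<^esub> ?F P' (2 * i + 1) (2 * j + 1) P' k))"
          using Fc[OF Pc Pc] Fc[OF Pc P'c] Fc[OF P'c Pc] Fc[OF P'c P'c] lt[OF ij(1)] lt[OF ij(2)]
          by (intro A.finsum_cong') (auto simp: Pi_iff)
        also have "\<dots> = (\<Oplus>\<^bsub>A\<^esub>k\<in>{..<2 * n}. ?F P (2 * i) (2 * j) P k) \<oplus>\<^bsub>A\<^esub> (\<Oplus>\<^bsub>A\<^esub>k\<in>{..<2 * n}. ?F P (2 * i) (2 * j + 1) P' k)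
          \<oplus>\<^bsub>A\<^esub> ((\<Oplus>\<^bsub>A\<^esub>k\<in>{..<2 * n}. ?F P' (2 * i + 1) (2 * j) P k) \<oplus>\<^bsub>A\<^esub> (\<Oplus>\<^bsub>A\<^esub>k\<in>{..<2 * n}. ?F P' (2 * i + 1) (2 * j + 1) P' k))"
          using Fc[OF Pc Pc lt(1)[OF ij(1)] lt(1)[OF ij(2)]] Fc[OF Pc P'c lt(1)[OF ij(1)] lt(2)[OF ij(2)]]
            Fc[OF P'c Pc lt(2)[OF ij(1)] lt(1)[OF ij(2)]] Fc[OF P'c P'c lt(2)[OF ij(1)] lt(2)[OF ij(2)]]
          by (subst A.finsum_addf, (auto simp: Pi_iff)[2], subst A.finsum_addf, (auto simp: Pi_iff)[2], subst A.finsum_addf, auto simp: Pi_iff)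
        finally show ?thesis using sandwich Pc P'c lt[OF ij(1)] lt[OF ij(2)] by simp
      qed
      define Y where "Y i j = J (\<lambda>a. X a i j + ce * dg (\<lambda>_. ev 0) a i j)" for i j
      have WX: "W r s = J (\<lambda>a. X a (r div 2) (s div 2)) \<oplus>\<^bsub>A\<^esub> (if r = s then ce \<odot>\<^bsub>A\<^esub> (if even r then P else P') \<oplus>\<^bsub>A\<^esub> ct \<odot>\<^bsub>A\<^esub> (if even r then P' else P) else \<zero>\<^bsub>A\<^esub>)" for r s
      proof (cases "r = s")
        case True
        have "W r s = J (\<lambda>a. X a (r div 2) (s div 2) + (ce * (if even r then ev b a else perp b a) + ct * (if even r then perp b a else ev b a)))"
          unfolding W_def using True by (simp add: dbl_def pd_def qd_def dg_def add.assoc if_distrib[of "\<lambda>f. f _"])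
        also have "\<dots> = J (\<lambda>a. X a (r div 2) (s div 2)) \<oplus>\<^bsub>A\<^esub> (J (\<lambda>a. ce * (if even r then ev b a else perp b a)) \<oplus>\<^bsub>A\<^esub> J (\<lambda>a. ct * (if even r then perp b a else ev b a)))"
          unfolding Jadd ..
        finally show ?thesis using True by (simp add: Jscale P_def P'_def)
      next
        case False
        then show ?thesis using Jc by (simp add: W_def dbl_def pd_def qd_def dg_def)
      qed
      have YB: "Y i j = (\<Oplus>\<^bsub>A\<^esub>k\<in>{..<2 * n}. star A (B k i) \<otimes>\<^bsub>A\<^esub> B k j)" if ij: "i < n" "j < n" for i j
      proof -
        define z where "z = J (\<lambda>a. X a i j)"
        have zc: "z \<in> carrier A" by (simp add: z_def Jc)
        have one: "z = (P \<oplus>\<^bsub>A\<^esub> P') \<otimes>\<^bsub>A\<^esub> z \<otimes>\<^bsub>A\<^esub> (P \<oplus>\<^bsub>A\<^esub> P')" using zc by (simp add: sum1)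
        have zexp: "z = P \<otimes>\<^bsub>A\<^esub> z \<otimes>\<^bsub>A\<^esub> P \<oplus>\<^bsub>A\<^esub> P \<otimes>\<^bsub>A\<^esub> z \<otimes>\<^bsub>A\<^esub> P' \<oplus>\<^bsub>A\<^esub> (P' \<otimes>\<^bsub>A\<^esub> z \<otimes>\<^bsub>A\<^esub> P \<oplus>\<^bsub>A\<^esub> P' \<otimes>\<^bsub>A\<^esub> z \<otimes>\<^bsub>A\<^esub> P')"
          by (subst one) (use Pc P'c zc in \<open>simp add: A.l_distr A.r_distr A.m_assoc A.a_assoc A.a_lcomm A.a_comm\<close>)
        note sc = svs_smult_closed[OF sv]
        show ?thesis
        proof (cases "i = j")
          case False
          have "Y i j = z" using False by (simp add: Y_def z_def dg_def)
          moreover have "W (2 * i) (2 * j) = z" "W (2 * i) (2 * j + 1) = z" "W (2 * i + 1) (2 * j) = z" "W (2 * i + 1) (2 * j + 1) = z"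
            using False zc unfolding WX by (auto simp: z_def)
          ultimately show ?thesis unfolding BB[OF ij] using zexp by simp
        next
          case True
          have "Y i j = z \<oplus>\<^bsub>A\<^esub> ce \<odot>\<^bsub>A\<^esub> (P \<oplus>\<^bsub>A\<^esub> P')"
            unfolding Y_def z_def Jadd sum1 e1[symmetric] Jscale[symmetric] using True by (simp add: dg_def)
          also have "\<dots> = z \<oplus>\<^bsub>A\<^esub> (ce \<odot>\<^bsub>A\<^esub> P \<oplus>\<^bsub>A\<^esub> ce \<odot>\<^bsub>A\<^esub> P')" using svs_smult_right[OF sv Pc P'c] by simp
          finally have Yz: "Y i j = z \<oplus>\<^bsub>A\<^esub> (ce \<odot>\<^bsub>A\<^esub> P \<oplus>\<^bsub>A\<^esub> ce \<odot>\<^bsub>A\<^esub> P')" .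
          have W1: "W (2 * i) (2 * j) = z \<oplus>\<^bsub>A\<^esub> (ce \<odot>\<^bsub>A\<^esub> P \<oplus>\<^bsub>A\<^esub> ct \<odot>\<^bsub>A\<^esub> P')"
            and W4: "W (2 * i + 1) (2 * j + 1) = z \<oplus>\<^bsub>A\<^esub> (ce \<odot>\<^bsub>A\<^esub> P' \<oplus>\<^bsub>A\<^esub> ct \<odot>\<^bsub>A\<^esub> P)"
            unfolding WX using True by (simp_all add: z_def)
          have "2 * i \<noteq> 2 * j + 1" "2 * i + 1 \<noteq> 2 * j" by presburger+
          then have W2: "W (2 * i) (2 * j + 1) = z" and W3: "W (2 * i + 1) (2 * j) = z"
            unfolding WX using zc by (simp_all add: z_def)
          have m1: "P \<otimes>\<^bsub>A\<^esub> W (2 * i) (2 * j) \<otimes>\<^bsub>A\<^esub> P = P \<otimes>\<^bsub>A\<^esub> z \<otimes>\<^bsub>A\<^esub> P \<oplus>\<^bsub>A\<^esub> ce \<odot>\<^bsub>A\<^esub> P"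
            unfolding W1 using Pc P'c zc sc
            by (simp add: A.l_distr A.r_distr cstar_smult_left[OF A] cstar_smult_right[OF A] PP PP' svs_smult_null[OF sv])
          have m4: "P' \<otimes>\<^bsub>A\<^esub> W (2 * i + 1) (2 * j + 1) \<otimes>\<^bsub>A\<^esub> P' = P' \<otimes>\<^bsub>A\<^esub> z \<otimes>\<^bsub>A\<^esub> P' \<oplus>\<^bsub>A\<^esub> ce \<odot>\<^bsub>A\<^esub> P'"
            unfolding W4 using Pc P'c zc sc
            by (simp add: A.l_distr A.r_distr cstar_smult_left[OF A] cstar_smult_right[OF A] P'P' P'P svs_smult_null[OF sv])
          show ?thesis unfolding BB[OF ij] m1 m4 W2 W3 Yz using Pc P'c zc sc
            by (subst zexp) (simp add: A.a_assoc A.a_lcomm A.a_comm)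
        qed
      qed
      \<comment> \<open>The factorisation has \<open>2n\<close> rows, but positivity is defined by square matrices. So the compressed element is padded by
        zeros to size \<open>2n\<close> and compressed again afterwards by the matrix that selects the even coordinates.\<close>
      let ?T = "\<lambda>a r s. if even r \<and> even s then X a (r div 2) (s div 2) + ce * dg (\<lambda>_. ev 0) a (r div 2) (s div 2) else 0"
      define B' where "B' k s = (if even s then B k (s div 2) else \<zero>\<^bsub>A\<^esub>)" for k s
      have "map_mat \<iota> (mk (2 * n) ?T) \<in> positives (matrices A (2 * n))"
      proof (rule positives_matricesI[OF A, of "2 * n" B'])
        show "B' k j \<in> carrier A" if "k < 2 * n" "j < 2 * n" for k j
          using Bc[OF that(1), of "j div 2"] that by (auto simp: B'_def)
        fix r s assume rs: "r < 2 * n" "s < 2 * n"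
        then have rs2: "r div 2 < n" "s div 2 < n" by auto
        have L: "map_mat \<iota> (mk (2 * n) ?T) $$ (r, s) = (if even r \<and> even s then Y (r div 2) (s div 2) else \<zero>\<^bsub>A\<^esub>)"
          using rs Js0 by (cases "even r \<and> even s") (auto simp: mk_def J_def Y_def)
        show "map_mat \<iota> (mk (2 * n) ?T) $$ (r, s) = (\<Oplus>\<^bsub>A\<^esub>k\<in>{..<2 * n}. star A (B' k r) \<otimes>\<^bsub>A\<^esub> B' k s)"
        proof (cases "even r \<and> even s")
          case True
          then show ?thesis unfolding L using YB[OF rs2] by (simp add: B'_def)
        next
          case False
          have "(\<Oplus>\<^bsub>A\<^esub>k\<in>{..<2 * n}. star A (B' k r) \<otimes>\<^bsub>A\<^esub> B' k s) = (\<Oplus>\<^bsub>A\<^esub>k\<in>{..<2 * n}. \<zero>\<^bsub>A\<^esub>)"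
            using False Bc[OF _ rs2(1)] Bc[OF _ rs2(2)] svs_star_closed[OF sv] svs_star_zero[OF sv]
            by (intro A.finsum_cong') (auto simp: B'_def)
          then show ?thesis unfolding L if_not_P[OF False] by (simp add: A.finsum_zero)
        qed
      qed (simp add: mk_def)
      then have "mk (2 * n) ?T \<in> C (2 * n)" using pos[OF mk_closed] by blast
      from mo_conj[OF C this, of n "\<lambda>r i. if r = 2 * i then 1 else 0"]
      have T: "mk n (cj (2 * n) (\<lambda>r i. if r = 2 * i then 1 else 0) ?T) \<in> C n" .
      have "mk n (cj (2 * n) (\<lambda>r i. if r = 2 * i then 1 else 0) ?T) = mk n (\<lambda>a i j. X a i j + ce * dg (\<lambda>_. ev 0) a i j)"
      proof (rule mk_cong)
        fix a i j assume ij: "i < n" "j < n"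
        have "cj (2 * n) (\<lambda>r i. if r = 2 * i then 1 else 0) F a i j
           = (\<Sum>k<2 * n. delta k (2 * i) * (\<Sum>l<2 * n. delta l (2 * j) * F a k l))" for F
          unfolding cj_def sum_distrib_left by (intro sum.cong refl) auto
        then show "cj (2 * n) (\<lambda>r i. if r = 2 * i then 1 else 0) ?T a i j = X a i j + ce * dg (\<lambda>_. ev 0) a i j"
          using ij by (simp only: sum_delta_mult lt) simp
      qed
      then show "mk n (\<lambda>a i j. X a i j + complex_of_real \<epsilon> * dg (\<lambda>_. ev 0) a i j) \<in> C n"
        using T unfolding ce_def by simp
    qed
    then show "x \<in> C n" unfolding X using operator_system_good_arch[OF os e] by blast
  qed
qed

end

section \<open>Separation from a matrix ordering\<close>

text \<open>Polarisation: a form with real values on the diagonal is hermitian.\<close>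
lemma psdI_real:
  assumes "finite S" "\<And>v. 0 \<le> Re (sesq S q v v)" "\<And>v. Im (sesq S q v v) = 0"
  shows "psd S q"
  unfolding psd_def
proof (intro conjI ballI allI)
  fix r s assume rs: "r \<in> S" "s \<in> S"
  note d = sesq_delta[OF assms(1)]
  have e: "sesq S q (\<lambda>x. delta r x + z * delta s x) (\<lambda>x. delta r x + z * delta s x)
     = q r r + z * q r s + cnj z * q s r + cnj z * (z * q s s)" for z
    using rs by (simp add: sesq_add_left sesq_add_right sesq_scale_left sesq_scale_right d distrib_left)
  have 0: "Im (q r r) = 0" "Im (q s s) = 0" using assms(3)[of "delta r"] assms(3)[of "delta s"] d rs by auto
  have "Im (q r s + q s r) = 0" using assms(3)[of "\<lambda>x. delta r x + 1 * delta s x"] 0 unfolding e by simp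
  moreover have "Re (q r s - q s r) = 0" using assms(3)[of "\<lambda>x. delta r x + \<i> * delta s x"] 0 unfolding e by simp
  ultimately show "q s r = cnj (q r s)" by (simp add: complex_eq_iff)
qed (rule assms(2))

context gen_space
begin

text \<open>Linear functionals on matrices over the space, given by a dual family of scalar matrices \<open>G a\<close>.\<close>
definition pair :: "nat \<Rightarrow> (nat \<Rightarrow> nat \<Rightarrow> nat \<Rightarrow> complex) \<Rightarrow> (nat \<Rightarrow> nat \<Rightarrow> nat \<Rightarrow> complex) \<Rightarrow> complex" where
  "pair m G X = (\<Sum>a\<le>N. \<Sum>i<m. \<Sum>j<m. G a i j * X a i j)"

lemma pair_add: "pair m G (\<lambda>a i j. X a i j + Y a i j) = pair m G X + pair m G Y"
  by (simp add: pair_def distrib_left sum.distrib)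

lemma pair_scale: "pair m G (\<lambda>a i j. c * X a i j) = c * pair m G X"
  by (simp add: pair_def sum_distrib_left mult_ac)

text \<open>The elements \<open>y\<close> and \<open>w\<close> generate, together with the negatives of the positive elements, a cone
  that does not contain the unit; equivalently \<open>-1\<close> is outside the cone of all \<open>c\<close> for which \<open>c + s y + t w\<close> is
  positive for some \<open>s, t \<ge> 0\<close>. An extension from the line through the unit is therefore positive on \<open>C m\<close> and not positive
  at \<open>y\<close> and \<open>w\<close>. Treating all \<open>t\<close> at once in this way replaces a limit of functionals that separate
  \<open>y + t w\<close> for growing \<open>t\<close>.\<close>
lemma separating_functional:
  assumes good: "good C"
    and yh: "\<And>a i j. y a j i = cnj (y a i j)" and wh: "\<And>a i j. w a j i = cnj (w a i j)"
    and w: "mk m w \<in> C m"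
    and sep: "\<And>t. 0 < t \<Longrightarrow> mk m (\<lambda>a i j. y a i j + complex_of_real t * w a i j) \<notin> C m"
  shows "\<exists>G. (\<forall>X. mk m X \<in> C m \<longrightarrow> 0 \<le> Re (pair m G X) \<and> Im (pair m G X) = 0) \<and>
    Re (pair m G (dg (\<lambda>_. ev 0))) = 1 \<and> Re (pair m G y) \<le> 0 \<and> Re (pair m G w) \<le> 0"
proof -
  note mo = goodD(1)[OF good]
  note C_add = mo_add[OF mo] and C_scale = mo_scale[OF mo] and C_zero = mo_zero[OF mo]
  define u where "u = dg (\<lambda>_. ev 0)"
  have uC: "mk m u \<in> C m" unfolding u_def by (rule mo_diag[OF mo goodD(4)[OF good]])
  have uh: "u a j i = cnj (u a i j)" for a i j unfolding u_def by (rule dg_herm[OF ev_real, symmetric])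
  \<comment> \<open>Real coordinates: \<open>Some\<close> indexes real and imaginary parts of the coefficients, and \<open>None\<close> the multiples of the unit.\<close>
  define T where "T c a i j = complex_of_real (c (Some (a, i, j, False))) + \<i> * complex_of_real (c (Some (a, i, j, True)))"
    for c :: "(nat \<times> nat \<times> nat \<times> bool) option \<Rightarrow> real" and a i j
  define H where "H c a i j = (1/2) * (T c a i j + cnj (T c a j i))" for c a i j
  \<comment> \<open>The coefficients \<open>H c\<close> are the hermitian part of \<open>T c\<close>; the cone \<open>K\<close> consists of the \<open>c\<close> that
    become positive after adding nonnegative multiples of \<open>y\<close> and \<open>w\<close>.\<close>
  define F where "F c s t a i j = complex_of_real (c None) * u a i j + H c a i j + complex_of_real s * y a i j + complex_of_real t * w a i j"
    for c and s t :: real and a i j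
  define K where "K = {c. \<exists>s\<ge>0. \<exists>t\<ge>0. mk m (F c s t) \<in> C m}"
  define I where "I = Some ` ({..N} \<times> {..<m} \<times> {..<m} \<times> (UNIV :: bool set))"
  have Hherm: "H c a j i = cnj (H c a i j)" for c a i j by (simp add: H_def add.commute)
  have Fext: "mk m (F c s t) = mk m Z" if "\<And>a i j. a \<le> N \<Longrightarrow> i < m \<Longrightarrow> j < m \<Longrightarrow> F c s t a i j = Z a i j" for c s t Z
    by (rule mk_cong) (rule that)
  have KI: "c \<in> K" if "mk m Z \<in> C m" "0 \<le> s" "0 \<le> t" "\<And>a i j. a \<le> N \<Longrightarrow> i < m \<Longrightarrow> j < m \<Longrightarrow> F c s t a i j = Z a i j" for c s t Z
  proof -
    have "mk m (F c s t) = mk m Z" by (rule Fext) (rule that(4))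
    with that(1) have "mk m (F c s t) \<in> C m" by simp
    with that(2,3) show ?thesis unfolding K_def by blast
  qed
  have "\<exists>g. g None = 1 \<and> (\<forall>x\<in>K. 0 \<le> (\<Sum>i\<in>insert None I. g i * x i))"
  proof (rule riesz_extension)
    show "finite I" by (simp add: I_def)
    show "None \<notin> I" by (auto simp: I_def)
  next
    fix c d assume "c \<in> K" "d \<in> K"
    then obtain s t s' t' where st: "0 \<le> s" "0 \<le> t" "mk m (F c s t) \<in> C m" "0 \<le> s'" "0 \<le> t'" "mk m (F d s' t') \<in> C m"
      unfolding K_def by blast
    show "(\<lambda>i. c i + d i) \<in> K"
    proof (rule KI[OF C_add[OF st(3,6)]])
      show "0 \<le> s + s'" "0 \<le> t + t'" using st by auto
    qed (simp add: F_def H_def T_def algebra_simps add_divide_distrib)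
  next
    fix r :: real and c assume r: "0 < r" and "c \<in> K"
    then obtain s t where st: "0 \<le> s" "0 \<le> t" "mk m (F c s t) \<in> C m" unfolding K_def by blast
    show "(\<lambda>i. r * c i) \<in> K"
    proof (rule KI[OF C_scale[OF st(3) less_imp_le[OF r]]])
      show "0 \<le> r * s" "0 \<le> r * t" using st r by auto
    qed (simp add: F_def H_def T_def algebra_simps)
  next
    fix c d assume "c \<in> K" and cd: "\<And>i. i \<in> insert None I \<Longrightarrow> c i = d i"
    then obtain s t where st: "0 \<le> s" "0 \<le> t" "mk m (F c s t) \<in> C m" unfolding K_def by blast
    show "d \<in> K"
    proof (rule KI[OF st(3,1,2)])
      fix a i j assume ij: "a \<le> N" "i < m" "j < m"
      have "c (Some (a, i, j, b)) = d (Some (a, i, j, b))" "c (Some (a, j, i, b)) = d (Some (a, j, i, b))" for b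
        by (rule cd; use ij in \<open>simp add: I_def\<close>)+
      then show "F d s t a i j = F c s t a i j" using cd[of None] by (simp add: F_def H_def T_def)
    qed
  next
    fix c
    have "\<exists>r>0. mk m (\<lambda>a i j. complex_of_real r * dg (\<lambda>_. ev 0) a i j - (- H c a i j)) \<in> C m"
    proof (rule order_unit[OF mo goodD(2)[OF good] goodD(3)[OF good]])
      fix a i j show "- H c a j i = cnj (- H c a i j)" by (subst Hherm) simp
    qed
    then obtain r where r: "0 < r" "mk m (\<lambda>a i j. complex_of_real r * dg (\<lambda>_. ev 0) a i j - (- H c a i j)) \<in> C m"
      by blast
    have "(\<lambda>i. (if i = None then r - c None else 0) + c i) \<in> K"
      by (rule KI[OF r(2) order.refl order.refl]) (simp add: F_def H_def T_def u_def algebra_simps)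
    then show "\<exists>r. (\<lambda>i. (if i = None then r else 0) + c i) \<in> K" by blast
  next
    \<comment> \<open>If \<open>-u + s y + t w\<close> were positive, dividing by \<open>s\<close> would give a positive \<open>y + t' w\<close>; for \<open>s = 0\<close> the
      element \<open>y\<close> is dominated by a multiple of \<open>u\<close>, hence of \<open>w\<close>.\<close>
    show "(\<lambda>i. if i = None then -1 else 0) \<notin> K"
    proof
      assume "(\<lambda>i. if i = None then -1 else 0) \<in> K"
      then obtain s t where st: "0 \<le> s" "0 \<le> t" "mk m (F (\<lambda>i. if i = None then -1 else 0) s t) \<in> C m" unfolding K_def by blast
      have "F (\<lambda>i. if i = None then -1 else 0) s t = (\<lambda>a i j. - u a i j + complex_of_real s * y a i j + complex_of_real t * w a i j)"
        by (simp add: fun_eq_iff F_def H_def T_def)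
      then have *: "mk m (\<lambda>a i j. - u a i j + complex_of_real s * y a i j + complex_of_real t * w a i j) \<in> C m"
        using st(3) by simp
      have "\<exists>r>0. mk m (\<lambda>a i j. complex_of_real r * dg (\<lambda>_. ev 0) a i j - (- y a i j)) \<in> C m"
      proof (rule order_unit[OF mo goodD(2)[OF good] goodD(3)[OF good]])
        fix a i j show "- y a j i = cnj (- y a i j)" by (subst yh) simp
      qed
      then obtain r where r: "0 < r" "mk m (\<lambda>a i j. complex_of_real r * dg (\<lambda>_. ev 0) a i j - (- y a i j)) \<in> C m"
        by blast
      show False
      proof (cases "s = 0")
        case True
        have "mk m (\<lambda>a i j. (complex_of_real r * dg (\<lambda>_. ev 0) a i j - (- y a i j)) +
            (complex_of_real r * (- u a i j + complex_of_real s * y a i j + complex_of_real t * w a i j) + w a i j)) \<in> C m"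
          by (intro C_add C_scale r(2) * w less_imp_le[OF r(1)])
        also have "(\<lambda>a i j. (complex_of_real r * dg (\<lambda>_. ev 0) a i j - (- y a i j)) +
            (complex_of_real r * (- u a i j + complex_of_real s * y a i j + complex_of_real t * w a i j) + w a i j))
          = (\<lambda>a i j. y a i j + complex_of_real (r * t + 1) * w a i j)"
          using True by (simp add: fun_eq_iff u_def algebra_simps)
        finally show False using sep[of "r * t + 1"] r(1) st(2) by (simp add: add_nonneg_pos)
      next
        case False
        then have s: "0 < s" using st(1) by simp
        have "mk m (\<lambda>a i j. (complex_of_real (1 / s) * (- u a i j + complex_of_real s * y a i j + complex_of_real t * w a i j)) +
            (complex_of_real (1 / s) * u a i j + w a i j)) \<in> C m"
          using s by (intro C_add C_scale uC * w) auto
        also have "(\<lambda>a i j. (complex_of_real (1 / s) * (- u a i j + complex_of_real s * y a i j + complex_of_real t * w a i j)) +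
            (complex_of_real (1 / s) * u a i j + w a i j))
          = (\<lambda>a i j. y a i j + complex_of_real (t / s + 1) * w a i j)"
          using s by (simp add: fun_eq_iff distrib_left distrib_right add_divide_distrib diff_divide_distrib)
        finally show False using sep[of "t / s + 1"] s st(2) by (simp add: add_nonneg_pos)
      qed
    qed
  qed
  then obtain g where g1: "g None = 1" and g: "\<And>x. x \<in> K \<Longrightarrow> 0 \<le> (\<Sum>i\<in>insert None I. g i * x i)" by blast
  define G where "G a i j = complex_of_real (g (Some (a, i, j, False))) - \<i> * complex_of_real (g (Some (a, i, j, True)))" for a i j
  have sumI: "(\<Sum>i\<in>insert None I. g i * x i) = x None + Re (pair m G (T x))" for x
  proof -
    have "(\<Sum>i\<in>I. g i * x i) = (\<Sum>(a, i, j, b)\<in>{..N} \<times> {..<m} \<times> {..<m} \<times> UNIV. g (Some (a, i, j, b)) * x (Some (a, i, j, b)))"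
      unfolding I_def by (subst sum.reindex) (auto simp: case_prod_beta)
    also have "\<dots> = (\<Sum>a\<le>N. \<Sum>i<m. \<Sum>j<m. \<Sum>b\<in>UNIV. g (Some (a, i, j, b)) * x (Some (a, i, j, b)))"
      by (simp add: sum.cartesian_product)
    also have "\<dots> = (\<Sum>a\<le>N. \<Sum>i<m. \<Sum>j<m. Re (G a i j * T x a i j))"
      by (simp add: UNIV_bool G_def T_def algebra_simps)
    also have "\<dots> = Re (pair m G (T x))" by (simp add: pair_def)
    finally show ?thesis using g1 by (subst sum.insert) (auto simp: I_def)
  qed
  define co where "co h X i = (case i of None \<Rightarrow> h | Some (a, i, j, b) \<Rightarrow> if b then Im (X a i j) else Re (X a i j))"
    for h :: real and X :: "nat \<Rightarrow> nat \<Rightarrow> nat \<Rightarrow> complex" and i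
  have Tco: "T (co h X) = X" for h X by (simp add: fun_eq_iff T_def co_def complex_eq_iff)
  have core: "0 \<le> h + Re (pair m G X)" if "mk m (\<lambda>a i j. complex_of_real h * u a i j + (1/2) * (X a i j + cnj (X a j i))
       + complex_of_real s * y a i j + complex_of_real t * w a i j) \<in> C m" "0 \<le> s" "0 \<le> t" for h X s t
  proof -
    have "co h X \<in> K" by (rule KI[OF that]) (simp add: F_def H_def Tco, simp add: co_def)
    from g[OF this] show ?thesis unfolding sumI Tco by (simp add: co_def)
  qed
  have core0: "0 \<le> h + Re (pair m G X)" if "mk m Z \<in> C m" "\<And>a i j. complex_of_real h * u a i j + (1/2) * (X a i j + cnj (X a j i))
       + complex_of_real s * y a i j + complex_of_real t * w a i j = Z a i j" "0 \<le> s" "0 \<le> t" for h X s t Z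
    by (rule core[OF _ that(3,4)]) (use that(1,2) in simp)
  have re: "0 \<le> Re (pair m G X)" and im: "Im (pair m G X) = 0" if X: "mk m X \<in> C m" for X
  proof -
    have hX: "mk m (\<lambda>a i j. cnj (X a j i)) = mk m X" by (rule mo_herm[OF mo X])
    have "mk m (\<lambda>a i j. (1/2) * (X a i j + cnj (X a j i))) = (1/2) \<odot>\<^bsub>matrices U m\<^esub> (mk m X \<oplus>\<^bsub>matrices U m\<^esub> mk m (\<lambda>a i j. cnj (X a j i)))"
      by (simp only: mk_smult mk_add)
    also have "\<dots> = mk m X" unfolding hX by (simp add: mk_smult mk_add)
    finally have "mk m (\<lambda>a i j. (1/2) * (X a i j + cnj (X a j i))) \<in> C m" using X by simp
    from core0[OF this, of 0 X 0 0] show "0 \<le> Re (pair m G X)" by simp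
    have z: "mk m (\<lambda>a i j. (1/2) * (c * X a i j + cnj (c * X a j i))) \<in> C m" if "cnj c = - c" for c
    proof -
      have "mk m (\<lambda>a i j. (1/2) * (c * X a i j + cnj (c * X a j i))) = mk m (\<lambda>a i j. (c/2) * (X a i j - cnj (X a j i)))"
        by (rule mk_cong) (simp add: that algebra_simps)
      also have "\<dots> = (c/2) \<odot>\<^bsub>matrices U m\<^esub> (mk m X \<ominus>\<^bsub>matrices U m\<^esub> mk m (\<lambda>a i j. cnj (X a j i)))"
        by (simp only: mk_smult mk_diff)
      also have "\<dots> = mk m (\<lambda>a i j. 0)" unfolding hX by (simp add: mk_smult mk_diff)
      finally show ?thesis using C_zero by simp
    qed
    have "0 \<le> 0 + Re (pair m G (\<lambda>a i j. \<i> * X a i j))" by (rule core0[OF z[of \<i>], of _ _ 0 0]) simp_all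
    moreover have "0 \<le> 0 + Re (pair m G (\<lambda>a i j. (- \<i>) * X a i j))" by (rule core0[OF z[of "- \<i>"], of _ _ 0 0]) simp_all
    ultimately show "Im (pair m G X) = 0" unfolding pair_scale by simp
  qed
  have "0 \<le> -1 + Re (pair m G u)" by (rule core0[OF C_zero, of _ _ 0 0]) (simp_all add: uh[symmetric])
  moreover have "0 \<le> 1 + Re (pair m G (\<lambda>a i j. (-1) * u a i j))"
    by (rule core0[OF C_zero, of _ _ 0 0]) (simp_all add: uh[symmetric])
  ultimately have "Re (pair m G u) = 1" unfolding pair_scale by simp
  moreover have "0 \<le> 0 + Re (pair m G (\<lambda>a i j. (-1) * y a i j))"
    by (rule core0[OF C_zero, of _ _ 1 0]) (simp_all add: yh[symmetric])
  moreover have "0 \<le> 0 + Re (pair m G (\<lambda>a i j. (-1) * w a i j))"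
    by (rule core0[OF C_zero, of _ _ 0 1]) (simp_all add: wh[symmetric])
  ultimately show ?thesis using re im unfolding pair_scale u_def by (intro exI[of _ G]) auto
qed

text \<open>The value at \<open>w\<close> of the matrix-valued form obtained from \<open>X\<close> by substituting the kernels
  \<open>T a\<close> for the generators. For kernels \<open>T\<close> of operators it is the quadratic form of the image of
  \<open>X\<close> under the amplified map.\<close>
definition frm :: "nat \<Rightarrow> 'i set \<Rightarrow> (nat \<Rightarrow> nat \<Rightarrow> nat \<Rightarrow> complex) \<Rightarrow> (nat \<Rightarrow> 'i \<Rightarrow> 'i \<Rightarrow> complex) \<Rightarrow> (nat \<Rightarrow> 'i \<Rightarrow> complex) \<Rightarrow> complex" where
  "frm n S X T w = (\<Sum>a\<le>N. \<Sum>i<n. \<Sum>j<n. X a i j * sesq S (T a) (w i) (w j))"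

lemma pair_cj: "pair m G (cj n w X) = frm n {..<m} X G w"
proof -
  have "(\<Sum>r<m. \<Sum>s<m. G a r s * cj n w X a r s) = (\<Sum>i<n. \<Sum>j<n. X a i j * sesq {..<m} (G a) (w i) (w j))" for a
  proof -
    have "(\<Sum>r<m. \<Sum>s<m. G a r s * cj n w X a r s) = (\<Sum>r<m. \<Sum>s<m. \<Sum>i<n. \<Sum>j<n. X a i j * (cnj (w i r) * G a r s * w j s))"
      unfolding cj_def sum_distrib_left by (simp add: mult_ac)
    also have "\<dots> = (\<Sum>r<m. \<Sum>i<n. \<Sum>s<m. \<Sum>j<n. X a i j * (cnj (w i r) * G a r s * w j s))"
      by (rule sum.cong[OF refl], rule sum.swap)
    also have "\<dots> = (\<Sum>i<n. \<Sum>r<m. \<Sum>s<m. \<Sum>j<n. X a i j * (cnj (w i r) * G a r s * w j s))"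
      by (rule sum.swap)
    also have "\<dots> = (\<Sum>i<n. \<Sum>r<m. \<Sum>j<n. \<Sum>s<m. X a i j * (cnj (w i r) * G a r s * w j s))"
      by (rule sum.cong[OF refl], rule sum.cong[OF refl], rule sum.swap)
    also have "\<dots> = (\<Sum>i<n. \<Sum>j<n. \<Sum>r<m. \<Sum>s<m. X a i j * (cnj (w i r) * G a r s * w j s))"
      by (rule sum.cong[OF refl], rule sum.swap)
    finally show ?thesis by (simp add: sesq_def sum_distrib_left)
  qed
  then show ?thesis by (simp add: pair_def frm_def)
qed

end

section \<open>Finite-dimensional representations\<close>

context gen_space
begin

text \<open>The matrices \<open>T 0, \<dots>, T N\<close> are the images of the generators under a unital completely positive map
  into the \<open>m \<times> m\<close> matrices that sends \<open>g b\<close> to an idempotent, hence to a projection.\<close>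
definition isrep :: "(nat \<Rightarrow> 'a mat set) \<Rightarrow> nat \<Rightarrow> nat \<Rightarrow> (nat \<Rightarrow> nat \<Rightarrow> nat \<Rightarrow> complex) \<Rightarrow> bool" where
  "isrep C b m T \<longleftrightarrow>
     (\<forall>k<m. \<forall>l<m. T 0 k l = delta k l) \<and>
     (\<forall>c. comb c = \<zero>\<^bsub>U\<^esub> \<longrightarrow> (\<forall>k<m. \<forall>l<m. (\<Sum>a\<le>N. c a * T a k l) = 0)) \<and>
     (\<forall>n X w. mk n X \<in> C n \<longrightarrow> 0 \<le> Re (frm n {..<m} X T w) \<and> Im (frm n {..<m} X T w) = 0) \<and>
     (\<forall>k<m. \<forall>l<m. (\<Sum>h<m. T b k h * T b h l) = T b k l)"

lemma frm_one: "frm 1 S (\<lambda>a i j. c a) T w = sesq S (\<lambda>r s. \<Sum>a\<le>N. c a * T a r s) (w 0) (w 0)"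
proof -
  have "sesq S (\<lambda>r s. \<Sum>a\<le>N. c a * T a r s) (w 0) (w 0) = (\<Sum>r\<in>S. \<Sum>s\<in>S. \<Sum>a\<le>N. c a * (cnj (w 0 r) * T a r s * w 0 s))"
    by (simp add: sesq_def sum_distrib_left sum_distrib_right mult_ac)
  also have "\<dots> = (\<Sum>r\<in>S. \<Sum>a\<le>N. \<Sum>s\<in>S. c a * (cnj (w 0 r) * T a r s * w 0 s))"
    by (intro sum.cong refl sum.swap)
  also have "\<dots> = (\<Sum>a\<le>N. \<Sum>r\<in>S. \<Sum>s\<in>S. c a * (cnj (w 0 r) * T a r s * w 0 s))"
    by (rule sum.swap)
  finally show ?thesis by (simp add: frm_def sesq_def sum_distrib_left)
qed

lemma psd_of_positive_form:
  assumes S: "finite S" and pos: "\<And>w. 0 \<le> Re (frm 1 S (\<lambda>a i j. c a) T w) \<and> Im (frm 1 S (\<lambda>a i j. c a) T w) = 0"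
  shows "psd S (\<lambda>r s. \<Sum>a\<le>N. c a * T a r s)"
proof (rule psdI_real[OF S])
  fix v
  show "0 \<le> Re (sesq S (\<lambda>r s. \<Sum>a\<le>N. c a * T a r s) v v)"
    using pos[of "\<lambda>_. v"] unfolding frm_one by blast
  show "Im (sesq S (\<lambda>r s. \<Sum>a\<le>N. c a * T a r s) v v) = 0"
    using pos[of "\<lambda>_. v"] unfolding frm_one by blast
qed

lemma sum_ev: "b \<le> N \<Longrightarrow> (\<Sum>a\<le>N. ev b a * f a) = f b"
proof -
  assume b: "b \<le> N"
  have "(\<Sum>a\<le>N. ev b a * f a) = (\<Sum>a\<le>N. if a = b then f b else 0)"
    by (intro sum.cong refl) (simp add: ev_def)
  then show ?thesis using b by simp
qed

lemma sum_perp: "b \<le> N \<Longrightarrow> (\<Sum>a\<le>N. perp b a * f a) = f 0 - f b"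
  by (simp add: perp_def left_diff_distrib sum_subtractf sum_ev)

text \<open>If \<open>X\<close> is not in \<open>C n\<close>, it is not in \<open>C(p) n\<close> either, so for some \<open>\<epsilon>\<close> no \<open>t\<close> makes the doubled
  element positive, and there is a positive functional \<open>G\<close> that is nonpositive at
  \<open>X \<otimes> J\<^sub>2 + \<epsilon> I \<otimes> (p \<oplus> p\<^sup>\<bottom>)\<close> and at \<open>I \<otimes> (p\<^sup>\<bottom> \<oplus> p)\<close>. It vanishes at the latter. The
  component \<open>G 0\<close> is a semi-inner product and \<open>G b\<close> a smaller form; the vanishing
  means that \<open>G b\<close> is zero on odd basis vectors while \<open>G 0 - G b\<close> is zero on even ones. Hence
  \<open>G b (v, w) = G 0 (v, ss w)\<close> for the restriction \<open>ss\<close> to even coordinates. In an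
  orthonormal frame of \<open>G 0\<close> the unit becomes the identity and \<open>p\<close> the projection \<open>ss\<close>. The
  functional of \<open>X \<otimes> J\<^sub>2\<close> is a value of the resulting map at \<open>X\<close>, and it is negative because
  the functional is at least \<open>1\<close> on \<open>I \<otimes> (p \<oplus> p\<^sup>\<bottom>)\<close>.\<close>
lemma representation_exists:
  assumes good: "good C" and b: "b \<le> N"
    and ps: "proj_step U (g 0) C (g b) n \<subseteq> C n"
    and herm: "\<And>a i j. X a j i = cnj (X a i j)" and notin: "mk n X \<notin> C n"
  shows "\<exists>m T v. isrep C b m T \<and> Re (frm n {..<m} X T v) < 0"
proof -
  note mo = goodD(1)[OF good]
  have "mk n X \<notin> proj_step U (g 0) C (g b) n" using notin ps by blast
  then obtain \<epsilon> :: real where eps: "0 < \<epsilon>" and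
    sep: "\<And>t. 0 < t \<Longrightarrow> mk (2 * n) (\<lambda>a r s. dbl X a r s + complex_of_real \<epsilon> * pd b a r s + complex_of_real t * qd b a r s) \<notin> C (2 * n)"
    unfolding proj_step_mk[OF b] by blast
  let ?m = "2 * n"
  let ?S = "{..<?m}"
  define y where "y a r s = dbl X a r s + complex_of_real \<epsilon> * pd b a r s" for a r s
  have yh: "y a s r = cnj (y a r s)" for a r s
    unfolding y_def complex_cnj_add complex_cnj_mult pd_herm complex_cnj_complex_of_real
    unfolding dbl_def by (subst herm) simp
  have qC: "mk ?m (qd b) \<in> C ?m" by (rule mo_qd[OF mo b goodD(2)[OF good b] goodD(3)[OF good b]])
  have "\<exists>G. (\<forall>X. mk ?m X \<in> C ?m \<longrightarrow> 0 \<le> Re (pair ?m G X) \<and> Im (pair ?m G X) = 0) \<and>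
    Re (pair ?m G (dg (\<lambda>_. ev 0))) = 1 \<and> Re (pair ?m G y) \<le> 0 \<and> Re (pair ?m G (qd b)) \<le> 0"
    by (rule separating_functional[OF good yh qd_herm[symmetric] qC]) (use sep in \<open>simp add: y_def\<close>)
  then obtain G where Gpos: "\<And>X. mk ?m X \<in> C ?m \<Longrightarrow> 0 \<le> Re (pair ?m G X) \<and> Im (pair ?m G X) = 0"
    and Gu: "Re (pair ?m G (dg (\<lambda>_. ev 0))) = 1" and Gy: "Re (pair ?m G y) \<le> 0" and Gq: "Re (pair ?m G (qd b)) \<le> 0"
    by blast
  have Gcp: "0 \<le> Re (frm k ?S Y G w) \<and> Im (frm k ?S Y G w) = 0" if "mk k Y \<in> C k" for k Y w
    unfolding pair_cj[symmetric] by (rule Gpos[OF mo_conj[OF mo that]])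
  have psd_c: "psd ?S (\<lambda>r s. \<Sum>a\<le>N. c a * G a r s)" if "mk 1 (\<lambda>a i j. c a) \<in> C 1" for c
    by (rule psd_of_positive_form[OF finite_lessThan Gcp[OF that]])
  let ?Q = "sesq ?S (G 0)"
  let ?P = "sesq ?S (G b)"
  have Q: "psd ?S (G 0)" using psd_c[OF goodD(2)[OF good le0]] by (simp add: sum_ev)
  have Pp: "psd ?S (G b)" using psd_c[OF goodD(2)[OF good b]] b by (simp add: sum_ev)
  have Pa: "psd ?S (G a)" "psd ?S (\<lambda>r s. G 0 r s - G a r s)" if "a \<le> N" for a
    using psd_c[OF goodD(2)[OF good that]] psd_c[OF goodD(3)[OF good that]] that by (simp_all add: sum_ev sum_perp)
  have R: "psd ?S (\<lambda>r s. G 0 r s - G b r s)" by (rule Pa(2)[OF b])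
  \<comment> \<open>A sum of nonnegative numbers that is nonpositive: every summand is zero.\<close>
  have qd_sum: "pair ?m G (qd b) = (\<Sum>r<?m. if even r then G 0 r r - G b r r else G b r r)"
  proof -
    have "(\<Sum>a\<le>N. \<Sum>r<?m. \<Sum>s<?m. G a r s * qd b a r s) = (\<Sum>a\<le>N. \<Sum>r<?m. (if even r then perp b a else ev b a) * G a r r)"
    proof (intro sum.cong refl)
      fix a r assume "r \<in> {..<?m}"
      have "(\<Sum>s<?m. G a r s * qd b a r s) = (\<Sum>s<?m. if s = r then (if even r then perp b a else ev b a) * G a r r else 0)"
        by (intro sum.cong refl) (auto simp: qd_def dg_def)
      then show "(\<Sum>s<?m. G a r s * qd b a r s) = (if even r then perp b a else ev b a) * G a r r"
        using \<open>r \<in> {..<?m}\<close> by simp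
    qed
    also have "\<dots> = (\<Sum>r<?m. \<Sum>a\<le>N. (if even r then perp b a else ev b a) * G a r r)" by (rule sum.swap)
    also have "\<dots> = (\<Sum>r<?m. if even r then G 0 r r - G b r r else G b r r)"
      by (intro sum.cong refl) (simp add: sum_ev sum_perp b)
    finally show ?thesis by (simp add: pair_def)
  qed
  have diag: "Re (sesq ?S (G b) (delta r) (delta r)) = Re (G b r r)"
    "Re (sesq ?S (\<lambda>r s. G 0 r s - G b r s) (delta r) (delta r)) = Re (G 0 r r - G b r r)" if "r < ?m" for r
    using that by (simp_all add: sesq_delta)
  have dnn: "0 \<le> Re (if even r then G 0 r r - G b r r else G b r r)" if "r \<in> {..<?m}" for r
    using psd_nonneg[OF Pp, of "delta r"] psd_nonneg[OF R, of "delta r"] diag[of r] that by simp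
  have "(\<Sum>r<?m. Re (if even r then G 0 r r - G b r r else G b r r)) \<le> 0" using Gq unfolding qd_sum by simp
  then have "(\<Sum>r<?m. Re (if even r then G 0 r r - G b r r else G b r r)) = 0"
    by (intro antisym sum_nonneg dnn)
  then have d0: "Re (if even r then G 0 r r - G b r r else G b r r) = 0" if "r < ?m" for r
    using that dnn by (subst (asm) sum_nonneg_eq_0_iff) auto
  have Podd: "?P v (delta r) = 0" if "r < ?m" "odd r" for r v
    by (rule psd_null[OF Pp]) (use d0[OF that(1)] that diag in simp)
  have Peven: "?P v (delta r) = ?Q v (delta r)" if "r < ?m" "even r" for r v
  proof -
    have "sesq ?S (\<lambda>r s. G 0 r s - G b r s) v (delta r) = 0"
      by (rule psd_null[OF R]) (use d0[OF that(1)] that diag in simp)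
    then show ?thesis by (simp add: sesq_diff)
  qed
  \<comment> \<open>the restriction of vectors to even coordinates\<close>
  define ss where "ss w r = (if even r then w r else 0)" for w :: "nat \<Rightarrow> complex" and r
  have PQ: "?P v w = ?Q v (ss w)" for v w
  proof -
    have "?P v w = (\<Sum>s<?m. w s * ?P v (delta s))" by (rule sesq_expand_right[OF finite_lessThan])
    also have "\<dots> = (\<Sum>s<?m. ss w s * ?Q v (delta s))"
      by (intro sum.cong refl) (simp add: ss_def Podd Peven)
    also have "\<dots> = ?Q v (ss w)" by (rule sesq_expand_right[OF finite_lessThan, symmetric])
    finally show ?thesis .
  qed
  have PQ': "?P v w = ?Q (ss v) w" for v w
    using sesq_cnj[OF Pp, of v w] sesq_cnj[OF Q, of "ss v" w] PQ[of w v] by simp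
  have ssss: "ss (ss w) = ss w" for w by (simp add: ss_def fun_eq_iff)
  obtain m :: nat and u where mu: "(\<forall>k<m. \<forall>l<m. ?Q (u k) (u l) = delta k l) \<and>
    (\<forall>v w. ?Q v w = (\<Sum>k<m. ?Q v (u k) * ?Q (u k) w))"
    using psd_orthonormal_frame[OF Q finite_lessThan] by (elim exE)
  have on: "?Q (u k) (u l) = delta k l" if "k < m" "l < m" for k l using mu that by blast
  have pars: "(\<Sum>k<m. ?Q v (u k) * ?Q (u k) w) = ?Q v w" for v w
    by (rule conjunct2[OF mu, THEN spec, THEN spec, symmetric])
  define T where "T a k l = sesq ?S (G a) (u k) (u l)" for a k l
  have frmT: "frm k {..<m} Y T w = frm k ?S Y G (\<lambda>i s. \<Sum>l<m. w i l * u l s)" for k Y w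
    unfolding frm_def
  proof (intro sum.cong refl arg_cong2[of _ _ _ _ "(*)"])
    fix a i j
    have "sesq ?S (G a) (\<lambda>s. \<Sum>l<m. w i l * u l s) (\<lambda>s. \<Sum>l<m. w j l * u l s)
       = (\<Sum>k<m. cnj (w i k) * (\<Sum>l<m. w j l * sesq ?S (G a) (u k) (u l)))"
      unfolding sesq_sum_left unfolding sesq_sum_right ..
    then show "sesq {..<m} (T a) (w i) (w j) = sesq ?S (G a) (\<lambda>s. \<Sum>l<m. w i l * u l s) (\<lambda>s. \<Sum>l<m. w j l * u l s)"
      by (simp add: sesq_def[of "{..<m}"] T_def sum_distrib_left mult_ac)
  qed
  have rep: "isrep C b m T"
    unfolding isrep_def
  proof (intro conjI allI impI)
    show "T 0 k l = delta k l" if "k < m" "l < m" for k l unfolding T_def by (rule on[OF that])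
    show "0 \<le> Re (frm k {..<m} Y T w)" "Im (frm k {..<m} Y T w) = 0" if "mk k Y \<in> C k" for k Y w
      unfolding frmT using Gcp[OF that] by blast+
    show "(\<Sum>h<m. T b k h * T b h l) = T b k l" for k l
    proof -
      have "(\<Sum>h<m. T b k h * T b h l) = (\<Sum>h<m. ?Q (ss (u k)) (u h) * ?Q (u h) (ss (u l)))"
        by (intro sum.cong refl arg_cong2[of _ _ _ _ "(*)"]) (simp_all only: T_def PQ'[of "u k"] PQ[of _ "u l"])
      also have "\<dots> = ?Q (ss (u k)) (ss (u l))" by (rule pars)
      also have "\<dots> = ?P (u k) (ss (u l))" by (rule PQ'[symmetric])
      also have "\<dots> = ?P (u k) (u l)" by (simp only: PQ ssss)
      finally show ?thesis by (simp add: T_def)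
    qed
    show "(\<Sum>a\<le>N. c a * T a k l) = 0" if c: "comb c = \<zero>\<^bsub>U\<^esub>" for c k l
    proof -
      have nul: "mk 1 (\<lambda>a i j. z * c a) \<in> C 1" for z
      proof -
        have "mk 1 (\<lambda>a i j. z * c a) = mk 1 (\<lambda>a i j. 0)"
          unfolding mk_eq_iff comb_zero using c comb_smult[of z c] svs_smult_null[OF svs] by simp
        then show ?thesis using mo_zero[OF mo] by simp
      qed
      have c1: "mk 1 (\<lambda>a i j. c a) \<in> C 1" and c2: "mk 1 (\<lambda>a i j. - c a) \<in> C 1" using nul[of 1] nul[of "-1"] by simp_all
      let ?q = "\<lambda>r s. \<Sum>a\<le>N. c a * G a r s"
      have "Re (sesq ?S ?q (u l) (u l)) = 0"
      proof -
        have "sesq ?S (\<lambda>r s. \<Sum>a\<le>N. - c a * G a r s) (u l) (u l) = - sesq ?S ?q (u l) (u l)"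
          by (simp add: sesq_def sum_negf)
        then show ?thesis using psd_nonneg[OF psd_c[OF c1], of "u l"] psd_nonneg[OF psd_c[OF c2], of "u l"] by simp
      qed
      then have "sesq ?S ?q (u k) (u l) = 0" by (rule psd_null[OF psd_c[OF c1]])
      moreover have "sesq ?S ?q (u k) (u l) = (\<Sum>a\<le>N. c a * T a k l)"
      proof -
        have "sesq ?S ?q (u k) (u l) = (\<Sum>r<?m. \<Sum>s<?m. \<Sum>a\<le>N. c a * (cnj (u k r) * G a r s * u l s))"
          by (simp add: sesq_def sum_distrib_left sum_distrib_right mult_ac)
        also have "\<dots> = (\<Sum>r<?m. \<Sum>a\<le>N. \<Sum>s<?m. c a * (cnj (u k r) * G a r s * u l s))"
          by (intro sum.cong refl sum.swap)
        also have "\<dots> = (\<Sum>a\<le>N. \<Sum>r<?m. \<Sum>s<?m. c a * (cnj (u k r) * G a r s * u l s))"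
          by (rule sum.swap)
        finally show ?thesis by (simp add: T_def sesq_def sum_distrib_left)
      qed
      ultimately show ?thesis by simp
    qed
  qed
  \<comment> \<open>The vectors \<open>d i\<close> pick the entry \<open>X a i j\<close> for all four positions of a block, so that the form at \<open>d\<close> is
    the functional at \<open>X \<otimes> J\<^sub>2\<close>; \<open>v i\<close> are their coordinates in the frame.\<close>
  define d where "d i s = (if s div 2 = i then 1 else (0::complex))" for i s :: nat
  define v where "v i k = ?Q (u k) (d i)" for i k
  have pd_eq: "sesq ?S (G a) (\<lambda>s. \<Sum>l<m. v i l * u l s) (\<lambda>s. \<Sum>l<m. v j l * u l s) = sesq ?S (G a) (d i) (d j)"
    if a: "a \<le> N" for a i j
  proof -
    define d' where "d' i s = (\<Sum>l<m. v i l * u l s)" for i s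
    \<comment> \<open>the component of \<open>d i\<close> outside the frame, which is in the radical of \<open>G 0\<close> and therefore of the smaller forms\<close>
    define z where "z i s = d i s + (-1) * d' i s" for i s
    have Qz: "?Q x (z i) = 0" for x i
      unfolding z_def sesq_add_right sesq_scale_right d'_def sesq_sum_right v_def
      using pars[of x "d i"] by (simp add: mult.commute)
    have null: "sesq ?S (G a) x (z i) = 0" for x i
    proof (rule psd_null[OF Pa(1)[OF a]])
      have "Re (sesq ?S (G a) (z i) (z i)) \<le> 0"
        using psd_nonneg[OF Pa(2)[OF a], of "z i"] Qz[of "z i" i] by (simp add: sesq_diff)
      then show "Re (sesq ?S (G a) (z i) (z i)) = 0" using psd_nonneg[OF Pa(1)[OF a], of "z i"] by simp
    qed
    have null': "sesq ?S (G a) (z i) x = 0" for x i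
      using sesq_cnj[OF Pa(1)[OF a], of "z i" x] null[of x i] by simp
    have dz: "d i = (\<lambda>s. d' i s + z i s)" for i by (simp add: z_def fun_eq_iff)
    have "sesq ?S (G a) (d i) (d j) = sesq ?S (G a) (d' i) (d' j)"
      unfolding dz[of i] dz[of j] sesq_add_left sesq_add_right null null' by simp
    then show ?thesis unfolding d'_def by simp
  qed
  have "frm n {..<m} X T v = frm n ?S X G d"
    unfolding frmT unfolding frm_def by (intro sum.cong refl arg_cong2[of _ _ _ _ "(*)"] pd_eq) simp
  also have "\<dots> = pair ?m G (cj n d X)" by (rule pair_cj[symmetric])
  also have "\<dots> = pair ?m G (dbl X)"
    unfolding pair_def
  proof (intro sum.cong refl arg_cong2[of _ _ _ _ "(*)"])
    fix a r s assume rs: "r \<in> {..<?m}" "s \<in> {..<?m}"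
    have "cj n d X a r s = (\<Sum>k<n. delta k (r div 2) * (\<Sum>l<n. delta l (s div 2) * X a k l))"
      unfolding cj_def d_def sum_distrib_left by (intro sum.cong refl) auto
    also have "\<dots> = dbl X a r s"
    proof -
      have "r div 2 < n" "s div 2 < n" using rs by auto
      then show ?thesis by (simp only: dbl_def sum_delta_mult)
    qed
    finally show "cj n d X a r s = dbl X a r s" .
  qed
  also have "Re (pair ?m G (dbl X)) < 0"
  proof -
    have "dg (\<lambda>_. ev 0) = (\<lambda>a r s. pd b a r s + qd b a r s)"
      by (auto simp: fun_eq_iff pd_def qd_def dg_def perp_def)
    then have "Re (pair ?m G (pd b)) + Re (pair ?m G (qd b)) = 1" using Gu by (simp add: pair_add)
    then have 1: "1 \<le> Re (pair ?m G (pd b))" using Gq by simp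
    have "pair ?m G y = pair ?m G (dbl X) + complex_of_real \<epsilon> * pair ?m G (pd b)"
      unfolding y_def pair_add pair_scale ..
    then have "Re (pair ?m G (dbl X)) + \<epsilon> * Re (pair ?m G (pd b)) \<le> 0" using Gy by simp
    moreover have "\<epsilon> * 1 \<le> \<epsilon> * Re (pair ?m G (pd b))" using 1 eps by (intro mult_left_mono) auto
    ultimately show ?thesis using eps by linarith
  qed
  finally show ?thesis using rep by blast
qed

end

section \<open>Countable direct sums of representations\<close>

lemma sesq_reindex:
  assumes "inj_on f S"
  shows "sesq (f ` S) q v w = sesq S (\<lambda>r s. q (f r) (f s)) (\<lambda>r. v (f r)) (\<lambda>r. w (f r))"
  unfolding sesq_def using assms by (simp add: sum.reindex)

text \<open>The sets \<open>B r\<close> are the finite classes of a partial equivalence relation on the natural numbers; an index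
  outside every class has \<open>B r = {}\<close>.\<close>
locale blocks =
  fixes B :: "nat \<Rightarrow> nat set"
  assumes B_finite: "finite (B r)"
    and B_sym: "s \<in> B r \<Longrightarrow> r \<in> B s"
    and B_eq: "s \<in> B r \<Longrightarrow> B s = B r"

context gen_space
begin

lemma continuous_frm: "continuous_on UNIV (\<lambda>Y. Re (frm n S Y T v))"
proof -
  have c1: "continuous_on UNIV (\<lambda>Y :: nat \<Rightarrow> nat \<Rightarrow> nat \<Rightarrow> complex. Y a)" for a
    by (rule continuous_on_product_then_coordinatewise[OF continuous_on_id])
  have c2: "continuous_on UNIV (\<lambda>Y :: nat \<Rightarrow> nat \<Rightarrow> nat \<Rightarrow> complex. Y a i)" for a i
    by (rule continuous_on_product_then_coordinatewise[OF c1])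
  have c: "continuous_on UNIV (\<lambda>Y :: nat \<Rightarrow> nat \<Rightarrow> nat \<Rightarrow> complex. Y a i j)" for a i j
    by (rule continuous_on_product_then_coordinatewise[OF c2])
  show ?thesis unfolding frm_def by (intro continuous_intros c)
qed

text \<open>Negativity at a fixed vector is an open condition on the coefficients of \<open>X\<close>, so by the Lindelof property
  countably many of these open sets already cover the complement of \<open>C n\<close>.\<close>
lemma countable_separating_reps:
  assumes good: "good C" and b: "b \<le> N"
    and ps: "\<And>n. proj_step U (g 0) C (g b) n \<subseteq> C n"
  shows "\<exists>m T. (\<forall>j::nat. isrep C b (m j) (T j)) \<and>
    (\<forall>n X. (\<forall>a i j. X a j i = cnj (X a i j)) \<longrightarrow> mk n X \<notin> C n \<longrightarrow>
       (\<exists>j v. Re (frm n {..<m j} X (T j) v) < 0))"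
proof -
  define Op where "Op n = (\<lambda>(m :: nat, T, v). {Y. Re (frm n {..<m} Y T v) < 0})" for n
  define RV where "RV = {(m, T, v :: nat \<Rightarrow> nat \<Rightarrow> complex) | m T v. isrep C b m T}"
  have "\<exists>R. R \<subseteq> RV \<and> countable R \<and> (\<Union>p\<in>R. Op n p) = (\<Union>p\<in>RV. Op n p)" for n
  proof -
    have op: "open S" if S: "S \<in> Op n ` RV" for S
    proof -
      obtain m T v where "S = {Y. Re (frm n {..<m :: nat} Y T v) < 0}"
        using S by (auto simp: Op_def RV_def)
      then show ?thesis by (simp add: open_Collect_less continuous_frm)
    qed
    obtain F' where F': "F' \<subseteq> Op n ` RV" "countable F'" "\<Union>F' = \<Union>(Op n ` RV)"
      using Lindelof[of "Op n ` RV"] op by blast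
    then obtain R where "R \<subseteq> RV" "countable R" "F' = Op n ` R"
      using countable_subset_image[of F' "Op n" RV] by blast
    with F'(3) show ?thesis by blast
  qed
  then have "\<forall>n. \<exists>R. R \<subseteq> RV \<and> countable R \<and> (\<Union>p\<in>R. Op n p) = (\<Union>p\<in>RV. Op n p)" by (rule allI)
  from choice[OF this] obtain R where
    R0: "\<forall>n. R n \<subseteq> RV \<and> countable (R n) \<and> (\<Union>p\<in>R n. Op n p) = (\<Union>p\<in>RV. Op n p)" ..
  have R: "R n \<subseteq> RV" "countable (R n)" "(\<Union>p\<in>R n. Op n p) = (\<Union>p\<in>RV. Op n p)" for n
    using R0[THEN spec, of n] by simp_all
  \<comment> \<open>a representation on the zero space, so that the countable family is not empty\<close>
  define p0 where "p0 = (0 :: nat, (\<lambda>a k l. 0) :: nat \<Rightarrow> nat \<Rightarrow> nat \<Rightarrow> complex, (\<lambda>i k. 0) :: nat \<Rightarrow> nat \<Rightarrow> complex)"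
  have "isrep C b 0 (\<lambda>a k l. 0)" unfolding isrep_def frm_def sesq_def by simp
  then have p0: "p0 \<in> RV" unfolding p0_def RV_def by blast
  define Rall where "Rall = insert p0 (\<Union>n. R n)"
  have cR: "countable Rall" "Rall \<noteq> {}" unfolding Rall_def using R(2) by auto
  define e where "e = from_nat_into Rall"
  have eR: "range e = Rall" unfolding e_def by (rule range_from_nat_into[OF cR(2,1)])
  have sub: "Rall \<subseteq> RV" unfolding Rall_def using p0 R(1) by blast
  have rep: "isrep C b (fst (e j)) (fst (snd (e j)))" for j
  proof -
    have "e j \<in> RV" using eR sub by blast
    then show ?thesis by (auto simp: RV_def)
  qed
  have "\<exists>j v. Re (frm n {..<fst (e j)} X (fst (snd (e j))) v) < 0"
    if X: "\<And>a i j. X a j i = cnj (X a i j)" "mk n X \<notin> C n" for n X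
  proof -
    obtain m T v where mTv: "isrep C b m T" "Re (frm n {..<m} X T v) < 0"
      using representation_exists[OF good b ps X] by blast
    then have "X \<in> (\<Union>p\<in>RV. Op n p)" unfolding RV_def Op_def by blast
    then have "X \<in> (\<Union>p\<in>R n. Op n p)" using R(3) by simp
    then obtain p where p: "p \<in> R n" "X \<in> Op n p" by blast
    then have "p \<in> range e" unfolding eR Rall_def by blast
    then obtain j where "p = e j" by blast
    with p(2) have "Re (frm n {..<fst (e j)} X (fst (snd (e j))) (snd (snd (e j)))) < 0"
      by (simp add: Op_def case_prod_beta)
    then show ?thesis by blast
  qed
  with rep show ?thesis
    by (intro exI[of _ "\<lambda>j. fst (e j)"] exI[of _ "\<lambda>j. fst (snd (e j))"]) blast
qed

text \<open>A direct sum of representations on the space with index set \<open>nat\<close>, stored as infinite block-diagonal matrices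
  \<open>\<Theta> a\<close>. The last clause says that the sum detects every element outside the ordering.\<close>
definition faithful_blocks :: "(nat \<Rightarrow> 'a mat set) \<Rightarrow> nat \<Rightarrow> (nat \<Rightarrow> nat set) \<Rightarrow> (nat \<Rightarrow> nat \<Rightarrow> nat \<Rightarrow> complex) \<Rightarrow> bool" where
  "faithful_blocks C b B \<Theta> \<longleftrightarrow> blocks B \<and>
     (\<forall>a x y. y \<notin> B x \<longrightarrow> \<Theta> a x y = 0) \<and>
     (\<forall>x y. y \<in> B x \<longrightarrow> \<Theta> 0 x y = delta x y) \<and>
     (\<forall>c. comb c = \<zero>\<^bsub>U\<^esub> \<longrightarrow> (\<forall>x y. (\<Sum>a\<le>N. c a * \<Theta> a x y) = 0)) \<and>
     (\<forall>x y. (\<Sum>h\<in>B x. \<Theta> b x h * \<Theta> b h y) = \<Theta> b x y) \<and>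
     (\<forall>n X x w. mk n X \<in> C n \<longrightarrow> 0 \<le> Re (frm n (B x) X \<Theta> w) \<and> Im (frm n (B x) X \<Theta> w) = 0) \<and>
     (\<forall>n X. (\<forall>a i j. X a j i = cnj (X a i j)) \<longrightarrow> mk n X \<notin> C n \<longrightarrow> (\<exists>x w. Re (frm n (B x) X \<Theta> w) < 0))"

text \<open>The pairs of a representation and one of its indices are numbered by the pairing function; the pairs that
  are out of range form empty blocks.\<close>
lemma faithful_blocks_exist:
  assumes good: "good C" and b: "b \<le> N"
    and ps: "\<And>n. proj_step U (g 0) C (g b) n \<subseteq> C n"
  shows "\<exists>B \<Theta>. faithful_blocks C b B \<Theta>"
proof -
  obtain m T where rep: "\<And>j::nat. isrep C b (m j) (T j)" and
    sep: "\<And>n X. (\<forall>a i j. X a j i = cnj (X a i j)) \<Longrightarrow> mk n X \<notin> C n \<Longrightarrow>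
       (\<exists>j v. Re (frm n {..<m j} X (T j) v) < 0)"
    using countable_separating_reps[OF good b ps] by blast
  define jj where "jj x = fst (prod_decode x)" for x
  define rr where "rr x = snd (prod_decode x)" for x
  define en where "en j r = prod_encode (j, r)" for j r
  have en: "jj (en j r) = j" "rr (en j r) = r" "en (jj x) (rr x) = x" for j r x
    by (simp_all add: jj_def rr_def en_def)
  have inj: "inj_on (en j) S" for j S by (rule inj_onI) (metis en(2))
  define B where "B x = (if rr x < m (jj x) then en (jj x) ` {..<m (jj x)} else {})" for x
  define \<Theta> where "\<Theta> a x y = (if y \<in> B x then T (jj x) a (rr x) (rr y) else 0)" for a x y
  have memB: "y \<in> B x \<longleftrightarrow> rr x < m (jj x) \<and> jj y = jj x \<and> rr y < m (jj x)" for x y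
    unfolding B_def using en by (auto simp: image_iff) (metis en(3) lessThan_iff)
  have Bfin: "finite (B x)" for x by (simp add: B_def)
  have Beq: "B y = B x" if "y \<in> B x" for x y using that memB by (auto simp: B_def)
  have bl: "blocks B" by unfold_locales (use Bfin Beq memB in auto)
  have form: "frm n (B x) X \<Theta> w = frm n {..<m (jj x)} X (T (jj x)) (\<lambda>i r. w i (en (jj x) r))"
    if "rr x < m (jj x)" for n x X w
  proof -
    have "sesq (B x) (\<Theta> a) v v' = sesq {..<m (jj x)} (T (jj x) a) (\<lambda>r. v (en (jj x) r)) (\<lambda>r. v' (en (jj x) r))" for a v v'
    proof -
      have "sesq (B x) (\<Theta> a) v v' = sesq {..<m (jj x)} (\<lambda>r s. \<Theta> a (en (jj x) r) (en (jj x) s)) (\<lambda>r. v (en (jj x) r)) (\<lambda>r. v' (en (jj x) r))"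
        unfolding B_def using that by (simp add: sesq_reindex[OF inj])
      also have "\<dots> = sesq {..<m (jj x)} (T (jj x) a) (\<lambda>r. v (en (jj x) r)) (\<lambda>r. v' (en (jj x) r))"
        by (rule sesq_cong) (simp_all add: \<Theta>_def memB en)
      finally show ?thesis .
    qed
    then show ?thesis by (simp add: frm_def)
  qed
  have empty: "frm n (B x) X \<Theta> w = 0" if "\<not> rr x < m (jj x)" for n x X w
    using that by (simp add: B_def frm_def sesq_def)
  have "faithful_blocks C b B \<Theta>"
    unfolding faithful_blocks_def
  proof (intro conjI allI impI)
    show "\<Theta> a x y = 0" if "y \<notin> B x" for a x y using that by (simp add: \<Theta>_def)
    show "\<Theta> 0 x y = delta x y" if y: "y \<in> B x" for x y
    proof -
      have "T (jj x) 0 (rr x) (rr y) = delta (rr x) (rr y)" using rep[of "jj x"] y memB unfolding isrep_def by blast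
      moreover have "x = y \<longleftrightarrow> rr x = rr y" using y memB by (metis en(3))
      ultimately show ?thesis using y by (simp add: \<Theta>_def)
    qed
    show "(\<Sum>a\<le>N. c a * \<Theta> a x y) = 0" if c: "comb c = \<zero>\<^bsub>U\<^esub>" for c x y
    proof (cases "y \<in> B x")
      case True
      then have "(\<Sum>a\<le>N. c a * T (jj x) a (rr x) (rr y)) = 0"
        using rep[of "jj x"] c memB unfolding isrep_def by blast
      then show ?thesis using True by (simp add: \<Theta>_def)
    qed (simp add: \<Theta>_def)
    show "(\<Sum>h\<in>B x. \<Theta> b x h * \<Theta> b h y) = \<Theta> b x y" for x y
    proof (cases "y \<in> B x")
      case True
      then have lt: "rr x < m (jj x)" "rr y < m (jj x)" "jj y = jj x" using memB by auto
      have "(\<Sum>h\<in>B x. \<Theta> b x h * \<Theta> b h y) = (\<Sum>h<m (jj x). \<Theta> b x (en (jj x) h) * \<Theta> b (en (jj x) h) y)"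
        unfolding B_def using lt by (simp add: sum.reindex[OF inj])
      also have "\<dots> = (\<Sum>h<m (jj x). T (jj x) b (rr x) h * T (jj x) b h (rr y))"
        by (intro sum.cong refl) (simp add: \<Theta>_def memB en lt)
      also have "\<dots> = T (jj x) b (rr x) (rr y)" using rep[of "jj x"] lt unfolding isrep_def by blast
      finally show ?thesis using True by (simp add: \<Theta>_def)
    next
      case False
      have "y \<notin> B h" if "h \<in> B x" for h using Beq[OF that] False by simp
      then show ?thesis using False by (simp add: \<Theta>_def)
    qed
    show "0 \<le> Re (frm n (B x) X \<Theta> w)" "Im (frm n (B x) X \<Theta> w) = 0" if X: "mk n X \<in> C n" for n X x w
    proof -
      have "0 \<le> Re (frm n {..<m (jj x)} X (T (jj x)) v) \<and> Im (frm n {..<m (jj x)} X (T (jj x)) v) = 0" for v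
        using rep[of "jj x"] X unfolding isrep_def by blast
      then show "0 \<le> Re (frm n (B x) X \<Theta> w)" "Im (frm n (B x) X \<Theta> w) = 0"
        by (cases "rr x < m (jj x)"; simp add: form empty)+
    qed
    show "\<exists>x w. Re (frm n (B x) X \<Theta> w) < 0" if X: "\<forall>a i j. X a j i = cnj (X a i j)" "mk n X \<notin> C n" for n X
    proof -
      obtain j v where jv: "Re (frm n {..<m j} X (T j) v) < 0" using sep[OF X] by blast
      have m0: "0 < m j" using jv by (cases "m j") (auto simp: frm_def sesq_def)
      have "frm n (B (en j 0)) X \<Theta> (\<lambda>i x. v i (rr x)) = frm n {..<m j} X (T j) v"
        using form[of "en j 0" n X "\<lambda>i x. v i (rr x)"] m0 by (simp add: en)
      then show ?thesis using jv by metis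
    qed
  qed (rule bl)
  then show ?thesis by blast
qed

end

section \<open>C*-algebras of block-diagonal matrices\<close>

context blocks
begin

text \<open>Block-diagonal matrices whose blocks are uniformly bounded: the \<open>\<ell>\<^sup>\<infinity>\<close>-sum of matrix
  algebras.\<close>
definition bcar :: "(nat \<Rightarrow> nat \<Rightarrow> complex) set" where
  "bcar = {a. (\<forall>r s. s \<notin> B r \<longrightarrow> a r s = 0) \<and> (\<exists>c\<ge>0. \<forall>r. bd (B r) a c)}"

definition bmul :: "(nat \<Rightarrow> nat \<Rightarrow> complex) \<Rightarrow> (nat \<Rightarrow> nat \<Rightarrow> complex) \<Rightarrow> nat \<Rightarrow> nat \<Rightarrow> complex" where
  "bmul a b r t = kmult (B r) a b r t"

definition bone :: "nat \<Rightarrow> nat \<Rightarrow> complex" where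
  "bone r s = (if s \<in> B r then delta r s else 0)"

definition bnorm :: "(nat \<Rightarrow> nat \<Rightarrow> complex) \<Rightarrow> real" where
  "bnorm a = Inf {c. 0 \<le> c \<and> (\<forall>r. bd (B r) a c)}"

lemma B_self: "s \<in> B r \<Longrightarrow> r \<in> B r"
  using B_sym B_eq by blast

lemma bcarI: "(\<And>r s. s \<notin> B r \<Longrightarrow> a r s = 0) \<Longrightarrow> 0 \<le> c \<Longrightarrow> (\<And>r. bd (B r) a c) \<Longrightarrow> a \<in> bcar"
  unfolding bcar_def by blast

lemma bcar_supp: "a \<in> bcar \<Longrightarrow> s \<notin> B r \<Longrightarrow> a r s = 0"
  unfolding bcar_def by blast

lemma bnorm_nonneg: "0 \<le> bnorm a" if "a \<in> bcar"
proof -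
  have "{c. 0 \<le> c \<and> (\<forall>r. bd (B r) a c)} \<noteq> {}" using that unfolding bcar_def by blast
  then show ?thesis unfolding bnorm_def by (rule cInf_greatest) simp
qed

lemma bnorm_le: "0 \<le> c \<Longrightarrow> (\<And>r. bd (B r) a c) \<Longrightarrow> bnorm a \<le> c"
  unfolding bnorm_def by (rule cInf_lower) (auto intro: bdd_belowI[of _ 0])

lemma bnorm_bd:
  assumes a: "a \<in> bcar" shows "bd (B r) a (bnorm a)"
  unfolding bd_def
proof
  fix v
  let ?S = "{c. 0 \<le> c \<and> (\<forall>r. bd (B r) a c)}"
  have ne: "?S \<noteq> {}" using a unfolding bcar_def by blast
  have le: "l2 (B r) (kapp (B r) a v) \<le> c * l2 (B r) v" if "c \<in> ?S" for c using that by (simp add: bd_def)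
  show "l2 (B r) (kapp (B r) a v) \<le> bnorm a * l2 (B r) v"
  proof (cases "l2 (B r) v = 0")
    case True
    then show ?thesis using le ne by auto
  next
    case False
    then have pos: "0 < l2 (B r) v" using l2_nonneg[of "B r" v] by simp
    have "l2 (B r) (kapp (B r) a v) / l2 (B r) v \<le> Inf ?S"
      by (rule cInf_greatest[OF ne]) (use le pos in \<open>simp add: pos_divide_le_eq\<close>)
    then show ?thesis using pos by (simp add: bnorm_def pos_divide_le_eq)
  qed
qed

lemma bnorm_entry: "a \<in> bcar \<Longrightarrow> cmod (a r s) \<le> bnorm a"
proof -
  assume a: "a \<in> bcar"
  show ?thesis
  proof (cases "s \<in> B r")
    case True
    show ?thesis by (rule bd_entry[OF bnorm_bd[OF a] B_finite B_self[OF True] True])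
  qed (simp add: bcar_supp[OF a] bnorm_nonneg[OF a])
qed

lemma bmul_cong_block: "s \<in> B r \<Longrightarrow> bmul a b s t = kmult (B r) a b s t"
  by (simp add: bmul_def B_eq)

lemma bd_bmul: "bd (B r) (bmul a b) c = bd (B r) (kmult (B r) a b) c"
  by (rule bd_cong) (simp add: bmul_cong_block)

lemma bcar_zero: "(\<lambda>r s. 0) \<in> bcar"
  by (rule bcarI[of _ 0]) (simp_all add: bd_zero)

lemma bcar_add: "a \<in> bcar \<Longrightarrow> b \<in> bcar \<Longrightarrow> (\<lambda>r s. a r s + b r s) \<in> bcar"
  by (rule bcarI[of _ "bnorm a + bnorm b"]) (simp_all add: bcar_supp bnorm_nonneg bd_add bnorm_bd)

lemma bcar_scale: "a \<in> bcar \<Longrightarrow> (\<lambda>r s. z * a r s) \<in> bcar"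
  by (rule bcarI[of _ "cmod z * bnorm a"]) (simp_all add: bcar_supp bnorm_nonneg bd_scale bnorm_bd)

lemma bcar_diff: "a \<in> bcar \<Longrightarrow> b \<in> bcar \<Longrightarrow> (\<lambda>r s. a r s - b r s) \<in> bcar"
  using bcar_add[of a "\<lambda>r s. (-1) * b r s"] bcar_scale[of b "-1"] by simp

lemma bmul_supp: "a \<in> bcar \<Longrightarrow> b \<in> bcar \<Longrightarrow> t \<notin> B r \<Longrightarrow> bmul a b r t = 0"
  unfolding bmul_def kmult_def using bcar_supp[of b] B_eq by (intro sum.neutral) auto

lemma bd_mul_norm: "a \<in> bcar \<Longrightarrow> b \<in> bcar \<Longrightarrow> bd (B r) (bmul a b) (bnorm a * bnorm b)"
  unfolding bd_bmul by (intro bd_mult bnorm_bd bnorm_nonneg)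

lemma bcar_mul: "a \<in> bcar \<Longrightarrow> b \<in> bcar \<Longrightarrow> bmul a b \<in> bcar"
  by (rule bcarI[of _ "bnorm a * bnorm b"]) (simp_all add: bmul_supp bnorm_nonneg bd_mul_norm)

lemma bd_delta:
  assumes S: "finite S" shows "bd S delta 1"
  unfolding bd_def
proof
  fix v
  have "l2 S (kapp S delta v) = l2 S v"
  proof (rule l2_cong)
    fix r assume "r \<in> S"
    have "kapp S delta v r = (\<Sum>s\<in>S. if s = r then v r else 0)"
      unfolding kapp_def by (intro sum.cong refl) auto
    then show "kapp S delta v r = v r" using S \<open>r \<in> S\<close> by simp
  qed
  then show "l2 S (kapp S delta v) \<le> 1 * l2 S v" by simp
qed

lemma bcar_one: "bone \<in> bcar"
proof (rule bcarI[of _ 1])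
  fix r
  have "bd (B r) bone 1 = bd (B r) delta 1"
    by (rule bd_cong) (simp add: bone_def B_eq)
  then show "bd (B r) bone 1" using bd_delta[OF B_finite] by simp
qed (simp_all add: bone_def)

lemma bcar_adj: "a \<in> bcar \<Longrightarrow> kadj a \<in> bcar"
proof (rule bcarI[of _ "bnorm a"])
  assume a: "a \<in> bcar"
  show "kadj a r s = 0" if "s \<notin> B r" for r s using bcar_supp[OF a, of r s] that B_sym by (auto simp: kadj_def)
  show "0 \<le> bnorm a" by (rule bnorm_nonneg[OF a])
  show "bd (B r) (kadj a) (bnorm a)" for r by (intro bd_adj bnorm_bd a bnorm_nonneg)
qed

lemma bmul_assoc: "bmul (bmul a b) c = bmul a (bmul b c)"
proof (intro ext)
  fix r t
  have "bmul (bmul a b) c r t = (\<Sum>s\<in>B r. \<Sum>u\<in>B r. a r u * b u s * c s t)"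
    by (simp add: bmul_def[of _ c] kmult_def bmul_cong_block sum_distrib_right bmul_def)
  also have "\<dots> = (\<Sum>u\<in>B r. \<Sum>s\<in>B r. a r u * b u s * c s t)" by (rule sum.swap)
  also have "\<dots> = bmul a (bmul b c) r t"
    unfolding bmul_def[of a] kmult_def[of _ a]
    by (intro sum.cong refl) (simp add: bmul_cong_block kmult_def sum_distrib_left mult.assoc)
  finally show "bmul (bmul a b) c r t = bmul a (bmul b c) r t" .
qed

lemma bmul_one_left: "a \<in> bcar \<Longrightarrow> bmul bone a = a"
proof (intro ext)
  fix r t assume a: "a \<in> bcar"
  have "bmul bone a r t = (\<Sum>s\<in>B r. if s = r then a r t else 0)"
    unfolding bmul_def kmult_def by (intro sum.cong refl) (auto simp: bone_def)
  also have "\<dots> = a r t" using bcar_supp[OF a, of t r] B_self[of t r] B_finite[of r] by auto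
  finally show "bmul bone a r t = a r t" .
qed

lemma bmul_one_right: "a \<in> bcar \<Longrightarrow> bmul a bone = a"
proof (intro ext)
  fix r t assume a: "a \<in> bcar"
  have "bmul a bone r t = (\<Sum>s\<in>B r. if s = t then a r t else 0)"
    unfolding bmul_def kmult_def by (intro sum.cong refl) (auto simp: bone_def B_eq)
  also have "\<dots> = a r t" using bcar_supp[OF a, of t r] B_finite[of r] by auto
  finally show "bmul a bone r t = a r t" .
qed

lemma bmul_add_left: "bmul (\<lambda>r s. a r s + b r s) c = (\<lambda>r s. bmul a c r s + bmul b c r s)"
  and bmul_add_right: "bmul a (\<lambda>r s. b r s + c r s) = (\<lambda>r s. bmul a b r s + bmul a c r s)"
  and bmul_scale_left: "bmul (\<lambda>r s. z * a r s) b = (\<lambda>r s. z * bmul a b r s)"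
  and bmul_scale_right: "bmul a (\<lambda>r s. z * b r s) = (\<lambda>r s. z * bmul a b r s)"
  by (simp_all add: fun_eq_iff bmul_def kmult_def algebra_simps sum.distrib sum_distrib_left)

lemma kadj_bmul: "a \<in> bcar \<Longrightarrow> b \<in> bcar \<Longrightarrow> kadj (bmul a b) = bmul (kadj b) (kadj a)"
proof (intro ext)
  fix r t assume ab: "a \<in> bcar" "b \<in> bcar"
  show "kadj (bmul a b) r t = bmul (kadj b) (kadj a) r t"
  proof (cases "t \<in> B r")
    case True
    then show ?thesis by (simp add: kadj_def bmul_def kmult_def B_eq mult.commute)
  next
    case False
    then have "r \<notin> B t" using B_sym by blast
    then show ?thesis using bmul_supp[OF ab, of r t] bmul_supp[OF bcar_adj bcar_adj, OF ab(2,1) False]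
      by (simp add: kadj_def)
  qed
qed

lemma bnorm_zero_iff: "a \<in> bcar \<Longrightarrow> bnorm a = 0 \<longleftrightarrow> a = (\<lambda>r s. 0)"
proof
  assume a: "a \<in> bcar"
  show "a = (\<lambda>r s. 0)" if "bnorm a = 0"
    using bnorm_entry[OF a] that by (simp add: fun_eq_iff)
  show "bnorm a = 0" if "a = (\<lambda>r s. 0)"
    using bnorm_le[of 0 a] bnorm_nonneg[OF a] that by (simp add: bd_zero)
qed

lemma bnorm_scale: "a \<in> bcar \<Longrightarrow> bnorm (\<lambda>r s. z * a r s) = cmod z * bnorm a"
proof -
  have le: "bnorm (\<lambda>r s. z * a r s) \<le> cmod z * bnorm a" if "a \<in> bcar" for a z
    using that by (intro bnorm_le) (simp_all add: bnorm_nonneg bd_scale bnorm_bd)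
  assume a: "a \<in> bcar"
  show ?thesis
  proof (cases "z = 0")
    case True
    then show ?thesis using bnorm_zero_iff[OF bcar_zero] by simp
  next
    case False
    have "bnorm a \<le> cmod (1 / z) * bnorm (\<lambda>r s. z * a r s)"
      using le[OF bcar_scale[OF a, of z], of "1 / z"] False by simp
    then have "cmod z * bnorm a \<le> bnorm (\<lambda>r s. z * a r s)" using False by (simp add: norm_divide field_simps)
    then show ?thesis using le[OF a, of z] by simp
  qed
qed

lemma bnorm_add: "a \<in> bcar \<Longrightarrow> b \<in> bcar \<Longrightarrow> bnorm (\<lambda>r s. a r s + b r s) \<le> bnorm a + bnorm b"
  by (intro bnorm_le bd_add bnorm_bd) (simp_all add: bnorm_nonneg)

lemma bnorm_mul: "a \<in> bcar \<Longrightarrow> b \<in> bcar \<Longrightarrow> bnorm (bmul a b) \<le> bnorm a * bnorm b"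
  by (intro bnorm_le bd_mul_norm) (simp_all add: bnorm_nonneg)

lemma bnorm_cstar: "a \<in> bcar \<Longrightarrow> bnorm (bmul (kadj a) a) = (bnorm a)\<^sup>2"
proof (rule antisym)
  assume a: "a \<in> bcar"
  note a' = bcar_adj[OF a] and nn = bnorm_nonneg[OF a]
  have "bnorm (kadj a) \<le> bnorm a" by (intro bnorm_le bd_adj bnorm_bd a nn)
  then have "bnorm (kadj a) * bnorm a \<le> bnorm a * bnorm a" using nn by (rule mult_right_mono)
  then show "bnorm (bmul (kadj a) a) \<le> (bnorm a)\<^sup>2"
    using bnorm_mul[OF a' a] by (simp add: power2_eq_square)
  let ?n = "bnorm (bmul (kadj a) a)"
  have n0: "0 \<le> ?n" by (rule bnorm_nonneg[OF bcar_mul[OF a' a]])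
  have "bnorm a \<le> sqrt ?n"
  proof (rule bnorm_le)
    fix r
    have "bd (B r) (kmult (B r) (kadj a) a) ((sqrt ?n)\<^sup>2)"
      using bnorm_bd[OF bcar_mul[OF a' a], of r] n0 by (simp add: bd_bmul)
    then show "bd (B r) a (sqrt ?n)" by (rule bd_cstar) (simp add: n0)
  qed (simp add: n0)
  then show "(bnorm a)\<^sup>2 \<le> ?n" using nn n0 by (metis power_mono real_sqrt_pow2)
qed

text \<open>Entries converge because they are bounded by the norm, and bounds on the blocks survive entrywise limits.\<close>
lemma bcar_complete:
  assumes f: "\<And>n. f n \<in> bcar"
    and cau: "\<And>e. 0 < e \<Longrightarrow> \<exists>K. \<forall>m\<ge>K. \<forall>n\<ge>K. bnorm (\<lambda>r s. f m r s - f n r s) < e"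
  shows "\<exists>a\<in>bcar. (\<lambda>n. bnorm (\<lambda>r s. f n r s - a r s)) \<longlonglongrightarrow> 0"
proof -
  have "Cauchy (\<lambda>n. f n r s)" for r s
    unfolding Cauchy_def
  proof (intro allI impI)
    fix e :: real assume "0 < e"
    then obtain K where K: "\<forall>m\<ge>K. \<forall>n\<ge>K. bnorm (\<lambda>r s. f m r s - f n r s) < e" using cau by blast
    have "dist (f m r s) (f n r s) < e" if "K \<le> m" "K \<le> n" for m n
      using bnorm_entry[OF bcar_diff[OF f f], of m r s n] K that by (fastforce simp: dist_norm)
    then show "\<exists>K. \<forall>m\<ge>K. \<forall>n\<ge>K. dist (f m r s) (f n r s) < e" by blast
  qed
  then have "\<forall>r s. \<exists>L. (\<lambda>n. f n r s) \<longlonglongrightarrow> L" using Cauchy_convergent convergent_def by blast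
  then obtain a where a: "\<And>r s. (\<lambda>n. f n r s) \<longlonglongrightarrow> a r s" by metis
  have close: "\<exists>K. \<forall>m\<ge>K. \<forall>r. bd (B r) (\<lambda>r s. f m r s - a r s) e" if e: "0 < e" for e
  proof -
    obtain K where K: "\<forall>m\<ge>K. \<forall>n\<ge>K. bnorm (\<lambda>r s. f m r s - f n r s) < e" using cau[OF e] by blast
    have "bd (B r) (\<lambda>r s. f m r s - a r s) e" if m: "K \<le> m" for m r
    proof (rule bd_lim[where f = "\<lambda>n r s. f m r s - f n r s"])
      show "(\<lambda>n. f m r s - f n r s) \<longlonglongrightarrow> f m r s - a r s" for r s by (intro tendsto_intros a)
      show "\<forall>\<^sub>F n in sequentially. bd (B r) (\<lambda>r s. f m r s - f n r s) e"
        unfolding eventually_sequentially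
      proof (intro exI allI impI)
        fix n assume "K \<le> n"
        then have "bnorm (\<lambda>r s. f m r s - f n r s) \<le> e" using K m less_imp_le by blast
        then show "bd (B r) (\<lambda>r s. f m r s - f n r s) e" by (rule bd_mono[OF bnorm_bd[OF bcar_diff[OF f f]]])
      qed
    qed
    then show ?thesis by blast
  qed
  have supp: "a r s = 0" if "s \<notin> B r" for r s
    using a[of r s] bcar_supp[OF f that] by (simp add: LIMSEQ_const_iff)
  obtain K where K: "\<And>r. bd (B r) (\<lambda>r s. f K r s - a r s) 1" using close[of 1] by auto
  have "(\<lambda>r s. f K r s - a r s) \<in> bcar"
    by (rule bcarI[of _ 1]) (simp_all add: supp bcar_supp[OF f] K)
  from bcar_diff[OF f this, of K] have ac: "a \<in> bcar" by simp
  have "(\<lambda>n. bnorm (\<lambda>r s. f n r s - a r s)) \<longlonglongrightarrow> 0"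
  proof (rule LIMSEQ_I)
    fix e :: real assume "0 < e"
    then obtain K where K: "\<forall>m\<ge>K. \<forall>r. bd (B r) (\<lambda>r s. f m r s - a r s) (e/2)" using close[of "e/2"] by auto
    have "norm (bnorm (\<lambda>r s. f n r s - a r s) - 0) < e" if "K \<le> n" for n
      using bnorm_le[of "e/2" "\<lambda>r s. f n r s - a r s"] bnorm_nonneg[OF bcar_diff[OF f ac], of n] K that \<open>0 < e\<close> by force
    then show "\<exists>no. \<forall>n\<ge>no. norm (bnorm (\<lambda>r s. f n r s - a r s) - 0) < e" by blast
  qed
  with ac show ?thesis by blast
qed

text \<open>Unital norm-closed *-subalgebras of the block-diagonal matrices.\<close>
definition closedalg :: "(nat \<Rightarrow> nat \<Rightarrow> complex) set \<Rightarrow> bool" where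
  "closedalg X \<longleftrightarrow> X \<subseteq> bcar \<and> (\<lambda>r s. 0) \<in> X \<and> bone \<in> X \<and>
     (\<forall>a\<in>X. \<forall>b\<in>X. (\<lambda>r s. a r s + b r s) \<in> X \<and> bmul a b \<in> X) \<and>
     (\<forall>z. \<forall>a\<in>X. (\<lambda>r s. z * a r s) \<in> X) \<and> (\<forall>a\<in>X. kadj a \<in> X) \<and>
     (\<forall>f::nat \<Rightarrow> _. \<forall>a\<in>bcar. range f \<subseteq> X \<longrightarrow> (\<lambda>n. bnorm (\<lambda>r s. f n r s - a r s)) \<longlonglongrightarrow> 0 \<longrightarrow> a \<in> X)"

lemma closedalg_bcar: "closedalg bcar"
  unfolding closedalg_def using bcar_zero bcar_one bcar_add bcar_mul bcar_scale bcar_adj by auto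

definition balg :: "(nat \<Rightarrow> nat \<Rightarrow> complex) set \<Rightarrow> (nat \<Rightarrow> nat \<Rightarrow> complex) normed_star_space" where
  "balg X = \<lparr>carrier = X, mult = bmul, one = bone, zero = (\<lambda>r s. 0),
     add = (\<lambda>a b r s. a r s + b r s), smult = (\<lambda>z a r s. z * a r s), star = kadj, cnorm = bnorm\<rparr>"

lemma balg_simps [simp]:
  "carrier (balg X) = X" "mult (balg X) = bmul" "one (balg X) = bone" "zero (balg X) = (\<lambda>r s. 0)"
  "add (balg X) = (\<lambda>a b r s. a r s + b r s)" "smult (balg X) = (\<lambda>z a r s. z * a r s)"
  "star (balg X) = kadj" "cnorm (balg X) = bnorm"
  by (simp_all add: balg_def)

context
  fixes X assumes X: "closedalg X"
begin

lemma closedalg_sub: "a \<in> X \<Longrightarrow> a \<in> bcar"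
  and closedalg_zero: "(\<lambda>r s. 0) \<in> X" and closedalg_one: "bone \<in> X"
  and closedalg_add: "a \<in> X \<Longrightarrow> b \<in> X \<Longrightarrow> (\<lambda>r s. a r s + b r s) \<in> X"
  and closedalg_mul: "a \<in> X \<Longrightarrow> b \<in> X \<Longrightarrow> bmul a b \<in> X"
  and closedalg_scale: "a \<in> X \<Longrightarrow> (\<lambda>r s. z * a r s) \<in> X"
  and closedalg_adj: "a \<in> X \<Longrightarrow> kadj a \<in> X"
  using X unfolding closedalg_def by (blast+)

lemma closedalg_lim: "range f \<subseteq> X \<Longrightarrow> a \<in> bcar \<Longrightarrow> (\<lambda>n. bnorm (\<lambda>r s. f n r s - a r s)) \<longlonglongrightarrow> 0 \<Longrightarrow> a \<in> X"
  using X unfolding closedalg_def by blast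

lemma balg_abelian_group: "abelian_group (balg X)"
proof (rule abelian_groupI)
  fix a assume "a \<in> carrier (balg X)"
  then show "\<exists>b\<in>carrier (balg X). b \<oplus>\<^bsub>balg X\<^esub> a = \<zero>\<^bsub>balg X\<^esub>"
    using closedalg_scale[of a "-1"] by (intro bexI[of _ "\<lambda>r s. (-1) * a r s"]) (simp_all add: fun_eq_iff)
qed (simp_all add: closedalg_add closedalg_zero add_ac)

lemma balg_minus: "a \<in> X \<Longrightarrow> b \<in> X \<Longrightarrow> a \<ominus>\<^bsub>balg X\<^esub> b = (\<lambda>r s. a r s - b r s)"
proof -
  assume ab: "a \<in> X" "b \<in> X"
  interpret abelian_group "balg X" by (rule balg_abelian_group)
  have "\<ominus>\<^bsub>balg X\<^esub> b = (\<lambda>r s. (-1) * b r s)"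
    by (rule minus_equality) (use ab closedalg_scale[of b "-1"] in \<open>simp_all add: fun_eq_iff\<close>)
  then show ?thesis by (simp add: a_minus_def)
qed

lemma balg_finsum: "finite K \<Longrightarrow> (\<And>k. k \<in> K \<Longrightarrow> F k \<in> X) \<Longrightarrow>
    (\<Oplus>\<^bsub>balg X\<^esub>k\<in>K. F k) = (\<lambda>r s. \<Sum>k\<in>K. F k r s)"
proof (induction K rule: finite_induct)
  case empty
  interpret abelian_group "balg X" by (rule balg_abelian_group)
  show ?case by simp
next
  case (insert k K)
  interpret abelian_group "balg X" by (rule balg_abelian_group)
  have "F \<in> K \<rightarrow> carrier (balg X)" "F k \<in> carrier (balg X)" using insert by auto
  then show ?case using insert by (simp add: finsum_insert)
qed

lemma balg_ring: "ring (balg X)"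
proof (rule ringI[OF balg_abelian_group])
  show "Group.monoid (balg X)"
    by (rule monoidI) (simp_all add: closedalg_mul closedalg_one bmul_assoc bmul_one_left bmul_one_right closedalg_sub)
qed (simp_all add: bmul_add_left bmul_add_right)

lemma balg_star_vector_space: "star_vector_space (balg X)"
proof -
  have "Module.module class_ring (balg X)"
    by (rule Module.moduleI[OF _ balg_abelian_group])
      (simp_all add: class_cring.is_cring closedalg_scale fun_eq_iff algebra_simps)
  then have "vectorspace class_ring (balg X)" by (simp add: vectorspace_def class_field)
  then show ?thesis unfolding star_vector_space_def
    by (simp add: closedalg_adj kadj_kadj) (simp add: kadj_def fun_eq_iff)
qed

lemma balg_cstar: "cstar_algebra (balg X)"
  unfolding cstar_algebra_def
proof (intro conjI)
  show "ring (balg X)" by (rule balg_ring)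
  show "star_vector_space (balg X)" by (rule balg_star_vector_space)
  show "\<forall>\<sigma>::nat \<Rightarrow> _. range \<sigma> \<subseteq> carrier (balg X) \<longrightarrow>
     (\<forall>\<epsilon>>0. \<exists>K. \<forall>m\<ge>K. \<forall>n\<ge>K. cnorm (balg X) (\<sigma> m \<ominus>\<^bsub>balg X\<^esub> \<sigma> n) < \<epsilon>) \<longrightarrow>
     (\<exists>x\<in>carrier (balg X). (\<lambda>n. cnorm (balg X) (\<sigma> n \<ominus>\<^bsub>balg X\<^esub> x)) \<longlonglongrightarrow> 0)"
  proof (intro allI impI)
    fix f :: "nat \<Rightarrow> nat \<Rightarrow> nat \<Rightarrow> complex" assume f: "range f \<subseteq> carrier (balg X)"
      and cau: "\<forall>\<epsilon>>0. \<exists>K. \<forall>m\<ge>K. \<forall>n\<ge>K. cnorm (balg X) (f m \<ominus>\<^bsub>balg X\<^esub> f n) < \<epsilon>"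
    have fX: "f n \<in> X" for n using f by auto
    have "\<exists>a\<in>bcar. (\<lambda>n. bnorm (\<lambda>r s. f n r s - a r s)) \<longlonglongrightarrow> 0"
      by (rule bcar_complete) (use cau fX in \<open>simp_all add: closedalg_sub balg_minus\<close>)
    then obtain a where a: "a \<in> bcar" "(\<lambda>n. bnorm (\<lambda>r s. f n r s - a r s)) \<longlonglongrightarrow> 0" by blast
    have aX: "a \<in> X" by (rule closedalg_lim[OF _ a]) (use f in simp)
    then show "\<exists>x\<in>carrier (balg X). (\<lambda>n. cnorm (balg X) (f n \<ominus>\<^bsub>balg X\<^esub> x)) \<longlonglongrightarrow> 0"
      using a(2) fX by (intro bexI[of _ a]) (simp_all add: balg_minus)
  qed
qed (simp_all add: bmul_scale_left bmul_scale_right kadj_bmul closedalg_sub bnorm_nonneg bnorm_zero_iff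
      bnorm_scale bnorm_add bnorm_mul bnorm_cstar)

end

text \<open>The C*-algebra generated by \<open>S\<close> and the unit.\<close>
definition galg :: "(nat \<Rightarrow> nat \<Rightarrow> complex) set \<Rightarrow> (nat \<Rightarrow> nat \<Rightarrow> complex) set" where
  "galg S = \<Inter>{X. closedalg X \<and> S \<subseteq> X}"

lemma galg_closedalg: "S \<subseteq> bcar \<Longrightarrow> closedalg (galg S)"
proof -
  assume S: "S \<subseteq> bcar"
  then have sub: "galg S \<subseteq> bcar" unfolding galg_def using closedalg_bcar by blast
  have I: "a \<in> galg S" if "\<And>X. closedalg X \<Longrightarrow> S \<subseteq> X \<Longrightarrow> a \<in> X" for a using that unfolding galg_def by blast
  have D: "a \<in> X" if "a \<in> galg S" "closedalg X" "S \<subseteq> X" for a X using that unfolding galg_def by blast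
  have zero: "(\<lambda>r s. 0) \<in> galg S" by (rule I) (rule closedalg_zero)
  have one: "bone \<in> galg S" by (rule I) (rule closedalg_one)
  have add: "(\<lambda>r s. a r s + b r s) \<in> galg S" if "a \<in> galg S" "b \<in> galg S" for a b
    by (rule I) (rule closedalg_add[OF _ D[OF that(1)] D[OF that(2)]])
  have mul: "bmul a b \<in> galg S" if "a \<in> galg S" "b \<in> galg S" for a b
    by (rule I) (rule closedalg_mul[OF _ D[OF that(1)] D[OF that(2)]])
  have scale: "(\<lambda>r s. z * a r s) \<in> galg S" if "a \<in> galg S" for a z
    by (rule I) (rule closedalg_scale[OF _ D[OF that]])
  have adj: "kadj a \<in> galg S" if "a \<in> galg S" for a
    by (rule I) (rule closedalg_adj[OF _ D[OF that]])
  have lim: "a \<in> galg S" if "a \<in> bcar" "range f \<subseteq> galg S" "(\<lambda>n. bnorm (\<lambda>r s. f n r s - a r s)) \<longlonglongrightarrow> 0"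
    for a and f :: "nat \<Rightarrow> nat \<Rightarrow> nat \<Rightarrow> complex"
  proof (rule I)
    fix X assume X: "closedalg X" "S \<subseteq> X"
    have "range f \<subseteq> X" using that(2) X unfolding galg_def by blast
    then show "a \<in> X" by (rule closedalg_lim[OF X(1) _ that(1,3)])
  qed
  show ?thesis unfolding closedalg_def
    using sub zero one add mul scale adj lim by (intro conjI allI ballI impI)
qed

text \<open>A closed *-subalgebra of the generated algebra is closed in the whole algebra. It contains the unit since \<open>S\<close> does, so it
  competes in the intersection.\<close>
lemma galg_generates:
  assumes S: "S \<subseteq> bcar" and one: "bone \<in> S"
  shows "generates (balg (galg S)) S"
  unfolding generates_def
proof (intro conjI allI impI)
  have SG: "S \<subseteq> galg S" unfolding galg_def by blast
  then show "S \<subseteq> carrier (balg (galg S))" by simp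
  note G = galg_closedalg[OF S]
  fix Y assume Y: "cstar_subalgebra (balg (galg S)) Y" and SY: "S \<subseteq> Y"
  have YG: "Y \<subseteq> galg S" using Y by (simp add: cstar_subalgebra_def)
  have "closedalg Y" unfolding closedalg_def
  proof (intro conjI)
    show "Y \<subseteq> bcar" using YG closedalg_sub[OF G] by blast
    show "bone \<in> Y" using one SY by blast
    show "\<forall>f::nat \<Rightarrow> _. \<forall>a\<in>bcar. range f \<subseteq> Y \<longrightarrow> (\<lambda>n. bnorm (\<lambda>r s. f n r s - a r s)) \<longlonglongrightarrow> 0 \<longrightarrow> a \<in> Y"
    proof (intro allI ballI impI)
      fix f a assume a: "a \<in> bcar" and f: "range f \<subseteq> Y" and lim: "(\<lambda>n. bnorm (\<lambda>r s. f n r s - a r s)) \<longlonglongrightarrow> 0"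
      have aG: "a \<in> galg S" by (rule closedalg_lim[OF G _ a lim]) (use f YG in blast)
      have "f n \<in> galg S" for n using f YG by blast
      then have "(\<lambda>n. cnorm (balg (galg S)) (f n \<ominus>\<^bsub>balg (galg S)\<^esub> a)) \<longlonglongrightarrow> 0"
        using lim aG by (simp add: balg_minus[OF G])
      then show "a \<in> Y" using Y f aG unfolding cstar_subalgebra_def by simp
    qed
  qed (use Y in \<open>simp_all add: cstar_subalgebra_def\<close>)
  then have "galg S \<subseteq> Y" unfolding galg_def using SY by blast
  then show "Y = carrier (balg (galg S))" using YG by auto
qed

end

section \<open>A C*-cover containing a projection\<close>

lemma bd_sum:
  assumes "finite K" "\<And>k. k \<in> K \<Longrightarrow> bd S (F k) (c k)"
  shows "bd S (\<lambda>r s. \<Sum>k\<in>K. F k r s) (\<Sum>k\<in>K. c k)"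
  using assms by (induction K rule: finite_induct) (simp_all add: bd_zero bd_add)

lemma sum_times: "finite I \<Longrightarrow> finite J \<Longrightarrow> sum f (I \<times> J) = (\<Sum>i\<in>I. \<Sum>r\<in>J. f (i, r))"
  by (simp add: sum.cartesian_product)

lemma sesq_times:
  assumes "finite I" "finite J"
  shows "sesq (I \<times> J) q v w = (\<Sum>i\<in>I. \<Sum>j\<in>I. sesq J (\<lambda>r s. q (i, r) (j, s)) (\<lambda>r. v (i, r)) (\<lambda>s. w (j, s)))"
  unfolding sesq_def sum_times[OF assms]
  by (rule sum.cong[OF refl], rule sum.swap)

lemma sesq_sum_kernel:
  "sesq S (\<lambda>r s. \<Sum>a\<in>K. c a * T a r s) v w = (\<Sum>a\<in>K. c a * sesq S (T a) v w)"
proof -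
  have "sesq S (\<lambda>r s. \<Sum>a\<in>K. c a * T a r s) v w = (\<Sum>r\<in>S. \<Sum>s\<in>S. \<Sum>a\<in>K. c a * (cnj (v r) * T a r s * w s))"
    by (simp add: sesq_def sum_distrib_left sum_distrib_right mult_ac)
  also have "\<dots> = (\<Sum>r\<in>S. \<Sum>a\<in>K. \<Sum>s\<in>S. c a * (cnj (v r) * T a r s * w s))"
    by (intro sum.cong refl sum.swap)
  also have "\<dots> = (\<Sum>a\<in>K. \<Sum>r\<in>S. \<Sum>s\<in>S. c a * (cnj (v r) * T a r s * w s))"
    by (rule sum.swap)
  finally show ?thesis by (simp add: sesq_def sum_distrib_left)
qed

lemma bd_sub_block:
  fixes a :: "'a \<times> 'b \<Rightarrow> 'a \<times> 'b \<Rightarrow> complex"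
  assumes "finite I" "finite J" "i \<in> I" "j \<in> I" "bd (I \<times> J) a c"
  shows "bd J (\<lambda>r s. a (i, r) (j, s)) c"
  unfolding bd_def
proof
  fix v :: "'b \<Rightarrow> complex"
  define w where "w p = (if fst p = j then v (snd p) else 0)" for p :: "'a \<times> 'b"
  have sub: "{i} \<times> J \<subseteq> I \<times> J" using assms by auto
  have app: "kapp (I \<times> J) a w (i, r) = kapp J (\<lambda>r s. a (i, r) (j, s)) v r" for r
  proof -
    have "kapp (I \<times> J) a w (i, r) = (\<Sum>j'\<in>I. if j' = j then \<Sum>s\<in>J. a (i, r) (j, s) * v s else 0)"
      unfolding kapp_def sum_times[OF assms(1,2)] by (intro sum.cong refl) (auto simp: w_def)
    then show ?thesis using assms by (simp add: kapp_def)
  qed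
  have lw: "(l2 (I \<times> J) w)\<^sup>2 = (l2 J v)\<^sup>2"
  proof -
    have "(l2 (I \<times> J) w)\<^sup>2 = (\<Sum>j'\<in>I. if j' = j then \<Sum>s\<in>J. (cmod (v s))\<^sup>2 else 0)"
      unfolding l2_sq sum_times[OF assms(1,2)] by (intro sum.cong refl) (auto simp: w_def)
    then show ?thesis using assms by (simp add: l2_sq)
  qed
  then have lw': "l2 (I \<times> J) w = l2 J v" using l2_nonneg by (metis power2_eq_iff_nonneg)
  have "(l2 J (kapp J (\<lambda>r s. a (i, r) (j, s)) v))\<^sup>2 = (\<Sum>p\<in>{i} \<times> J. (cmod (kapp (I \<times> J) a w p))\<^sup>2)"
    unfolding l2_sq using assms(2) by (simp add: sum_times app)
  also have "\<dots> \<le> (l2 (I \<times> J) (kapp (I \<times> J) a w))\<^sup>2"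
    unfolding l2_sq by (rule sum_mono2[OF _ sub]) (use assms in auto)
  finally have "l2 J (kapp J (\<lambda>r s. a (i, r) (j, s)) v) \<le> l2 (I \<times> J) (kapp (I \<times> J) a w)"
    by (rule power2_le_imp_le[OF _ l2_nonneg])
  also have "\<dots> \<le> c * l2 J v" using assms(5) unfolding bd_def lw'[symmetric] by blast
  finally show "l2 J (kapp J (\<lambda>r s. a (i, r) (j, s)) v) \<le> c * l2 J v" .
qed

context gen_space
begin

context
  fixes C b B \<Theta>
  assumes good: "good C" and fb: "faithful_blocks C b B \<Theta>" and bN: "b \<le> N"
    and proper1: "\<And>X. mk 1 X \<in> C 1 \<Longrightarrow> mk 1 (\<lambda>a i j. - X a i j) \<in> C 1 \<Longrightarrow> mk 1 X = mk 1 (\<lambda>a i j. 0)"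
begin

interpretation bl: blocks B using fb by (simp add: faithful_blocks_def)

lemma fb_supp: "y \<notin> B x \<Longrightarrow> \<Theta> a x y = 0"
  and fb_unit: "y \<in> B x \<Longrightarrow> \<Theta> 0 x y = delta x y"
  and fb_null: "comb c = \<zero>\<^bsub>U\<^esub> \<Longrightarrow> (\<Sum>a\<le>N. c a * \<Theta> a x y) = 0"
  and fb_proj: "(\<Sum>h\<in>B x. \<Theta> b x h * \<Theta> b h y) = \<Theta> b x y"
  and fb_pos: "mk n X \<in> C n \<Longrightarrow> 0 \<le> Re (frm n (B x) X \<Theta> w)"
  and fb_real: "mk n X \<in> C n \<Longrightarrow> Im (frm n (B x) X \<Theta> w) = 0"
  and fb_sep: "(\<And>a i j. X a j i = cnj (X a i j)) \<Longrightarrow> mk n X \<notin> C n \<Longrightarrow> \<exists>x w. Re (frm n (B x) X \<Theta> w) < 0"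
  using fb unfolding faithful_blocks_def by blast+

text \<open>The image of the element with coefficients \<open>c\<close> under the direct sum of the representations.\<close>
definition th :: "(nat \<Rightarrow> complex) \<Rightarrow> nat \<Rightarrow> nat \<Rightarrow> complex" where
  "th c r s = (\<Sum>a\<le>N. c a * \<Theta> a r s)"

lemma th_add: "th (\<lambda>a. c a + d a) = (\<lambda>r s. th c r s + th d r s)"
  and th_scale: "th (\<lambda>a. z * c a) = (\<lambda>r s. z * th c r s)"
  by (simp_all add: th_def fun_eq_iff distrib_right sum.distrib sum_distrib_left mult.assoc)

lemma psd_th: "mk 1 (\<lambda>a i j. c a) \<in> C 1 \<Longrightarrow> psd (B x) (th c)"
  unfolding th_def[abs_def] by (rule psd_of_positive_form[OF bl.B_finite]) (simp add: fb_pos fb_real)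

lemma th_ev: "a \<le> N \<Longrightarrow> th (ev a) = \<Theta> a"
  by (simp add: th_def fun_eq_iff sum_ev)

lemma psd_Theta: "a \<le> N \<Longrightarrow> psd (B x) (\<Theta> a)"
  using psd_th[OF goodD(2)[OF good]] th_ev by simp

lemma bd_Theta: "a \<le> N \<Longrightarrow> bd (B x) (\<Theta> a) 1"
proof (rule psd_contraction[OF bl.B_finite])
  assume a: "a \<le> N"
  show "psd (B x) (\<Theta> a)" by (rule psd_Theta[OF a])
  have "psd (B x) (th (perp a))" by (rule psd_th[OF goodD(3)[OF good a]])
  moreover have "psd (B x) (th (perp a)) = psd (B x) (\<lambda>r s. delta r s - \<Theta> a r s)"
    by (rule psd_cong) (simp add: th_def sum_perp[OF a] fb_unit bl.B_eq)
  ultimately show "psd (B x) (\<lambda>r s. delta r s - \<Theta> a r s)" by simp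
qed

lemma th_bcar: "th c \<in> bl.bcar"
proof (rule bl.bcarI)
  show "th c r s = 0" if "s \<notin> B r" for r s using fb_supp[OF that] by (simp add: th_def)
  show "0 \<le> (\<Sum>a\<le>N. cmod (c a) * 1)" by (simp add: sum_nonneg)
  show "bd (B r) (th c) (\<Sum>a\<le>N. cmod (c a) * 1)" for r
    unfolding th_def[abs_def] by (intro bd_sum bd_scale bd_Theta) auto
qed

lemma kadj_th: "kadj (th c) = th (\<lambda>a. cnj (c a))"
proof (intro ext)
  fix r s
  have "cnj (\<Theta> a s r) = \<Theta> a r s" if "a \<le> N" for a
  proof (cases "s \<in> B r")
    case True
    then show ?thesis using psd_hermitian[OF psd_Theta[OF that], of s r r] bl.B_self[OF True] by simp
  next
    case False
    then have "r \<notin> B s" using bl.B_sym by blast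
    then show ?thesis using False fb_supp by simp
  qed
  then show "kadj (th c) r s = th (\<lambda>a. cnj (c a)) r s" by (simp add: kadj_def th_def)
qed

lemma th_cong: "comb c = comb d \<Longrightarrow> th c = th d"
proof -
  assume "comb c = comb d"
  then have "comb c \<ominus>\<^bsub>U\<^esub> comb d = comb d \<ominus>\<^bsub>U\<^esub> comb d" by simp
  then have "comb (\<lambda>a. c a - d a) = \<zero>\<^bsub>U\<^esub>" by (simp add: comb_diff comb_zero)
  from fb_null[OF this] show ?thesis
    by (simp add: th_def fun_eq_iff left_diff_distrib sum_subtractf)
qed

text \<open>Faithfulness comes from the order: an element with image \<open>0\<close> and its negative are both undetected, so both are
  positive, and the ordering is proper.\<close>
lemma th_inj_real:
  assumes "th c = (\<lambda>r s. 0)" "\<And>a. cnj (c a) = c a"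
  shows "comb c = \<zero>\<^bsub>U\<^esub>"
proof -
  have 1: "mk 1 (\<lambda>a i j. d a) \<in> C 1" if d: "\<And>a. cnj (d a) = d a" "th d = (\<lambda>r s. 0)" for d
  proof (rule ccontr)
    assume "mk 1 (\<lambda>a i j. d a) \<notin> C 1"
    with fb_sep[of "\<lambda>a i j. d a" 1] d(1) obtain x w where "Re (frm 1 (B x) (\<lambda>a i j. d a) \<Theta> w) < 0" by auto
    then show False using d(2) unfolding frm_one th_def[symmetric, abs_def] by (simp add: sesq_def)
  qed
  have "th (\<lambda>a. (-1) * c a) = (\<lambda>r s. 0)" unfolding th_scale assms(1) by simp
  then have "mk 1 (\<lambda>a i j. - c a) \<in> C 1" using 1[of "\<lambda>a. (-1) * c a"] assms(2) by simp
  from proper1[OF 1[OF assms(2,1)] this] have "mk 1 (\<lambda>a i j. c a) = mk 1 (\<lambda>a i j. 0)" .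
  then show ?thesis unfolding mk_eq_iff using comb_zero by simp
qed

lemma th_inj: "th c = (\<lambda>r s. 0) \<Longrightarrow> comb c = \<zero>\<^bsub>U\<^esub>"
proof -
  assume z: "th c = (\<lambda>r s. 0)"
  then have z': "th (\<lambda>a. cnj (c a)) = (\<lambda>r s. 0)" using kadj_th[of c] by (simp add: kadj_def fun_eq_iff)
  let ?x = "\<lambda>a. (1/2) * (c a + cnj (c a))" and ?y = "\<lambda>a. (- \<i>/2) * (c a + (-1) * cnj (c a))"
  have "comb ?x = \<zero>\<^bsub>U\<^esub>"
    by (rule th_inj_real) (simp_all only: th_scale th_add z z', simp_all add: add.commute)
  moreover have "comb ?y = \<zero>\<^bsub>U\<^esub>"
    by (rule th_inj_real) (simp_all only: th_scale th_add z z', simp_all add: algebra_simps)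
  moreover have "comb c = comb (\<lambda>a. ?x a + \<i> * ?y a)"
    by (rule comb_cong) (simp add: complex_eq_iff)
  moreover have "comb (\<lambda>a. ?x a + \<i> * ?y a) = comb ?x \<oplus>\<^bsub>U\<^esub> \<i> \<odot>\<^bsub>U\<^esub> comb ?y"
    by (simp only: comb_add comb_smult)
  ultimately show ?thesis using svs_smult_null[OF svs] comb_add[of "\<lambda>a. 0" "\<lambda>a. 0"]
    by (simp add: comb_zero)
qed

definition iot :: "'a \<Rightarrow> nat \<Rightarrow> nat \<Rightarrow> complex" where
  "iot x = th (SOME c. x = comb c)"

lemma iot_comb: "iot (comb c) = th c"
  unfolding iot_def by (rule th_cong) (metis (mono_tags, lifting) someI)

abbreviation "gen_alg \<equiv> bl.galg (iot ` carrier U)"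

lemma iot_image: "iot ` carrier U \<subseteq> bl.bcar"
  using comb_surj iot_comb th_bcar by fastforce

lemma gen_alg_closed: "bl.closedalg gen_alg"
  by (rule bl.galg_closedalg[OF iot_image])

lemma th_gen_alg: "th c \<in> gen_alg"
proof -
  have "th c \<in> iot ` carrier U" using iot_comb[of c] comb_closed by (metis imageI)
  then show ?thesis unfolding bl.galg_def by blast
qed

lemma th_one: "th (ev 0) = bl.bone"
  unfolding th_ev[OF le0] by (auto simp: fun_eq_iff bl.bone_def fb_unit fb_supp)

lemma iot_linear: "linear_map class_ring U (bl.balg gen_alg) iot"
proof -
  have vU: "vectorspace class_ring U" using svs by (simp add: star_vector_space_def)
  have vA: "vectorspace class_ring (bl.balg gen_alg)"
    using bl.balg_star_vector_space[OF gen_alg_closed] by (simp add: star_vector_space_def)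
  have "iot \<in> LinearCombinations.module_hom class_ring U (bl.balg gen_alg)"
    unfolding LinearCombinations.module_hom_def
  proof (intro CollectI conjI allI impI)
    show "iot \<in> carrier U \<rightarrow> carrier (bl.balg gen_alg)"
      unfolding bl.galg_def by auto
    show "iot (x \<oplus>\<^bsub>U\<^esub> y) = iot x \<oplus>\<^bsub>bl.balg gen_alg\<^esub> iot y" if "x \<in> carrier U \<and> y \<in> carrier U" for x y
    proof -
      from that comb_surj obtain c d where cd: "x = comb c" "y = comb d" by meson
      show ?thesis unfolding cd by (simp add: comb_add iot_comb th_add)
    qed
    show "iot (z \<odot>\<^bsub>U\<^esub> x) = z \<odot>\<^bsub>bl.balg gen_alg\<^esub> iot x" if "z \<in> carrier class_ring \<and> x \<in> carrier U" for z x
    proof -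
      from that comb_surj obtain c where cd: "x = comb c" by meson
      show ?thesis unfolding cd by (simp add: comb_smult iot_comb th_scale)
    qed
  qed
  then show ?thesis using vU vA
    by (simp add: linear_map_def mod_hom_def mod_hom_axioms_def vectorspace_def)
qed

lemma iot_inj: "inj_on iot (carrier U)"
proof (rule inj_onI)
  fix x y assume xy: "x \<in> carrier U" "y \<in> carrier U" "iot x = iot y"
  from xy comb_surj obtain c d where cd: "x = comb c" "y = comb d" by meson
  have "th c = th d" using xy(3) by (simp add: cd iot_comb)
  then have "th (\<lambda>a. c a + (-1) * d a) = (\<lambda>r s. 0)" unfolding th_add th_scale by simp
  from th_inj[OF this] have "comb (\<lambda>a. c a - d a) = \<zero>\<^bsub>U\<^esub>" by simp
  then have "comb d \<oplus>\<^bsub>U\<^esub> comb (\<lambda>a. c a - d a) = comb d \<oplus>\<^bsub>U\<^esub> comb (\<lambda>a. 0)" by (simp add: comb_zero)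
  then show "x = y" by (simp add: comb_add cd)
qed

text \<open>The image of a matrix, as a kernel indexed by pairs of a matrix index and a block index.\<close>
definition hk :: "(nat \<Rightarrow> nat \<Rightarrow> nat \<Rightarrow> complex) \<Rightarrow> nat \<times> nat \<Rightarrow> nat \<times> nat \<Rightarrow> complex" where
  "hk X p q = th (\<lambda>a. X a (fst p) (fst q)) (snd p) (snd q)"

lemma sesq_hk: "sesq ({..<n} \<times> B x) (hk X) v v = frm n (B x) X \<Theta> (\<lambda>i r. v (i, r))"
proof -
  have "sesq ({..<n} \<times> B x) (hk X) v v = (\<Sum>i<n. \<Sum>j<n. \<Sum>a\<le>N. X a i j * sesq (B x) (\<Theta> a) (\<lambda>r. v (i, r)) (\<lambda>s. v (j, s)))"
    unfolding sesq_times[OF finite_lessThan bl.B_finite] hk_def fst_conv snd_conv th_def[abs_def] sesq_sum_kernel ..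
  also have "\<dots> = (\<Sum>i<n. \<Sum>a\<le>N. \<Sum>j<n. X a i j * sesq (B x) (\<Theta> a) (\<lambda>r. v (i, r)) (\<lambda>s. v (j, s)))"
    by (intro sum.cong refl sum.swap)
  also have "\<dots> = (\<Sum>a\<le>N. \<Sum>i<n. \<Sum>j<n. X a i j * sesq (B x) (\<Theta> a) (\<lambda>r. v (i, r)) (\<lambda>s. v (j, s)))"
    by (rule sum.swap)
  finally show ?thesis by (simp add: frm_def)
qed

lemma psd_hk: "mk n X \<in> C n \<Longrightarrow> psd ({..<n} \<times> B x) (hk X)"
  by (rule psdI_real) (simp_all add: sesq_hk fb_pos fb_real bl.B_finite)

text \<open>Positivity in a C*-algebra means having the form \<open>y\<^sup>* y\<close> with \<open>y\<close> in that same algebra, so a root has to be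
  found inside the generated algebra and not merely block by block. With \<open>R\<close> so large that \<open>X \<le> R\<close>, the matrix
  \<open>k = 1 - X/R\<close> is a contraction in every block. The square-root iteration for \<open>k\<close> stays in the
  generated algebra and converges there, uniformly over the blocks, to some hermitian \<open>L\<close> with \<open>(1 - L)\<^sup>2 = X/R\<close>;
  then \<open>Y = \<surd>R (1 - L)\<close> satisfies \<open>Y\<^sup>* Y = X\<close>.\<close>
lemma positive_root:
  assumes X: "mk n X \<in> C n"
  shows "map_mat iot (mk n X) \<in> positives (matrices (bl.balg gen_alg) n)"
proof -
  note mo = goodD(1)[OF good] and G = gen_alg_closed
  let ?A = "bl.balg gen_alg"
  have "mk n X \<in> hermitian (matrices U n)" unfolding mk_hermitian by (rule mo_herm[OF mo X])
  then obtain X' where X': "mk n X = mk n X'" "\<forall>a i j. X' a j i = cnj (X' a i j)"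
    using mk_hermitian_rep by blast
  have "\<exists>R>0. mk n (\<lambda>a i j. complex_of_real R * dg (\<lambda>_. ev 0) a i j - X' a i j) \<in> C n"
  proof (rule order_unit[OF mo goodD(2)[OF good] goodD(3)[OF good]])
    fix a i j show "X' a j i = cnj (X' a i j)" by (rule X'(2)[rule_format])
  qed
  then obtain R where R: "0 < R" "mk n (\<lambda>a i j. complex_of_real R * dg (\<lambda>_. ev 0) a i j - X' a i j) \<in> C n" by blast
  define Rc where "Rc = complex_of_real R"
  have Rc0: "Rc \<noteq> 0" using R(1) by (simp add: Rc_def)
  \<comment> \<open>coefficients of \<open>1 - X/R\<close>\<close>
  define kc where "kc a i j = (1 / Rc) * (Rc * dg (\<lambda>_. ev 0) a i j + (-1) * X' a i j)" for a i j
  have kcC: "mk n kc \<in> C n"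
  proof -
    have "mk n kc = mk n (\<lambda>a i j. complex_of_real (1/R) * (complex_of_real R * dg (\<lambda>_. ev 0) a i j - X' a i j))"
      by (rule mk_cong) (simp add: kc_def Rc_def)
    then show ?thesis using mo_scale[OF mo R(2), of "1/R"] R(1) by simp
  qed
  have XC: "mk n (\<lambda>a i j. complex_of_real (1/R) * X' a i j) \<in> C n"
    using mo_scale[OF mo, of n X' "1/R"] X X'(1) R(1) by simp
  define k where "k = hk kc"
  have hk_lin: "hk kc p q = (if fst p = fst q then th (ev 0) (snd p) (snd q) else 0) - (1 / Rc) * hk X' p q" for p q
  proof -
    have 1: "(\<lambda>a. kc a i j) = (\<lambda>a. (if i = j then 1 else 0) * ev 0 a + (- 1 / Rc) * X' a i j)" for i j
      by (simp add: kc_def fun_eq_iff dg_def Rc0 field_simps)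
    show ?thesis unfolding hk_def 1 th_add th_scale by simp
  qed
  have k_contr: "bd ({..<n} \<times> B x) k 1" for x
  proof (rule psd_contraction)
    show "finite ({..<n} \<times> B x)" using bl.B_finite by simp
    show "psd ({..<n} \<times> B x) k" unfolding k_def by (rule psd_hk[OF kcC])
    have "psd ({..<n} \<times> B x) (hk (\<lambda>a i j. complex_of_real (1/R) * X' a i j))" by (rule psd_hk[OF XC])
    moreover have "psd ({..<n} \<times> B x) (hk (\<lambda>a i j. complex_of_real (1/R) * X' a i j))
       = psd ({..<n} \<times> B x) (\<lambda>p q. delta p q - k p q)"
    proof (rule psd_cong)
      fix p q assume "p \<in> {..<n} \<times> B x" "q \<in> {..<n} \<times> B x"
      then have "snd q \<in> B (snd p)" using bl.B_eq by auto
      then have "th (ev 0) (snd p) (snd q) = delta (snd p) (snd q)" by (simp add: th_one bl.bone_def)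
      then show "hk (\<lambda>a i j. complex_of_real (1/R) * X' a i j) p q = delta p q - k p q"
        unfolding k_def hk_lin unfolding hk_def th_scale[of "complex_of_real (1/R)"]
        by (auto simp: Rc_def prod_eq_iff)
    qed
    ultimately show "psd ({..<n} \<times> B x) (\<lambda>p q. delta p q - k p q)" by simp
  qed
  \<comment> \<open>The iterates, cut back into matrices of block-diagonal matrices. Row \<open>r\<close> uses the block of \<open>r\<close>, and the
    choice of the representative does not matter within a block.\<close>
  define y where "y m i j r s = ksq ({..<n} \<times> B r) k m (i, r) (j, s)" for m i j r s
  have ysuc: "y (Suc m) i j = (\<lambda>r s. (1/2) * (th (\<lambda>a. kc a i j) r s + (\<Sum>l<n. bl.bmul (y m i l) (y m l j) r s)))" for m i j
  proof (intro ext)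
    fix r s
    have "kmult ({..<n} \<times> B r) (ksq ({..<n} \<times> B r) k m) (ksq ({..<n} \<times> B r) k m) (i, r) (j, s)
      = (\<Sum>l<n. \<Sum>t\<in>B r. y m i l r t * y m l j t s)"
      unfolding kmult_def sum_times[OF finite_lessThan bl.B_finite]
      by (intro sum.cong refl) (simp add: y_def bl.B_eq)
    then show "y (Suc m) i j r s = (1/2) * (th (\<lambda>a. kc a i j) r s + (\<Sum>l<n. bl.bmul (y m i l) (y m l j) r s))"
      by (simp add: y_def k_def hk_def bl.bmul_def kmult_def)
  qed
  have sum_in: "(\<lambda>r s. \<Sum>l<n. F l r s) \<in> gen_alg" if "\<And>l. l < n \<Longrightarrow> F l \<in> gen_alg" for F :: "nat \<Rightarrow> nat \<Rightarrow> nat \<Rightarrow> complex" and n :: nat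
    using that
  proof (induction n)
    case 0
    show ?case using bl.closedalg_zero[OF G] by simp
  next
    case (Suc n)
    then show ?case using bl.closedalg_add[OF G, of "\<lambda>r s. \<Sum>l<n. F l r s" "F n"] by simp
  qed
  have yG: "y m i j \<in> gen_alg" for m i j
  proof (induction m arbitrary: i j)
    case 0
    show ?case using bl.closedalg_zero[OF G] by (simp add: y_def[abs_def])
  next
    case (Suc m)
    show ?case unfolding ysuc
      by (intro bl.closedalg_scale[OF G] bl.closedalg_add[OF G] th_gen_alg sum_in bl.closedalg_mul[OF G] Suc.IH)
  qed
  note ybc = bl.closedalg_sub[OF G yG]
  have "\<exists>L\<in>gen_alg. (\<lambda>m. bl.bnorm (\<lambda>r s. y m i j r s - L r s)) \<longlonglongrightarrow> 0" if ij: "i < n" "j < n" for i j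
  proof -
    have "\<exists>L\<in>bl.bcar. (\<lambda>m. bl.bnorm (\<lambda>r s. y m i j r s - L r s)) \<longlonglongrightarrow> 0"
    proof (rule bl.bcar_complete[OF ybc])
      fix e :: real assume e: "0 < e"
      then have "0 < e / 2" by simp
      then obtain K where K: "\<And>S (k :: nat \<times> nat \<Rightarrow> nat \<times> nat \<Rightarrow> complex) m n. bd S k 1 \<Longrightarrow> K \<le> m \<Longrightarrow> K \<le> n \<Longrightarrow>
         bd S (\<lambda>r s. ksq S k m r s - ksq S k n r s) (e / 2)"
        by (rule ksq_Cauchy) blast
      have "bl.bnorm (\<lambda>r s. y m i j r s - y m' i j r s) < e" if mm: "K \<le> m" "K \<le> m'" for m m'
      proof -
        have "bl.bnorm (\<lambda>r s. y m i j r s - y m' i j r s) \<le> e / 2"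
        proof (rule bl.bnorm_le)
          fix r
          let ?D = "\<lambda>p q. ksq ({..<n} \<times> B r) k m p q - ksq ({..<n} \<times> B r) k m' p q"
          have "bd (B r) (\<lambda>x s. ?D (i, x) (j, s)) (e / 2)"
            by (rule bd_sub_block[OF finite_lessThan bl.B_finite _ _ K[OF k_contr mm]]) (use ij in auto)
          moreover have "bd (B r) (\<lambda>x s. ?D (i, x) (j, s)) (e / 2) = bd (B r) (\<lambda>r s. y m i j r s - y m' i j r s) (e / 2)"
            by (rule bd_cong) (simp add: y_def bl.B_eq)
          ultimately show "bd (B r) (\<lambda>r s. y m i j r s - y m' i j r s) (e / 2)" by simp
        qed (use e in simp)
        then show ?thesis using e by simp
      qed
      then show "\<exists>K. \<forall>m\<ge>K. \<forall>m'\<ge>K. bl.bnorm (\<lambda>r s. y m i j r s - y m' i j r s) < e" by blast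
    qed
    then obtain L where L: "L \<in> bl.bcar" "(\<lambda>m. bl.bnorm (\<lambda>r s. y m i j r s - L r s)) \<longlonglongrightarrow> 0" by blast
    have "L \<in> gen_alg" by (rule bl.closedalg_lim[OF G _ L]) (use yG in auto)
    with L(2) show ?thesis by blast
  qed
  then have "\<forall>p. \<exists>L. fst p < n \<longrightarrow> snd p < n \<longrightarrow> L \<in> gen_alg \<and>
      (\<lambda>m. bl.bnorm (\<lambda>r s. y m (fst p) (snd p) r s - L r s)) \<longlonglongrightarrow> 0" by blast
  from choice[OF this] obtain L' where L': "\<forall>p. fst p < n \<longrightarrow> snd p < n \<longrightarrow> L' p \<in> gen_alg \<and>
      (\<lambda>m. bl.bnorm (\<lambda>r s. y m (fst p) (snd p) r s - L' p r s)) \<longlonglongrightarrow> 0" ..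
  define L where "L i j = L' (i, j)" for i j
  have L: "L i j \<in> gen_alg" "(\<lambda>m. bl.bnorm (\<lambda>r s. y m i j r s - L i j r s)) \<longlonglongrightarrow> 0"
    if "i < n" "j < n" for i j
    using L'[THEN spec, of "(i, j)"] that by (simp_all add: L_def)
  have lim: "(\<lambda>m. y m i j r s) \<longlonglongrightarrow> L i j r s" if ij: "i < n" "j < n" for i j r s
  proof -
    have "(\<lambda>m. y m i j r s - L i j r s) \<longlonglongrightarrow> 0"
      by (rule Lim_null_comparison[OF _ L(2)[OF ij]])
        (use bl.bnorm_entry[OF bl.bcar_diff[OF ybc bl.closedalg_sub[OF G L(1)[OF ij]]]] in auto)
    then show ?thesis by (simp add: LIM_zero_iff)
  qed
  \<comment> \<open>the limit of the recursion\<close>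
  have Leq: "2 * L i j r s - (\<Sum>l<n. bl.bmul (L i l) (L l j) r s) = th (\<lambda>a. kc a i j) r s" if ij: "i < n" "j < n" for i j r s
  proof -
    have "(\<lambda>m. y (Suc m) i j r s) \<longlonglongrightarrow> (1/2) * (th (\<lambda>a. kc a i j) r s + (\<Sum>l<n. bl.bmul (L i l) (L l j) r s))"
      unfolding ysuc bl.bmul_def kmult_def by (intro tendsto_intros lim ij) auto
    moreover have "(\<lambda>m. y (Suc m) i j r s) \<longlonglongrightarrow> L i j r s" by (rule LIMSEQ_Suc[OF lim[OF ij]])
    ultimately have "L i j r s = (1/2) * (th (\<lambda>a. kc a i j) r s + (\<Sum>l<n. bl.bmul (L i l) (L l j) r s))"
      by (rule LIMSEQ_unique[rotated])
    then show ?thesis by (simp add: field_simps)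
  qed
  have Lherm: "kadj (L i j) = L j i" if ij: "i < n" "j < n" for i j
  proof (intro ext)
    fix r s
    show "kadj (L i j) r s = L j i r s"
    proof (cases "s \<in> B r")
      case True
      have "cnj (y m i j s r) = y m j i r s" for m
      proof -
        have "ksq ({..<n} \<times> B r) k m (j, r) (i, s) = cnj (ksq ({..<n} \<times> B r) k m (i, s) (j, r))"
          by (rule ksq_hermitian[OF psd_hermitian[OF psd_hk[OF kcC], folded k_def]])
            (use ij True bl.B_self[OF True] in auto)
        then show ?thesis by (simp add: y_def bl.B_eq[OF True])
      qed
      then have "(\<lambda>m. y m j i r s) \<longlonglongrightarrow> cnj (L i j s r)"
        using tendsto_cnj[OF lim[OF ij, of s r]] by simp
      then show ?thesis using LIMSEQ_unique[OF lim[OF ij(2,1), of r s]] by (simp add: kadj_def)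
    next
      case False
      then have "r \<notin> B s" using bl.B_sym by blast
      then show ?thesis using False bl.bcar_supp[OF bl.closedalg_sub[OF G L(1)[OF ij]]]
          bl.bcar_supp[OF bl.closedalg_sub[OF G L(1)[OF ij(2,1)]]] by (simp add: kadj_def)
    qed
  qed
  define q where "q = complex_of_real (sqrt R)"
  have qq: "q * q = Rc" "cnj q = q" unfolding q_def Rc_def of_real_mult[symmetric] using R(1) by simp_all
  \<comment> \<open>entries of the identity matrix over the algebra\<close>
  define dl where "dl i j = (\<lambda>r s. (if i = j then 1 else 0) * bl.bone r s)" for i j :: nat
  have dlG: "dl i j \<in> gen_alg" for i j unfolding dl_def by (intro bl.closedalg_scale[OF G] bl.closedalg_one[OF G])
  define Y where "Y i j = (\<lambda>r s. q * (dl i j r s + (-1) * L i j r s))" for i j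
  have YG: "Y i j \<in> gen_alg" if "i < n" "j < n" for i j
    unfolding Y_def by (intro bl.closedalg_scale[OF G] bl.closedalg_add[OF G] dlG L that)
  show ?thesis
  proof (rule positives_matricesI[OF bl.balg_cstar[OF G], of n Y])
    show "map_mat iot (mk n X) \<in> carrier_mat n n" by (simp add: mk_def)
    show "Y i j \<in> carrier ?A" if "i < n" "j < n" for i j using YG[OF that] by simp
    fix i j assume ij: "i < n" "j < n"
    have dstar: "kadj (dl l i) = dl i l" for l by (auto simp: fun_eq_iff dl_def kadj_def bl.bone_def dest: bl.B_sym)
    have ystar: "kadj (Y l i) = Y i l" if "l < n" for l
    proof -
      have "cnj (L l i s r) = L i l r s" "cnj (dl l i s r) = dl i l r s" for r s
        using Lherm[OF that ij(1)] dstar[of l] by (simp_all add: kadj_def fun_eq_iff)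
      then show ?thesis by (simp add: fun_eq_iff kadj_def Y_def qq)
    qed
    have "(\<Oplus>\<^bsub>?A\<^esub>k\<in>{..<n}. star ?A (Y k i) \<otimes>\<^bsub>?A\<^esub> Y k j) = (\<lambda>r s. \<Sum>l<n. bl.bmul (kadj (Y l i)) (Y l j) r s)"
      unfolding bl.balg_simps
    proof (rule bl.balg_finsum[OF G finite_lessThan])
      fix l assume "l \<in> {..<n}"
      then show "bl.bmul (kadj (Y l i)) (Y l j) \<in> gen_alg"
        by (intro bl.closedalg_mul[OF G] bl.closedalg_adj[OF G] YG ij) auto
    qed
    also have "\<dots> = (\<lambda>r s. \<Sum>l<n. bl.bmul (Y i l) (Y l j) r s)" by (simp add: ystar)
    also have "\<dots> = th (\<lambda>a. X' a i j)"
    proof (intro ext)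
      fix r s
      have Lb: "L i' j' \<in> bl.bcar" if "i' < n" "j' < n" for i' j' by (rule bl.closedalg_sub[OF G L(1)[OF that]])
      have T1: "bl.bmul (Y i l) (Y l j) r s = Rc * ((if i = l then dl l j r s else 0)
          + (-1) * (if i = l then L l j r s else 0) + ((-1) * (if l = j then L i l r s else 0) + bl.bmul (L i l) (L l j) r s))"
        if l: "l < n" for l
      proof -
        have b1: "bl.bmul (dl i l) Z = (\<lambda>r s. if i = l then Z r s else 0)" if "Z \<in> bl.bcar" for Z
          unfolding dl_def bl.bmul_scale_left bl.bmul_one_left[OF that] by (auto simp: fun_eq_iff)
        have b2: "bl.bmul (L i l) (dl l j) = (\<lambda>r s. if l = j then L i l r s else 0)"
          unfolding dl_def bl.bmul_scale_right bl.bmul_one_right[OF Lb[OF ij(1) l]] by (auto simp: fun_eq_iff)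
        show ?thesis unfolding Y_def bl.bmul_scale_left bl.bmul_scale_right bl.bmul_add_left bl.bmul_add_right
            b1[OF bl.closedalg_sub[OF G dlG]] b1[OF Lb[OF l ij(2)]] b2 qq(1)[symmetric]
          by (simp add: algebra_simps)
      qed
      have "(\<Sum>l<n. bl.bmul (Y i l) (Y l j) r s) = Rc * (\<Sum>l<n. (if i = l then dl l j r s else 0)
          + (-1) * (if i = l then L l j r s else 0) + ((-1) * (if l = j then L i l r s else 0) + bl.bmul (L i l) (L l j) r s))"
        unfolding sum_distrib_left by (rule sum.cong[OF refl], rule T1) simp
      also have "\<dots> = Rc * (dl i j r s - (2 * L i j r s - (\<Sum>l<n. bl.bmul (L i l) (L l j) r s)))"
        using ij by (simp add: sum.distrib sum_negf sum_subtractf)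
      also have "\<dots> = Rc * (dl i j r s - th (\<lambda>a. kc a i j) r s)" unfolding Leq[OF ij] ..
      also have "\<dots> = th (\<lambda>a. X' a i j) r s"
        using hk_lin[of "(i, r)" "(j, s)"] Rc0 by (simp add: hk_def dl_def th_one)
      finally show "(\<Sum>l<n. bl.bmul (Y i l) (Y l j) r s) = th (\<lambda>a. X' a i j) r s" .
    qed
    also have "\<dots> = map_mat iot (mk n X) $$ (i, j)"
    proof -
      have "comb (\<lambda>a. X' a i j) = comb (\<lambda>a. X a i j)" using X'(1) ij unfolding mk_eq_iff by simp
      from th_cong[OF this] show ?thesis using ij by (simp add: mk_def iot_comb)
    qed
    finally show "map_mat iot (mk n X) $$ (i, j) = (\<Oplus>\<^bsub>?A\<^esub>k\<in>{..<n}. star ?A (Y k i) \<otimes>\<^bsub>?A\<^esub> Y k j)" by simp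
  qed
qed

text \<open>A sum of squares is a positive form in every block, whereas an element outside \<open>C n\<close> has a negative
  value in some block. The latter is known for hermitian elements only, and \<open>X\<close> is hermitian since its
  image is.\<close>
lemma positive_reflect:
  assumes pos: "map_mat iot (mk n X) \<in> positives (matrices (bl.balg gen_alg) n)"
  shows "mk n X \<in> C n"
proof (rule ccontr)
  assume notin: "mk n X \<notin> C n"
  note G = gen_alg_closed
  let ?A = "bl.balg gen_alg"
  obtain y where y: "\<And>k j. k < n \<Longrightarrow> j < n \<Longrightarrow> y k j \<in> carrier ?A"
    "\<And>i j. i < n \<Longrightarrow> j < n \<Longrightarrow> map_mat iot (mk n X) $$ (i, j) = (\<Oplus>\<^bsub>?A\<^esub>k\<in>{..<n}. star ?A (y k i) \<otimes>\<^bsub>?A\<^esub> y k j)"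
    by (rule positives_matrices[OF bl.balg_cstar[OF G] pos]) blast
  have yG: "y k j \<in> gen_alg" if "k < n" "j < n" for k j using y(1)[OF that] by simp
  have XY: "th (\<lambda>a. X a i j) = (\<lambda>r s. \<Sum>l<n. bl.bmul (kadj (y l i)) (y l j) r s)" if ij: "i < n" "j < n" for i j
  proof -
    have "(\<Oplus>\<^bsub>?A\<^esub>k\<in>{..<n}. star ?A (y k i) \<otimes>\<^bsub>?A\<^esub> y k j) = (\<lambda>r s. \<Sum>l<n. bl.bmul (kadj (y l i)) (y l j) r s)"
      unfolding bl.balg_simps
    proof (rule bl.balg_finsum[OF G finite_lessThan])
      fix l assume "l \<in> {..<n}"
      then show "bl.bmul (kadj (y l i)) (y l j) \<in> gen_alg"
        by (intro bl.closedalg_mul[OF G] bl.closedalg_adj[OF G] yG ij) auto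
    qed
    then show ?thesis using y(2)[OF ij] ij by (simp add: mk_def iot_comb)
  qed
  have "th (\<lambda>a. cnj (X a j i)) = th (\<lambda>a. X a i j)" if ij: "i < n" "j < n" for i j
  proof -
    have "bl.bmul (kadj (y l i)) (y l j) = kadj (bl.bmul (kadj (y l j)) (y l i))" if l: "l < n" for l
      using bl.kadj_bmul[OF bl.bcar_adj bl.closedalg_sub[OF G yG], OF bl.closedalg_sub[OF G yG], OF l ij(2) l ij(1)]
      by (simp add: kadj_kadj)
    then have "bl.bmul (kadj (y l i)) (y l j) r s = cnj (bl.bmul (kadj (y l j)) (y l i) s r)" if "l < n" for l r s
      using that by (simp add: kadj_def)
    then have "th (\<lambda>a. X a i j) = kadj (th (\<lambda>a. X a j i))"
      unfolding XY[OF ij] XY[OF ij(2,1)] by (simp add: kadj_def fun_eq_iff)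
    then show ?thesis unfolding kadj_th by simp
  qed
  then have "iot (comb (\<lambda>a. cnj (X a j i))) = iot (comb (\<lambda>a. X a i j))" if "i < n" "j < n" for i j
    using that by (simp add: iot_comb)
  then have "comb (\<lambda>a. cnj (X a j i)) = comb (\<lambda>a. X a i j)" if "i < n" "j < n" for i j
    using inj_onD[OF iot_inj _ comb_closed comb_closed] that by blast
  then have "mk n X \<in> hermitian (matrices U n)" unfolding mk_hermitian mk_eq_iff by blast
  then obtain X' where X': "mk n X = mk n X'" "\<forall>a i j. X' a j i = cnj (X' a i j)"
    using mk_hermitian_rep by blast
  obtain x w where xw: "Re (frm n (B x) X' \<Theta> w) < 0"
    using fb_sep[of X' n, OF X'(2)[rule_format]] notin X'(1) by auto
  have XX: "th (\<lambda>a. X' a i j) = th (\<lambda>a. X a i j)" if "i < n" "j < n" for i j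
    by (rule th_cong) (use X'(1) that in \<open>simp add: mk_eq_iff\<close>)
  let ?S = "{..<n} \<times> B x"
  let ?yk = "\<lambda>p q. y (fst p) (fst q) (snd p) (snd q)"
  have "frm n (B x) X' \<Theta> w = sesq ?S (hk X') (\<lambda>p. w (fst p) (snd p)) (\<lambda>p. w (fst p) (snd p))"
    by (simp add: sesq_hk)
  also have "\<dots> = sesq ?S (kmult ?S (kadj ?yk) ?yk) (\<lambda>p. w (fst p) (snd p)) (\<lambda>p. w (fst p) (snd p))"
  proof (rule sesq_cong)
    fix p q assume pq: "p \<in> ?S" "q \<in> ?S"
    then have b: "B (snd p) = B x" using bl.B_eq by auto
    have "hk X' p q = (\<Sum>l<n. bl.bmul (kadj (y l (fst p))) (y l (fst q)) (snd p) (snd q))"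
      unfolding hk_def using pq by (simp add: XX XY mem_Times_iff)
    also have "\<dots> = kmult ?S (kadj ?yk) ?yk p q"
      unfolding kmult_def[of ?S] sum_times[OF finite_lessThan bl.B_finite]
      by (simp add: bl.bmul_def kmult_def b kadj_def)
    finally show "hk X' p q = kmult ?S (kadj ?yk) ?yk p q" .
  qed simp_all
  also have "\<dots> = (\<Sum>p\<in>?S. cnj (kapp ?S ?yk (\<lambda>p. w (fst p) (snd p)) p) * kapp ?S ?yk (\<lambda>p. w (fst p) (snd p)) p)"
    unfolding sesq_kapp kapp_kmult kadj_inner ..
  also have "\<dots> = complex_of_real ((l2 ?S (kapp ?S ?yk (\<lambda>p. w (fst p) (snd p))))\<^sup>2)"
    by (rule l2_inner_self)
  finally have "0 \<le> Re (frm n (B x) X' \<Theta> w)" by (simp del: of_real_power)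
  then show False using xw by simp
qed

lemma cover_exists:
  "\<exists>(A :: (nat \<Rightarrow> nat \<Rightarrow> complex) normed_star_space) \<iota>. cstar_cover U C (g 0) A \<iota> \<and> is_projection A (\<iota> (g b))"
proof (intro exI conjI)
  let ?A = "bl.balg gen_alg"
  have one: "iot (g 0) = bl.bone" using iot_comb[of "ev 0"] by (simp add: comb_gen th_one)
  have emb: "unital_complete_order_embedding U C (g 0) ?A iot"
    unfolding unital_complete_order_embedding_def
  proof (intro conjI allI ballI iot_linear iot_inj)
    show "iot (g 0) = \<one>\<^bsub>?A\<^esub>" by (simp add: one)
    fix n x assume "x \<in> carrier (matrices U n)"
    then obtain X where "x = mk n X" using mk_surj by blast
    then show "x \<in> C n \<longleftrightarrow> map_mat iot x \<in> positives (matrices ?A n)"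
      using positive_root positive_reflect by blast
  qed
  have "bl.bone \<in> iot ` carrier U" using one gen_carrier[of 0] by (metis imageI le0)
  then have "generates ?A (iot ` carrier U)" by (rule bl.galg_generates[OF iot_image])
  then show "cstar_cover U C (g 0) ?A iot"
    unfolding cstar_cover_def using emb bl.balg_cstar[OF gen_alg_closed] by blast
  have ib: "iot (g b) = \<Theta> b" using iot_comb[of "ev b"] bN by (simp add: comb_gen th_ev)
  have "kadj (\<Theta> b) = \<Theta> b" using kadj_th[of "ev b"] bN by (simp add: th_ev ev_real)
  moreover have "bl.bmul (\<Theta> b) (\<Theta> b) = \<Theta> b" by (simp add: fun_eq_iff bl.bmul_def kmult_def fb_proj)
  moreover have "\<Theta> b \<in> gen_alg" using th_gen_alg[of "ev b"] bN by (simp add: th_ev)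
  ultimately show "is_projection ?A (iot (g b))" by (simp add: is_projection_def ib)
qed

end

end

section \<open>Comparison with a given operator system\<close>

text \<open>By the exchange lemma a nonzero vector of the kernel extends to a spanning set of at most \<open>dim U\<close>
  elements, and the images of the others would span the codomain.\<close>
lemma surjective_equal_dim_kernel:
  assumes lin: "linear_map class_ring U V \<phi>" and U: "star_vector_space U" and V: "star_vector_space V"
    and fd: "vectorspace.fin_dim class_ring U" and surj: "\<phi> ` carrier U = carrier V"
    and dim: "vectorspace.dim class_ring V = vectorspace.dim class_ring U"
    and x: "x \<in> carrier U" "\<phi> x = \<zero>\<^bsub>V\<^esub>"
  shows "x = \<zero>\<^bsub>U\<^esub>"
proof (rule ccontr)
  assume x0: "x \<noteq> \<zero>\<^bsub>U\<^esub>"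
  interpret LV: vectorspace class_ring U using U by (simp add: star_vector_space_def)
  interpret LW: vectorspace class_ring V using V by (simp add: star_vector_space_def)
  interpret L: linear_map class_ring U V \<phi> by (rule lin)
  have li: "\<not> LV.lin_dep {x}"
  proof
    assume "LV.lin_dep {x}"
    then obtain A a v where A: "A \<subseteq> {x}" "LV.lincomb a A = \<zero>\<^bsub>U\<^esub>" "v \<in> A" "a v \<noteq> (0::complex)"
      unfolding LV.lin_dep_def by auto
    then have [simp]: "A = {x}" "v = x" by auto
    have "a x \<odot>\<^bsub>U\<^esub> x = \<zero>\<^bsub>U\<^esub>"
      using A(2) x(1) svs_smult_closed[OF U x(1)] by (simp add: LV.lincomb_def)
    then have "(1 / a x * a x) \<odot>\<^bsub>U\<^esub> x = \<zero>\<^bsub>U\<^esub>"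
      unfolding svs_smult_assoc[OF U x(1)] by (simp add: svs_smult_null[OF U])
    then show False using A(4) x0 svs_smult_one[OF U x(1)] by simp
  qed
  obtain A where A0: "finite A" "LV.basis A" using LV.finite_basis_exists[OF fd] by blast
  then have A: "finite A" "card A = LV.dim" "A \<subseteq> carrier U" "LV.span A = carrier U"
    using LV.dim_basis[OF A0] by (auto simp: LV.basis_def)
  obtain C where C: "finite C" "C \<subseteq> carrier U" "int (card C) \<le> int (card A) - int (card {x})"
    "LV.span ({x} \<union> C) = carrier U"
    using LV.replacement[OF _ A(1) A(3) li] x(1) A(4) by auto
  have fC: "\<phi> ` C \<subseteq> carrier V" using C(2) L.T_im by blast
  interpret S: submodule class_ring "LW.span (\<phi> ` C)" V by (rule LW.span_is_submodule[OF fC])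
  have sub: "submodule class_ring {u \<in> carrier U. \<phi> u \<in> LW.span (\<phi> ` C)} U"
  proof
    show "\<zero>\<^bsub>U\<^esub> \<in> {u \<in> carrier U. \<phi> u \<in> LW.span (\<phi> ` C)}"
      using S.zero_closed by simp
    fix v w assume "v \<in> {u \<in> carrier U. \<phi> u \<in> LW.span (\<phi> ` C)}" "w \<in> {u \<in> carrier U. \<phi> u \<in> LW.span (\<phi> ` C)}"
    then show "v \<oplus>\<^bsub>U\<^esub> w \<in> {u \<in> carrier U. \<phi> u \<in> LW.span (\<phi> ` C)}"
      using S.m_closed by simp
  next
    fix c :: complex and v assume "c \<in> carrier class_ring" "v \<in> {u \<in> carrier U. \<phi> u \<in> LW.span (\<phi> ` C)}"
    then show "c \<odot>\<^bsub>U\<^esub> v \<in> {u \<in> carrier U. \<phi> u \<in> LW.span (\<phi> ` C)}"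
      using S.smult_closed svs_smult_closed[OF U] by simp
  qed auto
  have gens: "{x} \<union> C \<subseteq> {u \<in> carrier U. \<phi> u \<in> LW.span (\<phi> ` C)}"
    using x C(2) S.zero_closed LW.in_own_span[OF fC] by auto
  have "carrier U \<subseteq> {u \<in> carrier U. \<phi> u \<in> LW.span (\<phi> ` C)}"
    using LV.span_is_subset[OF gens sub] C(4) by simp
  then have "carrier V \<subseteq> LW.span (\<phi> ` C)" unfolding surj[symmetric] by blast
  then have gen: "LW.span (\<phi> ` C) = carrier V" using S.subset by blast
  have "LW.dim \<le> card (\<phi> ` C)"
    unfolding LW.dim_def by (rule Least_le) (use C(1) fC gen in blast)
  also have "\<dots> \<le> card C" by (rule card_image_le[OF C(1)])
  also have "int (card C) \<le> int (card A) - 1" using C(3) by simp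
  finally have "int LW.dim \<le> int LV.dim - 1" using A(2) by simp
  then show False using dim by simp
qed

text \<open>The inclusion is carried through the construction: the generating cone goes to positive elements,
  hence so do \<open>D\<^sup>m\<^sup>a\<^sup>x\<close> and its closure, and each step of the chain is preserved because the target
  is closed under the corresponding operation.\<close>
lemma transfer_positivity:
  assumes U: "gen_space U N g" and V: "gen_space V N h" and N: "N \<ge> 1"
    and null: "\<And>c. herm_family.comb U N g c = \<zero>\<^bsub>U\<^esub> \<Longrightarrow> herm_family.comb V N h c = \<zero>\<^bsub>V\<^esub>"
    and goodD: "gen_space.good V N h D"
    and archD: "\<And>n. gen_space.arch V h D n \<subseteq> D n"
    and projD: "\<And>b n. b \<in> {1..N} \<Longrightarrow> proj_step V (h 0) D (h b) n \<subseteq> D n"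
    and X: "gen_space.mk U N g n X \<in> proj_limit U (g 0) N g n"
  shows "gen_space.mk V N h n X \<in> D n"
proof -
  interpret U: gen_space U N g by (rule U)
  interpret V: gen_space V N h by (rule V)
  have eqc: "V.comb c = V.comb d" if "U.comb c = U.comb d" for c d
  proof -
    have "U.comb c \<ominus>\<^bsub>U\<^esub> U.comb d = U.comb d \<ominus>\<^bsub>U\<^esub> U.comb d" using that by simp
    then have "U.comb (\<lambda>a. c a - d a) = \<zero>\<^bsub>U\<^esub>" by (simp add: U.comb_diff U.comb_zero)
    from null[OF this] have "V.comb d \<oplus>\<^bsub>V\<^esub> V.comb (\<lambda>a. c a - d a) = V.comb d \<oplus>\<^bsub>V\<^esub> V.comb (\<lambda>a. 0)"
      by (simp add: V.comb_zero)
    then show ?thesis by (simp add: V.comb_add)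
  qed
  have eqm: "V.mk n X = V.mk n Y" if "U.mk n X = U.mk n Y" for n X Y
    using that eqc unfolding U.mk_eq_iff V.mk_eq_iff by blast
  note mo = V.goodD(1)[OF goodD]
  have archI: "V.mk n X \<in> D n" if "\<And>\<epsilon>. 0 < \<epsilon> \<Longrightarrow> V.mk n (\<lambda>a i j. X a i j + complex_of_real \<epsilon> * dg (\<lambda>_. ev 0) a i j) \<in> D n" for n X
  proof -
    have "V.mk n X \<in> V.arch D n" unfolding V.arch_mk by (intro allI impI that)
    then show ?thesis using archD by blast
  qed
  have cone: "V.mk 1 (\<lambda>a i j. c a) \<in> D 1" if c: "U.comb c \<in> closed_gen_cone U (g 0) N g" for c
  proof (rule archI)
    fix \<epsilon> :: real assume "0 < \<epsilon>"
    then obtain r t s where rts: "r \<ge> 0" "\<forall>i\<in>{1..N}. t i \<ge> 0 \<and> s i \<ge> 0"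
      "U.comb (\<lambda>a. c a + complex_of_real \<epsilon> * ev 0 a) = U.comb (U.gcoef r t s)"
      using U.closed_gen_coneD[OF c] by blast
    have "V.mk 1 (\<lambda>a i j. complex_of_real r * ev 0 a + (\<Sum>i\<in>{1..N}. complex_of_real (t i) * ev i a)
      + (\<Sum>i\<in>{1..N}. complex_of_real (s i) * perp i a)) \<in> D 1"
      using rts(1,2)
      by (intro V.mo_add[OF mo] V.mo_scale[OF mo] V.mo_sum[OF mo] V.goodD[OF goodD]) auto
    then have "V.mk 1 (\<lambda>a i j. U.gcoef r t s a) \<in> D 1" by (simp add: U.gcoef_def)
    also have "V.mk 1 (\<lambda>a i j. U.gcoef r t s a) = V.mk 1 (\<lambda>a i j. c a + complex_of_real \<epsilon> * dg (\<lambda>_. ev 0) a i j)"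
      using eqc[OF rts(3)] by (simp add: V.mk_eq_iff dg_def)
    finally show "V.mk 1 (\<lambda>a i j. c a + complex_of_real \<epsilon> * dg (\<lambda>_. ev 0) a i j) \<in> D 1" .
  qed
  have base: "V.mk n X \<in> D n" if X: "U.mk n X \<in> U.cone0 n" for n X
  proof -
    obtain m A S where S: "\<And>k. k < m \<Longrightarrow> U.comb (S k) \<in> closed_gen_cone U (g 0) N g"
      and "U.mk n X = U.mk n (U.dm m A S)" and "\<And>k a. cnj (S k a) = S k a"
      by (rule U.D_maxE[OF X U.closed_gen_cone_hermitian]) blast
    then have "V.mk n X = V.mk n (U.dm m A S)" by (intro eqm)
    moreover have "V.mk n (\<lambda>a i j. \<Sum>k<m. cnj (A k i) * A k j * S k a) \<in> D n"
    proof (rule V.mo_sum[OF mo finite_lessThan])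
      fix k assume "k \<in> {..<m}"
      then have "V.mk 1 (\<lambda>a i j. S k a) \<in> D 1" using cone[OF S] by simp
      then show "V.mk n (\<lambda>a i j. cnj (A k i) * A k j * S k a) \<in> D n" by (rule V.mo_rank_one[OF mo])
    qed
    ultimately show ?thesis by (simp add: U.dm_def[abs_def])
  qed
  have step: "V.mk n X \<in> D n" if "U.mk n X \<in> U.chain m n" for n X m
    using that
  proof (induction m arbitrary: n X)
    case 0
    then have X: "U.mk n X \<in> U.arch U.cone0 n" by (simp add: U.E_max_eq)
    show ?case by (rule archI, rule base, rule U.archD[OF X])
  next
    case (Suc m)
    let ?b = "m mod N + 1"
    have b: "?b \<le> N" "?b \<in> {1..N}" using U.mod_range[OF N] by auto
    from Suc.prems have X: "U.mk n X \<in> proj_step U (g 0) (U.chain m) (g ?b) n" by simp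
    have "V.mk n X \<in> proj_step V (h 0) D (h ?b) n"
    proof (rule V.proj_stepI[OF b(1)])
      fix \<epsilon> :: real assume eps: "0 < \<epsilon>"
      obtain t where t: "0 < t" "U.mk (2 * n) (\<lambda>a r s. dbl X a r s + complex_of_real \<epsilon> * pd ?b a r s
           + complex_of_real t * qd ?b a r s) \<in> U.chain m (2 * n)"
        by (rule U.proj_stepE[OF X b(1) eps])
      then show "\<exists>t>0. V.mk (2 * n) (\<lambda>a r s. dbl X a r s + complex_of_real \<epsilon> * pd ?b a r s
           + complex_of_real t * qd ?b a r s) \<in> D (2 * n)"
        using Suc.IH[OF t(2)] by blast
    qed
    then show ?case using projD[OF b(2)] by blast
  qed
  show ?thesis
  proof (rule archI)
    fix \<epsilon> :: real assume "0 < \<epsilon>"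
    from U.archD[OF X[unfolded U.limit_eq] this] show "V.mk n (\<lambda>a i j. X a i j + complex_of_real \<epsilon> * dg (\<lambda>_. ev 0) a i j) \<in> D n"
      unfolding U.chain_union_def using step by blast
  qed
qed

context gen_space
begin

text \<open>What is left to check for a good ordering: the order unit comes from \<open>order_unit\<close>.\<close>
lemma operator_systemI:
  assumes good: "good C"
    and arch: "\<And>n. arch C n \<subseteq> C n"
    and proper: "\<And>n X. mk n X \<in> C n \<Longrightarrow> mk n (\<lambda>a i j. - X a i j) \<in> C n \<Longrightarrow> mk n X = mk n (\<lambda>a i j. 0)"
  shows "proper_matrix_ordering U C" "operator_system U C (g 0)"
proof -
  note mo = goodD(1)[OF good]
  show P: "proper_matrix_ordering U C"
    unfolding proper_matrix_ordering_def
  proof (intro conjI allI mo)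
    fix n
    have cone: "is_cone (matrices U n) (C n)" using mo by (simp add: matrix_ordering_def)
    have "C n \<inter> (\<lambda>x. \<ominus>\<^bsub>matrices U n\<^esub> x) ` C n \<subseteq> {\<zero>\<^bsub>matrices U n\<^esub>}"
    proof
      fix x assume "x \<in> C n \<inter> (\<lambda>x. \<ominus>\<^bsub>matrices U n\<^esub> x) ` C n"
      then obtain y where xy: "x \<in> C n" "y \<in> C n" "x = \<ominus>\<^bsub>matrices U n\<^esub> y" by blast
      obtain Y where Y: "y = mk n Y" using mo_sub[OF mo] mk_surj xy(2) by blast
      have "x = mk n (\<lambda>a i j. - Y a i j)" unfolding xy(3) Y mk_minus ..
      then show "x \<in> {\<zero>\<^bsub>matrices U n\<^esub>}" using proper[of n "\<lambda>a i j. - Y a i j"] xy Y by (simp add: mk_zero)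
    qed
    moreover have "\<zero>\<^bsub>matrices U n\<^esub> \<in> C n" unfolding mk_zero by (rule mo_zero[OF mo])
    moreover have "\<zero>\<^bsub>matrices U n\<^esub> = \<ominus>\<^bsub>matrices U n\<^esub> \<zero>\<^bsub>matrices U n\<^esub>" by (simp add: mk_zero mk_minus)
    ultimately show "proper_cone (matrices U n) (C n)" unfolding proper_cone_def using cone by blast
  qed
  have "archimedean_order_unit (matrices U n) (C n) (amp_unit U n (g 0))" for n
    unfolding archimedean_order_unit_def
  proof (intro conjI ballI impI)
    show "amp_unit U n (g 0) \<in> hermitian (matrices U n)"
      unfolding mk_amp_unit mk_hermitian by (rule mk_cong) (rule dg_herm[OF ev_real])
    fix x assume x: "x \<in> hermitian (matrices U n)"
    obtain X where X: "x = mk n X" "\<forall>a i j. X a j i = cnj (X a i j)" using mk_hermitian_rep[OF x] by blast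
    have "\<exists>r>0. mk n (\<lambda>a i j. complex_of_real r * dg (\<lambda>_. ev 0) a i j - X a i j) \<in> C n"
      by (rule order_unit[OF mo goodD(2)[OF good] goodD(3)[OF good] X(2)[rule_format]])
    then show "\<exists>r>0. complex_of_real r \<odot>\<^bsub>matrices U n\<^esub> amp_unit U n (g 0) \<ominus>\<^bsub>matrices U n\<^esub> x \<in> C n"
      unfolding X(1) mk_amp_unit mk_smult mk_diff .
    assume "\<forall>\<epsilon>>0. x \<oplus>\<^bsub>matrices U n\<^esub> complex_of_real \<epsilon> \<odot>\<^bsub>matrices U n\<^esub> amp_unit U n (g 0) \<in> C n"
    then have "x \<in> arch C n" using x by (simp add: arch_def hermitian_def)
    then show "x \<in> C n" using arch by blast
  qed
  then show "operator_system U C (g 0)"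
    unfolding operator_system_def using P svs gen_hermitian[of 0] by blast
qed

end

section \<open>The space of relations\<close>

context
  fixes N l :: nat and M :: "real mat"
  assumes M: "M \<in> carrier_mat l (Suc N)"
begin

abbreviation "rJ \<equiv> rel_span N M"

text \<open>The cosets of the relation space in an unbundled form; all operations of the quotient are computed on
  representatives.\<close>
definition cls :: "complex Matrix.vec \<Rightarrow> complex Matrix.vec set" where
  "cls v = (\<lambda>j. j + v) ` rJ"

lemma rows_sub: "set (Matrix.rows (map_mat complex_of_real M)) \<subseteq> carrier_vec (Suc N)"
proof -
  have "map_mat complex_of_real M \<in> carrier_mat l (Suc N)" using M by simp
  then show ?thesis using Matrix.rows_carrier[of "map_mat complex_of_real M"] by simp
qed

lemma rJ_submodule: "submodule class_ring rJ (std_space N)"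
  unfolding rel_span_def
  by (rule LinearCombinations.module.span_is_submodule[OF vec_module]) (simp add: module_vec_simps rows_sub)

lemma rJ_sub: "v \<in> rJ \<Longrightarrow> v \<in> carrier_vec (Suc N)"
  and rJ_add: "v \<in> rJ \<Longrightarrow> w \<in> rJ \<Longrightarrow> v + w \<in> rJ"
  and rJ_zero: "0\<^sub>v (Suc N) \<in> rJ"
  and rJ_smult: "v \<in> rJ \<Longrightarrow> c \<cdot>\<^sub>v v \<in> rJ"
  using submodule.subset[OF rJ_submodule] submodule.m_closed[OF rJ_submodule]
    submodule.zero_closed[OF rJ_submodule] submodule.smult_closed[OF rJ_submodule, of c]
  by (auto simp: module_vec_simps)

text \<open>Induction over the linear span of the rows.\<close>
lemma rJ_least:
  assumes "P (0\<^sub>v (Suc N))"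
    and "\<And>v w. v \<in> carrier_vec (Suc N) \<Longrightarrow> w \<in> carrier_vec (Suc N) \<Longrightarrow> P v \<Longrightarrow> P w \<Longrightarrow> P (v + w)"
    and "\<And>c v. v \<in> carrier_vec (Suc N) \<Longrightarrow> P v \<Longrightarrow> P (c \<cdot>\<^sub>v v)"
    and "\<And>i. i < dim_row M \<Longrightarrow> P (Matrix.vec (Suc N) (\<lambda>j. complex_of_real (M $$ (i, j))))"
    and v: "v \<in> rJ"
  shows "P v"
proof -
  have "submodule class_ring {v \<in> carrier_vec (Suc N). P v} (std_space N)"
    by (rule submodule.intro) (use assms(1-3) vec_module in \<open>auto simp: module_vec_simps\<close>)
  moreover have "set (Matrix.rows (map_mat complex_of_real M)) \<subseteq> {v \<in> carrier_vec (Suc N). P v}"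
  proof
    fix w assume w: "w \<in> set (Matrix.rows (map_mat complex_of_real M))"
    then obtain i where i: "i < dim_row M" "w = Matrix.row (map_mat complex_of_real M) i"
      by (auto simp: Matrix.rows_def)
    have "w = Matrix.vec (Suc N) (\<lambda>j. complex_of_real (M $$ (i, j)))"
      unfolding i(2) by (rule eq_vecI) (use M i(1) in auto)
    then show "w \<in> {v \<in> carrier_vec (Suc N). P v}" using assms(4)[OF i(1)] by simp
  qed
  ultimately have "rJ \<subseteq> {v \<in> carrier_vec (Suc N). P v}"
    unfolding rel_span_def by (intro LinearCombinations.module.span_is_subset[OF vec_module])
  then show ?thesis using v by blast
qed

text \<open>The rows are real. This is what makes the involution of the quotient well defined.\<close>
lemma rJ_cnj: "v \<in> rJ \<Longrightarrow> map_vec cnj v \<in> rJ"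
proof (rule rJ_least[where P = "\<lambda>v. map_vec cnj v \<in> rJ"])
  show "map_vec cnj (0\<^sub>v (Suc N)) \<in> rJ"
  proof -
    have "map_vec cnj (0\<^sub>v (Suc N)) = 0\<^sub>v (Suc N)" by (rule eq_vecI) auto
    then show ?thesis using rJ_zero by simp
  qed
  fix v w assume "v \<in> carrier_vec (Suc N)" "w \<in> carrier_vec (Suc N)" "map_vec cnj v \<in> rJ" "map_vec cnj w \<in> rJ"
  moreover from this(1,2) have "map_vec cnj (v + w) = map_vec cnj v + map_vec cnj w" by (intro eq_vecI) auto
  ultimately show "map_vec cnj (v + w) \<in> rJ" using rJ_add by simp
next
  fix c v assume "map_vec cnj v \<in> rJ"
  moreover have "map_vec cnj (c \<cdot>\<^sub>v v) = cnj c \<cdot>\<^sub>v map_vec cnj v" by (rule eq_vecI) auto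
  ultimately show "map_vec cnj (c \<cdot>\<^sub>v v) \<in> rJ" using rJ_smult by simp
next
  fix i assume i: "i < dim_row M"
  let ?w = "Matrix.vec (Suc N) (\<lambda>j. complex_of_real (M $$ (i, j)))"
  have "?w = Matrix.row (map_mat complex_of_real M) i"
    by (rule eq_vecI) (use M i in auto)
  then have "?w \<in> set (Matrix.rows (map_mat complex_of_real M))" using i by (auto simp: Matrix.rows_def)
  then have "?w \<in> rJ" unfolding rel_span_def
    using LinearCombinations.module.in_own_span[OF vec_module] rows_sub by (auto simp: module_vec_simps)
  moreover have "map_vec cnj ?w = ?w" by (rule eq_vecI) auto
  ultimately show "map_vec cnj ?w \<in> rJ" by simp
qed

lemma cls_eq_iff:
  assumes "v \<in> carrier_vec (Suc N)" "w \<in> carrier_vec (Suc N)"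
  shows "cls v = cls w \<longleftrightarrow> v - w \<in> rJ"
proof
  assume "cls v = cls w"
  moreover have "0\<^sub>v (Suc N) + v \<in> cls v" unfolding cls_def using rJ_zero by blast
  ultimately obtain j where j: "j \<in> rJ" "0\<^sub>v (Suc N) + v = j + w" unfolding cls_def by blast
  have vj: "v = j + w" using j(2) assms(1) by simp
  have "v - w = j" unfolding vj using assms rJ_sub[OF j(1)] by (intro eq_vecI) auto
  then show "v - w \<in> rJ" using j(1) by simp
next
  assume d: "v - w \<in> rJ"
  have 1: "j + v = (j + (v - w)) + w" if "j \<in> rJ" for j
    using assms rJ_sub[OF that] by (intro eq_vecI) auto
  have 2: "j + w = (j + (-1) \<cdot>\<^sub>v (v - w)) + v" if "j \<in> rJ" for j
    using assms rJ_sub[OF that] by (intro eq_vecI) auto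
  show "cls v = cls w"
  proof
    show "cls v \<subseteq> cls w" unfolding cls_def using 1 rJ_add[OF _ d] by fastforce
    show "cls w \<subseteq> cls v" unfolding cls_def using 2 rJ_add[OF _ rJ_smult[OF d, of "-1"]] by fastforce
  qed
qed

lemma cls_coset: "v \<in> carrier_vec (Suc N) \<Longrightarrow> rJ +>\<^bsub>std_space N\<^esub> v = cls v"
  unfolding a_r_coset_def' cls_def by (auto simp: module_vec_simps)

lemma rel_carrier: "carrier (rel_space N M) = cls ` carrier_vec (Suc N)"
  unfolding rel_space_def A_RCOSETS_def' by (auto simp: module_vec_simps cls_coset)

lemma rel_zero: "\<zero>\<^bsub>rel_space N M\<^esub> = cls (0\<^sub>v (Suc N))"
proof -
  have "j + 0\<^sub>v (Suc N) = j" if "j \<in> rJ" for j using rJ_sub[OF that] by simp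
  then show ?thesis unfolding rel_space_def cls_def by simp
qed

lemma rel_add:
  assumes "v \<in> carrier_vec (Suc N)" "w \<in> carrier_vec (Suc N)"
  shows "cls v \<oplus>\<^bsub>rel_space N M\<^esub> cls w = cls (v + w)"
proof -
  have 1: "(j + v) + (k + w) = (j + k) + (v + w)" if "j \<in> rJ" "k \<in> rJ" for j k
    using assms rJ_sub[OF that(1)] rJ_sub[OF that(2)] by (intro eq_vecI) auto
  have 2: "j + (v + w) = (j + v) + (0\<^sub>v (Suc N) + w)" if "j \<in> rJ" for j
    using assms rJ_sub[OF that] by (intro eq_vecI) auto
  have "cls v <+>\<^bsub>std_space N\<^esub> cls w = cls (v + w)"
    unfolding set_add_def' cls_def module_vec_simps
  proof (intro subset_antisym subsetI)
    fix x assume "x \<in> (\<Union>h\<in>(\<lambda>j. j + v) ` rJ. \<Union>k\<in>(\<lambda>j. j + w) ` rJ. {h + k})"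
    then obtain j k where "j \<in> rJ" "k \<in> rJ" "x = (j + v) + (k + w)" by blast
    then show "x \<in> (\<lambda>j. j + (v + w)) ` rJ" using 1 rJ_add by blast
  next
    fix x assume "x \<in> (\<lambda>j. j + (v + w)) ` rJ"
    then obtain j where "j \<in> rJ" "x = (j + v) + (0\<^sub>v (Suc N) + w)" using 2 by blast
    then show "x \<in> (\<Union>h\<in>(\<lambda>j. j + v) ` rJ. \<Union>k\<in>(\<lambda>j. j + w) ` rJ. {h + k})" using rJ_zero by blast
  qed
  then show ?thesis by (simp add: rel_space_def)
qed

lemma rel_smult:
  assumes "v \<in> carrier_vec (Suc N)"
  shows "c \<odot>\<^bsub>rel_space N M\<^esub> cls v = cls (c \<cdot>\<^sub>v v)"
proof -
  have 1: "j + c \<cdot>\<^sub>v (k + v) = (j + c \<cdot>\<^sub>v k) + c \<cdot>\<^sub>v v" if "j \<in> rJ" "k \<in> rJ" for j k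
    using assms rJ_sub[OF that(1)] rJ_sub[OF that(2)] by (intro eq_vecI) (auto simp: algebra_simps)
  have 2: "j + c \<cdot>\<^sub>v v = j + c \<cdot>\<^sub>v (0\<^sub>v (Suc N) + v)" for j using assms by simp
  have "rJ <+>\<^bsub>std_space N\<^esub> ((\<lambda>v. c \<cdot>\<^sub>v v) ` cls v) = cls (c \<cdot>\<^sub>v v)"
    unfolding set_add_def' cls_def module_vec_simps
  proof (intro subset_antisym subsetI)
    fix x assume "x \<in> (\<Union>h\<in>rJ. \<Union>k\<in>(\<lambda>v. c \<cdot>\<^sub>v v) ` (\<lambda>j. j + v) ` rJ. {h + k})"
    then obtain j k where "j \<in> rJ" "k \<in> rJ" "x = j + c \<cdot>\<^sub>v (k + v)" by blast
    then show "x \<in> (\<lambda>j. j + c \<cdot>\<^sub>v v) ` rJ" using 1 rJ_add rJ_smult by blast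
  next
    fix x assume "x \<in> (\<lambda>j. j + c \<cdot>\<^sub>v v) ` rJ"
    then obtain j where "j \<in> rJ" "x = j + c \<cdot>\<^sub>v (0\<^sub>v (Suc N) + v)" using 2 by blast
    then show "x \<in> (\<Union>h\<in>rJ. \<Union>k\<in>(\<lambda>v. c \<cdot>\<^sub>v v) ` (\<lambda>j. j + v) ` rJ. {h + k})" using rJ_zero by blast
  qed
  then show ?thesis by (simp add: rel_space_def)
qed

lemma rel_star:
  assumes "v \<in> carrier_vec (Suc N)"
  shows "star (rel_space N M) (cls v) = cls (map_vec cnj v)"
proof -
  have 1: "map_vec cnj (j + v) = map_vec cnj j + map_vec cnj v" if "j \<in> rJ" for j
    using assms rJ_sub[OF that] by (intro eq_vecI) auto
  have 2: "map_vec cnj (map_vec cnj j) = j" for j :: "complex Matrix.vec" by (rule eq_vecI) auto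
  have "map_vec cnj ` cls v = cls (map_vec cnj v)"
    unfolding cls_def
  proof (intro subset_antisym subsetI)
    fix x assume "x \<in> map_vec cnj ` (\<lambda>j. j + v) ` rJ"
    then show "x \<in> (\<lambda>j. j + map_vec cnj v) ` rJ" using 1 rJ_cnj by blast
  next
    fix x assume "x \<in> (\<lambda>j. j + map_vec cnj v) ` rJ"
    then obtain j where j: "j \<in> rJ" "x = j + map_vec cnj v" by blast
    then have "x = map_vec cnj (map_vec cnj j + v)" using 1[OF rJ_cnj[OF j(1)]] 2 by simp
    then show "x \<in> map_vec cnj ` (\<lambda>j. j + v) ` rJ" using rJ_cnj[OF j(1)] by blast
  qed
  then show ?thesis by (simp add: rel_space_def)
qed

lemma rel_svs: "star_vector_space (rel_space N M)"
proof -
  let ?U = "rel_space N M"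
  have ag: "abelian_group ?U"
  proof (rule abelian_groupI)
    fix x assume "x \<in> carrier ?U"
    then obtain v where v: "v \<in> carrier_vec (Suc N)" "x = cls v" unfolding rel_carrier by blast
    have "(-1) \<cdot>\<^sub>v v + v = 0\<^sub>v (Suc N)" using v(1) by (intro eq_vecI) auto
    then have "cls ((-1) \<cdot>\<^sub>v v) \<oplus>\<^bsub>?U\<^esub> x = \<zero>\<^bsub>?U\<^esub>" using v by (simp add: rel_add rel_zero)
    then show "\<exists>y\<in>carrier ?U. y \<oplus>\<^bsub>?U\<^esub> x = \<zero>\<^bsub>?U\<^esub>"
      by (rule bexI) (use v(1) in \<open>simp add: rel_carrier\<close>)
  next
    show "\<zero>\<^bsub>?U\<^esub> \<in> carrier ?U" unfolding rel_zero rel_carrier by (rule imageI) simp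
    fix x y assume "x \<in> carrier ?U" "y \<in> carrier ?U"
    then obtain v w where vw: "v \<in> carrier_vec (Suc N)" "w \<in> carrier_vec (Suc N)" "x = cls v" "y = cls w"
      unfolding rel_carrier by blast
    then show "x \<oplus>\<^bsub>?U\<^esub> y \<in> carrier ?U" by (simp add: rel_add rel_carrier)
    show "x \<oplus>\<^bsub>?U\<^esub> y = y \<oplus>\<^bsub>?U\<^esub> x" using vw by (simp add: rel_add comm_add_vec[OF vw(1,2)])
    fix z assume "z \<in> carrier ?U"
    then obtain u where u: "u \<in> carrier_vec (Suc N)" "z = cls u" unfolding rel_carrier by blast
    show "x \<oplus>\<^bsub>?U\<^esub> y \<oplus>\<^bsub>?U\<^esub> z = x \<oplus>\<^bsub>?U\<^esub> (y \<oplus>\<^bsub>?U\<^esub> z)"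
      using vw u by (simp add: rel_add assoc_add_vec[OF vw(1,2) u(1)])
  next
    fix x assume "x \<in> carrier ?U"
    then obtain v where v: "v \<in> carrier_vec (Suc N)" "x = cls v" unfolding rel_carrier by blast
    then show "\<zero>\<^bsub>?U\<^esub> \<oplus>\<^bsub>?U\<^esub> x = x" by (simp add: rel_zero rel_add)
  qed
  have "Module.module class_ring ?U"
  proof (rule Module.moduleI[OF class_cring.is_cring ag])
    fix a :: complex and x assume "x \<in> carrier ?U"
    then obtain v where v: "v \<in> carrier_vec (Suc N)" "x = cls v" unfolding rel_carrier by blast
    then show "a \<odot>\<^bsub>?U\<^esub> x \<in> carrier ?U" by (simp add: rel_smult rel_carrier)
  next
    fix a b :: complex and x assume "x \<in> carrier ?U"
    then obtain v where v: "v \<in> carrier_vec (Suc N)" "x = cls v" unfolding rel_carrier by blast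
    then show "(a \<oplus>\<^bsub>class_ring\<^esub> b) \<odot>\<^bsub>?U\<^esub> x = a \<odot>\<^bsub>?U\<^esub> x \<oplus>\<^bsub>?U\<^esub> b \<odot>\<^bsub>?U\<^esub> x"
      by (simp add: rel_smult rel_add add_smult_distrib_vec)
    from v show "(a \<otimes>\<^bsub>class_ring\<^esub> b) \<odot>\<^bsub>?U\<^esub> x = a \<odot>\<^bsub>?U\<^esub> (b \<odot>\<^bsub>?U\<^esub> x)"
      by (simp add: rel_smult smult_smult_assoc)
  next
    fix a :: complex and x y assume "x \<in> carrier ?U" "y \<in> carrier ?U"
    then obtain v w where vw: "v \<in> carrier_vec (Suc N)" "w \<in> carrier_vec (Suc N)" "x = cls v" "y = cls w"
      unfolding rel_carrier by blast
    then show "a \<odot>\<^bsub>?U\<^esub> (x \<oplus>\<^bsub>?U\<^esub> y) = a \<odot>\<^bsub>?U\<^esub> x \<oplus>\<^bsub>?U\<^esub> a \<odot>\<^bsub>?U\<^esub> y"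
      by (simp add: rel_smult rel_add smult_add_distrib_vec[OF vw(1,2)])
  next
    fix x assume "x \<in> carrier ?U"
    then obtain v where v: "v \<in> carrier_vec (Suc N)" "x = cls v" unfolding rel_carrier by blast
    then show "\<one>\<^bsub>class_ring\<^esub> \<odot>\<^bsub>?U\<^esub> x = x" by (simp add: rel_smult)
  qed
  then have "vectorspace class_ring ?U" by (simp add: vectorspace_def class_field)
  moreover have "map_vec cnj (map_vec cnj j) = j" for j :: "complex Matrix.vec" by (rule eq_vecI) auto
  moreover have "map_vec cnj (v + w) = map_vec cnj v + map_vec cnj w" if "v \<in> carrier_vec (Suc N)" "w \<in> carrier_vec (Suc N)" for v w
    using that by (intro eq_vecI) auto
  moreover have "map_vec cnj (c \<cdot>\<^sub>v v) = cnj c \<cdot>\<^sub>v map_vec cnj v" for c v by (rule eq_vecI) auto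
  ultimately show ?thesis
    unfolding star_vector_space_def by (auto simp: rel_carrier rel_star rel_add rel_smult)
qed

lemma rel_gen_cls: "a \<le> N \<Longrightarrow> rel_gen N M a = cls (unit_vec (Suc N) a)"
  unfolding rel_gen_def by (rule cls_coset) simp

lemma rel_herm: "herm_family (rel_space N M) N (rel_gen N M)"
proof
  show "star_vector_space (rel_space N M)" by (rule rel_svs)
  fix a assume a: "a \<le> N"
  have "map_vec cnj (unit_vec (Suc N) a) = unit_vec (Suc N) a" by (rule eq_vecI) (auto simp: unit_vec_def)
  then show "rel_gen N M a \<in> hermitian (rel_space N M)"
    using a by (auto simp: hermitian_def rel_gen_cls rel_carrier rel_star)
qed

lemma rel_comb: "herm_family.comb (rel_space N M) N (rel_gen N M) c = cls (Matrix.vec (Suc N) c)"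
proof -
  interpret H: herm_family "rel_space N M" N "rel_gen N M" by (rule rel_herm)
  interpret ab: abelian_group "rel_space N M" by (rule svs_abelian_group[OF rel_svs])
  have "(\<Oplus>\<^bsub>rel_space N M\<^esub>a\<in>K. c a \<odot>\<^bsub>rel_space N M\<^esub> rel_gen N M a) = cls (Matrix.vec (Suc N) (\<lambda>i. if i \<in> K then c i else 0))"
    if "finite K" "K \<subseteq> {..N}" for K
    using that
  proof (induction K rule: finite_induct)
    case empty
    have "Matrix.vec (Suc N) (\<lambda>i. if i \<in> {} then c i else 0) = 0\<^sub>v (Suc N)" by (rule eq_vecI) auto
    then show ?case by (simp add: rel_zero)
  next
    case (insert k K)
    have kN: "k \<le> N" and KN: "K \<subseteq> {..N}" using insert.prems by auto
    have t: "c a \<odot>\<^bsub>rel_space N M\<^esub> rel_gen N M a = cls (c a \<cdot>\<^sub>v unit_vec (Suc N) a)" if "a \<le> N" for a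
      using that by (simp add: rel_gen_cls rel_smult)
    have cl: "(\<lambda>a. c a \<odot>\<^bsub>rel_space N M\<^esub> rel_gen N M a) \<in> K \<rightarrow> carrier (rel_space N M)"
      using KN t by (auto simp: rel_carrier)
    have "c k \<odot>\<^bsub>rel_space N M\<^esub> rel_gen N M k \<in> carrier (rel_space N M)" using t[OF kN] by (auto simp: rel_carrier)
    then have "(\<Oplus>\<^bsub>rel_space N M\<^esub>a\<in>insert k K. c a \<odot>\<^bsub>rel_space N M\<^esub> rel_gen N M a)
      = cls (c k \<cdot>\<^sub>v unit_vec (Suc N) k + Matrix.vec (Suc N) (\<lambda>i. if i \<in> K then c i else 0))"
      using insert cl kN by (simp add: t rel_add)
    also have "c k \<cdot>\<^sub>v unit_vec (Suc N) k + Matrix.vec (Suc N) (\<lambda>i. if i \<in> K then c i else 0)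
      = Matrix.vec (Suc N) (\<lambda>i. if i \<in> insert k K then c i else 0)"
      using insert.hyps by (intro eq_vecI) (auto simp: unit_vec_def)
    finally show ?case .
  qed
  from this[of "{..N}"] have "H.comb c = cls (Matrix.vec (Suc N) (\<lambda>i. if i \<in> {..N} then c i else 0))"
    unfolding H.comb_def by simp
  also have "Matrix.vec (Suc N) (\<lambda>i. if i \<in> {..N} then c i else 0) = Matrix.vec (Suc N) c" by (rule eq_vecI) auto
  finally show ?thesis .
qed

lemma rel_gen_space: "gen_space (rel_space N M) N (rel_gen N M)"
proof -
  interpret H: herm_family "rel_space N M" N "rel_gen N M" by (rule rel_herm)
  show ?thesis
  proof
    fix x assume "x \<in> carrier (rel_space N M)"
    then obtain v where v: "v \<in> carrier_vec (Suc N)" "x = cls v" unfolding rel_carrier by blast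
    have "v = Matrix.vec (Suc N) (\<lambda>i. v $ i)" using v(1) by (intro eq_vecI) auto
    then show "\<exists>c. x = H.comb c" unfolding rel_comb v(2) by metis
  qed
qed

lemma rel_comb_null: "herm_family.comb (rel_space N M) N (rel_gen N M) c = \<zero>\<^bsub>rel_space N M\<^esub> \<longleftrightarrow> Matrix.vec (Suc N) c \<in> rJ"
proof -
  have "Matrix.vec (Suc N) c - 0\<^sub>v (Suc N) = Matrix.vec (Suc N) c" by (rule eq_vecI) auto
  then show ?thesis unfolding rel_comb rel_zero by (simp add: cls_eq_iff)
qed

lemma rel_fin_dim: "vectorspace.fin_dim class_ring (rel_space N M)"
proof -
  have vU: "vectorspace class_ring (rel_space N M)" using rel_svs by (simp add: star_vector_space_def)
  have "linear_map class_ring (std_space N) (rel_space N M) cls"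
    using vU vec_vs[of "Suc N"]
    by (auto simp: linear_map_def mod_hom_def mod_hom_axioms_def vectorspace_def LinearCombinations.module_hom_def
        module_vec_simps rel_carrier rel_add rel_smult)
  moreover have "vectorspace.fin_dim class_ring (std_space N :: (complex, complex Matrix.vec) module)"
    by (rule vec_space.fin_dim)
  ultimately show ?thesis
    by (rule linear_map.surj_fin_dim) (simp add: rel_carrier module_vec_simps)
qed

end

section \<open>The projection ordering is an operator system\<close>

text \<open>The embedding reflects positivity and a projection is positive, being its own square.\<close>
lemma abstract_projection_hermitian:
  assumes os: "operator_system V D f" and q: "abstract_projection TYPE('b) V D f q"
  shows "q \<in> hermitian V"
proof -
  from q obtain A :: "'b normed_star_space" and \<iota> where qV: "q \<in> carrier V"
    and cover: "cstar_cover V D f A \<iota>" and proj: "is_projection A (\<iota> q)"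
    unfolding abstract_projection_def by blast
  have A: "cstar_algebra A" and emb: "unital_complete_order_embedding V D f A \<iota>"
    using cover by (auto simp: cstar_cover_def)
  interpret A: ring A by (rule cstar_ring[OF A])
  let ?x = "Matrix.mat 1 1 (\<lambda>_. q)"
  have x: "?x \<in> carrier (matrices V 1)" using qV by (auto simp: matrices_def)
  have "map_mat \<iota> ?x \<in> positives (matrices A 1)"
  proof (rule positives_matricesI[OF A, of 1 "\<lambda>_ _. \<iota> q"])
    fix i j :: nat assume ij: "i < 1" "j < 1"
    have s: "{..<1::nat} = {0}" by auto
    show "map_mat \<iota> ?x $$ (i, j) = (\<Oplus>\<^bsub>A\<^esub>k\<in>{..<1::nat}. star A (\<iota> q) \<otimes>\<^bsub>A\<^esub> \<iota> q)"
      unfolding s using ij proj by (simp add: is_projection_def)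
  qed (use proj in \<open>auto simp: is_projection_def\<close>)
  then have "?x \<in> D 1" using emb x unfolding unital_complete_order_embedding_def by blast
  moreover have "D 1 \<subseteq> hermitian (matrices V 1)"
    using os unfolding operator_system_def proper_matrix_ordering_def matrix_ordering_def is_cone_def by blast
  ultimately have "star (matrices V 1) ?x = ?x" by (auto simp: hermitian_def)
  then have "star (matrices V 1) ?x $$ (0, 0) = ?x $$ (0, 0)" by simp
  then have "star V q = q" by (simp add: matrices_def)
  then show ?thesis using qV by (simp add: hermitian_def)
qed

lemma (in herm_family) gen_space_of_span:
  assumes span: "LinearCombinations.module.span class_ring U (g ` {..N}) = carrier U"
  shows "gen_space U N g"
proof
  fix x assume x: "x \<in> carrier U"
  have "submodule class_ring (range comb) U"
  proof (rule submodule.intro)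
    show "Module.module class_ring U" by (rule svs_module[OF svs])
    show "range comb \<subseteq> carrier U" using comb_closed by auto
    show "\<zero>\<^bsub>U\<^esub> \<in> range comb" using comb_zero by (metis rangeI)
    show "v \<oplus>\<^bsub>U\<^esub> w \<in> range comb" if "v \<in> range comb" "w \<in> range comb" for v w
      using that by (auto simp: comb_add)
    show "c \<odot>\<^bsub>U\<^esub> v \<in> range comb" if "c \<in> carrier class_ring" "v \<in> range comb" for c v
      using that by (auto simp: comb_smult)
  qed
  moreover have "g ` {..N} \<subseteq> range comb"
  proof
    fix y assume "y \<in> g ` {..N}"
    then obtain a where "a \<le> N" "y = g a" by auto
    then show "y \<in> range comb" using comb_gen[of a] by (metis rangeI)
  qed
  ultimately have "carrier U \<subseteq> range comb"
    unfolding span[symmetric] by (intro LinearCombinations.module.span_is_subset[OF svs_module[OF svs]])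
  then show "\<exists>c. x = comb c" using x by blast
qed

theorem theorem4p4:
  fixes N l :: nat
    and M :: "real mat"
    and V :: "'v star_space"
    and D :: "nat \<Rightarrow> 'v mat set"
    and f :: 'v
    and q :: "nat \<Rightarrow> 'v"
  assumes "N \<ge> 1"
    and "M \<in> carrier_mat l (Suc N)"
    and "operator_system V D f"
    and "LinearCombinations.module.span class_ring V (insert f (q ` {1..N})) = carrier V"
    and "\<forall>i\<in>{1..N}. abstract_projection TYPE('b) V D f (q i)"
    and "satisfies_relations V M (q(0 := f))"
    and "vectorspace.dim class_ring V = vectorspace.dim class_ring (rel_space N M)"
  shows "proper_matrix_ordering (rel_space N M) (E_proj N M)
    \<and> (operator_system (rel_space N M) (E_proj N M) (rel_gen N M 0)
        \<and> (\<forall>i\<in>{1..N}. abstract_projection TYPE(nat \<Rightarrow> nat \<Rightarrow> complex)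
              (rel_space N M) (E_proj N M) (rel_gen N M 0) (rel_gen N M i)))
    \<and> (\<exists>\<phi>. \<phi> (rel_gen N M 0) = f \<and> (\<forall>i\<in>{1..N}. \<phi> (rel_gen N M i) = q i)
        \<and> completely_positive (rel_space N M) (E_proj N M) V D \<phi>)"
proof -
  note N = assms(1) and M = assms(2) and os = assms(3)
  define h where "h = q(0 := f)"
  have h0: "h 0 = f" and hi: "\<And>i. i \<in> {1..N} \<Longrightarrow> h i = q i" by (auto simp: h_def)
  let ?U = "rel_space N M"
  let ?p = "rel_gen N M"
  let ?E = "E_proj N M"
  have svsU: "star_vector_space ?U" by (rule rel_svs[OF M])
  have svsV: "star_vector_space V" using os by (simp add: operator_system_def)
  interpret U: gen_space ?U N ?p by (rule rel_gen_space[OF M])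
  have hV: "herm_family V N h"
  proof
    show "star_vector_space V" by (rule svsV)
    fix a assume a: "a \<le> N"
    show "h a \<in> hermitian V"
    proof (cases "a = 0")
      case True
      then show ?thesis using os h0 by (simp add: operator_system_def)
    next
      case False
      then have "a \<in> {1..N}" using a by simp
      then show ?thesis using abstract_projection_hermitian[OF os] assms(5) hi by metis
    qed
  qed
  have "{..N} = insert 0 {1..N}" by auto
  then have "h ` {..N} = insert f (q ` {1..N})" using h0 hi by auto
  then have gV: "gen_space V N h" using herm_family.gen_space_of_span[OF hV] assms(4) by simp
  interpret V: gen_space V N h by (rule gV)
  have osV: "operator_system V D (h 0)" using os h0 by simp
  have proj: "V.mk 1 (\<lambda>a i j. ev 0 a) \<in> D 1" "V.mk 1 (\<lambda>a i j. ev b a) \<in> D 1"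
    "V.mk 1 (\<lambda>a i j. perp b a) \<in> D 1" "proj_step V (h 0) D (h b) n \<subseteq> D n" if b: "b \<in> {1..N}" for b n
  proof -
    have "abstract_projection TYPE('b) V D f (h b)" using assms(5) b hi by simp
    then obtain A :: "'b normed_star_space" and \<iota> where
      cover: "cstar_cover V D f A \<iota>" and pr: "is_projection A (\<iota> (h b))"
      unfolding abstract_projection_def by blast
    have A: "cstar_algebra A" and emb: "unital_complete_order_embedding V D (h 0) A \<iota>"
      using cover h0 by (auto simp: cstar_cover_def)
    have bN: "b \<le> N" using b by simp
    note pc = V.projection_in_cover[OF osV A emb bN pr]
    show "V.mk 1 (\<lambda>a i j. ev 0 a) \<in> D 1" "V.mk 1 (\<lambda>a i j. ev b a) \<in> D 1"
      "V.mk 1 (\<lambda>a i j. perp b a) \<in> D 1" "proj_step V (h 0) D (h b) n \<subseteq> D n" by (rule pc)+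
  qed
  have one: "1 \<in> {1..N}" using N by simp
  have moD: "matrix_ordering V D" using os by (simp add: operator_system_def proper_matrix_ordering_def)
  have goodD: "V.good D"
    unfolding V.good_def
  proof (intro conjI allI impI moD)
    fix b assume b: "b \<le> N"
    show "V.mk 1 (\<lambda>a i j. ev b a) \<in> D 1"
      by (cases "b = 0") (use proj(1)[OF one] proj(2)[of b] b in auto)
    have "perp 0 = (\<lambda>a. 0)" by (simp add: perp_def fun_eq_iff)
    then show "V.mk 1 (\<lambda>a i j. perp b a) \<in> D 1"
      by (cases "b = 0") (use V.mo_zero[OF moD] proj(3)[of b] b in auto)
  qed
  have archD: "V.arch D n \<subseteq> D n" for n by (rule V.operator_system_good_arch[OF osV proj(1)[OF one]])
  \<comment> \<open>The given elements satisfy the relations, so every relation between the classes of the basis vectors holds for them.\<close>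
  have null: "V.comb c = \<zero>\<^bsub>V\<^esub>" if c: "U.comb c = \<zero>\<^bsub>?U\<^esub>" for c
  proof -
    have "V.comb (\<lambda>a. vec_index (Matrix.vec (Suc N) c) a) = \<zero>\<^bsub>V\<^esub>"
    proof (rule rJ_least[OF M, where P = "\<lambda>v. V.comb (\<lambda>a. vec_index v a) = \<zero>\<^bsub>V\<^esub>"])
      show "V.comb (\<lambda>a. vec_index (0\<^sub>v (Suc N)) a) = \<zero>\<^bsub>V\<^esub>"
        unfolding V.comb_zero[symmetric] by (rule V.comb_cong) simp
      show "V.comb (\<lambda>a. vec_index (v + w) a) = \<zero>\<^bsub>V\<^esub>"
        if vw: "v \<in> carrier_vec (Suc N)" "w \<in> carrier_vec (Suc N)"
          "V.comb (\<lambda>a. vec_index v a) = \<zero>\<^bsub>V\<^esub>" "V.comb (\<lambda>a. vec_index w a) = \<zero>\<^bsub>V\<^esub>" for v w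
      proof -
        have "V.comb (\<lambda>a. vec_index (v + w) a) = V.comb (\<lambda>a. vec_index v a + vec_index w a)"
          by (rule V.comb_cong) (use vw in simp)
        also have "\<dots> = V.comb (\<lambda>a. 0) \<oplus>\<^bsub>V\<^esub> V.comb (\<lambda>a. 0)"
          by (simp only: V.comb_add[symmetric] vw(3,4) V.comb_zero)
        also have "\<dots> = \<zero>\<^bsub>V\<^esub>" unfolding V.comb_add by (simp add: V.comb_zero)
        finally show ?thesis .
      qed
      show "V.comb (\<lambda>a. vec_index (z \<cdot>\<^sub>v v) a) = \<zero>\<^bsub>V\<^esub>"
        if v: "v \<in> carrier_vec (Suc N)" "V.comb (\<lambda>a. vec_index v a) = \<zero>\<^bsub>V\<^esub>" for z v
      proof -
        have "V.comb (\<lambda>a. vec_index (z \<cdot>\<^sub>v v) a) = V.comb (\<lambda>a. z * vec_index v a)"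
          by (rule V.comb_cong) (use v in simp)
        also have "\<dots> = \<zero>\<^bsub>V\<^esub>" unfolding V.comb_smult[symmetric] v(2) by (rule svs_smult_null[OF svsV])
        finally show ?thesis .
      qed
      show "V.comb (\<lambda>a. vec_index (Matrix.vec (Suc N) (\<lambda>j. complex_of_real (M $$ (i, j)))) a) = \<zero>\<^bsub>V\<^esub>"
        if i: "i < dim_row M" for i
      proof -
        have "V.comb (\<lambda>a. vec_index (Matrix.vec (Suc N) (\<lambda>j. complex_of_real (M $$ (i, j)))) a)
            = V.comb (\<lambda>a. complex_of_real (M $$ (i, a)))"
          by (rule V.comb_cong) simp
        also have "\<dots> = (\<Oplus>\<^bsub>V\<^esub>j\<in>{..<dim_col M}. complex_of_real (M $$ (i, j)) \<odot>\<^bsub>V\<^esub> h j)"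
          using M by (simp add: V.comb_def lessThan_Suc_atMost)
        also have "\<dots> = \<zero>\<^bsub>V\<^esub>" using assms(6) i unfolding satisfies_relations_def h_def by blast
        finally show ?thesis .
      qed
      show "Matrix.vec (Suc N) c \<in> rel_span N M" using c rel_comb_null[OF M] by simp
    qed
    moreover have "V.comb (\<lambda>a. vec_index (Matrix.vec (Suc N) c) a) = V.comb c" by (rule V.comb_cong) simp
    ultimately show ?thesis by simp
  qed
  have eqc: "V.comb c = V.comb d" if cd: "U.comb c = U.comb d" for c d
  proof -
    have "U.comb c \<ominus>\<^bsub>?U\<^esub> U.comb d = U.comb d \<ominus>\<^bsub>?U\<^esub> U.comb d" using cd by simp
    then have "U.comb (\<lambda>a. c a - d a) = \<zero>\<^bsub>?U\<^esub>" by (simp add: U.comb_diff U.comb_zero)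
    from null[OF this] have "V.comb d \<oplus>\<^bsub>V\<^esub> V.comb (\<lambda>a. c a - d a) = V.comb d \<oplus>\<^bsub>V\<^esub> V.comb (\<lambda>a. 0)"
      by (simp add: V.comb_zero)
    then show ?thesis by (simp add: V.comb_add)
  qed
  \<comment> \<open>any coefficients will do, by \<open>eqc\<close>\<close>
  define \<phi> where "\<phi> x = V.comb (SOME c. x = U.comb c)" for x
  have phi: "\<phi> (U.comb c) = V.comb c" for c
    unfolding \<phi>_def by (rule eqc) (rule someI[of "\<lambda>d. U.comb c = U.comb d", OF refl, symmetric])
  have lin: "linear_map class_ring ?U V \<phi>"
  proof -
    have vU: "vectorspace class_ring ?U" using svsU by (simp add: star_vector_space_def)
    have vV: "vectorspace class_ring V" using svsV by (simp add: star_vector_space_def)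
    have "\<phi> \<in> LinearCombinations.module_hom class_ring ?U V"
      unfolding LinearCombinations.module_hom_def
    proof (intro CollectI conjI allI impI)
      show "\<phi> \<in> carrier ?U \<rightarrow> carrier V" by (simp add: \<phi>_def V.comb_closed)
      show "\<phi> (x \<oplus>\<^bsub>?U\<^esub> y) = \<phi> x \<oplus>\<^bsub>V\<^esub> \<phi> y" if xy: "x \<in> carrier ?U \<and> y \<in> carrier ?U" for x y
      proof -
        from xy U.comb_surj obtain c d where cd: "x = U.comb c" "y = U.comb d" by meson
        show ?thesis unfolding cd by (simp add: U.comb_add V.comb_add phi)
      qed
      show "\<phi> (z \<odot>\<^bsub>?U\<^esub> x) = z \<odot>\<^bsub>V\<^esub> \<phi> x" if zx: "z \<in> carrier class_ring \<and> x \<in> carrier ?U" for z x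
      proof -
        from zx U.comb_surj obtain c where c: "x = U.comb c" by meson
        show ?thesis unfolding c by (simp add: U.comb_smult V.comb_smult phi)
      qed
    qed
    then show ?thesis using vU vV by (simp add: linear_map_def mod_hom_def mod_hom_axioms_def vectorspace_def)
  qed
  have surj: "\<phi> ` carrier ?U = carrier V"
  proof
    show "\<phi> ` carrier ?U \<subseteq> carrier V" by (auto simp: \<phi>_def V.comb_closed)
    show "carrier V \<subseteq> \<phi> ` carrier ?U"
    proof
      fix y assume "y \<in> carrier V"
      then obtain c where "y = V.comb c" using V.comb_surj by blast
      then have "y = \<phi> (U.comb c)" by (simp add: phi)
      then show "y \<in> \<phi> ` carrier ?U" using U.comb_closed by blast
    qed
  qed
  \<comment> \<open>This is where the dimensions enter: without injectivity, properness could not be pulled back.\<close>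
  have inj: "U.comb c = \<zero>\<^bsub>?U\<^esub>" if c: "V.comb c = \<zero>\<^bsub>V\<^esub>" for c
    by (rule surjective_equal_dim_kernel[OF lin svsU svsV rel_fin_dim[OF M] surj assms(7) U.comb_closed])
      (simp add: phi c)
  have EL: "?E = U.limit_cone" by (rule E_proj_def)
  have cp: "V.mk n X \<in> D n" if X: "U.mk n X \<in> ?E n" for n X
    using transfer_positivity[OF U.gen_space_axioms gV N null goodD archD proj(4) X[unfolded EL]] .
  have goodE: "U.good ?E" unfolding EL by (rule U.good_limit[OF N])
  have archE: "U.arch ?E n \<subseteq> ?E n" for n
  proof
    fix x assume x: "x \<in> U.arch ?E n"
    then have "x \<in> carrier (matrices ?U n)" by (simp add: U.arch_def)
    then obtain X where X: "x = U.mk n X" using U.mk_surj by blast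
    show "x \<in> ?E n" unfolding X EL
      by (rule U.limit_archimedean, rule U.archD[OF x[unfolded X EL]])
  qed
  have properE: "U.mk n X = U.mk n (\<lambda>a i j. 0)"
    if X: "U.mk n X \<in> ?E n" "U.mk n (\<lambda>a i j. - X a i j) \<in> ?E n" for n X
  proof -
    have "proper_cone (matrices V n) (D n)"
      using os by (simp add: operator_system_def proper_matrix_ordering_def)
    then have z: "D n \<inter> (\<lambda>x. \<ominus>\<^bsub>matrices V n\<^esub> x) ` D n = {\<zero>\<^bsub>matrices V n\<^esub>}" by (simp add: proper_cone_def)
    have "V.mk n X = \<ominus>\<^bsub>matrices V n\<^esub> V.mk n (\<lambda>a i j. - X a i j)" by (simp add: V.mk_minus)
    then have "V.mk n X \<in> D n \<inter> (\<lambda>x. \<ominus>\<^bsub>matrices V n\<^esub> x) ` D n" using cp[OF X(1)] cp[OF X(2)] by blast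
    then have "V.mk n X = V.mk n (\<lambda>a i j. 0)" unfolding z by (simp add: V.mk_zero)
    then have "U.comb (\<lambda>a. X a i j) = \<zero>\<^bsub>?U\<^esub>" if "i < n" "j < n" for i j
      using that by (intro inj) (simp add: V.mk_eq_iff V.comb_zero)
    then show ?thesis by (simp add: U.mk_eq_iff U.comb_zero)
  qed
  \<comment> \<open>a separate C*-cover for each \<open>i\<close>\<close>
  have absE: "abstract_projection TYPE(nat \<Rightarrow> nat \<Rightarrow> complex) ?U ?E (?p 0) (?p i)" if i: "i \<in> {1..N}" for i
  proof -
    have iN: "i \<le> N" using i by simp
    have "proj_step ?U (?p 0) ?E (?p i) n \<subseteq> ?E n" for n unfolding EL by (rule U.limit_proj_step[OF N i])
    then obtain B \<Theta> where fb: "U.faithful_blocks ?E i B \<Theta>" using U.faithful_blocks_exist[OF goodE iN] by blast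
    show ?thesis unfolding abstract_projection_def
      using U.cover_exists[OF goodE fb iN properE] U.gen_carrier[OF iN] by blast
  qed
  have "map_mat \<phi> x \<in> D n" if x: "x \<in> ?E n" for n x
  proof -
    obtain X where X: "x = U.mk n X" using U.mo_sub[OF U.goodD(1)[OF goodE]] U.mk_surj x by blast
    have "map_mat \<phi> (U.mk n X) = V.mk n X" by (rule eq_matI) (auto simp: U.mk_def V.mk_def phi)
    then show ?thesis using cp x X by simp
  qed
  then have "completely_positive ?U ?E V D \<phi>" unfolding completely_positive_def using lin by blast
  moreover have "\<phi> (?p 0) = f" using phi[of "ev 0"] by (simp add: U.comb_gen V.comb_gen h0)
  moreover have "\<phi> (?p i) = q i" if "i \<in> {1..N}" for i
    using phi[of "ev i"] that hi by (simp add: U.comb_gen V.comb_gen)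
  ultimately show ?thesis
    using U.operator_systemI[OF goodE archE properE] absE by blast
qed

end
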